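(* Assume that $\mathcal{X}_s$ has non-empty interior. Suppose there exists a function $v\colon [0,T]\times \mathbb{R}^n\to \mathbb{R}$ that is continuously differentiable in $t$ and twice continuously differentiable in $x$, satisfying $$\begin{cases}\mathcal{L}v(t,x)\geq 0, & \forall x\in \mathcal{X},\ \forall t \in [0,T],\\ \frac{\partial v(t,x)}{\partial t}\geq 0, & \forall x\in \partial \mathcal{X},\ \forall t\in [0,T],\\ v(T,x)\leq 1_{\mathcal{X}_s}(x), & \forall x\in \overline{\mathcal{X}}.\end{cases}$$ Then $\mathbb{P}_{x_0}^{T}\geq v(0,x_0)$ for every $x_0\in \mathcal{X}\setminus \mathcal{X}_s$.
   Context: Let $b\colon\mathbb{R}^n\to\mathbb{R}^n$ and $\sigma\colon\mathbb{R}^n\to\mathbb{R}^{n\times k}$ be locally Lipschitz continuous, and let $W$ be a standard $k$-dimensional Wiener process on a probability space $(\Omega,\mathbb{P})$. For $x_0\in\mathbb{R}^n$, the SDE $dX=b(X)\,dt+\sigma(X)\,dW$ with initial state $x_0$ has a unique maximal local strong solution $X_{x_0}^{w}(t)$, $t\in[0,T^{x_0}(w))$, with continuous sample paths, where $T^{x_0}(w)\in(0,\infty]$. Let $\mathcal{X}\subseteq\mathbb{R}^n$ be open and bounded, $\mathcal{X}_s\subseteq\mathcal{X}$ a closed set, and $0<T<\infty$. An overline denotes closure, $\partial$ denotes topological boundary, and $1_A$ is the indicator function of $A$. For $x_0\in\mathcal{X}\setminus\mathcal{X}_s$ define $$\mathbb{P}_{x_0}^{T}:=\mathbb{P}\big(\{w\in\Omega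 \mid X_{x_0}^{w}(T)\in\mathcal{X}_s\ \wedge\ \forall\tau\in[0,T).\ X_{x_0}^{w}(\tau)\in\mathcal{X}\}\big),$$ where the path is required to be defined at the times involved. For a function $v(t,x)$ that is continuously differentiable in $t$ and twice continuously differentiable in $x$ (class $C^{1,2}$), $$\mathcal{L}v(t,x)=\frac{\partial v(t,x)}{\partial t}+\frac{\partial v(t,x)}{\partial x}b(x)+\frac12\mathrm{tr}\Big(\sigma(x)^{\top}\frac{\partial^2 v(t,x)}{\partial x^2}\sigma(x)\Big).$$ *)

theory Defs
  imports "HOL-Probability.Probability"
begin

subsection \<open>Wiener process and its filtration\<close>

definition independent_increments ::
  "'a measure \<Rightarrow> (real \<Rightarrow> 'a \<Rightarrow> 'b::euclidean_space) \<Rightarrow> bool" where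
  "independent_increments M W \<longleftrightarrow>
     (\<forall>(N::nat) (p::nat \<Rightarrow> real). 0 \<le> p 0 \<and> (\<forall>i<N. p i \<le> p (Suc i)) \<longrightarrow>
        prob_space.indep_vars M (\<lambda>_. borel) (\<lambda>i w. W (p (Suc i)) w - W (p i) w) {..<N})"

text \<open>The law of an increment over \<open>[s, t]\<close> is \<open>N(0, (t - s) I)\<close>, written as independence of the
  coordinates together with their one-dimensional densities.\<close>

definition wiener_process :: "'a measure \<Rightarrow> (real \<Rightarrow> 'a \<Rightarrow> real^'k) \<Rightarrow> bool" where
  "wiener_process M W \<longleftrightarrow>
     (\<forall>t\<ge>0. W t \<in> borel_measurable M) \<and>
     (AE w in M. W 0 w = 0) \<and>
     (AE w in M. continuous_on {0..} (\<lambda>t. W t w)) \<and>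
     independent_increments M W \<and>
     (\<forall>s t. 0 \<le> s \<and> s < t \<longrightarrow>
        prob_space.indep_vars M (\<lambda>_. borel) (\<lambda>j w. (W t w - W s w) $ j) UNIV \<and>
        (\<forall>j. distributed M lborel (\<lambda>w. (W t w - W s w) $ j) (normal_density 0 (sqrt (t - s)))))"

text \<open>The filtration generated by \<open>W\<close>, augmented by the null sets. \<open>M\<close> need not be complete;
  the null sets are the measurable ones, so that this is a filtration inside \<open>M\<close>.\<close>

definition augmented_filtration ::
  "'a measure \<Rightarrow> (real \<Rightarrow> 'a \<Rightarrow> 'b::topological_space) \<Rightarrow> real \<Rightarrow> 'a measure" where
  "augmented_filtration M W t =
     sigma (space M) ({W s -` B \<inter> space M | s B. 0 \<le> s \<and> s \<le> t \<and> B \<in> sets borel} \<union> null_sets M)"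

definition progressively_measurable ::
  "(real \<Rightarrow> 'a measure) \<Rightarrow> (real \<Rightarrow> 'a \<Rightarrow> 'b::topological_space) \<Rightarrow> bool" where
  "progressively_measurable F H \<longleftrightarrow>
     (\<forall>t\<ge>0. (\<lambda>(s, w). H s w) \<in> borel_measurable (restrict_space borel {0..t} \<Otimes>\<^sub>M F t))"


subsection \<open>The Ito integral\<close>

text \<open>Measurability is part of the definition, since \<^const>\<open>measure\<close> is 0 on non-measurable sets.\<close>

definition vanishes_in_probability :: "'a measure \<Rightarrow> (nat \<Rightarrow> 'a \<Rightarrow> ennreal) \<Rightarrow> bool" where
  "vanishes_in_probability M Z \<longleftrightarrow>
     (\<forall>m. Z m \<in> borel_measurable M) \<and>
     (\<forall>e>0. (\<lambda>m. measure M {w \<in> space M. ennreal e < Z m w}) \<longlonglongrightarrow> 0)"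

text \<open>A simple integrand \<open>\<Sum>i<N. \<xi> i * 1(p i, p (i + 1)]\<close> is represented by the triple \<open>(N, p, \<xi>)\<close>.\<close>

type_synonym ('a, 'b) simple_process = "nat \<times> (nat \<Rightarrow> real) \<times> (nat \<Rightarrow> 'a \<Rightarrow> 'b)"

definition is_simple_process ::
  "'a measure \<Rightarrow> (real \<Rightarrow> 'a measure) \<Rightarrow> ('a, 'b::real_normed_vector) simple_process \<Rightarrow> bool" where
  "is_simple_process M F = (\<lambda>(N, p, \<xi>).
     0 \<le> p 0 \<and> (\<forall>i<N. p i < p (Suc i)) \<and>
     (\<forall>i<N. \<xi> i \<in> borel_measurable (F (p i))) \<and>
     (\<exists>K. \<forall>i<N. \<forall>w\<in>space M. norm (\<xi> i w) \<le> K))"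

definition simple_value :: "('a, 'b::real_normed_vector) simple_process \<Rightarrow> real \<Rightarrow> 'a \<Rightarrow> 'b" where
  "simple_value = (\<lambda>(N, p, \<xi>) s w. \<Sum>i<N. indicator {p i<..p (Suc i)} s *\<^sub>R \<xi> i w)"

definition simple_integral ::
  "(real \<Rightarrow> 'a \<Rightarrow> real^'k) \<Rightarrow> ('a, real^'k^'n) simple_process \<Rightarrow> real \<Rightarrow> 'a \<Rightarrow> real^'n" where
  "simple_integral W = (\<lambda>(N, p, \<xi>) t w.
     \<Sum>i<N. \<xi> i w *v (W (min (p (Suc i)) t) w - W (min (p i) t) w))"

text \<open>\<open>I\<close> is (a version with continuous paths of) the process \<open>t \<mapsto> \<integral>\<^sub>0\<^sup>t H dW\<close>, for progressively
  measurable \<open>H\<close> whose paths are almost surely locally square integrable. The integral is the limit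
  in probability of the integrals of simple processes approximating \<open>H\<close>; the norm on matrices is
  the Frobenius norm.\<close>

definition is_ito_integral ::
  "'a measure \<Rightarrow> (real \<Rightarrow> 'a measure) \<Rightarrow> (real \<Rightarrow> 'a \<Rightarrow> real^'k) \<Rightarrow>
     (real \<Rightarrow> 'a \<Rightarrow> real^'k^'n) \<Rightarrow> (real \<Rightarrow> 'a \<Rightarrow> real^'n) \<Rightarrow> bool" where
  "is_ito_integral M F W H I \<longleftrightarrow>
     progressively_measurable F H \<and>
     (AE w in M. \<forall>t\<ge>0. (\<integral>\<^sup>+ s\<in>{0..t}. ennreal ((norm (H s w))\<^sup>2) \<partial>lborel) < \<infinity>) \<and>
     (\<forall>t\<ge>0. I t \<in> borel_measurable (F t)) \<and>
     (AE w in M. continuous_on {0..} (\<lambda>t. I t w)) \<and>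
     (\<forall>t\<ge>0. \<exists>S :: nat \<Rightarrow> ('a, real^'k^'n) simple_process.
        (\<forall>m. is_simple_process M F (S m)) \<and>
        vanishes_in_probability M
          (\<lambda>m w. \<integral>\<^sup>+ s\<in>{0..t}. ennreal ((norm (simple_value (S m) s w - H s w))\<^sup>2) \<partial>lborel) \<and>
        vanishes_in_probability M
          (\<lambda>m w. ennreal (norm (simple_integral W (S m) t w - I t w))))"


subsection \<open>Maximal local strong solutions\<close>

text \<open>\<open>X\<close> solves \<open>dX = b(X) dt + \<sigma>(X) dW\<close> up to the stopping time \<open>\<tau>\<close>: almost surely, for all \<open>t\<close>,
  \<open>X (t \<and> \<tau>) = x0 + \<integral>\<^sub>0\<^bsup>t \<and> \<tau>\<^esup> b (X s) ds + \<integral>\<^sub>0\<^bsup>t \<and> \<tau>\<^esup> \<sigma> (X s) dW s\<close>. As usual, the stochastic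
  integral up to \<open>t \<and> \<tau>\<close> is the integral up to \<open>t\<close> of the integrand multiplied by \<open>1[0, \<tau>]\<close>.\<close>

definition solves_sde_upto ::
  "'a measure \<Rightarrow> (real \<Rightarrow> 'a measure) \<Rightarrow> (real \<Rightarrow> 'a \<Rightarrow> real^'k) \<Rightarrow>
     (real^'n \<Rightarrow> real^'n) \<Rightarrow> (real^'n \<Rightarrow> real^'k^'n) \<Rightarrow> real^'n \<Rightarrow>
     ('a \<Rightarrow> real) \<Rightarrow> (real \<Rightarrow> 'a \<Rightarrow> real^'n) \<Rightarrow> bool" where
  "solves_sde_upto M F W b \<sigma> x0 \<tau> X \<longleftrightarrow>
     (\<exists>I. is_ito_integral M F W (\<lambda>s w. indicator {0..\<tau> w} s *\<^sub>R \<sigma> (X s w)) I \<and>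
          (AE w in M. \<forall>t\<ge>0.
             X (min t (\<tau> w)) w = x0 + integral {0..min t (\<tau> w)} (\<lambda>s. b (X s w)) + I t w))"

text \<open>\<open>\<zeta> w\<close> is the lifetime of the path \<open>t \<mapsto> X t w\<close>; the values \<open>X t w\<close> for \<open>t \<ge> \<zeta> w\<close> are
  irrelevant. The filtration of a strong solution is the one generated by \<open>W\<close>.\<close>

definition local_strong_solution ::
  "'a measure \<Rightarrow> (real \<Rightarrow> 'a \<Rightarrow> real^'k) \<Rightarrow>
     (real^'n \<Rightarrow> real^'n) \<Rightarrow> (real^'n \<Rightarrow> real^'k^'n) \<Rightarrow> real^'n \<Rightarrow>
     (real \<Rightarrow> 'a \<Rightarrow> real^'n) \<Rightarrow> ('a \<Rightarrow> ereal) \<Rightarrow> bool" where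
  "local_strong_solution M W b \<sigma> x0 X \<zeta> \<longleftrightarrow>
     (let F = augmented_filtration M W in
       (\<forall>w\<in>space M. 0 < \<zeta> w) \<and>
       (\<forall>t. Measurable.pred (F t) (\<lambda>w. \<zeta> w \<le> ereal t)) \<and>
       (\<forall>t\<ge>0. X t \<in> borel_measurable (restrict_space (F t) {w \<in> space M. ereal t < \<zeta> w})) \<and>
       (\<forall>w\<in>space M. continuous_on {t. 0 \<le> t \<and> ereal t < \<zeta> w} (\<lambda>t. X t w)) \<and>
       (AE w in M. X 0 w = x0) \<and>
       (\<exists>\<tau> :: nat \<Rightarrow> 'a \<Rightarrow> real.
          (\<forall>k. stopping_time F (\<tau> k)) \<and>
          (\<forall>w\<in>space M. incseq (\<lambda>k. \<tau> k w) \<and> (\<forall>k. 0 \<le> \<tau> k w \<and> ereal (\<tau> k w) < \<zeta> w)) \<and>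
          (AE w in M. (\<lambda>k. ereal (\<tau> k w)) \<longlonglongrightarrow> \<zeta> w) \<and>
          (\<forall>k. solves_sde_upto M F W b \<sigma> x0 (\<tau> k) X)))"

text \<open>For locally Lipschitz coefficients, a local solution is maximal when its lifetime is the
  explosion time.\<close>

definition maximal_local_strong_solution ::
  "'a measure \<Rightarrow> (real \<Rightarrow> 'a \<Rightarrow> real^'k) \<Rightarrow>
     (real^'n \<Rightarrow> real^'n) \<Rightarrow> (real^'n \<Rightarrow> real^'k^'n) \<Rightarrow> real^'n \<Rightarrow>
     (real \<Rightarrow> 'a \<Rightarrow> real^'n) \<Rightarrow> ('a \<Rightarrow> ereal) \<Rightarrow> bool" where
  "maximal_local_strong_solution M W b \<sigma> x0 X \<zeta> \<longleftrightarrow>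
     local_strong_solution M W b \<sigma> x0 X \<zeta> \<and>
     (AE w in M. \<zeta> w < \<infinity> \<longrightarrow>
        Limsup (at_left (real_of_ereal (\<zeta> w))) (\<lambda>t. ereal (norm (X t w))) = \<infinity>)"

definition reach_avoid_probability ::
  "'a measure \<Rightarrow> (real \<Rightarrow> 'a \<Rightarrow> 'b) \<Rightarrow> ('a \<Rightarrow> ereal) \<Rightarrow> 'b set \<Rightarrow> 'b set \<Rightarrow> real \<Rightarrow> real" where
  "reach_avoid_probability M X \<zeta> \<X> \<X>s T =
     measure M {w \<in> space M. ereal T < \<zeta> w \<and> X T w \<in> \<X>s \<and> (\<forall>t\<in>{0..<T}. X t w \<in> \<X>)}"


subsection \<open>Functions of class \<open>C\<^sup>1\<^sup>,\<^sup>2\<close> and the differential operator\<close>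

text \<open>Only the values of \<open>v\<close> on \<open>[0, T]\<close> matter: time derivatives at the end points are one-sided.\<close>

definition time_deriv :: "real \<Rightarrow> (real \<Rightarrow> real^'n \<Rightarrow> real) \<Rightarrow> real \<Rightarrow> real^'n \<Rightarrow> real" where
  "time_deriv T v t x = vector_derivative (\<lambda>s. v s x) (at t within {0..T})"

definition space_grad :: "(real \<Rightarrow> real^'n \<Rightarrow> real) \<Rightarrow> real \<Rightarrow> real^'n \<Rightarrow> real^'n" where
  "space_grad v t x = (\<chi> i. frechet_derivative (v t) (at x) (axis i 1))"

definition space_hessian :: "(real \<Rightarrow> real^'n \<Rightarrow> real) \<Rightarrow> real \<Rightarrow> real^'n \<Rightarrow> real^'n^'n" where
  "space_hessian v t x = jacobian (space_grad v t) (at x)"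

definition class_C12 :: "real \<Rightarrow> (real \<Rightarrow> real^'n \<Rightarrow> real) \<Rightarrow> bool" where
  "class_C12 T v \<longleftrightarrow>
     (\<forall>t\<in>{0..T}. \<forall>x.
        (\<lambda>s. v s x) differentiable (at t within {0..T}) \<and>
        v t differentiable (at x) \<and>
        space_grad v t differentiable (at x)) \<and>
     continuous_on ({0..T} \<times> UNIV) (\<lambda>(t, x). v t x) \<and>
     continuous_on ({0..T} \<times> UNIV) (\<lambda>(t, x). time_deriv T v t x) \<and>
     continuous_on ({0..T} \<times> UNIV) (\<lambda>(t, x). space_grad v t x) \<and>
     continuous_on ({0..T} \<times> UNIV) (\<lambda>(t, x). space_hessian v t x)"

definition generator ::
  "(real^'n \<Rightarrow> real^'n) \<Rightarrow> (real^'n \<Rightarrow> real^'k^'n) \<Rightarrow> real \<Rightarrow>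
     (real \<Rightarrow> real^'n \<Rightarrow> real) \<Rightarrow> real \<Rightarrow> real^'n \<Rightarrow> real" where
  "generator b \<sigma> T v t x =
     time_deriv T v t x + space_grad v t x \<bullet> b x
     + 1 / 2 * trace (transpose (\<sigma> x) ** space_hessian v t x ** \<sigma> x)"

end

theory Submission
  imports Defs
begin

text \<open>
  Stop the solution when it leaves \<open>\<X>\<close>, cut off at \<open>T\<close> and at a localising time \<open>\<tau> k\<close>; call the
  stopped process \<open>Y\<close>. If \<open>v (t, Y t)\<close> is a submartingale, then \<open>v 0 x0 \<le> E v (T, Y T)\<close>. A path that
  has left \<open>\<X>\<close> rests on the frontier, where \<open>v T \<le> 0\<close>, so \<open>v (T, Y T)\<close> is at most the indicator of
  the reach-avoid event. The drift of \<open>v (t, Y t)\<close> is the generator before the exit and the time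
  derivative after it, and both are nonnegative; only paths stopped by \<open>\<tau> k\<close> before \<open>T\<close> and before the exit
  spoil this, and their probability tends to 0 because a path that explodes cannot stay in the
  bounded set \<open>\<X>\<close>.

  For the drift it suffices to know three facts about the increments of the martingale part of
  \<open>Y\<close>: they are conditionally centred, their conditional covariance is the integral of
  \<open>\<sigma> \<sigma>\<^sup>T\<close>, and their fourth moment over an interval of length \<open>\<Delta>\<close> is at most \<open>C \<Delta>\<^sup>2\<close>. A
  second-order Taylor expansion along a uniform partition of \<open>[0, T]\<close> then has errors that vanish
  with the mesh. The three facts hold for step processes, where they follow from the independence of
  the Gaussian increments, and pass to the limit by uniform integrability.
\<close>

subsection \<open>Convergence in probability\<close>

text \<open>The Taylor remainder decides which moments are needed. On a compact set the derivatives
  of \<open>v\<close> have a modulus of continuity of the form \<epsilon> + C |h|^2, so the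
  remainder over a step of length \<Delta> is about (\<Delta> + |h|^2) (\<epsilon> + C |h|^2). With
  second moments O(\<Delta>) and fourth moments O(\<Delta>^2) its expectation is O(\<epsilon>
  \<Delta>) + O(\<Delta>^2): summed over the partition, the second part vanishes with the mesh for
  fixed \<epsilon>, and \<epsilon> tends to 0 afterwards. The obstacle is that the integral is given
  only as a limit in probability at each fixed time, while the exit is random and the integrand is
  bounded only up to it. Hence the approximating integrands are cut off at a rounded stopping time
  and clipped to the bound that holds before it; convergence in energy then yields convergence of
  the integrals. Conditional expectation is expressed by testing against bounded functions
  \<open>Z\<close> that are measurable at the left end of the interval. The gradient and the Hessian
  of \<open>v\<close> at the left end are such functions.\<close>

lemma (in prob_space) fatou_bounded_expectation:
  fixes f :: "nat \<Rightarrow> 'a \<Rightarrow> real"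
  assumes [measurable]: "g \<in> borel_measurable M"
    and int: "\<And>n. integrable M (f n)" and pos: "\<And>n. AE w in M. 0 \<le> f n w"
    and lim: "AE w in M. (\<lambda>n. f n w) \<longlonglongrightarrow> g w" and bnd: "\<And>n. expectation (f n) \<le> C"
  shows "integrable M g" "expectation g \<le> C"
proof -
  have posg: "AE w in M. 0 \<le> g w"
  proof -
    have "AE w in M. \<forall>n. 0 \<le> f n w" using pos by (simp add: AE_all_countable)
    with lim show ?thesis by eventually_elim (rule LIMSEQ_le_const, auto)
  qed
  have C: "0 \<le> C" using integral_nonneg_AE[OF pos[of 0]] bnd[of 0] by linarith
  have "(\<integral>\<^sup>+w. ennreal (g w) \<partial>M) = (\<integral>\<^sup>+w. liminf (\<lambda>n. ennreal (f n w)) \<partial>M)"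
    using lim by (intro nn_integral_cong_AE, eventually_elim)
      (metis lim_imp_Liminf sequentially_bot tendsto_ennrealI)
  also have "\<dots> \<le> liminf (\<lambda>n. \<integral>\<^sup>+w. ennreal (f n w) \<partial>M)"
    using int by (intro nn_integral_liminf) auto
  also have "\<dots> \<le> limsup (\<lambda>n. \<integral>\<^sup>+w. ennreal (f n w) \<partial>M)" by (simp add: Liminf_le_Limsup)
  also have "\<dots> \<le> ennreal C"
    using int pos bnd by (intro Limsup_bounded always_eventually)
      (auto simp: nn_integral_eq_integral intro!: ennreal_leI)
  finally have *: "(\<integral>\<^sup>+w. ennreal (g w) \<partial>M) \<le> ennreal C" .
  show ig: "integrable M g"
    using * posg by (intro integrableI_nonneg)
      (auto intro: le_less_trans[OF _ ennreal_less_top[of C]])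
  show "expectation g \<le> C"
    using * C ig posg by (simp add: nn_integral_eq_integral ennreal_le_iff)
qed

lemma (in prob_space) square_integrable_diff:
  fixes X Y :: "'a \<Rightarrow> real"
  assumes [measurable]: "X \<in> borel_measurable M" "Y \<in> borel_measurable M"
    and "integrable M (\<lambda>w. (X w)\<^sup>2)" "integrable M (\<lambda>w. (Y w)\<^sup>2)"
  shows "integrable M (\<lambda>w. (X w - Y w)\<^sup>2)"
    "expectation (\<lambda>w. (X w - Y w)\<^sup>2) \<le> 2 * expectation (\<lambda>w. (X w)\<^sup>2) + 2 * expectation (\<lambda>w. (Y w)\<^sup>2)"
proof -
  have b: "(X w - Y w)\<^sup>2 \<le> 2 * (X w)\<^sup>2 + 2 * (Y w)\<^sup>2" for w
    using zero_le_power2[of "X w + Y w"] by (simp add: power2_eq_square algebra_simps)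
  have i: "integrable M (\<lambda>w. 2 * (X w)\<^sup>2 + 2 * (Y w)\<^sup>2)" using assms by auto
  show 1: "integrable M (\<lambda>w. (X w - Y w)\<^sup>2)"
    by (rule Bochner_Integration.integrable_bound[OF i]) (use b in auto)
  have "expectation (\<lambda>w. (X w - Y w)\<^sup>2) \<le> expectation (\<lambda>w. 2 * (X w)\<^sup>2 + 2 * (Y w)\<^sup>2)"
    using 1 i b by (intro integral_mono) auto
  also have "\<dots> = 2 * expectation (\<lambda>w. (X w)\<^sup>2) + 2 * expectation (\<lambda>w. (Y w)\<^sup>2)"
    using assms by (subst Bochner_Integration.integral_add) auto
  finally show "expectation (\<lambda>w. (X w - Y w)\<^sup>2) \<le> \<dots>" .
qed

text \<open>Bounded second moments give uniform integrability. Since x \<le> min x R + x^2 / R for x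
  \<ge> 0, truncating \<open>\<bar>X n - Y\<bar>\<close> at R costs at most 4 C / R in expectation,
  and the truncated part tends to 0 by dominated convergence.\<close>

lemma (in prob_space) integral_tendsto_of_bounded_second_moment:
  fixes X :: "nat \<Rightarrow> 'a \<Rightarrow> real"
  assumes [measurable]: "\<And>n. X n \<in> borel_measurable M" "Y \<in> borel_measurable M"
    and lim: "AE w in M. (\<lambda>n. X n w) \<longlonglongrightarrow> Y w"
    and int: "\<And>n. integrable M (\<lambda>w. (X n w)\<^sup>2)" and bnd: "\<And>n. expectation (\<lambda>w. (X n w)\<^sup>2) \<le> C"
  shows "integrable M (\<lambda>w. (Y w)\<^sup>2)" "expectation (\<lambda>w. (Y w)\<^sup>2) \<le> C"
    "(\<lambda>n. expectation (X n)) \<longlonglongrightarrow> expectation Y"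
proof -
  have lim2: "AE w in M. (\<lambda>n. (X n w)\<^sup>2) \<longlonglongrightarrow> (Y w)\<^sup>2"
    using lim by eventually_elim (intro tendsto_power)
  show Y2: "integrable M (\<lambda>w. (Y w)\<^sup>2)" and YC: "expectation (\<lambda>w. (Y w)\<^sup>2) \<le> C"
    by (rule fatou_bounded_expectation[OF _ int _ lim2 bnd]; simp)+
  have C: "0 \<le> C" by (rule order_trans[OF _ bnd[of 0]]) simp
  have iX: "integrable M (X n)" for n using square_integrable_imp_integrable[of "X n", OF _ int] by simp
  have iY: "integrable M Y" using square_integrable_imp_integrable[of Y, OF _ Y2] by simp
  define D where "D n w = \<bar>X n w - Y w\<bar>" for n w
  have [measurable]: "D n \<in> borel_measurable M" for n unfolding D_def by measurable
  have iD: "integrable M (D n)" for n unfolding D_def using iX iY by auto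
  have D2: "integrable M (\<lambda>w. (D n w)\<^sup>2)" "expectation (\<lambda>w. (D n w)\<^sup>2) \<le> 4 * C" for n
    using square_integrable_diff[of "X n" Y] int Y2 bnd[of n] YC by (auto simp: D_def)
  have key: "expectation (D n) \<le> expectation (\<lambda>w. min (D n w) R) + 4 * C / R" if "R > 0" for n R
  proof -
    have imin: "integrable M (\<lambda>w. min (D n w) R)"
      by (rule Bochner_Integration.integrable_bound[OF iD[of n]]) (use that in \<open>auto simp: D_def\<close>)
    have p: "D n w \<le> min (D n w) R + (D n w)\<^sup>2 / R" for w
    proof (cases "D n w \<le> R")
      case False
      then have "D n w * R \<le> D n w * D n w" using that by (intro mult_left_mono) (auto simp: D_def)
      then have "D n w \<le> (D n w)\<^sup>2 / R" using that by (simp add: field_simps power2_eq_square)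
      then show ?thesis using that by (simp add: min_def D_def)
    qed (use that in auto)
    have "expectation (D n) \<le> expectation (\<lambda>w. min (D n w) R + (D n w)\<^sup>2 / R)"
      using iD imin D2 p by (intro integral_mono) auto
    also have "\<dots> = expectation (\<lambda>w. min (D n w) R) + expectation (\<lambda>w. (D n w)\<^sup>2) / R"
      using imin D2 by (subst Bochner_Integration.integral_add) auto
    also have "\<dots> \<le> expectation (\<lambda>w. min (D n w) R) + 4 * C / R"
      using D2(2)[of n] that by (intro add_left_mono divide_right_mono) auto
    finally show ?thesis .
  qed
  have D0: "(\<lambda>n. expectation (D n)) \<longlonglongrightarrow> 0"
  proof (rule LIMSEQ_I)
    fix e :: real assume e: "0 < e"
    \<comment> \<open>Makes 4 C / R smaller than e / 2; the summand 1 keeps R positive when C =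
      0.\<close>
    define R where "R = 8 * C / e + 1"
    have R: "R > 0" "4 * C / R < e / 2 \<or> C = 0"
      using e C by (auto simp: R_def field_simps add_pos_nonneg add_nonneg_pos)
    then have R2: "4 * C / R < e / 2" using e by auto
    have "(\<lambda>n. expectation (\<lambda>w. min (D n w) R)) \<longlonglongrightarrow> expectation (\<lambda>w. 0)"
    proof (rule integral_dominated_convergence[where w="\<lambda>_. R"])
      show "AE w in M. (\<lambda>n. min (D n w) R) \<longlonglongrightarrow> 0"
        using lim
      proof eventually_elim
        case (elim w)
        have "(\<lambda>n. min (D n w) R) \<longlonglongrightarrow> min \<bar>Y w - Y w\<bar> R"
          unfolding D_def by (intro tendsto_intros elim)
        then show ?case using R by simp
      qed
    qed (use R in \<open>auto simp: D_def\<close>)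
    then have "(\<lambda>n. expectation (\<lambda>w. min (D n w) R)) \<longlonglongrightarrow> 0" by simp
    then have "\<forall>\<^sub>F n in sequentially. expectation (\<lambda>w. min (D n w) R) < e / 2"
      using e by (intro order_tendstoD(2)) auto
    then obtain N where N: "\<And>n. n \<ge> N \<Longrightarrow> expectation (\<lambda>w. min (D n w) R) < e / 2"
      by (auto simp: eventually_sequentially)
    show "\<exists>N. \<forall>n\<ge>N. norm (expectation (D n) - 0) < e"
    proof (intro exI[of _ N] allI impI)
      fix n assume "n \<ge> N"
      then have "expectation (D n) < e" using key[OF R(1), of n] N[of n] R2 by linarith
      moreover have "0 \<le> expectation (D n)" by (rule Bochner_Integration.integral_nonneg) (auto simp: D_def)
      ultimately show "norm (expectation (D n) - 0) < e" by simp
    qed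
  qed
  have "norm (expectation (X n) - expectation Y) \<le> expectation (D n)" for n
    using integral_norm_bound[of M "\<lambda>w. X n w - Y w"] iX iY
    by (simp add: D_def[abs_def])
  then have "(\<lambda>n. expectation (X n) - expectation Y) \<longlonglongrightarrow> 0"
    using D0 by (intro Lim_null_comparison[OF _ D0]) auto
  then show "(\<lambda>n. expectation (X n)) \<longlonglongrightarrow> expectation Y" by (simp add: LIM_zero_iff)
qed

context prob_space begin

lemma vanishes_mono:
  assumes Z: "vanishes_in_probability M Z" and [measurable]: "\<And>m. Z' m \<in> borel_measurable M"
    and le: "\<And>m. AE w in M. Z' m w \<le> Z m w"
  shows "vanishes_in_probability M Z'"
  unfolding vanishes_in_probability_def
proof (intro conjI allI impI)
  have [measurable]: "Z m \<in> borel_measurable M" for m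
    using Z by (auto simp: vanishes_in_probability_def)
  fix e :: real assume "e > 0"
  then have l: "(\<lambda>m. measure M {w \<in> space M. ennreal e < Z m w}) \<longlonglongrightarrow> 0"
    using Z by (auto simp: vanishes_in_probability_def)
  have "measure M {w \<in> space M. ennreal e < Z' m w} \<le> measure M {w \<in> space M. ennreal e < Z m w}" for m
    using le[of m] by (intro finite_measure_mono_AE) auto
  then show "(\<lambda>m. measure M {w \<in> space M. ennreal e < Z' m w}) \<longlonglongrightarrow> 0"
    by (intro Lim_null_comparison[OF always_eventually l]) auto
qed (use assms in auto)

lemma vanishes_measurable: "vanishes_in_probability M Z \<Longrightarrow> Z m \<in> borel_measurable M"
  by (auto simp: vanishes_in_probability_def)

lemma vanishes_add:
  assumes Z: "vanishes_in_probability M Z" and Y: "vanishes_in_probability M Y"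
  shows "vanishes_in_probability M (\<lambda>m w. Z m w + Y m w)"
  unfolding vanishes_in_probability_def
proof (intro conjI allI impI)
  note [measurable] = vanishes_measurable[OF Z] vanishes_measurable[OF Y]
  show "(\<lambda>w. Z m w + Y m w) \<in> borel_measurable M" for m by measurable
  fix e :: real assume e: "e > 0"
  let ?P = "\<lambda>Z m. measure M {w \<in> space M. ennreal (e/2) < Z m w}"
  have "?P Z \<longlonglongrightarrow> 0" "?P Y \<longlonglongrightarrow> 0" using Z Y e by (auto simp: vanishes_in_probability_def)
  then have s: "(\<lambda>m. ?P Z m + ?P Y m) \<longlonglongrightarrow> 0" using tendsto_add by fastforce
  have "measure M {w \<in> space M. ennreal e < Z m w + Y m w} \<le> ?P Z m + ?P Y m" for m
  proof -
    have "{w \<in> space M. ennreal e < Z m w + Y m w} \<subseteq>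
      {w \<in> space M. ennreal (e/2) < Z m w} \<union> {w \<in> space M. ennreal (e/2) < Y m w}"
    proof safe
      fix w assume 1: "ennreal e < Z m w + Y m w" and "\<not> ennreal (e/2) < Y m w"
      show "ennreal (e/2) < Z m w"
      proof (rule ccontr)
        assume "\<not> ennreal (e/2) < Z m w"
        then have "Z m w + Y m w \<le> ennreal (e/2) + ennreal (e/2)"
          using \<open>\<not> ennreal (e/2) < Y m w\<close> by (intro add_mono) auto
        also have "\<dots> = ennreal e" using e by (subst ennreal_plus[symmetric]) auto
        finally show False using 1 by simp
      qed
    qed
    then have "measure M {w \<in> space M. ennreal e < Z m w + Y m w} \<le>
      measure M ({w \<in> space M. ennreal (e/2) < Z m w} \<union> {w \<in> space M. ennreal (e/2) < Y m w})"
      by (intro finite_measure_mono) auto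
    also have "\<dots> \<le> ?P Z m + ?P Y m" by (intro measure_Un_le) auto
    finally show ?thesis .
  qed
  then show "(\<lambda>m. measure M {w \<in> space M. ennreal e < Z m w + Y m w}) \<longlonglongrightarrow> 0"
    by (intro Lim_null_comparison[OF always_eventually s]) auto
qed

lemma vanishes_zero: "vanishes_in_probability M (\<lambda>m w. 0)"
  by (auto simp: vanishes_in_probability_def)

lemma vanishes_sum:
  assumes "finite I" "\<And>i. i \<in> I \<Longrightarrow> vanishes_in_probability M (Z i)"
  shows "vanishes_in_probability M (\<lambda>m w. \<Sum>i\<in>I. Z i m w)"
  using assms by (induction I rule: finite_induct) (auto intro: vanishes_zero vanishes_add)

text \<open>Stated for numerals because such a multiple is a sum of that many copies of
  \<open>Z\<close>.\<close>

lemma vanishes_numeral_mult: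
  assumes Z: "vanishes_in_probability M Z"
  shows "vanishes_in_probability M (\<lambda>m w. numeral k * Z m w)"
  using vanishes_sum[of "{..<numeral k::nat}" "\<lambda>_. Z"] Z by simp

lemma vanishes_AE:
  assumes [measurable]: "\<And>m. Z m \<in> borel_measurable M" and lim: "AE w in M. (\<lambda>m. Z m w) \<longlonglongrightarrow> 0"
  shows "vanishes_in_probability M Z"
  unfolding vanishes_in_probability_def
proof (intro conjI allI impI)
  fix e :: real assume e: "e > 0"
  let ?A = "\<lambda>m. {w \<in> space M. ennreal e < Z m w}"
  have "(\<lambda>m. expectation (indicator (?A m))) \<longlonglongrightarrow> expectation (\<lambda>w. 0::real)"
  proof (rule integral_dominated_convergence[where w="\<lambda>_. 1"])
    show "AE w in M. (\<lambda>m. indicator (?A m) w) \<longlonglongrightarrow> (0::real)"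
      using lim
    proof eventually_elim
      case (elim w)
      then have "\<forall>\<^sub>F m in sequentially. Z m w < ennreal e" using e by (intro order_tendstoD(2)) auto
      then have "\<forall>\<^sub>F m in sequentially. indicator (?A m) w = (0::real)"
        by eventually_elim (auto simp: indicator_def)
      then show ?case by (rule tendsto_eventually)
    qed
  qed (auto simp: indicator_def)
  then show "(\<lambda>m. measure M (?A m)) \<longlonglongrightarrow> 0" by simp
qed auto

text \<open>For each N some index has exceptional probability below 1/(N+1) at the threshold
  1/(N+1), and following these indices gives the diagonal. This allows an approximating simple
  process to be chosen after the mesh of the time rounding has been fixed.\<close>

lemma vanishes_diagonal:
  assumes Z: "\<And>N. vanishes_in_probability M (Z N)"
  obtains m :: "nat \<Rightarrow> nat" where "vanishes_in_probability M (\<lambda>N. Z N (m N))"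
proof -
  have "\<exists>k. measure M {w \<in> space M. ennreal (1 / Suc N) < Z N k w} < 1 / Suc N" for N
  proof -
    have "(\<lambda>k. measure M {w \<in> space M. ennreal (1 / Suc N) < Z N k w}) \<longlonglongrightarrow> 0"
      using Z[of N] by (auto simp: vanishes_in_probability_def)
    then have "\<forall>\<^sub>F k in sequentially. measure M {w \<in> space M. ennreal (1 / Suc N) < Z N k w} < 1 / Suc N"
      by (rule order_tendstoD(2)) auto
    then show ?thesis by (auto simp: eventually_sequentially)
  qed
  then have "\<exists>m. \<forall>N. measure M {w \<in> space M. ennreal (1 / Suc N) < Z N (m N) w} < 1 / Suc N"
    by (intro choice allI)
  then obtain m where m: "\<And>N. measure M {w \<in> space M. ennreal (1 / Suc N) < Z N (m N) w} < 1 / Suc N"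
    by blast
  have "vanishes_in_probability M (\<lambda>N. Z N (m N))"
    unfolding vanishes_in_probability_def
  proof (intro conjI allI impI)
    note [measurable] = vanishes_measurable[OF Z]
    show "Z N (m N) \<in> borel_measurable M" for N by measurable
    fix e :: real assume e: "e > 0"
    have ev: "\<forall>\<^sub>F N in sequentially. inverse (real (Suc N)) < e"
      using LIMSEQ_inverse_real_of_nat e by (rule order_tendstoD(2))
    show "(\<lambda>N. measure M {w \<in> space M. ennreal e < Z N (m N) w}) \<longlonglongrightarrow> 0"
    proof (rule Lim_null_comparison[OF _ LIMSEQ_inverse_real_of_nat])
      show "\<forall>\<^sub>F N in sequentially. norm (measure M {w \<in> space M. ennreal e < Z N (m N) w}) \<le> inverse (real (Suc N))"
        using ev
      proof eventually_elim
        case (elim N)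
        have "measure M {w \<in> space M. ennreal e < Z N (m N) w} \<le> measure M {w \<in> space M. ennreal (1 / Suc N) < Z N (m N) w}"
          using elim by (intro finite_measure_mono)
            (auto simp: inverse_eq_divide intro: le_less_trans[OF ennreal_leI[OF less_imp_le]])
        then show ?case using m[of N] by (simp add: inverse_eq_divide)
      qed
    qed
  qed
  then show thesis by (rule that)
qed

text \<open>The N-th index lies beyond the previous one and has exceptional probability below 2^-N
  at the threshold 2^-N. The probabilities are summable, so by Borel-Cantelli almost every outcome
  is eventually below the thresholds.\<close>

lemma vanishes_imp_AE_subseq:
  assumes Z: "vanishes_in_probability M Z"
  obtains r :: "nat \<Rightarrow> nat" where "strict_mono r" "AE w in M. (\<lambda>k. Z (r k) w) \<longlonglongrightarrow> 0"
proof -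
  note [measurable] = vanishes_measurable[OF Z]
  have ex: "\<exists>k>l. measure M {w \<in> space M. ennreal ((1/2)^N) < Z k w} < (1/2)^N" for N l
  proof -
    have "(\<lambda>k. measure M {w \<in> space M. ennreal ((1/2)^N) < Z k w}) \<longlonglongrightarrow> 0"
      using Z by (auto simp: vanishes_in_probability_def)
    then have "\<forall>\<^sub>F k in sequentially. measure M {w \<in> space M. ennreal ((1/2)^N) < Z k w} < (1/2)^N"
      by (rule order_tendstoD(2)) auto
    with eventually_gt_at_top[of l] have "\<forall>\<^sub>F k in sequentially. k > l \<and> measure M {w \<in> space M. ennreal ((1/2)^N) < Z k w} < (1/2)^N"
      by eventually_elim auto
    then show ?thesis by (auto simp: eventually_sequentially)
  qed
  then have "\<exists>g. \<forall>N l. g N l > l \<and> measure M {w \<in> space M. ennreal ((1/2)^N) < Z (g N l) w} < (1/2)^N"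
    by (intro choice allI)
  then obtain g where g: "\<And>N l. g N l > l" "\<And>N l. measure M {w \<in> space M. ennreal ((1/2)^N) < Z (g N l) w} < (1/2)^N"
    by blast
  define r where "r = rec_nat (g 0 0) (\<lambda>N l. g (Suc N) l)"
  have rs: "r (Suc N) = g (Suc N) (r N)" and r0: "r 0 = g 0 0" for N by (auto simp: r_def)
  have "strict_mono r" using g rs by (auto simp: strict_mono_Suc_iff)
  define A where "A N = {w \<in> space M. ennreal ((1/2)^N) < Z (r N) w}" for N
  have A: "measure M (A N) < (1/2)^N" for N
    using g(2)[of 0 0] g(2)[of "Suc _"] by (cases N) (auto simp: A_def r0 rs)
  have [measurable]: "A N \<in> sets M" for N unfolding A_def by measurable
  have "AE w in M. eventually (\<lambda>N. w \<in> space M - A N) sequentially"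
  proof (rule borel_cantelli_AE1)
    show "summable (\<lambda>N. measure M (A N))"
      by (rule summable_comparison_test'[of "\<lambda>N. (1/2::real)^N" 0]) (use A in \<open>auto intro: less_imp_le summable_geometric\<close>)
  qed (auto simp: less_top[symmetric])
  then have "AE w in M. (\<lambda>k. Z (r k) w) \<longlonglongrightarrow> 0"
  proof eventually_elim
    case (elim w)
    then have ev: "eventually (\<lambda>N. Z (r N) w \<le> ennreal ((1/2)^N)) sequentially"
      by eventually_elim (auto simp: A_def not_less)
    have "(\<lambda>N. ennreal ((1/2)^N)) \<longlonglongrightarrow> ennreal 0"
      by (intro tendsto_ennrealI LIMSEQ_power_zero) auto
    then show ?case
      by (intro tendsto_sandwich[OF _ ev tendsto_const[of 0]]) auto
  qed
  with \<open>strict_mono r\<close> show thesis by (rule that)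
qed

end

subsection \<open>Wiener increments\<close>

locale wiener = prob_space M for M :: "'a measure" +
  fixes W :: "real \<Rightarrow> 'a \<Rightarrow> real^'k"
  assumes wiener: "wiener_process M W"
begin

abbreviation F where "F \<equiv> augmented_filtration M W"

lemma W_measurable [measurable]: "0 \<le> t \<Longrightarrow> W t \<in> borel_measurable M"
  using wiener by (auto simp: wiener_process_def)

lemma sets_W_in: "0 \<le> t \<Longrightarrow> B \<in> sets borel \<Longrightarrow> {w \<in> space M. W t w \<in> B} \<in> sets M"
  using measurable_sets[OF W_measurable, of t B] by (simp add: vimage_def Int_def conj_commute)

lemma filtration_generator_subset:
  "{W s -` B \<inter> space M | s B. 0 \<le> s \<and> s \<le> t \<and> B \<in> sets borel} \<union> null_sets M \<subseteq> sets M"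
  by (auto intro: measurable_sets[OF W_measurable])

lemma space_filtration [simp]: "space (F t) = space M"
  by (simp add: augmented_filtration_def space_measure_of_conv)

lemma sets_filtration: "sets (F t) = sigma_sets (space M)
  ({W s -` B \<inter> space M | s B. 0 \<le> s \<and> s \<le> t \<and> B \<in> sets borel} \<union> null_sets M)"
  unfolding augmented_filtration_def
  by (rule sets_measure_of) (use filtration_generator_subset[of t] sets.sets_into_space in blast)

lemma sets_filtration_subset: "sets (F t) \<subseteq> sets M"
  unfolding sets_filtration by (rule sets.sigma_sets_subset[OF filtration_generator_subset])

lemma filtration_mono: "s \<le> t \<Longrightarrow> sets (F s) \<subseteq> sets (F t)"
  unfolding sets_filtration by (rule sigma_sets_mono') fastforce

lemma subalgebra_filtration: "subalgebra M (F t)"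
  by (simp add: subalgebra_def sets_filtration_subset)

lemma measurable_filtration: "f \<in> measurable (F t) N \<Longrightarrow> f \<in> measurable M N"
  by (rule measurable_from_subalg[OF subalgebra_filtration])

lemma measurable_filtration_mono:
  "f \<in> measurable (F s) N \<Longrightarrow> s \<le> t \<Longrightarrow> f \<in> measurable (F t) N"
  by (rule measurable_from_subalg[of "F t" "F s"]) (simp_all add: subalgebra_def filtration_mono)

lemma W_filtration: "0 \<le> s \<Longrightarrow> s \<le> t \<Longrightarrow> W s \<in> borel_measurable (F t)"
  by (rule measurableI) (auto simp: sets_filtration intro!: sigma_sets.Basic)

text \<open>The values of \<open>W\<close> at the times in \<open>R\<close> are sums of increments over a partition of \<open>[0, s]\<close>; this
  holds only almost surely, since \<open>W 0 = 0\<close> holds only almost surely.\<close>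

lemma cylinder_indep_increment:
  assumes R: "finite R" "R \<subseteq> {0..s}" and st: "0 \<le> s" "s \<le> t"
    and B: "\<And>r. r \<in> R \<Longrightarrow> B r \<in> sets borel" and D: "D \<in> sets borel"
  shows "prob ({w \<in> space M. \<forall>r\<in>R. W r w \<in> B r} \<inter> {w \<in> space M. W t w - W s w \<in> D}) =
    prob {w \<in> space M. \<forall>r\<in>R. W r w \<in> B r} * prob {w \<in> space M. W t w - W s w \<in> D}"
proof -
  \<comment> \<open>The point 0 is added so that each \<open>W r\<close> is a sum of increments
    starting from \<open>W 0\<close>, and s so that the partition of the past ends there. The point
    t, appended by \<open>p\<close> below, makes the n-th increment exactly
    \<open>W t - W s\<close>.\<close>
  define l where "l = sorted_list_of_set (R \<union> {0, s})"
  have fin: "finite (R \<union> {0, s})" using R by simp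
  have l: "sorted l" "set l = R \<union> {0, s}"
    unfolding l_def by (rule sorted_sorted_list_of_set, rule set_sorted_list_of_set[OF fin])
  have l0: "l \<noteq> []" using l by auto
  define n where "n = length l - 1"
  have len: "length l = Suc n" using l0 by (cases l) (auto simp: n_def)
  have ex: "\<exists>i<Suc n. l ! i = x" if "x \<in> R \<union> {0, s}" for x
    using that unfolding l(2)[symmetric] in_set_conv_nth len by auto
  define p where "p i = (if i < Suc n then l ! i else t)" for i
  have ls: "set l \<subseteq> {0..s}" using l R st by auto
  have pR: "p i \<in> {0..s}" if "i \<le> n" for i
    using subsetD[OF ls nth_mem[of i l]] that len by (simp add: p_def)
  have mono: "p i \<le> p (Suc i)" for i
    using l(1) len pR[of i] st by (auto simp: p_def sorted_iff_nth_mono)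
  have mono': "p i \<le> p j" if "i \<le> j" for i j using that mono by (rule lift_Suc_mono_le[rotated])
  have p0: "p 0 = 0"
  proof -
    obtain i where "i < Suc n" "l ! i = 0" using ex[of 0] by auto
    then show ?thesis using mono'[of 0 i] pR[of 0] by (auto simp: p_def)
  qed
  have pn: "p n = s"
  proof -
    obtain i where "i < Suc n" "l ! i = s" using ex[of s] by auto
    then show ?thesis using mono'[of i n] pR[of n] by (auto simp: p_def)
  qed
  have pt: "p (Suc n) = t" by (simp add: p_def)
  have pR': "\<exists>k\<le>n. r = p k" if "r \<in> R" for r
  proof -
    obtain i where "i < Suc n" "l ! i = r" using ex[of r] \<open>r \<in> R\<close> by auto
    then show ?thesis by (intro exI[of _ i]) (auto simp: p_def)
  qed
  define d where "d i w = W (p (Suc i)) w - W (p i) w" for i w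
  have "indep_vars (\<lambda>_. borel) d {..<Suc n}"
    using wiener[unfolded wiener_process_def independent_increments_def, THEN conjunct2, THEN conjunct2,
        THEN conjunct2, THEN conjunct1, rule_format, of p "Suc n"] mono p0
    unfolding d_def[abs_def] by simp
  then have iv: "indep_var (PiM {..<n} (\<lambda>_. borel)) (\<lambda>w. restrict (\<lambda>i. d i w) {..<n})
      (PiM {n} (\<lambda>_. borel)) (\<lambda>w. restrict (\<lambda>i. d i w) {n})"
    by (rule indep_var_restrict) auto
  \<comment> \<open>\<open>S r\<close> recovers \<open>W r - W 0\<close> from the increments by
    adding those of the intervals that end by time r.\<close>
  define S where "S r x = (\<Sum>i<n. if p (Suc i) \<le> r then x i else 0)" for r and x :: "nat \<Rightarrow> real^'k"
  have [measurable]: "S r \<in> borel_measurable (PiM {..<n} (\<lambda>_. borel))" for r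
    unfolding S_def by measurable
  define XA where "XA = {x \<in> space (PiM {..<n} (\<lambda>_. borel)). \<forall>r\<in>R. S r x \<in> B r}"
  define XB where "XB = {x \<in> space (PiM {n} (\<lambda>_. borel)). (x n :: real^'k) \<in> D}"
  have XA: "XA \<in> sets (PiM {..<n} (\<lambda>_. borel))"
    unfolding XA_def
  proof (rule sets.sets_Collect_finite_All)
    fix r assume "r \<in> R"
    then have [measurable]: "B r \<in> sets borel" by (rule B)
    show "{x \<in> space (PiM {..<n} (\<lambda>_. borel)). S r x \<in> B r} \<in> sets (PiM {..<n} (\<lambda>_. borel))"
      by measurable
  qed (use R in auto)
  have XB: "XB \<in> sets (PiM {n} (\<lambda>_. borel))"
    unfolding XB_def using D by measurable
  note [measurable] = D
  have dm: "d i \<in> borel_measurable M" if "i \<le> n" for i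
    unfolding d_def using pR[OF that] pR[of "Suc i"] st pt that
    by (intro borel_measurable_diff W_measurable) (auto simp: p_def le_Suc_eq)
  have Eq: "{w \<in> space M. W t w - W s w \<in> D} = (\<lambda>w. restrict (\<lambda>i. d i w) {n}) -` XB \<inter> space M"
    by (auto simp: XB_def space_PiM d_def pn pt)
  have Sd: "S (p k) (restrict (\<lambda>i. d i w) {..<n}) = W (p k) w - W 0 w" if k: "k \<le> n" for k w
  proof -
    \<comment> \<open>The two conditions can differ only on an interval of length 0, whose increment
      is 0.\<close>
    have strict: "(if p (Suc i) \<le> p k then d i w else 0) = (if i < k then d i w else 0)" for i
    proof (cases "i < k")
      case True then show ?thesis using mono'[of "Suc i" k] by auto
    next
      case False
      then have "p k \<le> p i" using mono' by auto
      then show ?thesis using False mono[of i] by (auto simp: d_def dest: order_antisym)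
    qed
    have "S (p k) (restrict (\<lambda>i. d i w) {..<n}) = (\<Sum>i<n. if i < k then d i w else 0)"
      unfolding S_def by (rule sum.cong) (auto simp flip: strict)
    also have "\<dots> = (\<Sum>i<k. d i w)" using k by (intro sum.mono_neutral_cong_right) auto
    also have "\<dots> = W (p k) w - W (p 0) w" unfolding d_def by (rule sum_lessThan_telescope)
    finally show ?thesis by (simp add: p0)
  qed
  let ?A = "{w \<in> space M. \<forall>r\<in>R. W r w \<in> B r}" and ?A' = "(\<lambda>w. restrict (\<lambda>i. d i w) {..<n}) -` XA \<inter> space M"
    and ?E = "{w \<in> space M. W t w - W s w \<in> D}"
  have AE0: "AE w in M. W 0 w = 0" using wiener by (auto simp: wiener_process_def)
  have eqA: "AE w in M. w \<in> ?A \<longleftrightarrow> w \<in> ?A'"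
    using AE0
  proof eventually_elim
    case (elim w)
    have "S r (restrict (\<lambda>i. d i w) {..<n}) = W r w" if "r \<in> R" for r
      using pR'[OF that] Sd elim by auto
    then show ?case by (auto simp: XA_def space_PiM)
  qed
  have Am: "?A \<in> sets M"
  proof (rule sets.sets_Collect_finite_All)
    fix r assume "r \<in> R"
    then show "{w \<in> space M. W r w \<in> B r} \<in> sets M"
      using B[of r] R by (intro sets_W_in) auto
  qed (use R in auto)
  have A'm: "?A' \<in> sets M"
    by (rule measurable_sets[OF _ XA]) (auto intro!: measurable_restrict dm)
  have "(\<lambda>w. W t w - W s w) \<in> borel_measurable M"
    using st by (intro borel_measurable_diff W_measurable) auto
  then have Em: "?E \<in> sets M"
    using measurable_sets[OF _ D] by (simp add: vimage_def Int_def conj_commute)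
  have "prob (?A \<inter> ?E) = prob (?A' \<inter> ?E)"
    by (rule finite_measure_eq_AE) (use eqA Am A'm Em in auto)
  also have "\<dots> = prob ((\<lambda>w. (restrict (\<lambda>i. d i w) {..<n}, restrict (\<lambda>i. d i w) {n})) -` (XA \<times> XB) \<inter> space M)"
    unfolding Eq by (rule arg_cong[where f=prob]) auto
  also have "\<dots> = prob ?A' * prob ?E" unfolding Eq by (rule indep_varD[OF iv XA XB])
  also have "prob ?A' = prob ?A"
    by (rule finite_measure_eq_AE) (use eqA Am A'm in auto)
  finally show ?thesis .
qed

text \<open>Cylinder sets over finitely many times up to s, together with the null sets, form an
  intersection-stable generator of \<open>F s\<close>. Cylinders are independent of the increment by
  the previous lemma and null sets are independent of everything, so independence extends to the
  generated sigma-algebras.\<close>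

lemma indep_filtration_increment:
  assumes st: "0 \<le> s" "s \<le> t"
  shows "indep_set (sets (F s)) (sigma_sets (space M) {(\<lambda>w. W t w - W s w) -` D \<inter> space M | D. D \<in> sets borel})"
proof -
  define C where "C = {{w \<in> space M. \<forall>r\<in>R. W r w \<in> B r} | R B. finite R \<and> R \<subseteq> {0..s} \<and> (\<forall>r\<in>R. B r \<in> sets borel)}"
  let ?E = "{(\<lambda>w. W t w - W s w) -` D \<inter> space M | D. D \<in> sets borel}"
  have Csets: "C \<subseteq> sets M"
    unfolding C_def
  proof safe
    fix R :: "real set" and B :: "real \<Rightarrow> (real^'k) set"
    assume R: "finite R" "R \<subseteq> {0..s}" "\<forall>r\<in>R. B r \<in> sets borel"
    show "{w \<in> space M. \<forall>r\<in>R. W r w \<in> B r} \<in> sets M"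
    proof (rule sets.sets_Collect_finite_All)
      fix r assume "r \<in> R"
      then show "{w \<in> space M. W r w \<in> B r} \<in> sets M"
        using R by (intro sets_W_in) auto
    qed (use R in auto)
  qed
  have "indep_set (C \<union> null_sets M) ?E"
    unfolding indep_sets2_eq
  proof (intro conjI ballI)
    show "C \<union> null_sets M \<subseteq> events" using Csets by auto
    have m: "(\<lambda>w. W t w - W s w) \<in> borel_measurable M" using st by auto
    then show "?E \<subseteq> events" by (auto intro: measurable_sets)
    fix a e assume a: "a \<in> C \<union> null_sets M" and "e \<in> ?E"
    then obtain D where D: "e = (\<lambda>w. W t w - W s w) -` D \<inter> space M" "D \<in> sets borel" by auto
    then have e: "e \<in> sets M" using m by (auto intro: measurable_sets)
    from a show "prob (a \<inter> e) = prob a * prob e"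
    proof
      assume "a \<in> C"
      then obtain R B where R: "finite R" "R \<subseteq> {0..s}" "\<forall>r\<in>R. B r \<in> sets borel"
        and a: "a = {w \<in> space M. \<forall>r\<in>R. W r w \<in> B r}" by (auto simp: C_def)
      have "e = {w \<in> space M. W t w - W s w \<in> D}" using D by auto
      then show ?thesis unfolding a using cylinder_indep_increment[OF R(1,2) st, of B D] R D by auto
    next
      assume a: "a \<in> null_sets M"
      then have "a \<inter> e \<in> null_sets M" using e by (rule null_set_Int2)
      then show ?thesis using a by (auto simp: measure_eq_0_null_sets)
    qed
  qed
  moreover have "Int_stable (C \<union> null_sets M)"
  proof (rule Int_stableI)
    fix a b assume ab: "a \<in> C \<union> null_sets M" "b \<in> C \<union> null_sets M"
    then have sets: "a \<in> sets M" "b \<in> sets M" using Csets by auto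
    show "a \<inter> b \<in> C \<union> null_sets M"
    proof (cases "a \<in> null_sets M \<or> b \<in> null_sets M")
      case True then show ?thesis using sets by (auto intro: null_set_Int1 null_set_Int2)
    next
      case False
      then obtain R B R' B' where
        R: "finite R" "R \<subseteq> {0..s}" "\<forall>r\<in>R. B r \<in> sets borel" "a = {w \<in> space M. \<forall>r\<in>R. W r w \<in> B r}" and
        R': "finite R'" "R' \<subseteq> {0..s}" "\<forall>r\<in>R'. B' r \<in> sets borel" "b = {w \<in> space M. \<forall>r\<in>R'. W r w \<in> B' r}"
        using ab by (auto simp: C_def)
      define B'' where "B'' r = (if r \<in> R then B r else UNIV) \<inter> (if r \<in> R' then B' r else UNIV)" for r
      have "a \<inter> b = {w \<in> space M. \<forall>r\<in>R \<union> R'. W r w \<in> B'' r}"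
        unfolding R R' B''_def by auto
      moreover have "finite (R \<union> R') \<and> R \<union> R' \<subseteq> {0..s} \<and> (\<forall>r\<in>R \<union> R'. B'' r \<in> sets borel)"
        using R R' by (simp add: B''_def)
      ultimately have "a \<inter> b \<in> C" unfolding C_def by (intro CollectI exI conjI) auto
      then show ?thesis ..
    qed
  qed
  moreover have "Int_stable ?E"
  proof (rule Int_stableI, clarsimp)
    fix D D' :: "(real^'k) set" assume D: "D \<in> sets borel" "D' \<in> sets borel"
    show "\<exists>D''. (\<lambda>w. W t w - W s w) -` D \<inter> space M \<inter> ((\<lambda>w. W t w - W s w) -` D' \<inter> space M) =
      (\<lambda>w. W t w - W s w) -` D'' \<inter> space M \<and> D'' \<in> sets borel"
      using D by (intro exI[of _ "D \<inter> D'"]) auto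
  qed
  ultimately have ind: "indep_set (sigma_sets (space M) (C \<union> null_sets M)) (sigma_sets (space M) ?E)"
    by (rule indep_set_sigma_sets)
  have "sets (F s) \<subseteq> sigma_sets (space M) (C \<union> null_sets M)"
    unfolding sets_filtration
  proof (rule sigma_sets_mono', safe)
    fix r B assume r: "0 \<le> r" "r \<le> s" "B \<in> sets (borel :: (real^'k) measure)" "W r -` B \<inter> space M \<notin> null_sets M"
    have "W r -` B \<inter> space M = {w \<in> space M. \<forall>r\<in>{r}. W r w \<in> B}" by auto
    moreover have "finite {r} \<and> {r} \<subseteq> {0..s} \<and> (\<forall>r\<in>{r}. B \<in> sets borel)" using r by simp
    ultimately have "\<exists>R B'. W r -` B \<inter> space M = {w \<in> space M. \<forall>r\<in>R. W r w \<in> B' r} \<and>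
        finite R \<and> R \<subseteq> {0..s} \<and> (\<forall>r\<in>R. B' r \<in> sets borel)"
      by (intro exI[of _ "{r}"] exI[of _ "\<lambda>_. B"]) simp
    then show "W r -` B \<inter> space M \<in> C" unfolding C_def by (rule CollectI)
  qed
  with ind show ?thesis unfolding indep_sets2_eq by blast
qed

text \<open>The form in which independence of the past enters all moment computations: a factor
  known at time s splits off any function of the later increment.\<close>

lemma
  fixes Z :: "'a \<Rightarrow> real" and \<phi> :: "real^'k \<Rightarrow> real"
  assumes st: "0 \<le> s" "s \<le> t"
    and Z: "Z \<in> borel_measurable (F s)" "integrable M Z"
    and phi: "\<phi> \<in> borel_measurable borel" "integrable M (\<lambda>w. \<phi> (W t w - W s w))"
  shows integrable_mult_increment: "integrable M (\<lambda>w. Z w * \<phi> (W t w - W s w))"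
    and expectation_mult_increment:
      "expectation (\<lambda>w. Z w * \<phi> (W t w - W s w)) = expectation Z * expectation (\<lambda>w. \<phi> (W t w - W s w))"
proof -
  let ?d = "\<lambda>w. W t w - W s w"
  have d: "?d \<in> borel_measurable M" using st by auto
  have "indep_var borel Z borel (\<lambda>w. \<phi> (?d w))"
    unfolding indep_var_eq
  proof (intro conjI)
    show "Z \<in> borel_measurable M" using Z by (auto intro: measurable_filtration)
    show "(\<lambda>w. \<phi> (?d w)) \<in> borel_measurable M" using phi d by auto
    have 1: "sigma_sets (space M) {Z -` A \<inter> space M |A. A \<in> sets borel} \<subseteq> sets (F s)"
      using sets.sigma_sets_subset[of "{Z -` A \<inter> space M |A. A \<in> sets borel}" "F s"]
        measurable_sets[OF Z(1)] by auto
    have 2: "sigma_sets (space M) {(\<lambda>w. \<phi> (?d w)) -` A \<inter> space M |A. A \<in> sets borel} \<subseteq>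
      sigma_sets (space M) {?d -` D \<inter> space M | D. D \<in> sets borel}"
    proof (rule sigma_sets_mono', safe)
      fix A :: "real set" assume A: "A \<in> sets borel"
      have "(\<lambda>w. \<phi> (?d w)) -` A \<inter> space M = ?d -` (\<phi> -` A) \<inter> space M" by auto
      moreover have "\<phi> -` A \<in> sets borel" using measurable_sets[OF phi(1) A] by simp
      ultimately show "\<exists>D. (\<lambda>w. \<phi> (?d w)) -` A \<inter> space M = ?d -` D \<inter> space M \<and> D \<in> sets borel" by blast
    qed
    show "indep_set (sigma_sets (space M) {Z -` A \<inter> space M |A. A \<in> sets borel})
     (sigma_sets (space M) {(\<lambda>w. \<phi> (?d w)) -` A \<inter> space M |A. A \<in> sets borel})"
      using indep_filtration_increment[OF st] 1 2 unfolding indep_sets2_eq by blast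
  qed
  from indep_var_integrable[OF this Z(2) phi(2)] indep_var_lebesgue_integral[OF this Z(2) phi(2)]
  show "integrable M (\<lambda>w. Z w * \<phi> (?d w))"
    "expectation (\<lambda>w. Z w * \<phi> (?d w)) = expectation Z * expectation (\<lambda>w. \<phi> (?d w))" by auto
qed

lemma increment_normal:
  assumes "0 \<le> s" "s < t"
  shows "distributed M lborel (\<lambda>w. (W t w - W s w) $ a) (normal_density 0 (sqrt (t - s)))"
  using wiener assms by (auto simp: wiener_process_def)

lemma integrable_increment_power:
  assumes "0 \<le> s" "s < t"
  shows "integrable M (\<lambda>w. ((W t w - W s w) $ a) ^ n)"
  using distributed_integrable[OF increment_normal[OF assms], of "\<lambda>x. x ^ n" a]
    integrable_normal_moment[of "sqrt (t - s)" 0 n] assms by simp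

lemma increment_moments:
  assumes "0 \<le> s" "s < t"
  shows "expectation (\<lambda>w. (W t w - W s w) $ a) = 0"
    "expectation (\<lambda>w. ((W t w - W s w) $ a) ^ 2) = t - s"
    "expectation (\<lambda>w. ((W t w - W s w) $ a) ^ 3) = 0"
    "expectation (\<lambda>w. ((W t w - W s w) $ a) ^ 4) = 3 * (t - s)^2"
proof -
  have e: "expectation (\<lambda>w. ((W t w - W s w) $ a) ^ n) = (\<integral>x. normal_density 0 (sqrt (t - s)) x * x ^ n \<partial>lborel)" for n
    using distributed_integral[OF increment_normal[OF assms], of "\<lambda>x. x ^ n" a] by simp
  have pos: "0 < sqrt (t - s)" using assms by simp
  show "expectation (\<lambda>w. (W t w - W s w) $ a) = 0"
    using e[of 1] integral_normal_moment_odd[OF pos, of 0 0] by simp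
  show "expectation (\<lambda>w. ((W t w - W s w) $ a) ^ 2) = t - s"
    using e[of 2] integral_normal_moment_even[OF pos, of 0 1] assms by simp
  show "expectation (\<lambda>w. ((W t w - W s w) $ a) ^ 3) = 0"
    using e[of 3] integral_normal_moment_odd[OF pos, of 0 1] by (simp add: numeral_eq_Suc)
  show "expectation (\<lambda>w. ((W t w - W s w) $ a) ^ 4) = 3 * (t - s)^2"
    using e[of 4] integral_normal_moment_even[OF pos, of 0 2] assms
    by (simp add: fact_numeral power2_eq_square)
qed

lemma increment_covariance:
  assumes "0 \<le> s" "s < t"
  shows "integrable M (\<lambda>w. (W t w - W s w) $ a * (W t w - W s w) $ c)"
    "expectation (\<lambda>w. (W t w - W s w) $ a * (W t w - W s w) $ c) = (if a = c then t - s else 0)"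
proof -
  let ?d = "\<lambda>a w. (W t w - W s w) $ a"
  have i: "integrable M (?d a)" for a using integrable_increment_power[OF assms, of a 1] by simp
  have ind: "indep_vars (\<lambda>_. borel) ?d UNIV" using wiener assms by (auto simp: wiener_process_def)
  have "integrable M (\<lambda>w. ?d a w * ?d c w) \<and> expectation (\<lambda>w. ?d a w * ?d c w) = (if a = c then t - s else 0)"
  proof (cases "a = c")
    case True
    then show ?thesis using integrable_increment_power[OF assms, of a 2] increment_moments(2)[OF assms, of a]
      by (simp add: power2_eq_square)
  next
    case False
    have iv: "indep_vars (\<lambda>_. borel) ?d {a, c}" using ind by (rule indep_vars_subset) auto
    show ?thesis
      using indep_vars_lebesgue_integral[OF _ iv] indep_vars_integrable[OF _ iv] i increment_moments(1)[OF assms] False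
      by simp
  qed
  then show "integrable M (\<lambda>w. ?d a w * ?d c w)" "expectation (\<lambda>w. ?d a w * ?d c w) = (if a = c then t - s else 0)" by auto
qed

end

subsection \<open>Stochastic integrals of step processes\<close>

lemma borel_measurable_vec_nth [measurable (raw)]:
  fixes f :: "'a \<Rightarrow> 'b::topological_space ^ 'n"
  assumes "f \<in> borel_measurable N" shows "(\<lambda>w. f w $ i) \<in> borel_measurable N"
  by (rule measurable_compose[OF assms borel_measurable_continuous_onI]) (intro continuous_intros)

lemma power_le_1_plus_power4:
  fixes x :: real assumes "k \<le> 4" shows "\<bar>x\<bar> ^ k \<le> 1 + x ^ 4"
proof (cases "\<bar>x\<bar> \<le> 1")
  case True
  then have "\<bar>x\<bar> ^ k \<le> 1" by (intro power_le_one) auto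
  moreover have "0 \<le> x ^ 4" by simp
  ultimately show ?thesis by linarith
next
  case False
  then have "\<bar>x\<bar> ^ k \<le> \<bar>x\<bar> ^ 4" using assms by (intro power_increasing) auto
  then show ?thesis by simp
qed

lemma (in prob_space) integrable_power_of_power4:
  fixes X :: "'a \<Rightarrow> real"
  assumes [measurable]: "X \<in> borel_measurable M" and i: "integrable M (\<lambda>w. X w ^ 4)" and "k \<le> 4"
  shows "integrable M (\<lambda>w. X w ^ k)"
proof (rule Bochner_Integration.integrable_bound)
  show "integrable M (\<lambda>w. 1 + X w ^ 4)" using i by simp
  show "AE w in M. norm (X w ^ k) \<le> norm (1 + X w ^ 4)"
    using power_le_1_plus_power4[OF \<open>k \<le> 4\<close>] by (intro always_eventually allI) (simp add: power_abs add_nonneg_nonneg)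
qed simp

lemma (in prob_space) integrable_mult_bounded:
  fixes X :: "'a \<Rightarrow> real"
  assumes [measurable]: "Z \<in> borel_measurable M" and X: "integrable M X" and Z: "\<And>w. w \<in> space M \<Longrightarrow> \<bar>Z w\<bar> \<le> L"
  shows "integrable M (\<lambda>w. Z w * X w)"
proof (rule Bochner_Integration.integrable_bound)
  show "integrable M (\<lambda>w. L * X w)" using X by simp
  show "AE w in M. norm (Z w * X w) \<le> norm (L * X w)"
    using Z by (intro AE_I2) (auto simp: abs_mult intro!: mult_right_mono intro: order_trans[OF _ abs_ge_self])
qed (use X in auto)

lemma (in prob_space) integrable_prod_of_square:
  fixes X Y :: "'a \<Rightarrow> real"
  assumes [measurable]: "X \<in> borel_measurable M" "Y \<in> borel_measurable M"
    and "integrable M (\<lambda>w. (X w)\<^sup>2)" "integrable M (\<lambda>w. (Y w)\<^sup>2)"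
  shows "integrable M (\<lambda>w. X w * Y w)"
proof (rule Bochner_Integration.integrable_bound)
  show "integrable M (\<lambda>w. (X w)\<^sup>2 + (Y w)\<^sup>2)" using assms by simp
  have "\<bar>x * y\<bar> \<le> x\<^sup>2 + y\<^sup>2" for x y :: real
    using sum_squares_bound[of "\<bar>x\<bar>" "\<bar>y\<bar>"] mult_nonneg_nonneg[OF abs_ge_zero[of x] abs_ge_zero[of y]]
    unfolding abs_mult power2_abs by linarith
  then show "AE w in M. norm (X w * Y w) \<le> norm ((X w)\<^sup>2 + (Y w)\<^sup>2)" by (intro always_eventually allI) simp
qed simp

text \<open>The Cauchy-Schwarz inequality twice, first for \<open>f\<close> and then for its
  squares.\<close>

lemma sum_power4_le:
  fixes f :: "'i \<Rightarrow> real"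
  shows "(\<Sum>i\<in>I. f i) ^ 4 \<le> real (card I) ^ 3 * (\<Sum>i\<in>I. f i ^ 4)"
proof -
  have 1: "(\<Sum>i\<in>I. f i)\<^sup>2 \<le> real (card I) * (\<Sum>i\<in>I. (f i)\<^sup>2)" for f :: "'i \<Rightarrow> real"
    using sum_squared_le_sum_of_squares[of f I] by (cases "finite I") (auto simp: mult.commute)
  have "(\<Sum>i\<in>I. f i) ^ 4 = ((\<Sum>i\<in>I. f i)\<^sup>2)\<^sup>2" by simp
  also have "\<dots> \<le> (real (card I) * (\<Sum>i\<in>I. (f i)\<^sup>2))\<^sup>2" by (intro power_mono 1) auto
  also have "\<dots> = real (card I) ^ 2 * (\<Sum>i\<in>I. (f i)\<^sup>2)\<^sup>2" by (simp add: power_mult_distrib)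
  also have "\<dots> \<le> real (card I) ^ 2 * (real (card I) * (\<Sum>i\<in>I. ((f i)\<^sup>2)\<^sup>2))"
    by (intro mult_left_mono 1) auto
  finally show ?thesis
    by (simp add: power3_eq_cube power2_eq_square[of "real (card I)"] mult.assoc)
qed

context wiener begin

definition grid :: "nat \<Rightarrow> (nat \<Rightarrow> real) \<Rightarrow> bool" where
  "grid N q \<longleftrightarrow> 0 \<le> q 0 \<and> (\<forall>i<N. q i < q (Suc i))"

definition adapted :: "nat \<Rightarrow> (nat \<Rightarrow> real) \<Rightarrow> (nat \<Rightarrow> 'a \<Rightarrow> 'b::topological_space) \<Rightarrow> bool" where
  "adapted N q f \<longleftrightarrow> (\<forall>j<N. f j \<in> borel_measurable (F (q j)))"

text \<open>Integration of a scalar integrand against one coordinate of \<open>W\<close>. With a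
  single Gaussian factor in each step, powers can be expanded binomially; matrix integrals are
  finite sums of these.\<close>

definition scalar_int :: "(nat \<Rightarrow> real) \<Rightarrow> 'k \<Rightarrow> (nat \<Rightarrow> 'a \<Rightarrow> real) \<Rightarrow> nat \<Rightarrow> nat \<Rightarrow> 'a \<Rightarrow> real" where
  "scalar_int q a f m n w = (\<Sum>j\<in>{m..<n}. f j w * (W (q (Suc j)) w - W (q j) w) $ a)"

lemma grid_mono:
  assumes "grid N q" "i \<le> j" "j \<le> N" shows "q i \<le> q j"
  using assms(2,3)
proof (induction j rule: dec_induct)
  case (step n)
  then have "q n < q (Suc n)" using assms(1) by (auto simp: grid_def)
  with step show ?case by auto
qed simp

lemma grid_nonneg: "grid N q \<Longrightarrow> j \<le> N \<Longrightarrow> 0 \<le> q j"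
  using grid_mono[of N q 0 j] by (auto simp: grid_def)

lemma adaptedD: "adapted N q f \<Longrightarrow> grid N q \<Longrightarrow> j < N \<Longrightarrow> j \<le> n \<Longrightarrow> n \<le> N \<Longrightarrow> f j \<in> borel_measurable (F (q n))"
  using measurable_filtration_mono[of "f j" "q j" borel "q n"] grid_mono[of N q j n] by (auto simp: adapted_def)

lemma increment_filtration:
  assumes "grid N q" "j < n" "n \<le> N"
  shows "(\<lambda>w. W (q (Suc j)) w - W (q j) w) \<in> borel_measurable (F (q n))"
  using assms grid_mono[OF assms(1), of "Suc j" n] grid_mono[OF assms(1), of j n] grid_nonneg[OF assms(1)]
  by (intro borel_measurable_diff W_filtration) auto

lemma scalar_int_measurable:
  assumes g: "grid N q" and f: "adapted N q f" and n: "m \<le> n" "n \<le> N"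
  shows "scalar_int q a f m n \<in> borel_measurable (F (q n))"
  unfolding scalar_int_def
proof (intro borel_measurable_sum borel_measurable_times)
  fix j assume j: "j \<in> {m..<n}"
  then show "f j \<in> borel_measurable (F (q n))" using f g n by (intro adaptedD) auto
  show "(\<lambda>w. (W (q (Suc j)) w - W (q j) w) $ a) \<in> borel_measurable (F (q n))"
    using increment_filtration[OF g, of j n] j n by (intro borel_measurable_vec_nth) auto
qed

lemma scalar_int_Suc: "m \<le> n \<Longrightarrow> scalar_int q a f m (Suc n) w =
    scalar_int q a f m n w + f n w * (W (q (Suc n)) w - W (q n) w) $ a"
  by (simp add: scalar_int_def)

lemma scalar_int_refl [simp]: "scalar_int q a f m m w = 0"
  by (simp add: scalar_int_def)

text \<open>Induction on the last interval. In the expansion of (U + f e)^4 the odd powers of the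
  increment e have mean 0, which leaves at most E U^4 + 6 K^2 \<delta> E U^2 + 3 K^4 \<delta>^2.
  With x = \<open>q n - q m\<close> the bound closes because 3 x^2 + 6 x \<delta> + 3 \<delta>^2 = 3
  (x + \<delta>)^2; the 3 is the fourth moment of a standard normal variable. The cross term needs
  the second moment, and each expansion needs integrability, so all three claims share one
  induction.\<close>

lemma scalar_int_fourth_moment:
  assumes g: "grid N q" and f: "adapted N q f" and n: "m \<le> n" "n \<le> N"
    and K: "\<And>j w. j < N \<Longrightarrow> w \<in> space M \<Longrightarrow> \<bar>f j w\<bar> \<le> K"
  shows "integrable M (\<lambda>w. scalar_int q a f m n w ^ 4)"
    and "expectation (\<lambda>w. scalar_int q a f m n w ^ 2) \<le> K^2 * (q n - q m)"
    and "expectation (\<lambda>w. scalar_int q a f m n w ^ 4) \<le> 3 * K^4 * (q n - q m)^2"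
  using n
proof (induction n rule: dec_induct)
  case base
  { case 1 then show ?case by simp next case 2 then show ?case by simp next case 3 then show ?case by simp }
next
  case (step n)
  have n: "n < N" "n \<le> N" if "Suc n \<le> N" using that by auto
  let ?U = "scalar_int q a f m n" let ?e = "\<lambda>w. (W (q (Suc n)) w - W (q n) w) $ a"
  define \<delta> where "\<delta> = q (Suc n) - q n"
  { assume N: "Suc n \<le> N"
    have q: "0 \<le> q n" "q n < q (Suc n)" using g n[OF N] grid_nonneg[OF g, of n] by (auto simp: grid_def)
    have d: "\<delta> > 0" using q by (simp add: \<delta>_def)
    have U: "?U \<in> borel_measurable (F (q n))" using scalar_int_measurable[OF g f step(1) n(2)[OF N]] .
    have UM[measurable]: "?U \<in> borel_measurable M" using U by (rule measurable_filtration)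
    have fF: "f n \<in> borel_measurable (F (q n))" using f n[OF N] by (auto simp: adapted_def)
    have fM[measurable]: "f n \<in> borel_measurable M" using fF by (rule measurable_filtration)
    have K0: "0 \<le> K" using K[OF n(1)[OF N]] not_empty by (metis abs_ge_zero all_not_in_conv order_trans)
    have fk: "\<bar>f n w ^ k\<bar> \<le> K ^ k" if "w \<in> space M" for w k
      using K[OF n(1)[OF N] that] by (simp add: power_abs power_mono)
    note IH = step(3)[OF n(2)[OF N]] step(4)[OF n(2)[OF N]] step(5)[OF n(2)[OF N]]
    have Uk: "integrable M (\<lambda>w. ?U w ^ k)" if "k \<le> 4" for k
      using integrable_power_of_power4[OF UM IH(1) that] .
    have Zk: "integrable M (\<lambda>w. f n w ^ l * ?U w ^ k)" if "k \<le> 4" for k l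
      using integrable_mult_bounded[of "\<lambda>w. f n w ^ l", OF _ Uk[OF that] fk] by simp
    have ZF: "(\<lambda>w. f n w ^ l * ?U w ^ k) \<in> borel_measurable (F (q n))" for k l
      using U fF by (intro borel_measurable_times borel_measurable_power)
    have I: "integrable M (\<lambda>w. (f n w ^ l * ?U w ^ k) * ?e w ^ l)"
      and E: "expectation (\<lambda>w. (f n w ^ l * ?U w ^ k) * ?e w ^ l) = expectation (\<lambda>w. f n w ^ l * ?U w ^ k) * expectation (\<lambda>w. ?e w ^ l)"
      if "k \<le> 4" for k l
      using integrable_mult_increment[OF q(1) less_imp_le[OF q(2)] ZF[of l k] Zk[OF that], of "\<lambda>x. (x $ a) ^ l"]
        expectation_mult_increment[OF q(1) less_imp_le[OF q(2)] ZF[of l k] Zk[OF that], of "\<lambda>x. (x $ a) ^ l"]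
        integrable_increment_power[OF q, of a l] by (auto intro!: borel_measurable_power borel_measurable_vec_nth)
    note mom = increment_moments[OF q, of a]
    \<comment> \<open>The exponents 0 and 1 are kept so that every term has the shape to which
      \<open>I\<close> and \<open>E\<close> apply.\<close>
    have p4: "scalar_int q a f m (Suc n) w ^ 4 = ?U w ^ 4 + 4 * ((f n w ^ 1 * ?U w ^ 3) * ?e w ^ 1)
      + 6 * ((f n w ^ 2 * ?U w ^ 2) * ?e w ^ 2) + 4 * ((f n w ^ 3 * ?U w ^ 1) * ?e w ^ 3) + (f n w ^ 4 * ?U w ^ 0) * ?e w ^ 4" for w
      unfolding scalar_int_Suc[OF step(1)] by (simp add: algebra_simps power2_eq_square power3_eq_cube power4_eq_xxxx)
    have p2: "scalar_int q a f m (Suc n) w ^ 2 = ?U w ^ 2 + 2 * ((f n w ^ 1 * ?U w ^ 1) * ?e w ^ 1)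
      + (f n w ^ 2 * ?U w ^ 0) * ?e w ^ 2" for w
      unfolding scalar_int_Suc[OF step(1)] by (simp add: algebra_simps power2_eq_square)
    have i4: "integrable M (\<lambda>w. scalar_int q a f m (Suc n) w ^ 4)"
      unfolding p4 by (intro Bochner_Integration.integrable_add integrable_mult_right I Uk) auto
    have bnd: "expectation (\<lambda>w. f n w ^ l * ?U w ^ k) \<le> K ^ l * expectation (\<lambda>w. ?U w ^ k)" if "k \<le> 4" "even k" for k l
    proof -
      have "expectation (\<lambda>w. f n w ^ l * ?U w ^ k) \<le> expectation (\<lambda>w. K ^ l * ?U w ^ k)"
      proof (intro integral_mono Zk integrable_mult_right Uk that)
        fix w assume "w \<in> space M"
        then show "f n w ^ l * ?U w ^ k \<le> K ^ l * ?U w ^ k"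
          using fk[of w l] that by (intro mult_right_mono) auto
      qed
      then show ?thesis by simp
    qed
    have "expectation (\<lambda>w. scalar_int q a f m (Suc n) w ^ 2) = expectation (\<lambda>w. ?U w ^ 2) + expectation (\<lambda>w. f n w ^ 2 * ?U w ^ 0) * \<delta>"
      unfolding p2 using E[of 1 1] E[of 0 2] mom I[of 1 1] I[of 0 2] Uk[of 2] by (simp add: \<delta>_def)
    also have "\<dots> \<le> K^2 * (q n - q m) + (K^2 * 1) * \<delta>"
      using bnd[of 0 2] IH(2) d by (intro add_mono mult_right_mono) (auto simp: prob_space)
    also have "\<dots> = K^2 * (q (Suc n) - q m)" by (simp add: \<delta>_def algebra_simps)
    finally have e2: "expectation (\<lambda>w. scalar_int q a f m (Suc n) w ^ 2) \<le> K^2 * (q (Suc n) - q m)" .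
    have "expectation (\<lambda>w. scalar_int q a f m (Suc n) w ^ 4) = expectation (\<lambda>w. ?U w ^ 4)
        + 6 * (expectation (\<lambda>w. f n w ^ 2 * ?U w ^ 2) * \<delta>) + expectation (\<lambda>w. f n w ^ 4 * ?U w ^ 0) * (3 * \<delta>^2)"
      unfolding p4 using E[of 3 1] E[of 2 2] E[of 1 3] E[of 0 4] mom I[of 3 1] I[of 2 2] I[of 1 3] I[of 0 4] Uk[of 4]
      by (simp add: \<delta>_def)
    also have "\<dots> \<le> 3 * K^4 * (q n - q m)^2 + 6 * ((K^2 * (K^2 * (q n - q m))) * \<delta>) + (K^4 * 1) * (3 * \<delta>^2)"
    proof (intro add_mono mult_left_mono mult_right_mono)
      show "expectation (\<lambda>w. f n w ^ 2 * ?U w ^ 2) \<le> K^2 * (K^2 * (q n - q m))"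
        using bnd[of 2 2] mult_left_mono[OF IH(2), of "K^2"] by simp
    qed (use IH(3) d bnd[of 0 4] in \<open>auto simp: prob_space\<close>)
    also have "\<dots> = 3 * K^4 * (q (Suc n) - q m)^2"
      by (simp add: \<delta>_def power2_eq_square power4_eq_xxxx algebra_simps)
    finally have e4: "expectation (\<lambda>w. scalar_int q a f m (Suc n) w ^ 4) \<le> 3 * K^4 * (q (Suc n) - q m)^2" .
    note i4 e2 e4 }
  note res = this
  { case 1 then show ?case using res(1) by simp next case 2 then show ?case using res(2) by simp next case 3 then show ?case using res(3) by simp }
qed

text \<open>In the inductive step the product of the two sums gains two mixed terms, which are
  linear in the new increment and hence centred given the past, and one term quadratic in it, whose
  expectation is the new summand when a = c and 0 otherwise. Since \<open>Z\<close> is an arbitrary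
  bounded function known at \<open>q m\<close>, these are statements about conditional means and
  covariances.\<close>

lemma scalar_int_mean_cov:
  assumes g: "grid N q" and f: "adapted N q f" and f': "adapted N q f'" and n: "m \<le> n" "n \<le> N"
    and K: "\<And>j w. j < N \<Longrightarrow> w \<in> space M \<Longrightarrow> \<bar>f j w\<bar> \<le> K"
    and K': "\<And>j w. j < N \<Longrightarrow> w \<in> space M \<Longrightarrow> \<bar>f' j w\<bar> \<le> K"
    and Z: "Z \<in> borel_measurable (F (q m))" and L: "\<And>w. w \<in> space M \<Longrightarrow> \<bar>Z w\<bar> \<le> L"
  shows "expectation (\<lambda>w. Z w * scalar_int q a f m n w) = 0"
    and "expectation (\<lambda>w. Z w * (scalar_int q a f m n w * scalar_int q c f' m n w)) =
      (if a = c then \<Sum>j\<in>{m..<n}. expectation (\<lambda>w. Z w * (f j w * f' j w)) * (q (Suc j) - q j) else 0)"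
  using n
proof (induction n rule: dec_induct)
  case base
  { case 1 then show ?case by simp next case 2 then show ?case by simp }
next
  case (step n)
  let ?U = "scalar_int q a f m n" let ?V = "scalar_int q c f' m n"
  let ?e = "\<lambda>a w. (W (q (Suc n)) w - W (q n) w) $ a"
  { assume N: "Suc n \<le> N"
    then have n: "n < N" "n \<le> N" by auto
    have q: "0 \<le> q n" "q n < q (Suc n)" using g n grid_nonneg[OF g, of n] by (auto simp: grid_def)
    have UF: "?U \<in> borel_measurable (F (q n))" "?V \<in> borel_measurable (F (q n))"
      using scalar_int_measurable[OF g f step(1) n(2)] scalar_int_measurable[OF g f' step(1) n(2)] by auto
    have fF: "f n \<in> borel_measurable (F (q n))" "f' n \<in> borel_measurable (F (q n))"
      using f f' n by (auto simp: adapted_def)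
    have ZF: "Z \<in> borel_measurable (F (q n))"
      using measurable_filtration_mono[OF Z grid_mono[OF g step(1) n(2)]] .
    note [measurable] = UF[THEN measurable_filtration] fF[THEN measurable_filtration] ZF[THEN measurable_filtration]
    have U4: "integrable M (\<lambda>w. ?U w ^ 4)" "integrable M (\<lambda>w. ?V w ^ 4)"
      using scalar_int_fourth_moment(1)[OF g f step(1) n(2) K] scalar_int_fourth_moment(1)[OF g f' step(1) n(2) K'] by auto
    have U2: "integrable M (\<lambda>w. ?U w ^ k)" "integrable M (\<lambda>w. ?V w ^ k)" if "k \<le> 4" for k
      using U4 that by (auto intro: integrable_power_of_power4)
    have U1: "integrable M ?U" "integrable M ?V" using U2[of 1] by auto
    have UV: "integrable M (\<lambda>w. ?U w * ?V w)" using U2[of 2] by (intro integrable_prod_of_square) auto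
    have b: "\<bar>Z w * f n w\<bar> \<le> L * K" "\<bar>Z w * f' n w\<bar> \<le> L * K" "\<bar>Z w * (f n w * f' n w)\<bar> \<le> L * (K * K)" if "w \<in> space M" for w
      using L[OF that] K[OF n(1) that] K'[OF n(1) that] abs_ge_zero[of "Z w"] abs_ge_zero[of "f n w"]
      by (auto simp: abs_mult intro!: mult_mono)
    have I1: "integrable M (\<lambda>w. Z w * f n w)" "integrable M (\<lambda>w. Z w * (f n w * f' n w))"
      using b by (intro integrable_const_bound; force)+
    have I2: "integrable M (\<lambda>w. (Z w * f n w) * ?V w)" "integrable M (\<lambda>w. (Z w * f' n w) * ?U w)"
      by (rule integrable_mult_bounded[of _ _ "L * K"], use U1 b in auto)+
    have I3: "integrable M (\<lambda>w. Z w * ?U w)" "integrable M (\<lambda>w. Z w * (?U w * ?V w))"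
      by (rule integrable_mult_bounded[of _ _ "L"], use U1 UV L in auto)+
    note st = q(1) less_imp_le[OF q(2)]
    have e1: "integrable M (?e a)" for a using integrable_increment_power[OF q, of a 1] by simp
    have R1: "integrable M (\<lambda>w. Y w * ?e a w)" "expectation (\<lambda>w. Y w * ?e a w) = 0"
      if "Y \<in> borel_measurable (F (q n))" "integrable M Y" for Y a
      using integrable_mult_increment[OF st that, of "\<lambda>x. x $ a"] expectation_mult_increment[OF st that, of "\<lambda>x. x $ a"]
        e1[of a] increment_moments(1)[OF q, of a] by (auto intro: borel_measurable_vec_nth)
    have R2: "integrable M (\<lambda>w. Y w * (?e a w * ?e c w))"
       "expectation (\<lambda>w. Y w * (?e a w * ?e c w)) = expectation Y * (if a = c then q (Suc n) - q n else 0)"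
      if "Y \<in> borel_measurable (F (q n))" "integrable M Y" for Y
      using integrable_mult_increment[OF st that, of "\<lambda>x. x $ a * x $ c"] expectation_mult_increment[OF st that, of "\<lambda>x. x $ a * x $ c"]
        increment_covariance[OF q, of a c] by (auto intro!: borel_measurable_times borel_measurable_vec_nth)
    have A1: "integrable M (\<lambda>w. (Z w * f n w) * ?e a w)" "expectation (\<lambda>w. (Z w * f n w) * ?e a w) = 0"
      using ZF fF I1 by (intro R1; simp)+
    have A2: "integrable M (\<lambda>w. (Z w * f n w * ?V w) * ?e a w)" "expectation (\<lambda>w. (Z w * f n w * ?V w) * ?e a w) = 0"
      using ZF fF UF I2 by (intro R1; simp)+
    have A3: "integrable M (\<lambda>w. (Z w * f' n w * ?U w) * ?e c w)" "expectation (\<lambda>w. (Z w * f' n w * ?U w) * ?e c w) = 0"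
      using ZF fF UF I2 by (intro R1; simp)+
    have A4: "integrable M (\<lambda>w. (Z w * (f n w * f' n w)) * (?e a w * ?e c w))"
      "expectation (\<lambda>w. (Z w * (f n w * f' n w)) * (?e a w * ?e c w)) = expectation (\<lambda>w. Z w * (f n w * f' n w)) * (if a = c then q (Suc n) - q n else 0)"
      using ZF fF I1 by (intro R2; simp)+
    have "expectation (\<lambda>w. Z w * scalar_int q a f m (Suc n) w) = expectation (\<lambda>w. Z w * ?U w + (Z w * f n w) * ?e a w)"
      unfolding scalar_int_Suc[OF step(1)] by (simp add: algebra_simps)
    also have "\<dots> = expectation (\<lambda>w. Z w * ?U w) + 0"
      using I3 A1 by (subst Bochner_Integration.integral_add) auto
    finally have r1: "expectation (\<lambda>w. Z w * scalar_int q a f m (Suc n) w) = expectation (\<lambda>w. Z w * ?U w)" by simp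
    have "expectation (\<lambda>w. Z w * (scalar_int q a f m (Suc n) w * scalar_int q c f' m (Suc n) w)) =
      expectation (\<lambda>w. Z w * (?U w * ?V w) + (Z w * f n w * ?V w) * ?e a w + (Z w * f' n w * ?U w) * ?e c w
        + (Z w * (f n w * f' n w)) * (?e a w * ?e c w))"
      unfolding scalar_int_Suc[OF step(1)] by (simp add: algebra_simps)
    also have "\<dots> = expectation (\<lambda>w. Z w * (?U w * ?V w)) + expectation (\<lambda>w. Z w * (f n w * f' n w)) * (if a = c then q (Suc n) - q n else 0)"
      using I3 A2 A3 A4 by simp
    finally have r2: "expectation (\<lambda>w. Z w * (scalar_int q a f m (Suc n) w * scalar_int q c f' m (Suc n) w)) = \<dots>" .
    note r1 r2 }
  note res = this
  { case 1 then show ?case using res(1) step(3) by simp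
  next case 2 then show ?case using res(2) step(1,4) by (simp add: split: if_splits) }
qed

end

text \<open>The cells are open on the left, so nothing is assumed about \<open>f\<close> at the
  first point \<open>g m\<close>. That point has measure 0, and it forms the base case of the
  induction.\<close>

lemma piecewise_integral:
  fixes f :: "real \<Rightarrow> real"
  assumes "m \<le> n" "\<And>j. m \<le> j \<Longrightarrow> j < n \<Longrightarrow> g j \<le> g (Suc j)"
    and "\<And>j r. m \<le> j \<Longrightarrow> j < n \<Longrightarrow> r \<in> {g j<..g (Suc j)} \<Longrightarrow> f r = c j"
  shows "has_bochner_integral lborel (\<lambda>r. indicator {g m..g n} r * f r) (\<Sum>j\<in>{m..<n}. c j * (g (Suc j) - g j))"
    (is "?P n")
proof -
  have "m \<le> n' \<longrightarrow> n' \<le> n \<longrightarrow> g m \<le> g n' \<and> ?P n'" for n'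
  proof (induction n')
    have base: "?P m"
    proof -
      have "has_bochner_integral lborel (\<lambda>r. f (g m) * indicator {g m} r) (f (g m) * measure lborel {g m})"
        by (intro has_bochner_integral_mult_right has_bochner_integral_real_indicator) auto
      moreover have "(\<lambda>r. f (g m) * indicator {g m} r) = (\<lambda>r. indicator {g m..g m} r * f r)"
        by (auto simp: indicator_def)
      ultimately show ?thesis by (simp add: measure_def)
    qed
    { case 0 then show ?case using base by auto }
    { case (Suc n')
      show ?case
      proof (intro impI)
        assume n: "m \<le> Suc n'" "Suc n' \<le> n"
        show "g m \<le> g (Suc n') \<and> ?P (Suc n')"
        proof (cases "m = Suc n'")
          case True then show ?thesis using base by auto
        next
          case False
          then have mn: "m \<le> n'" using n by auto
          with Suc n have IH: "g m \<le> g n'" "?P n'" by auto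
          have gg: "g n' \<le> g (Suc n')" using assms(2) mn n by auto
          have "has_bochner_integral lborel (\<lambda>r. c n' * indicator {g n'<..g (Suc n')} r) (c n' * measure lborel {g n'<..g (Suc n')})"
            using gg by (intro has_bochner_integral_mult_right has_bochner_integral_real_indicator) auto
          then have 2: "has_bochner_integral lborel (\<lambda>r. c n' * indicator {g n'<..g (Suc n')} r) (c n' * (g (Suc n') - g n'))"
            using gg by simp
          have "has_bochner_integral lborel (\<lambda>r. indicator {g m..g n'} r * f r + c n' * indicator {g n'<..g (Suc n')} r)
             ((\<Sum>j\<in>{m..<n'}. c j * (g (Suc j) - g j)) + c n' * (g (Suc n') - g n'))"
            by (rule has_bochner_integral_add[OF IH(2) 2])
          moreover have "(\<lambda>r. indicator {g m..g n'} r * f r + c n' * indicator {g n'<..g (Suc n')} r) = (\<lambda>r. indicator {g m..g (Suc n')} r * f r)"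
            using IH(1) gg assms(3)[OF mn] n by (auto simp: indicator_def fun_eq_iff)
          ultimately show ?thesis using IH(1) gg mn by simp
        qed
      qed }
  qed
  then show ?thesis using assms(1) by auto
qed

section \<open>Matrix-valued integrands on a grid\<close>

lemma norm_matrix_sq: "(norm (A :: real^'k^'n))\<^sup>2 = (\<Sum>i\<in>UNIV. \<Sum>a\<in>UNIV. A $ i $ a * A $ i $ a)"
  by (simp add: power2_norm_eq_inner inner_vec_def)

lemma abs_entry_le_norm: "\<bar>(A :: real^'k^'n) $ i $ a\<bar> \<le> norm A"
  by (rule order_trans[OF component_le_norm_cart[of "A $ i" a] Finite_Cartesian_Product.norm_nth_le])

lemma abs_mult_le: "\<bar>x\<bar> \<le> K \<Longrightarrow> \<bar>y\<bar> \<le> L \<Longrightarrow> \<bar>x * y\<bar> \<le> K * L" for x y :: real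
  unfolding abs_mult by (rule mult_mono') auto

context wiener begin

definition vec_int :: "(nat \<Rightarrow> real) \<Rightarrow> (nat \<Rightarrow> 'a \<Rightarrow> real^'k^'n) \<Rightarrow> nat \<Rightarrow> nat \<Rightarrow> 'a \<Rightarrow> real^'n" where
  "vec_int q A m n w = (\<Sum>j\<in>{m..<n}. A j w *v (W (q (Suc j)) w - W (q j) w))"

lemma vec_int_nth: "vec_int q A m n w $ i = (\<Sum>a\<in>UNIV. scalar_int q a (\<lambda>j w. A j w $ i $ a) m n w)"
  unfolding vec_int_def scalar_int_def by (subst sum.swap) (simp add: matrix_vector_mult_def)

context
  fixes N :: nat and q :: "nat \<Rightarrow> real" and A :: "nat \<Rightarrow> 'a \<Rightarrow> real^'k^'n" and K :: real
  assumes g: "grid N q" and A: "adapted N q A" and K: "\<And>j w. j < N \<Longrightarrow> w \<in> space M \<Longrightarrow> norm (A j w) \<le> K"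
begin

lemma entry_adapted: "adapted N q (\<lambda>j w. A j w $ i $ a)"
  using A by (auto simp: adapted_def)

lemma entry_bounded: "j < N \<Longrightarrow> w \<in> space M \<Longrightarrow> \<bar>A j w $ i $ a\<bar> \<le> K"
  using K abs_entry_le_norm order_trans by blast

lemma vec_int_measurable: "m \<le> n \<Longrightarrow> n \<le> N \<Longrightarrow> (\<lambda>w. vec_int q A m n w $ i) \<in> borel_measurable (F (q n))"
  unfolding vec_int_nth by (intro borel_measurable_sum scalar_int_measurable[OF g entry_adapted])

lemma norm_vec_int_measurable:
  assumes "n \<le> N" shows "(\<lambda>w. norm (vec_int q A 0 n w)) \<in> borel_measurable M"
proof -
  have [measurable]: "(\<lambda>w. vec_int q A 0 n w $ i) \<in> borel_measurable M" for i
    using vec_int_measurable[of 0 n i] assms by (auto intro: measurable_filtration)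
  show ?thesis by (simp add: norm_eq_sqrt_inner inner_vec_def)
qed

text \<open>Of the four factors \<open>CARD('k)\<close>, three come from the power inequality for
  the sum over the coordinates of \<open>W\<close>, and one from adding up the coordinate
  bounds.\<close>

lemma vec_int_fourth_moment:
  assumes n: "m \<le> n" "n \<le> N"
  shows "integrable M (\<lambda>w. (vec_int q A m n w $ i) ^ 4)"
    "expectation (\<lambda>w. (vec_int q A m n w $ i) ^ 4) \<le> 3 * real CARD('k) ^ 4 * K ^ 4 * (q n - q m)\<^sup>2"
proof -
  let ?U = "\<lambda>a. scalar_int q a (\<lambda>j w. A j w $ i $ a) m n"
  note mom = scalar_int_fourth_moment[OF g entry_adapted n entry_bounded]
  have [measurable]: "?U a \<in> borel_measurable M" for a
    using scalar_int_measurable[OF g entry_adapted n] by (rule measurable_filtration)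
  have le: "(vec_int q A m n w $ i) ^ 4 \<le> real CARD('k) ^ 3 * (\<Sum>a\<in>UNIV. ?U a w ^ 4)" for w
    unfolding vec_int_nth by (rule sum_power4_le)
  have i: "integrable M (\<lambda>w. real CARD('k) ^ 3 * (\<Sum>a\<in>UNIV. ?U a w ^ 4))"
    using mom(1) by simp
  show i4: "integrable M (\<lambda>w. (vec_int q A m n w $ i) ^ 4)"
  proof (rule Bochner_Integration.integrable_bound[OF i])
    show "AE w in M. norm ((vec_int q A m n w $ i) ^ 4) \<le> norm (real CARD('k) ^ 3 * (\<Sum>a\<in>UNIV. ?U a w ^ 4))"
      using le by (intro AE_I2) (smt (verit) real_norm_def zero_le_even_power even_numeral)
  qed (simp add: vec_int_nth)
  have "expectation (\<lambda>w. (vec_int q A m n w $ i) ^ 4) \<le> expectation (\<lambda>w. real CARD('k) ^ 3 * (\<Sum>a\<in>UNIV. ?U a w ^ 4))"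
    by (intro integral_mono i4 i le)
  also have "\<dots> = real CARD('k) ^ 3 * (\<Sum>a\<in>UNIV. expectation (\<lambda>w. ?U a w ^ 4))"
    using mom(1) by simp
  also have "\<dots> \<le> real CARD('k) ^ 3 * (\<Sum>a\<in>(UNIV::'k set). 3 * K^4 * (q n - q m)\<^sup>2)"
    by (intro mult_left_mono sum_mono mom(3)) auto
  also have "\<dots> = 3 * real CARD('k) ^ 4 * K ^ 4 * (q n - q m)\<^sup>2" by (simp add: numeral_eq_Suc)
  finally show "expectation (\<lambda>w. (vec_int q A m n w $ i) ^ 4) \<le> \<dots>" .
qed

text \<open>Expanding both components over the coordinates of \<open>W\<close>, only equal
  coordinates contribute to the covariance; what remains is the integral of the (i, i') entry of A
  times its transpose.\<close>

lemma vec_int_mean_cov: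
  assumes n: "m \<le> n" "n \<le> N"
    and Z: "Z \<in> borel_measurable (F (q m))" and L: "\<And>w. w \<in> space M \<Longrightarrow> \<bar>Z w\<bar> \<le> L"
  shows "expectation (\<lambda>w. Z w * vec_int q A m n w $ i) = 0"
    "expectation (\<lambda>w. Z w * (vec_int q A m n w $ i * vec_int q A m n w $ i')) =
      expectation (\<lambda>w. Z w * (\<Sum>j\<in>{m..<n}. (\<Sum>a\<in>UNIV. A j w $ i $ a * A j w $ i' $ a) * (q (Suc j) - q j)))"
proof -
  let ?U = "\<lambda>i a. scalar_int q a (\<lambda>j w. A j w $ i $ a) m n"
  note mom = scalar_int_fourth_moment[OF g entry_adapted n entry_bounded]
  have [measurable]: "?U i a \<in> borel_measurable M" for i a
    using scalar_int_measurable[OF g entry_adapted n] by (rule measurable_filtration)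
  have [measurable]: "Z \<in> borel_measurable M" using Z by (rule measurable_filtration)
  have Aen[measurable]: "(\<lambda>w. A j w $ i $ a) \<in> borel_measurable M" if "j < N" for j i a
    using entry_adapted[of i a] that measurable_filtration unfolding adapted_def by blast
  have U2: "integrable M (\<lambda>w. (?U i a w)^k)" if "k \<le> 4" for i a k
    using mom(1) that by (auto intro: integrable_power_of_power4)
  have ZU: "integrable M (\<lambda>w. Z w * ?U i a w)" for i a
    using integrable_mult_bounded[of Z "?U i a" L] U2[of 1] L by simp
  have ZUV: "integrable M (\<lambda>w. Z w * (?U i a w * ?U i' c w))" for i i' a c
    using integrable_mult_bounded[of Z "\<lambda>w. ?U i a w * ?U i' c w" L] integrable_prod_of_square[of "?U i a" "?U i' c"] U2[of 2] L by simp
  note mc = scalar_int_mean_cov[OF g entry_adapted entry_adapted n entry_bounded entry_bounded Z L]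
  show "expectation (\<lambda>w. Z w * vec_int q A m n w $ i) = 0"
    unfolding vec_int_nth sum_distrib_left using ZU mc(1) by simp
  have ia: "integrable M (\<lambda>w. Z w * (A j w $ i $ a * A j w $ i' $ a))" if "j < N" for j a
  proof (rule integrable_const_bound[of _ "L * (K * K)"])
    show "AE w in M. norm (Z w * (A j w $ i $ a * A j w $ i' $ a)) \<le> L * (K * K)"
      using L entry_bounded[OF that] by (intro AE_I2) (auto intro!: abs_mult_le)
  qed (use that in auto)
  have cov: "expectation (\<lambda>w. Z w * (?U i a w * ?U i' c w)) =
      (if a = c then \<Sum>j\<in>{m..<n}. expectation (\<lambda>w. Z w * (A j w $ i $ a * A j w $ i' $ c)) * (q (Suc j) - q j) else 0)" for a c
    by (rule mc(2)) auto
  have e: "Z w * (vec_int q A m n w $ i * vec_int q A m n w $ i') = (\<Sum>a\<in>UNIV. \<Sum>c\<in>UNIV. Z w * (?U i a w * ?U i' c w))" for w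
    unfolding vec_int_nth sum_product by (simp only: sum_distrib_left)
  have "expectation (\<lambda>w. Z w * (vec_int q A m n w $ i * vec_int q A m n w $ i')) =
    expectation (\<lambda>w. \<Sum>a\<in>UNIV. \<Sum>c\<in>UNIV. Z w * (?U i a w * ?U i' c w))"
    by (simp only: e)
  also have "\<dots> = (\<Sum>a\<in>UNIV. \<Sum>c\<in>UNIV. expectation (\<lambda>w. Z w * (?U i a w * ?U i' c w)))"
    using ZUV by simp
  also have "\<dots> = (\<Sum>a\<in>UNIV. \<Sum>j\<in>{m..<n}. expectation (\<lambda>w. Z w * (A j w $ i $ a * A j w $ i' $ a)) * (q (Suc j) - q j))"
    by (simp add: cov)
  also have "\<dots> = (\<Sum>a\<in>UNIV. \<Sum>j\<in>{m..<n}. expectation (\<lambda>w. Z w * (A j w $ i $ a * A j w $ i' $ a) * (q (Suc j) - q j)))"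
    by simp
  also have "\<dots> = expectation (\<lambda>w. \<Sum>a\<in>UNIV. \<Sum>j\<in>{m..<n}. Z w * (A j w $ i $ a * A j w $ i' $ a) * (q (Suc j) - q j))"
    using ia n by (subst Bochner_Integration.integral_sum) (auto intro!: Bochner_Integration.integrable_sum sum.cong simp: Bochner_Integration.integral_sum)
  also have "\<dots> = expectation (\<lambda>w. Z w * (\<Sum>j\<in>{m..<n}. (\<Sum>a\<in>UNIV. A j w $ i $ a * A j w $ i' $ a) * (q (Suc j) - q j)))"
    by (subst sum.swap) (simp add: sum_distrib_left sum_distrib_right mult.assoc)
  finally show "expectation (\<lambda>w. Z w * (vec_int q A m n w $ i * vec_int q A m n w $ i')) = \<dots>" .
qed

text \<open>The covariance identity with \<open>Z\<close> = 1 and i = i', summed over i.\<close>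

lemma vec_int_isometry:
  assumes n: "n \<le> N"
  shows "integrable M (\<lambda>w. (norm (vec_int q A 0 n w))\<^sup>2)"
    "expectation (\<lambda>w. (norm (vec_int q A 0 n w))\<^sup>2) = expectation (\<lambda>w. \<Sum>j<n. (norm (A j w))\<^sup>2 * (q (Suc j) - q j))"
proof -
  have [measurable]: "(\<lambda>w. vec_int q A 0 n w $ i) \<in> borel_measurable M" for i
    using vec_int_measurable[of 0 n i] n by (auto intro: measurable_filtration)
  have e: "(norm (vec_int q A 0 n w))\<^sup>2 = (\<Sum>i\<in>UNIV. vec_int q A 0 n w $ i * vec_int q A 0 n w $ i)" for w
    by (simp add: power2_norm_eq_inner inner_vec_def)
  have i2: "integrable M (\<lambda>w. vec_int q A 0 n w $ i * vec_int q A 0 n w $ i)" for i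
    using integrable_power_of_power4[of "\<lambda>w. vec_int q A 0 n w $ i" 2] vec_int_fourth_moment(1)[of 0 n i] n
    by (simp add: power2_eq_square)
  show "integrable M (\<lambda>w. (norm (vec_int q A 0 n w))\<^sup>2)" unfolding e using i2 by simp
  have Aen[measurable]: "(\<lambda>w. A j w $ i $ a) \<in> borel_measurable M" if "j < N" for j i a
    using entry_adapted[of i a] that measurable_filtration unfolding adapted_def by blast
  have i3: "integrable M (\<lambda>w. \<Sum>j\<in>{0..<n}. (\<Sum>a\<in>UNIV. A j w $ i $ a * A j w $ i $ a) * (q (Suc j) - q j))" for i
  proof (intro Bochner_Integration.integrable_sum integrable_mult_left)
    fix j a assume "j \<in> {0..<n}"
    then have j: "j < N" using n by auto
    show "integrable M (\<lambda>w. A j w $ i $ a * A j w $ i $ a)"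
    proof (rule integrable_const_bound[of _ "K * K"])
      show "AE w in M. norm (A j w $ i $ a * A j w $ i $ a) \<le> K * K"
      proof (intro AE_I2)
        fix w assume "w \<in> space M"
        then show "norm (A j w $ i $ a * A j w $ i $ a) \<le> K * K"
          using abs_mult_le[OF entry_bounded[OF j, of w i a] entry_bounded[OF j, of w i a]] by simp
      qed
    qed (use j in auto)
  qed
  have "expectation (\<lambda>w. (norm (vec_int q A 0 n w))\<^sup>2) = (\<Sum>i\<in>UNIV. expectation (\<lambda>w. vec_int q A 0 n w $ i * vec_int q A 0 n w $ i))"
    unfolding e using i2 by simp
  also have "\<dots> = (\<Sum>i\<in>UNIV. expectation (\<lambda>w. \<Sum>j\<in>{0..<n}. (\<Sum>a\<in>UNIV. A j w $ i $ a * A j w $ i $ a) * (q (Suc j) - q j)))"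
    using vec_int_mean_cov(2)[of 0 n "\<lambda>_. 1" 1] n by simp
  also have "\<dots> = expectation (\<lambda>w. \<Sum>i\<in>UNIV. \<Sum>j\<in>{0..<n}. (\<Sum>a\<in>UNIV. A j w $ i $ a * A j w $ i $ a) * (q (Suc j) - q j))"
    using i3 by simp
  also have "\<dots> = expectation (\<lambda>w. \<Sum>j<n. (norm (A j w))\<^sup>2 * (q (Suc j) - q j))"
    unfolding norm_matrix_sq by (subst sum.swap) (simp add: sum_distrib_right atLeast0LessThan)
  finally show "expectation (\<lambda>w. (norm (vec_int q A 0 n w))\<^sup>2) = \<dots>" .
qed

end

text \<open>The integrand is stopped before its energy exceeds \<open>\<delta>\<close>, which is possible because its value
  on a grid interval is known at the left end point.\<close>

lemma vec_int_tail:
  fixes A :: "nat \<Rightarrow> 'a \<Rightarrow> real^'k^'n"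
  assumes g: "grid N q" and A: "adapted N q A" and K: "\<And>j w. j < N \<Longrightarrow> w \<in> space M \<Longrightarrow> norm (A j w) \<le> K"
    and n: "n \<le> N" and pos: "\<epsilon> > 0" "\<delta> > 0"
  shows "prob {w \<in> space M. \<epsilon> < norm (vec_int q A 0 n w)} \<le>
    \<delta> / \<epsilon>\<^sup>2 + prob {w \<in> space M. \<delta> < (\<Sum>j<n. (norm (A j w))\<^sup>2 * (q (Suc j) - q j))}"
proof -
  define E where "E k w = (\<Sum>j<k. (norm (A j w))\<^sup>2 * (q (Suc j) - q j))" for k w
  define B where "B j w = (if E (Suc j) w \<le> \<delta> then A j w else 0)" for j w
  have qs: "q j \<le> q (Suc j)" if "j < N" for j using g that by (auto simp: grid_def less_imp_le)
  have Aj: "A i \<in> borel_measurable (F (q j))" if "i \<le> j" "j < N" for i j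
    using adaptedD[OF A g, of i j] that by auto
  have EF: "E (Suc j) \<in> borel_measurable (F (q j))" if "j < N" for j
    unfolding E_def[abs_def]
  proof (rule borel_measurable_sum)
    fix i assume "i \<in> {..<Suc j}"
    then have [measurable]: "A i \<in> borel_measurable (F (q j))" using Aj that by auto
    show "(\<lambda>w. (norm (A i w))\<^sup>2 * (q (Suc i) - q i)) \<in> borel_measurable (F (q j))" by measurable
  qed
  have B: "adapted N q B"
    unfolding adapted_def
  proof (intro allI impI)
    fix j assume j: "j < N"
    have [measurable]: "E (Suc j) \<in> borel_measurable (F (q j))" "A j \<in> borel_measurable (F (q j))" using EF Aj j by auto
    show "B j \<in> borel_measurable (F (q j))" unfolding B_def[abs_def] by measurable
  qed
  have KB: "norm (B j w) \<le> max K 0" if "j < N" "w \<in> space M" for j w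
    using K[OF that] by (auto simp: B_def)
  have EM[measurable]: "E n \<in> borel_measurable M"
  proof (cases n)
    case (Suc j) then show ?thesis using EF[of j] n by (auto intro: measurable_filtration)
  qed (simp add: E_def[abs_def])
  have [measurable]: "(\<lambda>w. norm (vec_int q B 0 n w)) \<in> borel_measurable M" "(\<lambda>w. norm (vec_int q A 0 n w)) \<in> borel_measurable M"
    using norm_vec_int_measurable[OF g B KB n] norm_vec_int_measurable[OF g A K n] by auto
  \<comment> \<open>The second conjunct carries the induction: if the k-th term is kept, the energy
    of \<open>B\<close> up to it is at most that of \<open>A\<close>, which the test in
    \<open>B\<close> bounds by \<delta>; if it is cut, nothing is added.\<close>
  have EB: "(\<Sum>j<k. (norm (B j w))\<^sup>2 * (q (Suc j) - q j)) \<le> \<delta> \<and> (\<Sum>j<k. (norm (B j w))\<^sup>2 * (q (Suc j) - q j)) \<le> E k w"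
    if "k \<le> N" for k w using that
  proof (induction k)
    case (Suc k)
    then have k: "k < N" by auto
    have "0 \<le> (norm (A k w))\<^sup>2 * (q (Suc k) - q k)" using qs[OF k] by simp
    then show ?case using Suc k by (auto simp: B_def E_def)
  qed (use pos in \<open>simp add: E_def\<close>)
  have Emono: "E (Suc j) w \<le> E n w" if "j < n" for j w
    unfolding E_def using that n qs by (intro sum_mono2) (auto intro!: mult_nonneg_nonneg)
  \<comment> \<open>The energy is increasing, so when the total stays within \<delta> no term has
    been cut.\<close>
  have eq: "vec_int q A 0 n w = vec_int q B 0 n w" if "E n w \<le> \<delta>" for w
    unfolding vec_int_def
  proof (rule sum.cong[OF refl])
    fix j assume "j \<in> {0..<n}"
    then have "E (Suc j) w \<le> \<delta>" using Emono[of j w] that by auto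
    then show "A j w *v (W (q (Suc j)) w - W (q j) w) = B j w *v (W (q (Suc j)) w - W (q j) w)"
      by (simp add: B_def)
  qed
  have sub: "{w \<in> space M. \<epsilon> < norm (vec_int q A 0 n w)} \<subseteq>
    {w \<in> space M. \<epsilon> \<le> norm (vec_int q B 0 n w)} \<union> {w \<in> space M. \<delta> < E n w}"
    using eq by (auto simp: not_less[symmetric])
  have "prob {w \<in> space M. \<epsilon> < norm (vec_int q A 0 n w)} \<le>
      prob ({w \<in> space M. \<epsilon> \<le> norm (vec_int q B 0 n w)} \<union> {w \<in> space M. \<delta> < E n w})"
    by (intro finite_measure_mono sub) measurable
  also have "\<dots> \<le> prob {w \<in> space M. \<epsilon> \<le> norm (vec_int q B 0 n w)} + prob {w \<in> space M. \<delta> < E n w}"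
    by (intro measure_Un_le) measurable
  also have "prob {w \<in> space M. \<epsilon> \<le> norm (vec_int q B 0 n w)} = prob {w \<in> space M. \<epsilon>\<^sup>2 \<le> (norm (vec_int q B 0 n w))\<^sup>2}"
    using pos by (intro arg_cong[where f=prob]) (auto simp: power_mono_iff)
  also have "\<dots> \<le> expectation (\<lambda>w. (norm (vec_int q B 0 n w))\<^sup>2) / \<epsilon>\<^sup>2"
    using vec_int_isometry(1)[OF g B KB n] pos by (intro integral_Markov_inequality_measure[where A="space M"]) auto
  also have "\<dots> = expectation (\<lambda>w. \<Sum>j<n. (norm (B j w))\<^sup>2 * (q (Suc j) - q j)) / \<epsilon>\<^sup>2"
    using vec_int_isometry(2)[OF g B KB n] by simp
  also have "\<dots> \<le> \<delta> / \<epsilon>\<^sup>2"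
  proof (intro divide_right_mono)
    have "expectation (\<lambda>w. \<Sum>j<n. (norm (B j w))\<^sup>2 * (q (Suc j) - q j)) \<le> expectation (\<lambda>w. \<delta>)"
    proof (rule integral_mono)
      have [measurable]: "B j \<in> borel_measurable M" if "j < n" for j
        using B that n measurable_filtration unfolding adapted_def by (meson less_le_trans)
      show "integrable M (\<lambda>w. \<Sum>j<n. (norm (B j w))\<^sup>2 * (q (Suc j) - q j))"
      proof (rule integrable_const_bound[of _ \<delta>])
        show "AE w in M. norm (\<Sum>j<n. (norm (B j w))\<^sup>2 * (q (Suc j) - q j)) \<le> \<delta>"
        proof (intro AE_I2)
          fix w
          have "0 \<le> (\<Sum>j<n. (norm (B j w))\<^sup>2 * (q (Suc j) - q j))"
            using qs n by (intro sum_nonneg) auto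
          then show "norm (\<Sum>j<n. (norm (B j w))\<^sup>2 * (q (Suc j) - q j)) \<le> \<delta>" using EB[OF n, of w] by simp
        qed
      qed auto
    qed (use EB[OF n] in auto)
    then show "expectation (\<lambda>w. \<Sum>j<n. (norm (B j w))\<^sup>2 * (q (Suc j) - q j)) \<le> \<delta>" by (simp add: prob_space)
  qed simp
  finally show ?thesis by (simp add: E_def)
qed

end

section \<open>Finite grids and step processes\<close>

lemma matrix_vector_mult_sum_left: "(\<Sum>i\<in>I. A i) *v x = (\<Sum>i\<in>I. A i *v x)" for A :: "'i \<Rightarrow> real^'k^'n"
  by (induction I rule: infinite_finite_induct) (auto simp: matrix_vector_mult_add_rdistrib)

lemma borel_measurable_vec_component:
  fixes f :: "'a \<Rightarrow> 'b::euclidean_space ^ 'n"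
  assumes "\<And>i. (\<lambda>w. f w $ i) \<in> borel_measurable N" shows "f \<in> borel_measurable N"
  unfolding borel_measurable_euclidean_space[of f]
  by (auto simp: Basis_vec_def inner_axis intro!: borel_measurable_inner assms)

definition grid_point :: "real set \<Rightarrow> nat \<Rightarrow> real" where
  "grid_point Q j = sorted_list_of_set Q ! j"

lemma grid_point_less: "finite Q \<Longrightarrow> i < j \<Longrightarrow> j < card Q \<Longrightarrow> grid_point Q i < grid_point Q j"
  unfolding grid_point_def
  by (rule sorted_wrt_nth_less[OF strict_sorted_list_of_set]) auto

lemma grid_point_le: "finite Q \<Longrightarrow> i \<le> j \<Longrightarrow> j < card Q \<Longrightarrow> grid_point Q i \<le> grid_point Q j"
  using grid_point_less[of Q i j] by (cases "i = j") auto

lemma grid_point_in: "finite Q \<Longrightarrow> j < card Q \<Longrightarrow> grid_point Q j \<in> Q"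
  using nth_mem[of j "sorted_list_of_set Q"] by (simp add: grid_point_def)

lemma grid_point_ex: "finite Q \<Longrightarrow> x \<in> Q \<Longrightarrow> \<exists>j<card Q. grid_point Q j = x"
  using in_set_conv_nth[of x "sorted_list_of_set Q"] by (auto simp: grid_point_def)

text \<open>No point of \<open>Q\<close> lies strictly inside a cell. Hence the indicator of an
  interval with end points in \<open>Q\<close> is constant on cells, and comparing its left end with
  the right end of a cell gives information already available at the left end of the cell.\<close>

lemma grid_point_succ:
  assumes "finite Q" "x \<in> Q" "Suc j < card Q"
  shows "x < grid_point Q (Suc j) \<longleftrightarrow> x \<le> grid_point Q j"
proof -
  obtain k where k: "k < card Q" "grid_point Q k = x" using grid_point_ex[OF assms(1,2)] by blast
  show ?thesis
    using grid_point_le[OF assms(1), of k j] grid_point_le[OF assms(1), of "Suc j" k] grid_point_less[OF assms(1), of j "Suc j"] k assms(3)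
    by (cases "k \<le> j") (auto simp: not_le)
qed

lemma grid_point_0:
  assumes "finite Q" "0 \<in> Q" "Q \<subseteq> {0..}" shows "grid_point Q 0 = 0"
proof -
  obtain k where k: "k < card Q" "grid_point Q k = 0" using grid_point_ex[OF assms(1,2)] by blast
  then have "grid_point Q 0 \<le> 0" using grid_point_le[OF assms(1), of 0 k] by simp
  moreover have "grid_point Q 0 \<in> Q" using k assms(1) by (intro grid_point_in) auto
  ultimately show ?thesis using assms(3) by force
qed

context wiener begin

text \<open>Step processes are functions of time and outcome that are constant on the cells \<open>(q, q']\<close> of a finite
  grid; the value at the right end point \<open>q'\<close> stands for the whole cell and is known at time \<open>q\<close>.\<close>

definition adapted_step :: "real set \<Rightarrow> (real \<Rightarrow> 'a \<Rightarrow> real^'k^'n) \<Rightarrow> bool" where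
  "adapted_step Q A \<longleftrightarrow> finite Q \<and> 0 \<in> Q \<and> Q \<subseteq> {0..} \<and>
    (\<forall>j. Suc j < card Q \<longrightarrow> A (grid_point Q (Suc j)) \<in> borel_measurable (F (grid_point Q j)) \<and>
      (\<forall>s\<in>{grid_point Q j<..grid_point Q (Suc j)}. \<forall>w\<in>space M. A s w = A (grid_point Q (Suc j)) w)) \<and>
    (\<exists>K. \<forall>s\<in>Q. \<forall>w\<in>space M. norm (A s w) \<le> K)"

definition step_int :: "real set \<Rightarrow> (real \<Rightarrow> 'a \<Rightarrow> real^'k^'n) \<Rightarrow> real \<Rightarrow> 'a \<Rightarrow> real^'n" where
  "step_int Q A t w = (\<Sum>j<card Q - 1. A (grid_point Q (Suc j)) w *v
     (W (min (grid_point Q (Suc j)) t) w - W (min (grid_point Q j) t) w))"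

lemma adapted_stepD:
  assumes "adapted_step Q A"
  shows "finite Q" "0 \<in> Q" "Q \<subseteq> {0..}" "grid (card Q - 1) (grid_point Q)"
    "adapted (card Q - 1) (grid_point Q) (\<lambda>j. A (grid_point Q (Suc j)))"
    "\<And>j s w. Suc j < card Q \<Longrightarrow> s \<in> {grid_point Q j<..grid_point Q (Suc j)} \<Longrightarrow> w \<in> space M \<Longrightarrow> A s w = A (grid_point Q (Suc j)) w"
proof -
  show f: "finite Q" "0 \<in> Q" "Q \<subseteq> {0..}" using assms unfolding adapted_step_def by blast+
  show "grid (card Q - 1) (grid_point Q)"
    using grid_point_less[OF f(1)] grid_point_0[OF f] by (auto simp: grid_def less_diff_conv)
  show "adapted (card Q - 1) (grid_point Q) (\<lambda>j. A (grid_point Q (Suc j)))"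
    using assms unfolding adapted_step_def adapted_def by (simp add: less_diff_conv)
  show "\<And>j s w. Suc j < card Q \<Longrightarrow> s \<in> {grid_point Q j<..grid_point Q (Suc j)} \<Longrightarrow> w \<in> space M \<Longrightarrow> A s w = A (grid_point Q (Suc j)) w"
    using assms unfolding adapted_step_def by blast
qed

lemma adapted_step_bound:
  assumes "adapted_step Q A"
  obtains K where "\<And>j w. j < card Q - 1 \<Longrightarrow> w \<in> space M \<Longrightarrow> norm (A (grid_point Q (Suc j)) w) \<le> K"
proof -
  obtain K where "\<forall>s\<in>Q. \<forall>w\<in>space M. norm (A s w) \<le> K" using assms unfolding adapted_step_def by blast
  then show thesis using grid_point_in[OF adapted_stepD(1)[OF assms]] by (intro that[of K]) (auto simp: less_diff_conv)
qed

lemma step_int_grid_point: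
  assumes Q: "finite Q" and n: "n < card Q"
  shows "step_int Q A (grid_point Q n) w = vec_int (grid_point Q) (\<lambda>j. A (grid_point Q (Suc j))) 0 n w"
proof -
  have "step_int Q A (grid_point Q n) w = (\<Sum>j<card Q - 1. if j < n then A (grid_point Q (Suc j)) w *v
     (W (grid_point Q (Suc j)) w - W (grid_point Q j) w) else 0)"
    unfolding step_int_def
  proof (rule sum.cong[OF refl])
    fix j assume "j \<in> {..<card Q - 1}"
    then have j: "Suc j < card Q" by auto
    show "A (grid_point Q (Suc j)) w *v (W (min (grid_point Q (Suc j)) (grid_point Q n)) w - W (min (grid_point Q j) (grid_point Q n)) w) =
       (if j < n then A (grid_point Q (Suc j)) w *v (W (grid_point Q (Suc j)) w - W (grid_point Q j) w) else 0)"
      using grid_point_le[OF Q, of "Suc j" n] grid_point_le[OF Q, of j n] grid_point_le[OF Q, of n j] grid_point_le[OF Q, of n "Suc j"] j n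
      by (cases "j < n") (auto simp: min_def)
  qed
  also have "\<dots> = (\<Sum>j<n. A (grid_point Q (Suc j)) w *v (W (grid_point Q (Suc j)) w - W (grid_point Q j) w))"
    using n by (intro sum.mono_neutral_cong_right) auto
  finally show ?thesis by (simp add: vec_int_def atLeast0LessThan)
qed

lemma step_int_diff: "step_int Q (\<lambda>s w. A s w - B s w) t w = step_int Q A t w - step_int Q B t w"
  by (simp add: step_int_def matrix_vector_mult_diff_rdistrib sum_subtractf)

lemma adapted_step_diff:
  assumes A: "adapted_step Q A" and B: "adapted_step Q B"
  shows "adapted_step Q (\<lambda>s w. A s w - B s w)"
proof -
  obtain K L where "\<forall>s\<in>Q. \<forall>w\<in>space M. norm (A s w) \<le> K" "\<forall>s\<in>Q. \<forall>w\<in>space M. norm (B s w) \<le> L"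
    using A B unfolding adapted_step_def by blast
  then have "\<forall>s\<in>Q. \<forall>w\<in>space M. norm (A s w - B s w) \<le> K + L"
    by (blast intro: order_trans[OF norm_triangle_ineq4] add_mono)
  then have b: "\<exists>K. \<forall>s\<in>Q. \<forall>w\<in>space M. norm (A s w - B s w) \<le> K" by blast
  show ?thesis
    unfolding adapted_step_def
  proof (intro conjI allI impI ballI b)
    fix j assume j: "Suc j < card Q"
    show "(\<lambda>w. A (grid_point Q (Suc j)) w - B (grid_point Q (Suc j)) w) \<in> borel_measurable (F (grid_point Q j))"
      using adapted_stepD(5)[OF A] adapted_stepD(5)[OF B] j
      by (intro borel_measurable_diff) (simp_all add: adapted_def less_diff_conv)
    show "A s w - B s w = A (grid_point Q (Suc j)) w - B (grid_point Q (Suc j)) w"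
      if "s \<in> {grid_point Q j<..grid_point Q (Suc j)}" "w \<in> space M" for s w
      using adapted_stepD(6)[OF A j that] adapted_stepD(6)[OF B j that] by simp
  qed (use adapted_stepD(1-3)[OF A] in auto)
qed

lemma adapted_step_comp:
  assumes A: "adapted_step Q A" and h: "h \<in> borel_measurable borel" "\<And>x. norm (h x) \<le> L"
  shows "adapted_step Q (\<lambda>s w. h (A s w))"
  unfolding adapted_step_def
proof (intro conjI allI impI ballI exI[of _ L] h(2))
  fix j assume j: "Suc j < card Q"
  show "(\<lambda>w. h (A (grid_point Q (Suc j)) w)) \<in> borel_measurable (F (grid_point Q j))"
    using adapted_stepD(5)[OF A] j by (intro measurable_compose[OF _ h(1)]) (simp add: adapted_def less_diff_conv)
  show "h (A s w) = h (A (grid_point Q (Suc j)) w)"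
    if "s \<in> {grid_point Q j<..grid_point Q (Suc j)}" "w \<in> space M" for s w
    using adapted_stepD(6)[OF A j that] by simp
qed (use adapted_stepD(1-3)[OF A] in auto)

text \<open>The function \<open>h\<close> is left open for three uses: the squared norm for the
  energy, products of entries for the covariance, and single entries for measurability of the paths
  in time.\<close>

lemma step_energy:
  fixes h :: "real^'k^'n \<Rightarrow> real"
  assumes A: "adapted_step Q A" and n: "m \<le> n" "n < card Q" and w: "w \<in> space M"
  shows "has_bochner_integral lborel (\<lambda>r. indicator {grid_point Q m..grid_point Q n} r * h (A r w))
    (\<Sum>j\<in>{m..<n}. h (A (grid_point Q (Suc j)) w) * (grid_point Q (Suc j) - grid_point Q j))"
proof (rule piecewise_integral[OF n(1)])
  show "grid_point Q j \<le> grid_point Q (Suc j)" if "m \<le> j" "j < n" for j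
    using that n by (intro grid_point_le adapted_stepD[OF A]) auto
  show "h (A r w) = h (A (grid_point Q (Suc j)) w)" if "m \<le> j" "j < n" "r \<in> {grid_point Q j<..grid_point Q (Suc j)}" for j r
    using adapted_stepD(6)[OF A _ that(3) w] that n by simp
qed

lemma step_energy_nn:
  assumes A: "adapted_step Q A" and n: "n < card Q" and w: "w \<in> space M"
  shows "(\<integral>\<^sup>+ s\<in>{0..grid_point Q n}. ennreal ((norm (A s w))\<^sup>2) \<partial>lborel) =
    ennreal (\<Sum>j<n. (norm (A (grid_point Q (Suc j)) w))\<^sup>2 * (grid_point Q (Suc j) - grid_point Q j))"
proof -
  have 0: "grid_point Q 0 = 0" using adapted_stepD[OF A] by (intro grid_point_0)
  have hb: "has_bochner_integral lborel (\<lambda>r. indicator {0..grid_point Q n} r * (norm (A r w))\<^sup>2)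
    (\<Sum>j<n. (norm (A (grid_point Q (Suc j)) w))\<^sup>2 * (grid_point Q (Suc j) - grid_point Q j))"
    using step_energy[OF A _ n w, of 0 "\<lambda>x. (norm x)\<^sup>2"] by (simp add: 0 atLeast0LessThan)
  have "(\<integral>\<^sup>+ s\<in>{0..grid_point Q n}. ennreal ((norm (A s w))\<^sup>2) \<partial>lborel) =
    (\<integral>\<^sup>+ s. ennreal (indicator {0..grid_point Q n} s * (norm (A s w))\<^sup>2) \<partial>lborel)"
    by (rule nn_integral_cong) (auto simp: indicator_def)
  also have "\<dots> = ennreal (\<Sum>j<n. (norm (A (grid_point Q (Suc j)) w))\<^sup>2 * (grid_point Q (Suc j) - grid_point Q j))"
    using hb by (subst nn_integral_eq_integral) (auto simp: has_bochner_integral_iff)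
  finally show ?thesis .
qed

lemma step_energy_measurable:
  assumes A: "adapted_step Q A" and t: "t \<in> Q"
  shows "(\<lambda>w. \<integral>\<^sup>+ s\<in>{0..t}. ennreal ((norm (A s w))\<^sup>2) \<partial>lborel) \<in> borel_measurable M"
proof -
  obtain n where n: "n < card Q" "grid_point Q n = t" using grid_point_ex[OF adapted_stepD(1)[OF A] t] by blast
  have "(\<lambda>w. ennreal (\<Sum>j<n. (norm (A (grid_point Q (Suc j)) w))\<^sup>2 * (grid_point Q (Suc j) - grid_point Q j))) \<in> borel_measurable M"
  proof (intro measurable_compose[OF _ measurable_ennreal] borel_measurable_sum)
    fix j assume "j \<in> {..<n}"
    then have [measurable]: "A (grid_point Q (Suc j)) \<in> borel_measurable M"
      using adapted_stepD(5)[OF A] n by (intro measurable_filtration[of _ "grid_point Q j"]) (auto simp: adapted_def)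
    show "(\<lambda>w. (norm (A (grid_point Q (Suc j)) w))\<^sup>2 * (grid_point Q (Suc j) - grid_point Q j)) \<in> borel_measurable M"
      by measurable
  qed
  then show ?thesis using step_energy_nn[OF A n(1)] unfolding n(2) by (subst measurable_cong) auto
qed

lemma step_int_measurable:
  assumes A: "adapted_step Q A" and t: "t \<in> Q"
  shows "step_int Q A t \<in> borel_measurable M"
proof (rule borel_measurable_vec_component)
  fix i
  obtain n where n: "n < card Q" "grid_point Q n = t" using grid_point_ex[OF adapted_stepD(1)[OF A] t] by blast
  obtain K where K: "\<And>j w. j < card Q - 1 \<Longrightarrow> w \<in> space M \<Longrightarrow> norm (A (grid_point Q (Suc j)) w) \<le> K"
    using adapted_step_bound[OF A] by blast
  have n': "n \<le> card Q - Suc 0" using n by linarith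
  have "(\<lambda>w. vec_int (grid_point Q) (\<lambda>j. A (grid_point Q (Suc j))) 0 n w $ i) \<in> borel_measurable (F (grid_point Q n))"
    using vec_int_measurable[OF adapted_stepD(4,5)[OF A] K, of 0 n i] n' by simp
  from measurable_filtration[OF this] show "(\<lambda>w. step_int Q A t w $ i) \<in> borel_measurable M"
    using step_int_grid_point[OF adapted_stepD(1)[OF A] n(1), of A] unfolding n(2) by simp
qed

lemma step_int_norm_measurable:
  "adapted_step Q A \<Longrightarrow> t \<in> Q \<Longrightarrow> (\<lambda>w. norm (step_int Q A t w)) \<in> borel_measurable M"
  by (intro measurable_compose[OF step_int_measurable borel_measurable_norm])

text \<open>By \<open>vec_int_tail\<close>, the integral exceeds e with probability at most \<delta>
  / e^2 plus the probability that the energy exceeds \<delta>. With \<delta> = \<eta> e^2 / 2 the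
  first part is \<eta> / 2 and the second is eventually smaller than that. The bounds of the
  \<open>A m\<close> may grow with m.\<close>

lemma step_int_vanishes:
  assumes A: "\<And>m. adapted_step (Q m) (A m)" and t: "\<And>m. t \<in> Q m"
    and van: "vanishes_in_probability M (\<lambda>m w. \<integral>\<^sup>+ s\<in>{0..t}. ennreal ((norm (A m s w))\<^sup>2) \<partial>lborel)"
  shows "vanishes_in_probability M (\<lambda>m w. ennreal (norm (step_int (Q m) (A m) t w)))"
  unfolding vanishes_in_probability_def
proof (intro conjI allI impI)
  note [measurable] = step_int_norm_measurable[OF A t]
  show "(\<lambda>w. ennreal (norm (step_int (Q m) (A m) t w))) \<in> borel_measurable M" for m by measurable
  fix e :: real assume e: "e > 0"
  show "(\<lambda>m. prob {w \<in> space M. ennreal e < ennreal (norm (step_int (Q m) (A m) t w))}) \<longlonglongrightarrow> 0"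
  proof (rule LIMSEQ_I)
    fix \<eta> :: real assume eta: "\<eta> > 0"
    define \<delta> where "\<delta> = \<eta> / 2 * e\<^sup>2"
    have d: "\<delta> > 0" using e eta by (simp add: \<delta>_def)
    let ?G = "\<lambda>m w. \<integral>\<^sup>+ s\<in>{0..t}. ennreal ((norm (A m s w))\<^sup>2) \<partial>lborel"
    have "(\<lambda>m. prob {w \<in> space M. ennreal \<delta> < ?G m w}) \<longlonglongrightarrow> 0"
      using van d by (auto simp: vanishes_in_probability_def)
    then have "\<forall>\<^sub>F m in sequentially. prob {w \<in> space M. ennreal \<delta> < ?G m w} < \<eta> / 2"
      using eta by (intro order_tendstoD(2)) auto
    then obtain m0 where m0: "\<And>m. m \<ge> m0 \<Longrightarrow> prob {w \<in> space M. ennreal \<delta> < ?G m w} < \<eta> / 2"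
      by (auto simp: eventually_sequentially)
    have "prob {w \<in> space M. ennreal e < ennreal (norm (step_int (Q m) (A m) t w))} < \<eta>" if "m \<ge> m0" for m
    proof -
      obtain n where n: "n < card (Q m)" "grid_point (Q m) n = t"
        using grid_point_ex[OF adapted_stepD(1)[OF A[of m]] t[of m]] by blast
      obtain K where K: "\<And>j w. j < card (Q m) - 1 \<Longrightarrow> w \<in> space M \<Longrightarrow> norm (A m (grid_point (Q m) (Suc j)) w) \<le> K"
        using adapted_step_bound[OF A[of m]] by blast
      have n': "n \<le> card (Q m) - 1" using n by auto
      note s = step_int_grid_point[OF adapted_stepD(1)[OF A[of m]] n(1), of "A m", unfolded n(2)]
      have "prob {w \<in> space M. ennreal e < ennreal (norm (step_int (Q m) (A m) t w))} =
         prob {w \<in> space M. e < norm (step_int (Q m) (A m) t w)}"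
        using e by (simp add: ennreal_less_iff)
      also have "\<dots> \<le> \<delta> / e\<^sup>2 + prob {w \<in> space M. \<delta> < (\<Sum>j<n. (norm (A m (grid_point (Q m) (Suc j)) w))\<^sup>2 * (grid_point (Q m) (Suc j) - grid_point (Q m) j))}"
        unfolding s using vec_int_tail[OF adapted_stepD(4,5)[OF A[of m]] K n' e d] by simp
      also have "{w \<in> space M. \<delta> < (\<Sum>j<n. (norm (A m (grid_point (Q m) (Suc j)) w))\<^sup>2 * (grid_point (Q m) (Suc j) - grid_point (Q m) j))}
         = {w \<in> space M. ennreal \<delta> < ?G m w}"
        using step_energy_nn[OF A[of m] n(1), unfolded n(2)] d by (auto simp: ennreal_less_iff)
      also have "\<delta> / e\<^sup>2 + prob {w \<in> space M. ennreal \<delta> < ?G m w} < \<eta>"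
        using m0[OF that] e by (simp add: \<delta>_def)
      finally show ?thesis .
    qed
    then show "\<exists>no. \<forall>m\<ge>no. norm (prob {w \<in> space M. ennreal e < ennreal (norm (step_int (Q m) (A m) t w))} - 0) < \<eta>"
      by (intro exI[of _ m0]) auto
  qed
qed

text \<open>Two simple processes can be subtracted once both are placed on a common refinement of
  their partitions. The refinement leaves the integral unchanged because the increments inside one
  original interval telescope.\<close>

lemma simple_process_step:
  fixes \<xi> :: "nat \<Rightarrow> 'a \<Rightarrow> real^'k^'n"
  assumes S: "is_simple_process M F (N, p, \<xi>)"
    and Q: "finite Q" "0 \<in> Q" "Q \<subseteq> {0..}" "p ` {..N} \<subseteq> Q"
  shows "adapted_step Q (simple_value (N, p, \<xi>))"
    and "simple_integral W (N, p, \<xi>) t w = step_int Q (simple_value (N, p, \<xi>)) t w"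
proof -
  let ?g = "grid_point Q" and ?A = "simple_value (N, p, \<xi>)"
  have pm: "0 \<le> p 0" "\<And>i. i < N \<Longrightarrow> p i < p (Suc i)" "\<And>i. i < N \<Longrightarrow> \<xi> i \<in> borel_measurable (F (p i))"
    using S by (auto simp: is_simple_process_def)
  obtain K where K: "\<And>i w. i < N \<Longrightarrow> w \<in> space M \<Longrightarrow> norm (\<xi> i w) \<le> K"
    using S unfolding is_simple_process_def split by blast
  have pQ: "p i \<in> Q" if "i \<le> N" for i using Q(4) that by auto
  have ind: "indicator {p i<..p (Suc i)} s = (indicator {p i<..p (Suc i)} (?g (Suc j)) :: real)"
    if "i < N" "Suc j < card Q" "s \<in> {?g j<..?g (Suc j)}" for i j s
    using grid_point_succ[OF Q(1) pQ[of i] that(2)] grid_point_succ[OF Q(1) pQ[of "Suc i"] that(2)] that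
    by (auto simp: indicator_def)
  show "adapted_step Q ?A"
    unfolding adapted_step_def
  proof (intro conjI allI impI ballI exI[of _ "\<Sum>i<N. K"])
    fix j assume j: "Suc j < card Q"
    show "?A (?g (Suc j)) \<in> borel_measurable (F (?g j))"
      unfolding simple_value_def split
    proof (rule borel_measurable_sum)
      fix i assume "i \<in> {..<N}"
      then have i: "i < N" by simp
      show "(\<lambda>w. indicator {p i<..p (Suc i)} (?g (Suc j)) *\<^sub>R \<xi> i w) \<in> borel_measurable (F (?g j))"
      proof (cases "p i < ?g (Suc j)")
        case True
        then have "p i \<le> ?g j" using grid_point_succ[OF Q(1) pQ[of i] j] i by simp
        then have [measurable]: "\<xi> i \<in> borel_measurable (F (?g j))"
          using pm(3)[OF i] by (rule measurable_filtration_mono[rotated])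
        show ?thesis by measurable
      qed simp
    qed
    show "?A s w = ?A (?g (Suc j)) w" if "s \<in> {?g j<..?g (Suc j)}" for s w
      unfolding simple_value_def split by (rule sum.cong[OF refl], subst ind[OF _ j that]) auto
  next
    fix s w assume "w \<in> space M"
    have "norm (?A s w) \<le> (\<Sum>i<N. norm (indicator {p i<..p (Suc i)} s *\<^sub>R \<xi> i w))"
      unfolding simple_value_def split by (rule norm_sum)
    also have "\<dots> \<le> (\<Sum>i<N. K)"
    proof (rule sum_mono)
      fix i assume "i \<in> {..<N}"
      then have "norm (\<xi> i w) \<le> K" using K \<open>w \<in> space M\<close> by auto
      then show "norm (indicator {p i<..p (Suc i)} s *\<^sub>R \<xi> i w) \<le> K"
        using order_trans[OF norm_ge_zero[of "\<xi> i w"]] by (auto simp: indicator_def)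
    qed
    finally show "norm (?A s w) \<le> (\<Sum>i<N. K)" .
  qed (use Q in auto)
  let ?d = "\<lambda>j. W (min (?g (Suc j)) t) w - W (min (?g j) t) w"
  have "step_int Q ?A t w = (\<Sum>i<N. \<Sum>j<card Q - 1. (indicator {p i<..p (Suc i)} (?g (Suc j)) *\<^sub>R \<xi> i w) *v ?d j)"
    unfolding step_int_def simple_value_def split
    by (simp only: matrix_vector_mult_sum_left, rule sum.swap)
  also have "\<dots> = simple_integral W (N, p, \<xi>) t w"
    unfolding simple_integral_def split
  proof (rule sum.cong[OF refl])
    fix i assume "i \<in> {..<N}"
    then have i: "i < N" by simp
    \<comment> \<open>The interval from \<open>p i\<close> to \<open>p (Suc i)\<close> consists of
      the cells k, ..., l - 1 of the refined grid.\<close>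
    obtain k l where k: "k < card Q" "?g k = p i" and l: "l < card Q" "?g l = p (Suc i)"
      using grid_point_ex[OF Q(1) pQ[of i]] grid_point_ex[OF Q(1) pQ[of "Suc i"]] i by auto
    have kl: "k \<le> l" using pm(2)[OF i] k l grid_point_le[OF Q(1), of l k] by (cases "k \<le> l") auto
    have eq: "indicator {p i<..p (Suc i)} (?g (Suc j)) = (if j \<in> {k..<l} then 1 else 0 :: real)" if "j < card Q - 1" for j
    proof -
      have Sj: "Suc j < card Q" using that by auto
      have "p i < ?g (Suc j) \<longleftrightarrow> k \<le> j"
        using grid_point_less[OF Q(1), of k "Suc j"] grid_point_le[OF Q(1), of "Suc j" k] k Sj by (cases "k \<le> j") auto
      moreover have "?g (Suc j) \<le> p (Suc i) \<longleftrightarrow> j < l"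
        using grid_point_less[OF Q(1), of l "Suc j"] grid_point_le[OF Q(1), of "Suc j" l] l Sj by (cases "j < l") auto
      ultimately show ?thesis by (auto simp: indicator_def)
    qed
    have "(\<Sum>j<card Q - 1. (indicator {p i<..p (Suc i)} (?g (Suc j)) *\<^sub>R \<xi> i w) *v ?d j) =
      (\<Sum>j<card Q - 1. if j \<in> {k..<l} then \<xi> i w *v ?d j else 0)"
      by (rule sum.cong[OF refl]) (simp add: eq)
    also have "\<dots> = (\<Sum>j\<in>{k..<l}. \<xi> i w *v ?d j)"
      using l by (intro sum.mono_neutral_cong_right) auto
    also have "\<dots> = \<xi> i w *v (\<Sum>j\<in>{k..<l}. ?d j)"
      by (simp add: linear_sum[OF matrix_vector_mul_linear])
    also have "(\<Sum>j\<in>{k..<l}. ?d j) = W (min (?g l) t) w - W (min (?g k) t) w"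
      using kl by (rule sum_Suc_diff')
    finally show "(\<Sum>j<card Q - 1. (indicator {p i<..p (Suc i)} (?g (Suc j)) *\<^sub>R \<xi> i w) *v ?d j) =
      \<xi> i w *v (W (min (p (Suc i)) t) w - W (min (p i) t) w)" using k l by simp
  qed
  finally show "simple_integral W (N, p, \<xi>) t w = step_int Q ?A t w" by simp
qed

section \<open>Cutting off at a rounded stopping time\<close>

lemma ceiling_ge: "h > 0 \<Longrightarrow> s \<le> h * \<lceil>s / h\<rceil>" for h s :: real
  using mult_left_mono[OF le_of_int_ceiling[of "s / h"], of h] by simp

text \<open>Both sides say that the coarse cell of s is not later than that of r, the cells being
  the intervals (h (i - 1), h i]. The left form tests r against the left end of the cell of s, hence
  is adapted; the right form says that s has not passed r rounded up.\<close>

lemma ceiling_cell_less_iff: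
  fixes h :: real assumes "h > 0"
  shows "h * (real_of_int \<lceil>s / h\<rceil> - 1) < r \<longleftrightarrow> s \<le> h * \<lceil>r / h\<rceil>"
proof -
  have "h * (real_of_int \<lceil>s / h\<rceil> - 1) < r \<longleftrightarrow> real_of_int (\<lceil>s / h\<rceil> - 1) < r / h"
    using assms by (simp add: field_simps)
  also have "\<dots> \<longleftrightarrow> \<lceil>s / h\<rceil> \<le> \<lceil>r / h\<rceil>" by (simp only: less_ceiling_iff[symmetric]) linarith
  also have "\<dots> \<longleftrightarrow> s / h \<le> \<lceil>r / h\<rceil>" by (simp add: ceiling_le_iff)
  also have "\<dots> \<longleftrightarrow> s \<le> h * \<lceil>r / h\<rceil>" using assms by (simp add: field_simps)
  finally show ?thesis .
qed

lemma ceiling_grid: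
  fixes h :: real assumes "h > 0" "0 \<le> r" "r \<le> h * real n"
  shows "h * \<lceil>r / h\<rceil> \<in> (\<lambda>i. h * real i) ` {..n}"
proof -
  have "- 1 < r / h" using assms by (simp add: less_le_trans[of "-1" 0])
  then have "0 \<le> \<lceil>r / h\<rceil>" by simp
  then obtain i where i: "\<lceil>r / h\<rceil> = int i" by (rule nonneg_int_cases)
  have "r / h \<le> real n" using assms by (simp add: pos_divide_le_eq mult.commute)
  then have "\<lceil>r / h\<rceil> \<le> int n" by (simp add: ceiling_le_iff)
  then show ?thesis using i by (intro image_eqI[of _ _ i]) auto
qed

text \<open>Whether \<rho> exceeds the left end of the current coarse cell is known at that left
  end. As the coarse grid is contained in \<open>Q\<close>, the left end is at or before the left
  end of the current cell of \<open>Q\<close>, so the cut-off integrand is still adapted and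
  constant on cells.\<close>

lemma adapted_step_stop:
  assumes A: "adapted_step Q A" and h: "h > 0" and Qh: "(\<lambda>i. h * real i) ` {..n} \<subseteq> Q"
    and \<rho>: "stopping_time F \<rho>" and \<rho>b: "\<And>w. w \<in> space M \<Longrightarrow> \<rho> w \<le> h * real n"
  shows "adapted_step Q (\<lambda>s w. if h * (real_of_int \<lceil>s / h\<rceil> - 1) < \<rho> w then A s w else 0)"
proof -
  let ?g = "grid_point Q" and ?l = "\<lambda>s. h * (real_of_int \<lceil>s / h\<rceil> - 1)"
  note Q = adapted_stepD[OF A]
  \<comment> \<open>A cell of \<open>Q\<close> lies within one coarse cell, so the left end of the
    coarse cell is the same for all its points.\<close>
  have cell: "?l s \<le> ?g j" "?l s = ?l (?g (Suc j))"
    if j: "Suc j < card Q" and s: "s \<in> {?g j<..?g (Suc j)}" and gn: "?g (Suc j) \<le> h * real n" for j s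
  proof -
    have g: "0 \<le> ?g j" using grid_point_in[OF Q(1), of j] j Q(3) by auto
    have s0: "0 < s" "s \<le> h * real n" using g s gn by auto
    have l: "?l s < s" using ceiling_cell_less_iff[OF h, of s s] ceiling_ge[OF h, of s] by simp
    have "\<lceil>s / h\<rceil> \<ge> 1" using s0 h by (simp add: le_ceiling_iff)
    then obtain i where i: "\<lceil>s / h\<rceil> - 1 = int i" using nonneg_int_cases[of "\<lceil>s / h\<rceil> - 1"] by auto
    have "s / h \<le> real n" using s0 h by (simp add: pos_divide_le_eq mult.commute)
    then have "\<lceil>s / h\<rceil> \<le> int n" by (simp add: ceiling_le_iff)
    moreover have "\<lceil>s / h\<rceil> = int i + 1" using i by simp
    ultimately have "?l s \<in> (\<lambda>i. h * real i) ` {..n}"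
      by (intro image_eqI[of _ _ i]) auto
    then have "?l s \<in> Q" using Qh by auto
    then show "?l s \<le> ?g j" using l s grid_point_succ[OF Q(1) _ j, of "?l s"] by auto
    have cQ: "h * \<lceil>s / h\<rceil> \<in> Q" using ceiling_grid[OF h _ s0(2)] s0 Qh by auto
    have "s \<le> h * \<lceil>s / h\<rceil>" using h by (rule ceiling_ge)
    then have "?g (Suc j) \<le> h * \<lceil>s / h\<rceil>"
      using s grid_point_succ[OF Q(1) cQ j] by (meson greaterThanAtMost_iff leD leI less_le_trans)
    then have "\<lceil>?g (Suc j) / h\<rceil> \<le> \<lceil>s / h\<rceil>" using h by (simp add: ceiling_le_iff field_simps)
    moreover have "\<lceil>s / h\<rceil> \<le> \<lceil>?g (Suc j) / h\<rceil>" using s h by (intro ceiling_mono divide_right_mono) auto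
    ultimately show "?l s = ?l (?g (Suc j))" by simp
  qed
  \<comment> \<open>\<open>Q\<close> may continue beyond h n, where it need not contain coarse grid
    points; there \<rho> has already passed and the integrand is 0.\<close>
  have late: "\<not> ?l s < \<rho> w" if j: "Suc j < card Q" and s: "s \<in> {?g j<..?g (Suc j)}" and gn: "\<not> ?g (Suc j) \<le> h * real n"
    and w: "w \<in> space M" for s j w
  proof -
    have "h * real n \<in> Q" using Qh by auto
    then have "h * real n < s" using grid_point_succ[OF Q(1) _ j] gn s by fastforce
    moreover have "\<rho> w / h \<le> real n" using \<rho>b[OF w] h by (simp add: pos_divide_le_eq mult.commute)
    then have "\<lceil>\<rho> w / h\<rceil> \<le> int n" by (simp add: ceiling_le_iff)
    then have "h * \<lceil>\<rho> w / h\<rceil> \<le> h * real n" using h by auto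
    ultimately show ?thesis unfolding ceiling_cell_less_iff[OF h] by linarith
  qed
  obtain K where K: "\<forall>s\<in>Q. \<forall>w\<in>space M. norm (A s w) \<le> K" using A unfolding adapted_step_def by blast
  show ?thesis
    unfolding adapted_step_def
  proof (intro conjI allI impI exI[of _ "max K 0"] ballI)
    fix j assume j: "Suc j < card Q"
    have gj: "?g (Suc j) \<in> {?g j<..?g (Suc j)}" using grid_point_less[OF Q(1) _ j, of j] by auto
    have [measurable]: "A (?g (Suc j)) \<in> borel_measurable (F (?g j))"
      using Q(5) j by (auto simp: adapted_def less_diff_conv)
    show "(\<lambda>w. if ?l (?g (Suc j)) < \<rho> w then A (?g (Suc j)) w else 0) \<in> borel_measurable (F (?g j))"
    proof (cases "?g (Suc j) \<le> h * real n")
      case True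
      have "Measurable.pred (F (?l (?g (Suc j)))) (\<lambda>w. ?l (?g (Suc j)) < \<rho> w)"
        by (rule stopping_timeD2[OF \<rho>])
      then have [measurable]: "Measurable.pred (F (?g j)) (\<lambda>w. ?l (?g (Suc j)) < \<rho> w)"
        using cell(1)[OF j gj True] by (rule measurable_filtration_mono)
      show ?thesis by measurable
    next
      case False
      have "(\<lambda>w. if ?l (?g (Suc j)) < \<rho> w then A (?g (Suc j)) w else 0) \<in> borel_measurable (F (?g j)) \<longleftrightarrow>
         (\<lambda>w. 0 :: real^'k^'b) \<in> borel_measurable (F (?g j))"
        using late[OF j gj False] by (intro measurable_cong) simp
      then show ?thesis by simp
    qed
    show "(if ?l s < \<rho> w then A s w else 0) = (if ?l (?g (Suc j)) < \<rho> w then A (?g (Suc j)) w else 0)"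
      if "s \<in> {?g j<..?g (Suc j)}" "w \<in> space M" for s w
    proof (cases "?g (Suc j) \<le> h * real n")
      case True
      then show ?thesis by (simp only: cell(2)[OF j that(1)] Q(6)[OF j that])
    next
      case False
      then show ?thesis using late[OF j that(1) False that(2)] late[OF j gj False that(2)] by simp
    qed
  qed (use Q K in \<open>auto simp: max.coboundedI1\<close>)
qed

text \<open>Cutting off the integrand is the same as evaluating the integral at the rounded time.
  That time is a grid point, so each cell is either kept whole or removed whole.\<close>

lemma step_int_stop:
  fixes h t :: real and \<rho> :: "'a \<Rightarrow> real"
  assumes Q: "finite Q" and h: "h > 0" and r: "h * \<lceil>\<rho> w / h\<rceil> \<in> Q"
  shows "step_int Q (\<lambda>s w. if h * (real_of_int \<lceil>s / h\<rceil> - 1) < \<rho> w then A s w else 0) t w = step_int Q A (min t (h * \<lceil>\<rho> w / h\<rceil>)) w"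
  unfolding step_int_def
proof (rule sum.cong[OF refl])
  fix j assume "j \<in> {..<card Q - 1}"
  then have j: "Suc j < card Q" by auto
  let ?g = "grid_point Q" and ?r = "h * \<lceil>\<rho> w / h\<rceil>"
  have lt: "?g j < ?g (Suc j)" using grid_point_less[OF Q _ j, of j] by auto
  show "(if h * (real_of_int \<lceil>?g (Suc j) / h\<rceil> - 1) < \<rho> w then A (?g (Suc j)) w else 0) *v (W (min (?g (Suc j)) t) w - W (min (?g j) t) w) =
    A (?g (Suc j)) w *v (W (min (?g (Suc j)) (min t ?r)) w - W (min (?g j) (min t ?r)) w)"
  proof (cases "?g (Suc j) \<le> ?r")
    case True
    then have "min (?g (Suc j)) (min t ?r) = min (?g (Suc j)) t" "min (?g j) (min t ?r) = min (?g j) t"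
      using lt by (auto simp: min_def)
    then show ?thesis using True by (simp add: ceiling_cell_less_iff[OF h])
  next
    case False
    then have "?r \<le> ?g j" using grid_point_succ[OF Q r j] by auto
    then have "min (?g (Suc j)) (min t ?r) = min t ?r" "min (?g j) (min t ?r) = min t ?r"
      using lt by (auto simp: min_def)
    then show ?thesis using False by (simp add: ceiling_cell_less_iff[OF h])
  qed
qed

end

subsection \<open>The stopped Ito integral\<close>

lemma nn_integral_le_combination:
  fixes f g h :: "real \<Rightarrow> real"
  assumes [measurable]: "(\<lambda>r. indicator S r * g r) \<in> borel_measurable borel" "(\<lambda>r. indicator S r * h r) \<in> borel_measurable borel"
    and nn: "\<And>r. 0 \<le> g r" "\<And>r. 0 \<le> h r"
    and le: "AE r in lborel. r \<in> S \<longrightarrow> f r \<le> numeral a * g r + numeral c * h r"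
  shows "(\<integral>\<^sup>+ r\<in>S. ennreal (f r) \<partial>lborel) \<le>
    numeral a * (\<integral>\<^sup>+ r\<in>S. ennreal (g r) \<partial>lborel) + numeral c * (\<integral>\<^sup>+ r\<in>S. ennreal (h r) \<partial>lborel)"
proof -
  have "(\<integral>\<^sup>+ r\<in>S. ennreal (f r) \<partial>lborel) \<le>
    (\<integral>\<^sup>+ r. numeral a * (ennreal (g r) * indicator S r) + numeral c * (ennreal (h r) * indicator S r) \<partial>lborel)"
  proof (rule nn_integral_mono_AE, use le in eventually_elim)
    case (elim r)
    have "ennreal (f r) \<le> numeral a * ennreal (g r) + numeral c * ennreal (h r)" if "r \<in> S"
    proof -
      have "ennreal (f r) \<le> ennreal (numeral a * g r + numeral c * h r)" using elim that by (intro ennreal_leI) auto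
      also have "\<dots> = ennreal (numeral a * g r) + ennreal (numeral c * h r)" using nn by (intro ennreal_plus) auto
      finally show ?thesis by (simp add: ennreal_mult nn)
    qed
    then show ?case by (auto simp: indicator_def)
  qed
  also have "\<dots> = numeral a * (\<integral>\<^sup>+ r\<in>S. ennreal (g r) \<partial>lborel) + numeral c * (\<integral>\<^sup>+ r\<in>S. ennreal (h r) \<partial>lborel)"
  proof -
    have e: "ennreal (k r) * indicator S r = ennreal (indicator S r * k r)" for k :: "real \<Rightarrow> real" and r
      by (auto simp: indicator_def)
    show ?thesis unfolding e by (simp add: nn_integral_add nn_integral_cmult)
  qed
  finally show ?thesis .
qed

lemma norm_sq_le_two: "(norm (x + y))\<^sup>2 \<le> 2 * (norm x)\<^sup>2 + 2 * (norm y)\<^sup>2" for x y :: "'b::real_normed_vector"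
proof -
  have "(norm (x + y))\<^sup>2 \<le> (norm x + norm y)\<^sup>2" by (intro power_mono norm_triangle_ineq) auto
  also have "\<dots> \<le> 2 * (norm x)\<^sup>2 + 2 * (norm y)\<^sup>2"
    using zero_le_power2[of "norm x - norm y"] by (simp add: power2_eq_square algebra_simps)
  finally show ?thesis .
qed

lemma norm_sq_diff_le_two: "(norm (x - y))\<^sup>2 \<le> 2 * (norm (x - z))\<^sup>2 + 2 * (norm (y - z))\<^sup>2" for x y :: "'b::real_normed_vector"
  using norm_sq_le_two[of "x - z" "z - y"] by (simp add: norm_minus_commute)

context wiener begin

text \<open>Extension by 0 outside [0, t] turns progressive measurability into measurability on the
  full product space, which integration over time and Fubini arguments require.\<close>

lemma progressively_measurable_joint:
  fixes H :: "real \<Rightarrow> 'a \<Rightarrow> 'b::real_normed_vector"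
  assumes H: "progressively_measurable F H" and t: "0 \<le> t"
  shows "(\<lambda>(r, w). indicator {0..t} r *\<^sub>R H r w) \<in> borel_measurable (borel \<Otimes>\<^sub>M M)"
proof -
  let ?R = "restrict_space (borel \<Otimes>\<^sub>M M) ({0..t} \<times> UNIV)"
  have "fst \<in> measurable ?R (restrict_space borel {0..t})"
    by (rule measurable_restrict_space2) (auto simp: space_restrict_space intro: measurable_restrict_space1)
  moreover have "(\<lambda>x. x) \<in> measurable M (F t)"
    using measurable_ident by (intro measurable_filtration[of _ t]) (simp add: id_def)
  then have "snd \<in> measurable ?R (F t)"
    using measurable_compose[OF measurable_snd] by (intro measurable_restrict_space1) fastforce
  ultimately have "(\<lambda>p. (fst p, snd p)) \<in> measurable ?R (restrict_space borel {0..t} \<Otimes>\<^sub>M F t)"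
    by (rule measurable_Pair)
  moreover have "(\<lambda>(r, w). H r w) \<in> borel_measurable (restrict_space borel {0..t} \<Otimes>\<^sub>M F t)"
    using H t by (simp add: progressively_measurable_def)
  ultimately have "(\<lambda>(r, w). H r w) \<in> borel_measurable ?R"
    using measurable_compose[of "\<lambda>p. (fst p, snd p)" ?R _ "\<lambda>(r, w). H r w"] by simp
  moreover have "({0..t} \<times> UNIV) \<inter> space (borel \<Otimes>\<^sub>M M) \<in> sets (borel \<Otimes>\<^sub>M M)"
  proof -
    have "({0..t} \<times> UNIV) \<inter> space (borel \<Otimes>\<^sub>M M) = {0..t} \<times> space M" by (auto simp: space_pair_measure)
    then show ?thesis by simp
  qed
  ultimately have "(\<lambda>x. indicator ({0..t} \<times> UNIV) x *\<^sub>R (case x of (r, w) \<Rightarrow> H r w)) \<in> borel_measurable (borel \<Otimes>\<^sub>M M)"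
    by (subst (asm) borel_measurable_restrict_space_iff) auto
  moreover have "(\<lambda>x. indicator ({0..t} \<times> UNIV) x *\<^sub>R (case x of (r, w) \<Rightarrow> H r w)) = (\<lambda>(r, w). indicator {0..t} r *\<^sub>R H r w)"
    by (auto simp: indicator_def fun_eq_iff)
  ultimately show ?thesis by simp
qed

text \<open>On the ball of radius K the sum of products is Lipschitz with constant 2 c K, where c =
  \<open>CARD('k)\<close>, so the difference of the integrals is bounded by the integral of 2 c K |g
  - h|. The inequality x \<le> \<eta> + x^2 / \<eta> then trades this for the squared distance. The
  bounds are assumed for positive times only, time 0 being a null set.\<close>

lemma L2_products_tendsto:
  fixes g :: "nat \<Rightarrow> real \<Rightarrow> real^'k^'n" and h :: "real \<Rightarrow> real^'k^'n"
  assumes [measurable]: "\<And>m. (\<lambda>r. indicator {0..t} r *\<^sub>R g m r) \<in> borel_measurable borel"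
      "(\<lambda>r. indicator {0..t} r *\<^sub>R h r) \<in> borel_measurable borel"
    and K: "\<And>m r. r \<in> {0<..t} \<Longrightarrow> norm (g m r) \<le> K" "\<And>r. r \<in> {0<..t} \<Longrightarrow> norm (h r) \<le> K"
    and st: "0 \<le> s" "s \<le> t"
    and lim: "(\<lambda>m. \<integral>\<^sup>+ r\<in>{0..t}. ennreal ((norm (g m r - h r))\<^sup>2) \<partial>lborel) \<longlonglongrightarrow> 0"
  shows "(\<lambda>m. \<integral>r. indicator {s..t} r * (\<Sum>a\<in>UNIV. g m r $ i $ a * g m r $ i' $ a) \<partial>lborel) \<longlonglongrightarrow>
    (\<integral>r. indicator {s..t} r * (\<Sum>a\<in>UNIV. h r $ i $ a * h r $ i' $ a) \<partial>lborel)"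
proof (cases "0 < t")
  case False
  then have "s = t" using st by simp
  then have "AE r in lborel. r \<notin> {s..t}" using AE_lborel_singleton[of t] by simp
  then have z: "(\<integral>r. indicator {s..t} r * f r \<partial>lborel) = 0" for f :: "real \<Rightarrow> real"
    by (intro integral_eq_zero_AE) (auto simp: indicator_def elim: eventually_mono)
  show ?thesis unfolding z by simp
next
  case True
  have K0: "0 \<le> K" using order_trans[OF norm_ge_zero K(2)[of t]] True by auto
  let ?c = "real CARD('k)"
  define P where "P x = (\<Sum>a\<in>UNIV. x $ i $ a * x $ i' $ a)" for x :: "real^'k^'n"
  have P0: "P 0 = 0" by (simp add: P_def)
  have Pind: "indicator {s..t} r * P x = indicator {s..t} r * P (indicator {0..t} r *\<^sub>R x)" for r x
    using st by (auto simp: indicator_def)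
  have [measurable]: "P \<in> borel_measurable borel"
    unfolding P_def[abs_def] by (intro borel_measurable_continuous_onI continuous_intros)
  have gm: "(\<lambda>r. indicator {s..t} r * P (g m r)) \<in> borel_measurable borel" for m
    unfolding Pind[of _ "g m _"] by measurable
  have hm: "(\<lambda>r. indicator {s..t} r * P (h r)) \<in> borel_measurable borel"
    unfolding Pind[of _ "h _"] by measurable
  have Pb: "\<bar>P x\<bar> \<le> ?c * (K * K)" if "norm x \<le> K" for x
  proof -
    have "\<bar>P x\<bar> \<le> (\<Sum>a\<in>UNIV. \<bar>x $ i $ a * x $ i' $ a\<bar>)" unfolding P_def by (rule sum_abs)
    also have "\<dots> \<le> (\<Sum>a\<in>(UNIV::'k set). K * K)"
      by (intro sum_mono abs_mult_le) (use abs_entry_le_norm[of x] that order_trans in blast)+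
    finally show ?thesis by simp
  qed
  have Pd: "\<bar>P x - P y\<bar> \<le> 2 * ?c * K * norm (x - y)" if "norm x \<le> K" "norm y \<le> K" for x y
  proof -
    have "\<bar>P x - P y\<bar> = \<bar>\<Sum>a\<in>UNIV. x $ i $ a * (x - y) $ i' $ a + (x - y) $ i $ a * y $ i' $ a\<bar>"
      unfolding P_def sum_subtractf[symmetric] by (simp add: algebra_simps)
    also have "\<dots> \<le> (\<Sum>a\<in>UNIV. \<bar>x $ i $ a * (x - y) $ i' $ a + (x - y) $ i $ a * y $ i' $ a\<bar>)" by (rule sum_abs)
    also have "\<dots> \<le> (\<Sum>a\<in>(UNIV::'k set). K * norm (x - y) + norm (x - y) * K)"
    proof (intro sum_mono order_trans[OF abs_triangle_ineq] add_mono abs_mult_le)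
      show "\<bar>x $ i $ a\<bar> \<le> K" "\<bar>y $ i' $ a\<bar> \<le> K" for a using abs_entry_le_norm[of x i a] abs_entry_le_norm[of y i' a] that by auto
    qed (rule abs_entry_le_norm)+
    also have "\<dots> = 2 * ?c * K * norm (x - y)" by (simp add: algebra_simps)
    finally show ?thesis .
  qed
  have bi: "integrable lborel (\<lambda>r. indicator {s..t} r * (?c * (K * K)))"
    by (intro integrable_mult_left integrable_real_indicator) (auto simp: emeasure_lborel_Icc_eq)
  have AE0: "AE r in lborel. r \<noteq> (0::real)" by (rule AE_lborel_singleton)
  have ig: "integrable lborel (\<lambda>r. indicator {s..t} r * P (g m r))" for m
  proof (rule Bochner_Integration.integrable_bound[OF bi])
    show "AE r in lborel. norm (indicator {s..t} r * P (g m r)) \<le> norm (indicator {s..t} r * (?c * (K * K)))"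
      using AE0 by eventually_elim (use Pb[OF K(1)] st K0 in \<open>auto simp: indicator_def\<close>)
  qed (use gm in simp)
  have ih: "integrable lborel (\<lambda>r. indicator {s..t} r * P (h r))"
  proof (rule Bochner_Integration.integrable_bound[OF bi])
    show "AE r in lborel. norm (indicator {s..t} r * P (h r)) \<le> norm (indicator {s..t} r * (?c * (K * K)))"
      using AE0 by eventually_elim (use Pb[OF K(2)] st K0 in \<open>auto simp: indicator_def\<close>)
  qed (use hm in simp)
  let ?E = "\<lambda>m. \<integral>\<^sup>+ r\<in>{0..t}. ennreal ((norm (g m r - h r))\<^sup>2) \<partial>lborel"
  let ?D = "\<lambda>m. (\<integral>r. indicator {s..t} r * P (g m r) \<partial>lborel) - (\<integral>r. indicator {s..t} r * P (h r) \<partial>lborel)"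
  have key: "ennreal \<bar>?D m\<bar> \<le> ennreal (2 * ?c * K * \<eta> * t) + ennreal (2 * ?c * K / \<eta>) * ?E m" if eta: "\<eta> > 0" for m \<eta>
  proof -
    have c12: "0 \<le> 2 * ?c * K * \<eta>" "0 \<le> 2 * ?c * K / \<eta>" using K0 eta by simp_all
    have "ennreal \<bar>?D m\<bar> = ennreal (norm (\<integral>r. indicator {s..t} r * P (g m r) - indicator {s..t} r * P (h r) \<partial>lborel))"
      using ig ih by simp
    also have "\<dots> \<le> (\<integral>\<^sup>+ r. ennreal (norm (indicator {s..t} r * P (g m r) - indicator {s..t} r * P (h r))) \<partial>lborel)"
      using ig[of m] ih by (intro integral_norm_bound_ennreal) auto
    also have "\<dots> \<le> (\<integral>\<^sup>+ r. ennreal (2 * ?c * K * \<eta>) * indicator {0..t} r + ennreal (2 * ?c * K / \<eta>) * (ennreal ((norm (g m r - h r))\<^sup>2) * indicator {0..t} r) \<partial>lborel)"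
    proof (rule nn_integral_mono_AE, use AE0 in eventually_elim)
      case (elim r)
      show ?case
      proof (cases "r \<in> {s..t}")
        case True
        then have r: "r \<in> {0<..t}" using st elim by auto
        let ?x = "norm (g m r - h r)"
        have "?x \<le> \<eta> + ?x\<^sup>2 / \<eta>"
        proof (cases "?x \<le> \<eta>")
          case True then show ?thesis using eta by (simp add: add_increasing2)
        next
          case False
          then have "?x * \<eta> \<le> ?x * ?x" by (intro mult_left_mono) auto
          then have "?x \<le> ?x\<^sup>2 / \<eta>" using eta by (simp add: field_simps power2_eq_square)
          then show ?thesis using eta by simp
        qed
        then have "2 * ?c * K * ?x \<le> 2 * ?c * K * (\<eta> + ?x\<^sup>2 / \<eta>)" using K0 by (intro mult_left_mono) auto
        then have "\<bar>P (g m r) - P (h r)\<bar> \<le> 2 * ?c * K * \<eta> + 2 * ?c * K / \<eta> * ?x\<^sup>2"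
          using Pd[OF K(1)[OF r, of m] K(2)[OF r]] by (simp add: algebra_simps)
        then have "ennreal \<bar>P (g m r) - P (h r)\<bar> \<le> ennreal (2 * ?c * K * \<eta> + 2 * ?c * K / \<eta> * ?x\<^sup>2)"
          by (rule ennreal_leI)
        also have "\<dots> = ennreal (2 * ?c * K * \<eta>) + ennreal (2 * ?c * K / \<eta>) * ennreal (?x\<^sup>2)"
          by (simp only: ennreal_plus[OF c12(1) mult_nonneg_nonneg[OF c12(2) zero_le_power2]] ennreal_mult[OF c12(2) zero_le_power2])
        finally show ?thesis using True r by (simp add: indicator_def)
      qed simp
    qed
    also have "\<dots> = ennreal (2 * ?c * K * \<eta>) * ennreal t + ennreal (2 * ?c * K / \<eta>) * ?E m"
    proof -
      have e: "ennreal ((norm (g m r - h r))\<^sup>2) * indicator {0..t} r =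
        ennreal ((norm (indicator {0..t} r *\<^sub>R g m r - indicator {0..t} r *\<^sub>R h r))\<^sup>2)" for r
        by (auto simp: indicator_def)
      have [measurable]: "(\<lambda>r. ennreal ((norm (g m r - h r))\<^sup>2) * indicator {0..t} r) \<in> borel_measurable lborel"
        unfolding e by measurable
      show ?thesis using True by (subst nn_integral_add) (auto simp: nn_integral_cmult nn_integral_cmult_indicator)
    qed
    finally show ?thesis using K0 eta True by (simp add: ennreal_mult[symmetric])
  qed
  have "(\<lambda>m. ?D m) \<longlonglongrightarrow> 0"
  proof (rule LIMSEQ_I)
    fix e :: real assume e: "e > 0"
    \<comment> \<open>Makes 2 c K \<eta> t smaller than e / 2; the summand 1 covers K = 0.\<close>
    define \<eta> where "\<eta> = e / (2 * (2 * ?c * K * t + 1))"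
    have "2 * ?c * K * t + 1 > 0" using K0 True by (simp add: add_nonneg_pos)
    then have eta: "\<eta> > 0" "2 * ?c * K * \<eta> * t < e / 2 + 0"
      using e by (auto simp: \<eta>_def field_simps)
    have "(\<lambda>m. ennreal (2 * ?c * K / \<eta>) * ?E m) \<longlonglongrightarrow> ennreal (2 * ?c * K / \<eta>) * 0"
      by (intro ennreal_tendsto_cmult lim) simp
    then have "\<forall>\<^sub>F m in sequentially. ennreal (2 * ?c * K / \<eta>) * ?E m < ennreal (e / 2)"
      using e by (intro order_tendstoD(2)) auto
    then obtain m0 where m0: "\<And>m. m \<ge> m0 \<Longrightarrow> ennreal (2 * ?c * K / \<eta>) * ?E m < ennreal (e / 2)"
      by (auto simp: eventually_sequentially)
    have "\<bar>?D m\<bar> < e" if "m \<ge> m0" for m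
    proof -
      have "ennreal \<bar>?D m\<bar> \<le> ennreal (2 * ?c * K * \<eta> * t) + ennreal (2 * ?c * K / \<eta>) * ?E m" by (rule key[OF eta(1)])
      also have "\<dots> \<le> ennreal (2 * ?c * K * \<eta> * t) + ennreal (e / 2)" using m0[OF that] by (intro add_left_mono) auto
      also have "\<dots> = ennreal (2 * ?c * K * \<eta> * t + e / 2)" using e K0 eta True by (subst ennreal_plus) auto
      finally have "\<bar>?D m\<bar> \<le> 2 * ?c * K * \<eta> * t + e / 2"
        by (subst (asm) ennreal_le_iff) (use e K0 eta True in auto)
      then show ?thesis using eta by simp
    qed
    then show "\<exists>no. \<forall>m\<ge>no. norm (?D m - 0) < e" by (intro exI[of _ m0]) auto
  qed
  then show ?thesis by (simp add: LIM_zero_iff P_def)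
qed

end

section \<open>Approximation of the stopped integral by bounded step processes\<close>

definition simple_points :: "('a, 'b) simple_process \<Rightarrow> real set" where
  "simple_points S = fst (snd S) ` {..fst S}"

lemma simple_value_section [measurable]:
  fixes S :: "('a, 'b::{real_normed_vector, second_countable_topology}) simple_process"
  shows "(\<lambda>r. simple_value S r w) \<in> borel_measurable borel"
proof -
  obtain N p \<xi> where S: "S = (N, p, \<xi>)" by (cases S)
  show ?thesis unfolding S simple_value_def split by measurable
qed

text \<open>The projection to a ball is used to clip integrands. It does not increase the distance
  to any point of the ball, so clipping to a bound of the limit does not spoil an
  approximation.\<close>

lemma closest_point_cball:
  fixes x y :: "'b::euclidean_space"
  assumes "0 \<le> K"
  shows "norm (closest_point (cball 0 K) x) \<le> K"
    and "norm y \<le> K \<Longrightarrow> norm (closest_point (cball 0 K) x - y) \<le> norm (x - y)"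
    and "norm (closest_point (cball 0 K) x) \<le> norm x"
    and "norm (x - closest_point (cball 0 K) x) \<le> norm x"
    and "(closest_point (cball 0 K) :: 'b \<Rightarrow> 'b) \<in> borel_measurable borel"
proof -
  have ne: "cball (0::'b) K \<noteq> {}" using assms by simp
  note lip = closest_point_lipschitz[OF convex_cball closed_cball ne]
  show "norm (closest_point (cball 0 K) x) \<le> K"
    using closest_point_in_set[OF closed_cball ne, of x] by (simp add: dist_norm)
  have lipy: "norm (closest_point (cball 0 K) x - y) \<le> norm (x - y)" if "norm y \<le> K" for y
    using lip[of x y] closest_point_self[of y "cball 0 K"] that by (simp add: dist_norm)
  then show "norm y \<le> K \<Longrightarrow> norm (closest_point (cball 0 K) x - y) \<le> norm (x - y)" .
  show "norm (closest_point (cball 0 K) x) \<le> norm x" using lipy[of 0] assms by simp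
  show "norm (x - closest_point (cball 0 K) x) \<le> norm x"
    using closest_point_le[OF closed_cball, of 0 0 K x] assms by (simp add: dist_norm)
  show "closest_point (cball (0::'b) K) \<in> borel_measurable borel"
    by (intro borel_measurable_continuous_onI continuous_on_closest_point) (use assms in auto)
qed

context wiener begin

lemma simple_points:
  assumes "is_simple_process M F (S :: ('a, real^'k^'n) simple_process)"
  shows "finite (simple_points S)" "simple_points S \<subseteq> {0..}"
proof -
  obtain N p \<xi> where S: "S = (N, p, \<xi>)" by (cases S)
  have "grid N p" using assms by (auto simp: S is_simple_process_def grid_def)
  then show "finite (simple_points S)" "simple_points S \<subseteq> {0..}"
    using grid_nonneg by (auto simp: S simple_points_def)
qed

lemma simple_process_adapted_step:
  assumes "is_simple_process M F (S :: ('a, real^'k^'n) simple_process)"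
    and "finite Q" "0 \<in> Q" "Q \<subseteq> {0..}" "simple_points S \<subseteq> Q"
  shows "adapted_step Q (simple_value S)" "simple_integral W S t w = step_int Q (simple_value S) t w"
  using assms simple_process_step[of "fst S" "fst (snd S)" "snd (snd S)" Q]
  by (auto simp: simple_points_def)

lemma simple_integral_measurable:
  assumes S: "is_simple_process M F (S :: ('a, real^'k^'n) simple_process)" and r: "0 \<le> r"
  shows "simple_integral W S r \<in> borel_measurable M"
proof -
  let ?Q = "insert 0 (insert r (simple_points S))"
  have Q: "finite ?Q" "0 \<in> ?Q" "?Q \<subseteq> {0..}" "simple_points S \<subseteq> ?Q" using simple_points[OF S] r by auto
  have "step_int ?Q (simple_value S) r \<in> borel_measurable M"
    using simple_process_adapted_step(1)[OF S Q] by (rule step_int_measurable) simp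
  moreover have "step_int ?Q (simple_value S) r = simple_integral W S r"
    by (rule ext) (simp only: simple_process_adapted_step(2)[OF S Q])
  ultimately show ?thesis by simp
qed

lemma progressively_measurable_section:
  fixes H :: "real \<Rightarrow> 'a \<Rightarrow> 'b::real_normed_vector"
  assumes H: "progressively_measurable F H" and t: "0 \<le> t" and w: "w \<in> space M"
  shows "(\<lambda>r. indicator {0..t} r *\<^sub>R H r w) \<in> borel_measurable borel"
  using measurable_compose[OF measurable_Pair2'[OF w] progressively_measurable_joint[OF H t]] by simp

lemma energy_section:
  fixes H :: "real \<Rightarrow> 'a \<Rightarrow> real^'k^'n"
  assumes H: "progressively_measurable F H" and t: "0 \<le> r" "r \<le> t" and w: "w \<in> space M"
  shows "(\<lambda>u. indicator {0..r} u * (norm (simple_value S u w - H u w))\<^sup>2) \<in> borel_measurable borel"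
    "(\<lambda>u. indicator {0..r} u * (norm (H u w))\<^sup>2) \<in> borel_measurable borel"
proof -
  have [measurable]: "(\<lambda>u. indicator {0..r} u *\<^sub>R H u w) \<in> borel_measurable borel"
    using progressively_measurable_section[OF H _ w] t by simp
  have e: "indicator {0..r} u * (norm (simple_value S u w - H u w))\<^sup>2 =
      (norm (indicator {0..r} u *\<^sub>R simple_value S u w - indicator {0..r} u *\<^sub>R H u w))\<^sup>2"
    "indicator {0..r} u * (norm (H u w))\<^sup>2 = (norm (indicator {0..r} u *\<^sub>R H u w))\<^sup>2" for u
    by (auto simp: indicator_def)
  show "(\<lambda>u. indicator {0..r} u * (norm (simple_value S u w - H u w))\<^sup>2) \<in> borel_measurable borel"
    "(\<lambda>u. indicator {0..r} u * (norm (H u w))\<^sup>2) \<in> borel_measurable borel"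
    unfolding e by measurable
qed

lemma energy_mono: "r \<le> t \<Longrightarrow> (\<integral>\<^sup>+ s\<in>{0..r}. ennreal (f s) \<partial>lborel) \<le> (\<integral>\<^sup>+ s\<in>{0..t}. ennreal (f s) \<partial>lborel)" for r t :: real
  by (rule nn_integral_mono) (auto simp: indicator_def)

text \<open>The approximating sequence in the definition of the integral depends on the end point, but any
  sequence that works for \<open>t\<close> works for every earlier time.\<close>

lemma ito_approx_earlier:
  fixes H :: "real \<Rightarrow> 'a \<Rightarrow> real^'k^'n"
  assumes ito: "is_ito_integral M F W H I" and S: "\<And>m. is_simple_process M F (S m)"
    and vS: "vanishes_in_probability M (\<lambda>m w. \<integral>\<^sup>+ s\<in>{0..t}. ennreal ((norm (simple_value (S m) s w - H s w))\<^sup>2) \<partial>lborel)"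
    and r: "0 \<le> r" "r \<le> t"
  shows "vanishes_in_probability M (\<lambda>m w. ennreal (norm (simple_integral W (S m) r w - I r w)))"
proof -
  have H: "progressively_measurable F H" using ito by (auto simp: is_ito_integral_def)
  obtain S' where S': "\<And>m. is_simple_process M F (S' m)"
    and vS': "vanishes_in_probability M (\<lambda>m w. \<integral>\<^sup>+ s\<in>{0..r}. ennreal ((norm (simple_value (S' m) s w - H s w))\<^sup>2) \<partial>lborel)"
    and vI: "vanishes_in_probability M (\<lambda>m w. ennreal (norm (simple_integral W (S' m) r w - I r w)))"
    using ito r(1) unfolding is_ito_integral_def by blast
  \<comment> \<open>A common grid for both approximating sequences. Both are close to
    \<open>H\<close> in energy up to r, so their difference has vanishing energy and its integral
    vanishes by \<open>step_int_vanishes\<close>.\<close>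
  define Q where "Q m = insert 0 (insert r (simple_points (S m) \<union> simple_points (S' m)))" for m
  have Q: "finite (Q m)" "0 \<in> Q m" "Q m \<subseteq> {0..}" "simple_points (S m) \<subseteq> Q m" "simple_points (S' m) \<subseteq> Q m" "r \<in> Q m" for m
    using simple_points[OF S[of m]] simple_points[OF S'[of m]] r by (auto simp: Q_def)
  note st = simple_process_adapted_step[OF S Q(1-4)] and st' = simple_process_adapted_step[OF S' Q(1-3,5)]
  define D where "D m s w = simple_value (S m) s w - simple_value (S' m) s w" for m s w
  have D: "adapted_step (Q m) (D m)" for m
    unfolding D_def[abs_def] by (rule adapted_step_diff[OF st(1) st'(1)])
  have vD: "vanishes_in_probability M (\<lambda>m w. ennreal (norm (step_int (Q m) (D m) r w)))"
  proof (rule step_int_vanishes[OF D Q(6)])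
    show "vanishes_in_probability M (\<lambda>m w. \<integral>\<^sup>+ s\<in>{0..r}. ennreal ((norm (D m s w))\<^sup>2) \<partial>lborel)"
    \<comment> \<open>\<open>num.Bit0 num.One\<close> is the numeral 2, the factor in
      \<open>norm_sq_diff_le_two\<close>.\<close>
    proof (rule vanishes_mono[OF vanishes_add[OF vanishes_numeral_mult[OF vS, of "num.Bit0 num.One"] vanishes_numeral_mult[OF vS', of "num.Bit0 num.One"]]])
      show "AE w in M. (\<integral>\<^sup>+ s\<in>{0..r}. ennreal ((norm (D m s w))\<^sup>2) \<partial>lborel) \<le>
        2 * (\<integral>\<^sup>+ s\<in>{0..t}. ennreal ((norm (simple_value (S m) s w - H s w))\<^sup>2) \<partial>lborel) +
        2 * (\<integral>\<^sup>+ s\<in>{0..r}. ennreal ((norm (simple_value (S' m) s w - H s w))\<^sup>2) \<partial>lborel)" for m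
      proof (rule AE_I2)
        fix w assume w: "w \<in> space M"
        have "(\<integral>\<^sup>+ s\<in>{0..r}. ennreal ((norm (D m s w))\<^sup>2) \<partial>lborel) \<le>
          2 * (\<integral>\<^sup>+ s\<in>{0..r}. ennreal ((norm (simple_value (S m) s w - H s w))\<^sup>2) \<partial>lborel) +
          2 * (\<integral>\<^sup>+ s\<in>{0..r}. ennreal ((norm (simple_value (S' m) s w - H s w))\<^sup>2) \<partial>lborel)"
          unfolding D_def using energy_section(1)[OF H r w]
          by (intro nn_integral_le_combination) (auto intro: norm_sq_diff_le_two)
        also have "\<dots> \<le> 2 * (\<integral>\<^sup>+ s\<in>{0..t}. ennreal ((norm (simple_value (S m) s w - H s w))\<^sup>2) \<partial>lborel) +
          2 * (\<integral>\<^sup>+ s\<in>{0..r}. ennreal ((norm (simple_value (S' m) s w - H s w))\<^sup>2) \<partial>lborel)"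
          by (intro add_right_mono mult_left_mono energy_mono r) auto
        finally show "(\<integral>\<^sup>+ s\<in>{0..r}. ennreal ((norm (D m s w))\<^sup>2) \<partial>lborel) \<le> \<dots>" .
      qed
    qed (rule step_energy_measurable[OF D Q(6)])
  qed
  have [measurable]: "I r \<in> borel_measurable M"
    using ito r unfolding is_ito_integral_def by (blast intro: measurable_filtration)
  note [measurable] = simple_integral_measurable[OF S r(1)]
  show ?thesis
  proof (rule vanishes_mono[OF vanishes_add[OF vD vI]])
    show "AE w in M. ennreal (norm (simple_integral W (S m) r w - I r w)) \<le>
      ennreal (norm (step_int (Q m) (D m) r w)) + ennreal (norm (simple_integral W (S' m) r w - I r w))" for m
    proof (rule AE_I2)
      fix w
      have "step_int (Q m) (D m) r w = simple_integral W (S m) r w - simple_integral W (S' m) r w"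
        unfolding D_def[abs_def] step_int_diff st(2) st'(2) ..
      then have "norm (simple_integral W (S m) r w - I r w) \<le> norm (step_int (Q m) (D m) r w) + norm (simple_integral W (S' m) r w - I r w)"
        using norm_triangle_ineq[of "simple_integral W (S m) r w - simple_integral W (S' m) r w" "simple_integral W (S' m) r w - I r w"] by simp
      then show "ennreal (norm (simple_integral W (S m) r w - I r w)) \<le>
        ennreal (norm (step_int (Q m) (D m) r w)) + ennreal (norm (simple_integral W (S' m) r w - I r w))"
        by (simp add: ennreal_plus[symmetric] ennreal_leI del: ennreal_plus)
    qed
  qed measurable
qed

lemma stopping_time_measurable:
  fixes \<rho> :: "'a \<Rightarrow> real" assumes "stopping_time F \<rho>" shows "\<rho> \<in> borel_measurable M"
  unfolding borel_measurable_iff_le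
proof
  fix a
  have "{w \<in> space M. \<rho> w \<le> a} \<in> sets (F a)"
    using stopping_timeD[OF assms, of a] unfolding pred_def space_filtration .
  then show "{w \<in> space M. \<rho> w \<le> a} \<in> sets M" using sets_filtration_subset by blast
qed

text \<open>\<open>\<rho>\<close> is rounded up to a grid of width \<open>h N\<close>, which keeps the cut-off integrands adapted step processes.
  Between \<open>\<rho>\<close> and its rounding the integrand need not be bounded; \<open>late\<close> is the indicator of this
  interval (and of the time 0, where no bound is assumed either), and its contribution \<open>E N\<close>
  tends to 0.\<close>

lemma ito_stopped_approx:
  fixes H :: "real \<Rightarrow> 'a \<Rightarrow> real^'k^'n"
  assumes ito: "is_ito_integral M F W H I" and t: "0 < t" and s: "0 \<le> s" "s \<le> t"
    and \<rho>: "stopping_time F \<rho>" and \<rho>b: "\<And>w. w \<in> space M \<Longrightarrow> 0 \<le> \<rho> w \<and> \<rho> w \<le> t"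
    and K: "0 \<le> K" "\<And>w r. w \<in> space M \<Longrightarrow> 0 < r \<Longrightarrow> r \<le> \<rho> w \<Longrightarrow> norm (H r w) \<le> K"
  obtains Q :: "nat \<Rightarrow> real set" and G :: "nat \<Rightarrow> real \<Rightarrow> 'a \<Rightarrow> real^'k^'n" where
    "\<And>m. adapted_step (Q m) (G m)" "\<And>m. s \<in> Q m" "\<And>m. t \<in> Q m" "\<And>m r w. norm (G m r w) \<le> K"
    "AE w in M. (\<lambda>m. step_int (Q m) (G m) t w) \<longlonglongrightarrow> I (min t (\<rho> w)) w"
    "AE w in M. (\<lambda>m. step_int (Q m) (G m) s w) \<longlonglongrightarrow> I (min s (\<rho> w)) w"
    "AE w in M. (\<lambda>m. \<integral>\<^sup>+ r\<in>{0..t}. ennreal ((norm (G m r w - (if r \<le> \<rho> w then H r w else 0)))\<^sup>2) \<partial>lborel) \<longlonglongrightarrow> 0"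
proof -
  have H: "progressively_measurable F H" using ito by (auto simp: is_ito_integral_def)
  have L2: "AE w in M. \<forall>t\<ge>0. (\<integral>\<^sup>+ s\<in>{0..t}. ennreal ((norm (H s w))\<^sup>2) \<partial>lborel) < \<infinity>"
    and Icont: "AE w in M. continuous_on {0..} (\<lambda>t. I t w)"
    and Im: "\<And>r. 0 \<le> r \<Longrightarrow> I r \<in> borel_measurable (F r)"
    using ito unfolding is_ito_integral_def by blast+
  have Im'[measurable]: "I r \<in> borel_measurable M" if "0 \<le> r" for r using Im[OF that] by (rule measurable_filtration)
  obtain S where S: "\<And>m. is_simple_process M F (S m)"
    and vS: "vanishes_in_probability M (\<lambda>m w. \<integral>\<^sup>+ s\<in>{0..t}. ennreal ((norm (simple_value (S m) s w - H s w))\<^sup>2) \<partial>lborel)"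
    using ito t unfolding is_ito_integral_def by (meson less_imp_le)
  have \<rho>M[measurable]: "\<rho> \<in> borel_measurable M" using \<rho> by (rule stopping_time_measurable)
  define h where "h N = t / Suc N" for N
  have h: "h N > 0" "h N * real (Suc N) = t" for N using t by (auto simp: h_def)
  define R where "R N w = h N * \<lceil>\<rho> w / h N\<rceil>" for N w
  define J where "J N m r w = simple_integral W (S m) (min r (R N w)) w - I (min r (R N w)) w" for N m r w
  \<comment> \<open>For fixed N the rounded time takes only the values h i with i \<le> N + 1. The
    error at the random time is therefore at most the sum of the errors at these fixed times, each
    of which vanishes by \<open>ito_approx_earlier\<close>.\<close>
  have vJ: "vanishes_in_probability M (\<lambda>m w. ennreal (norm (J N m r w)))" if r: "0 \<le> r" "r \<le> t" for N r
  proof -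
    define d where "d m i w = norm (simple_integral W (S m) (min r (h N * real i)) w - I (min r (h N * real i)) w)" for m i w
    have pos: "0 \<le> min r (h N * real i)" for i using r h[of N] by simp
    have v: "vanishes_in_probability M (\<lambda>m w. ennreal (d m i w))" for i
      unfolding d_def using r pos by (intro ito_approx_earlier[OF ito S vS]) auto
    have [measurable]: "d m i \<in> borel_measurable M" for m i
      unfolding d_def[abs_def] using simple_integral_measurable[OF S pos] Im'[OF pos] by measurable
    have ex: "\<exists>i\<le>Suc N. \<lceil>\<rho> w / h N\<rceil> = int i \<and> R N w = h N * real i" if w: "w \<in> space M" for w
    proof -
      have "R N w \<in> (\<lambda>i. h N * real i) ` {..Suc N}"
        unfolding R_def using \<rho>b[OF w] h[of N] by (intro ceiling_grid) auto
      then obtain i where "i \<le> Suc N" "R N w = h N * real i" by auto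
      then show ?thesis using h(1)[of N] unfolding R_def by (intro exI[of _ i]) simp
    qed
    have J: "norm (J N m r w) = (\<Sum>i\<le>Suc N. if \<lceil>\<rho> w / h N\<rceil> = int i then d m i w else 0)" if w: "w \<in> space M" for m w
    proof -
      obtain i where i: "i \<le> Suc N" "\<lceil>\<rho> w / h N\<rceil> = int i" "R N w = h N * real i" using ex[OF w] by blast
      have "(\<Sum>j\<le>Suc N. if \<lceil>\<rho> w / h N\<rceil> = int j then d m j w else 0) = (\<Sum>j\<le>Suc N. if j = i then d m j w else 0)"
        unfolding i by (intro sum.cong) auto
      also have "\<dots> = d m i w" using i(1) by simp
      finally show ?thesis unfolding J_def d_def i(3) by simp
    qed
    have "(\<lambda>w. ennreal (norm (J N m r w))) \<in> borel_measurable M \<longleftrightarrow>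
        (\<lambda>w. ennreal (\<Sum>i\<le>Suc N. if \<lceil>\<rho> w / h N\<rceil> = int i then d m i w else 0)) \<in> borel_measurable M" for m
      using J by (intro measurable_cong) simp
    then have Jm: "(\<lambda>w. ennreal (norm (J N m r w))) \<in> borel_measurable M" for m by simp
    show ?thesis
    proof (rule vanishes_mono[OF vanishes_sum[of "{..Suc N}" "\<lambda>i m w. ennreal (d m i w)"] Jm])
      show "AE w in M. ennreal (norm (J N m r w)) \<le> (\<Sum>i\<le>Suc N. ennreal (d m i w))" for m
      proof (rule AE_I2)
        fix w assume w: "w \<in> space M"
        have "norm (J N m r w) \<le> (\<Sum>i\<le>Suc N. d m i w)"
          unfolding J[OF w] by (intro sum_mono) (auto simp: d_def)
        then show "ennreal (norm (J N m r w)) \<le> (\<Sum>i\<le>Suc N. ennreal (d m i w))"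
          by (subst sum_ennreal) (auto simp: d_def intro: ennreal_leI)
      qed
    qed (use v in auto)
  qed
  let ?e = "\<lambda>m w. \<integral>\<^sup>+ s\<in>{0..t}. ennreal ((norm (simple_value (S m) s w - H s w))\<^sup>2) \<partial>lborel"
  \<comment> \<open>The mesh must shrink while the simple processes improve. As the errors vanish
    for each fixed N, the diagonal choice \<open>m N\<close> makes all three small together.\<close>
  obtain m where m: "vanishes_in_probability M (\<lambda>N w. ?e (m N) w + (ennreal (norm (J N (m N) t w)) + ennreal (norm (J N (m N) s w))))"
    by (rule vanishes_diagonal[of "\<lambda>N k w. ?e k w + (ennreal (norm (J N k t w)) + ennreal (norm (J N k s w)))"])
      (use vS vJ s t in \<open>auto intro!: vanishes_add\<close>)
  define late where "late N r w = (if r = 0 \<or> \<rho> w < r \<and> h N * (real_of_int \<lceil>r / h N\<rceil> - 1) < \<rho> w then 1 else 0 :: real)" for N r w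
  define E where "E N w = (\<integral>\<^sup>+ r\<in>{0..t}. ennreal (late N r w * (norm (H r w))\<^sup>2) \<partial>lborel)" for N w
  have Hj[measurable]: "(\<lambda>(w, r). indicator {0..t} r *\<^sub>R H r w) \<in> borel_measurable (M \<Otimes>\<^sub>M borel)"
    using measurable_pair_swap[OF progressively_measurable_joint[OF H, of t]] t by simp
  have latem[measurable]: "(\<lambda>(w, r). late N r w) \<in> borel_measurable (M \<Otimes>\<^sub>M borel)" for N
    unfolding late_def by measurable
  have Em: "E N \<in> borel_measurable M" for N
  proof -
    have "E N = (\<lambda>w. \<integral>\<^sup>+ r. ennreal (late N r w * (norm (indicator {0..t} r *\<^sub>R H r w))\<^sup>2) \<partial>lborel)"
      unfolding E_def by (intro ext nn_integral_cong) (auto simp: indicator_def)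
    also have "\<dots> \<in> borel_measurable M" by measurable
    finally show ?thesis .
  qed
  \<comment> \<open>Dominated convergence along each path, with the integrable energy of
    \<open>H\<close> as majorant: a time r after \<rho> leaves the window as soon as
    \<open>h N\<close> is smaller than its distance to \<rho>.\<close>
  have E0: "AE w in M. (\<lambda>N. E N w) \<longlonglongrightarrow> 0"
    using L2 AE_space
  proof eventually_elim
    case (elim w)
    note es = energy_section[OF H less_imp_le[OF t] order_refl elim(2)]
    have ind: "ennreal (k r) * indicator {0..t} r = ennreal (indicator {0..t} r * k r)" for k :: "real \<Rightarrow> real" and r
      by (auto simp: indicator_def)
    have lates[measurable]: "(\<lambda>r. late N r w) \<in> borel_measurable borel" for N unfolding late_def by measurable
    have "(\<lambda>N. \<integral>\<^sup>+ r. ennreal (late N r w * (norm (H r w))\<^sup>2) * indicator {0..t} r \<partial>lborel) \<longlonglongrightarrow> (\<integral>\<^sup>+ r. 0 \<partial>(lborel :: real measure))"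
    proof (rule nn_integral_dominated_convergence[where w="\<lambda>r. ennreal ((norm (H r w))\<^sup>2) * indicator {0..t} r"])
      show "(\<lambda>r. ennreal (late N r w * (norm (H r w))\<^sup>2) * indicator {0..t} r) \<in> borel_measurable lborel" for N
      proof -
        have "ennreal (late N r w * (norm (H r w))\<^sup>2) * indicator {0..t} r = ennreal (late N r w * (indicator {0..t} r * (norm (H r w))\<^sup>2))" for r
          by (auto simp: indicator_def)
        then show ?thesis using es(2) by simp
      qed
      show "(\<lambda>r. ennreal ((norm (H r w))\<^sup>2) * indicator {0..t} r) \<in> borel_measurable lborel"
        unfolding ind[of "\<lambda>r. (norm (H r w))\<^sup>2"] using es(2) by simp
      show "(\<integral>\<^sup>+ r. ennreal ((norm (H r w))\<^sup>2) * indicator {0..t} r \<partial>lborel) < \<infinity>" using elim t by auto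
      show "AE r in lborel. ennreal (late N r w * (norm (H r w))\<^sup>2) * indicator {0..t} r \<le> ennreal ((norm (H r w))\<^sup>2) * indicator {0..t} r" for N
        by (intro always_eventually allI) (auto simp: late_def indicator_def)
      show "AE r in lborel. (\<lambda>N. ennreal (late N r w * (norm (H r w))\<^sup>2) * indicator {0..t} r) \<longlonglongrightarrow> 0"
        using AE_lborel_singleton[of 0]
      proof eventually_elim
        case (elim r)
        have "\<forall>\<^sub>F N in sequentially. late N r w = 0"
        proof (cases "r \<le> \<rho> w")
          case True then show ?thesis using elim by (simp add: late_def)
        next
          case False
          have "(\<lambda>N. t * inverse (real (Suc N))) \<longlonglongrightarrow> t * 0"
            by (intro tendsto_mult_left LIMSEQ_inverse_real_of_nat)
          then have "\<forall>\<^sub>F N in sequentially. t * inverse (real (Suc N)) < r - \<rho> w"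
            using False by (intro order_tendstoD(2)) auto
          then show ?thesis
          proof eventually_elim
            case (elim N)
            have "r - h N \<le> h N * (real_of_int \<lceil>r / h N\<rceil> - 1)"
              using ceiling_ge[OF h(1), of r N] by (simp add: algebra_simps)
            moreover have "h N < r - \<rho> w" using elim by (simp add: h_def divide_inverse)
            ultimately show ?case using \<open>r \<noteq> 0\<close> by (auto simp: late_def)
          qed
        qed
        then have "\<forall>\<^sub>F N in sequentially. ennreal (late N r w * (norm (H r w))\<^sup>2) * indicator {0..t} r = 0"
          by eventually_elim simp
        then show ?case by (rule tendsto_eventually)
      qed
    qed simp
    then show ?case unfolding E_def by simp
  qed
  define T where "T = (closest_point (cball 0 K) :: real^'k^'n \<Rightarrow> real^'k^'n)"
  note T = closest_point_cball[OF K(1), where 'b="real^'k^'n", folded T_def]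
  have T0: "T 0 = 0" using T(3)[of 0] by simp
  define A where "A N r w = (if h N * (real_of_int \<lceil>r / h N\<rceil> - 1) < \<rho> w then simple_value (S (m N)) r w else 0)" for N r w
  define G where "G N r w = T (A N r w)" for N r w
  \<comment> \<open>The integral of \<open>A\<close> is a simple integral at the rounded time and
    hence close to \<open>I\<close> there, while the moment bounds need the clipped
    \<open>G\<close>. The integral of the clipping error \<open>D\<close> has to vanish.\<close>
  define D where "D N r w = A N r w - G N r w" for N r w
  define Q where "Q N = {0, s} \<union> (\<lambda>i. h N * real i) ` {..Suc N} \<union> simple_points (S (m N))" for N
  have Q: "finite (Q N)" "0 \<in> Q N" "Q N \<subseteq> {0..}" "simple_points (S (m N)) \<subseteq> Q N" "s \<in> Q N" for N
    using simple_points[OF S[of "m N"]] s h(1)[of N] by (auto simp: Q_def)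
  have Qh: "(\<lambda>i. h N * real i) ` {..Suc N} \<subseteq> Q N" for N by (auto simp: Q_def)
  have tQ: "t \<in> Q N" for N
    using Qh[of N] h(2)[of N] by (metis atMost_iff image_subset_iff order_refl)
  note st = simple_process_adapted_step[OF S Q(1-4)]
  have A: "adapted_step (Q N) (A N)" for N
    unfolding A_def[abs_def] using \<rho>b h(2)[of N] by (intro adapted_step_stop[OF st(1) h(1) Qh \<rho>]) auto
  have G: "adapted_step (Q N) (G N)" for N
    unfolding G_def[abs_def] by (rule adapted_step_comp[OF A T(5,1)])
  have D: "adapted_step (Q N) (D N)" for N
    unfolding D_def[abs_def] by (rule adapted_step_diff[OF A G])
  have RQ: "R N w \<in> Q N" if "w \<in> space M" for N w
  proof -
    have "R N w \<in> (\<lambda>i. h N * real i) ` {..Suc N}"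
      unfolding R_def using \<rho>b[OF that] h[of N] by (intro ceiling_grid) auto
    then show ?thesis using Qh by auto
  qed
  have intA: "step_int (Q N) (A N) r w = simple_integral W (S (m N)) (min r (R N w)) w" if w: "w \<in> space M" for N r w
    unfolding A_def[abs_def] st(2) R_def using RQ[OF w, of N] unfolding R_def by (intro step_int_stop Q h)
  define B where "B N w = 4 * ?e (m N) w + 2 * E N w" for N w
  \<comment> \<open>Up to \<rho> the target is bounded by K, so clipping moves no further from it.
    In the window after \<rho> only |x|^2 \<le> 2 |x - y|^2 + 2 |y|^2 is available, which brings in
    the energy of \<open>H\<close>. Later both processes are 0. The factors 4 and 2 cover all
    cases.\<close>
  have pw: "(norm (D N r w))\<^sup>2 \<le> 4 * (norm (simple_value (S (m N)) r w - H r w))\<^sup>2 + 2 * (late N r w * (norm (H r w))\<^sup>2) \<and>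
      (norm (G N r w - (if r \<le> \<rho> w then H r w else 0)))\<^sup>2 \<le> 4 * (norm (simple_value (S (m N)) r w - H r w))\<^sup>2 + 2 * (late N r w * (norm (H r w))\<^sup>2)"
    if w: "w \<in> space M" and r: "0 < r" for N r w
  proof -
    let ?x = "simple_value (S (m N)) r w" and ?y = "H r w" and ?l = "h N * (real_of_int \<lceil>r / h N\<rceil> - 1)"
    have nn: "0 \<le> late N r w * (norm (H r w))\<^sup>2" by (simp add: late_def)
    consider "r \<le> \<rho> w" | "\<rho> w < r" "?l < \<rho> w" | "\<rho> w < r" "\<not> ?l < \<rho> w" by linarith
    then show ?thesis
    proof cases
      case 1
      have "?l < r" using ceiling_cell_less_iff[OF h(1), of N r r] ceiling_ge[OF h(1), of r N] by simp
      then have Ax: "A N r w = ?x" using 1 by (simp add: A_def)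
      have Tx: "norm (T ?x - ?y) \<le> norm (?x - ?y)" by (rule T(2)[OF K(2)[OF w r 1]])
      then have 2: "(norm (T ?x - ?y))\<^sup>2 \<le> (norm (?x - ?y))\<^sup>2" by (intro power_mono) auto
      have 3: "(norm (?x - T ?x))\<^sup>2 \<le> 2 * (norm (?x - ?y))\<^sup>2 + 2 * (norm (T ?x - ?y))\<^sup>2"
        by (rule norm_sq_diff_le_two)
      show ?thesis unfolding D_def G_def Ax if_P[OF 1]
        using 2 3 nn zero_le_power2[of "norm (?x - ?y)"] by (intro conjI; linarith)
    next
      case 2
      then have Ax: "A N r w = ?x" and ch: "late N r w = 1" by (simp_all add: A_def late_def)
      have "(norm ?x)\<^sup>2 \<le> 2 * (norm (?x - ?y))\<^sup>2 + 2 * (norm ?y)\<^sup>2"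
        using norm_sq_le_two[of "?x - ?y" ?y] by simp
      moreover have "(norm (?x - T ?x))\<^sup>2 \<le> (norm ?x)\<^sup>2" "(norm (T ?x))\<^sup>2 \<le> (norm ?x)\<^sup>2"
        using T(3,4)[of ?x] by (auto intro: power_mono)
      moreover have "\<not> r \<le> \<rho> w" using 2 by simp
      ultimately show ?thesis unfolding D_def G_def Ax ch
        using zero_le_power2[of "norm (?x - ?y)"] by (simp only: if_False diff_0_right mult_1) linarith
    next
      case 3
      then have "A N r w = 0" by (simp add: A_def)
      then show ?thesis using 3 nn by (simp add: D_def G_def T0)
    qed
  qed
  have AEpos: "AE r in lborel. r \<in> {0..t} \<longrightarrow> 0 < r"
    using AE_lborel_singleton[of "0::real"] by eventually_elim auto
  have comb: "(\<integral>\<^sup>+ r\<in>{0..t}. ennreal (f r) \<partial>lborel) \<le> B N w"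
    if w: "w \<in> space M" and f: "\<And>r. 0 < r \<Longrightarrow> f r \<le> 4 * (norm (simple_value (S (m N)) r w - H r w))\<^sup>2 + 2 * (late N r w * (norm (H r w))\<^sup>2)"
    for f N w
    unfolding B_def E_def
  proof (rule nn_integral_le_combination)
    note es = energy_section[OF H less_imp_le[OF t] order_refl w]
    show "(\<lambda>r. indicator {0..t} r * (norm (simple_value (S (m N)) r w - H r w))\<^sup>2) \<in> borel_measurable borel" by (rule es)
    have [measurable]: "(\<lambda>r. late N r w) \<in> borel_measurable borel" unfolding late_def by measurable
    have "(\<lambda>r. late N r w * (indicator {0..t} r * (norm (H r w))\<^sup>2)) \<in> borel_measurable borel"
      using es(2) by measurable
    then show "(\<lambda>r. indicator {0..t} r * (late N r w * (norm (H r w))\<^sup>2)) \<in> borel_measurable borel"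
      by (simp add: mult.left_commute)
    show "AE r in lborel. r \<in> {0..t} \<longrightarrow> f r \<le> 4 * (norm (simple_value (S (m N)) r w - H r w))\<^sup>2 + 2 * (late N r w * (norm (H r w))\<^sup>2)"
      using AEpos by eventually_elim (auto intro: f)
  qed (auto simp: late_def)
  have vE: "vanishes_in_probability M E" by (rule vanishes_AE[OF Em E0])
  have ve: "vanishes_in_probability M (\<lambda>N. ?e (m N))"
    by (rule vanishes_mono[OF m]) (use vanishes_measurable[OF vS] in auto)
  have vB: "vanishes_in_probability M B"
    unfolding B_def[abs_def] by (intro vanishes_add vanishes_numeral_mult ve vE)
  have vD: "vanishes_in_probability M (\<lambda>N w. ennreal (norm (step_int (Q N) (D N) r w)))" if r: "r \<in> {s, t}" for r
  proof (rule step_int_vanishes[OF D])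
    show rQ: "r \<in> Q N" for N using r Q tQ by auto
    show "vanishes_in_probability M (\<lambda>N w. \<integral>\<^sup>+ u\<in>{0..r}. ennreal ((norm (D N u w))\<^sup>2) \<partial>lborel)"
    proof (rule vanishes_mono[OF vB step_energy_measurable[OF D rQ]])
      show "AE w in M. (\<integral>\<^sup>+ u\<in>{0..r}. ennreal ((norm (D N u w))\<^sup>2) \<partial>lborel) \<le> B N w" for N
      proof (rule AE_I2)
        fix w assume w: "w \<in> space M"
        show "(\<integral>\<^sup>+ u\<in>{0..r}. ennreal ((norm (D N u w))\<^sup>2) \<partial>lborel) \<le> B N w"
          using r s by (intro order_trans[OF energy_mono comb[OF w]]) (use pw[OF w] in auto)
      qed
    qed
  qed
  \<comment> \<open>All errors are added before a subsequence is extracted, so that a single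
    subsequence serves s, t and the energy.\<close>
  have "vanishes_in_probability M (\<lambda>N w. (?e (m N) w + (ennreal (norm (J N (m N) t w)) + ennreal (norm (J N (m N) s w)))) +
     (ennreal (norm (step_int (Q N) (D N) t w)) + ennreal (norm (step_int (Q N) (D N) s w)) + B N w))"
    by (intro vanishes_add m vD vB) auto
  then obtain \<kappa> :: "nat \<Rightarrow> nat" where \<kappa>: "strict_mono \<kappa>" and
    lim: "AE w in M. (\<lambda>k. (?e (m (\<kappa> k)) w + (ennreal (norm (J (\<kappa> k) (m (\<kappa> k)) t w)) + ennreal (norm (J (\<kappa> k) (m (\<kappa> k)) s w)))) +
     (ennreal (norm (step_int (Q (\<kappa> k)) (D (\<kappa> k)) t w)) + ennreal (norm (step_int (Q (\<kappa> k)) (D (\<kappa> k)) s w)) + B (\<kappa> k) w)) \<longlonglongrightarrow> 0"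
    by (rule vanishes_imp_AE_subseq)
  \<comment> \<open>Clipped integral = \<open>I\<close> at the rounded time + \<open>J\<close> -
    integral of \<open>D\<close>. The last two vanish, and the rounded time decreases its distance
    to \<rho> below the mesh, so continuity of \<open>I\<close> gives the limit.\<close>
  have conv: "AE w in M. (\<lambda>k. step_int (Q (\<kappa> k)) (G (\<kappa> k)) r w) \<longlonglongrightarrow> I (min r (\<rho> w)) w" if r: "r \<in> {s, t}" for r
    using lim Icont AE_space
  proof eventually_elim
    case (elim w)
    let ?n = "\<lambda>k. norm (J (\<kappa> k) (m (\<kappa> k)) r w) + norm (step_int (Q (\<kappa> k)) (D (\<kappa> k)) r w)"
    have "(\<lambda>k. ennreal (?n k)) \<longlonglongrightarrow> 0"
    proof (rule tendsto_sandwich[OF _ _ tendsto_const[of 0] elim(1)])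
      have mono: "a \<le> c + (a + b) + (d + e' + f)" "b \<le> c + (a + b) + (d + e' + f)"
        "a + d \<le> c + (a + b) + (d + e' + f)" "b + e' \<le> c + (a + b) + (d + e' + f)" for a b c d e' f :: ennreal
        by (simp_all add: add_ac add_increasing add_increasing2 add_left_mono)
      show "\<forall>\<^sub>F k in sequentially. ennreal (?n k) \<le> ?e (m (\<kappa> k)) w + (ennreal (norm (J (\<kappa> k) (m (\<kappa> k)) t w)) + ennreal (norm (J (\<kappa> k) (m (\<kappa> k)) s w))) +
     (ennreal (norm (step_int (Q (\<kappa> k)) (D (\<kappa> k)) t w)) + ennreal (norm (step_int (Q (\<kappa> k)) (D (\<kappa> k)) s w)) + B (\<kappa> k) w)"
        using r mono(3,4) by (intro always_eventually allI) auto
    qed simp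
    then have n0: "?n \<longlonglongrightarrow> 0"
      using tendsto_ennrealD[of ?n 0] by (simp add: add_nonneg_nonneg)
    have le: "norm (step_int (Q (\<kappa> k)) (G (\<kappa> k)) r w - I (min r (R (\<kappa> k) w)) w) \<le> ?n k" for k
    proof -
      have "step_int (Q (\<kappa> k)) (D (\<kappa> k)) r w = step_int (Q (\<kappa> k)) (A (\<kappa> k)) r w - step_int (Q (\<kappa> k)) (G (\<kappa> k)) r w"
        unfolding D_def[abs_def] by (rule step_int_diff)
      then have "step_int (Q (\<kappa> k)) (G (\<kappa> k)) r w - I (min r (R (\<kappa> k) w)) w = J (\<kappa> k) (m (\<kappa> k)) r w - step_int (Q (\<kappa> k)) (D (\<kappa> k)) r w"
        unfolding J_def intA[OF elim(3)] by simp
      then show ?thesis using norm_triangle_ineq4 by metis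
    qed
    have 1: "(\<lambda>k. step_int (Q (\<kappa> k)) (G (\<kappa> k)) r w - I (min r (R (\<kappa> k) w)) w) \<longlonglongrightarrow> 0"
      by (rule Lim_null_comparison[OF _ n0]) (use le in auto)
    have Rb: "\<rho> w \<le> R N w" "R N w \<le> \<rho> w + t * inverse (real (Suc N))" for N
    proof -
      show "\<rho> w \<le> R N w" unfolding R_def by (rule ceiling_ge[OF h(1)])
      have "h N * \<lceil>\<rho> w / h N\<rceil> \<le> h N * (\<rho> w / h N + 1)" using h(1)[of N] by (intro mult_left_mono) linarith+
      also have "\<dots> = \<rho> w + h N" using h(1)[of N] by (simp add: distrib_left)
      finally show "R N w \<le> \<rho> w + t * inverse (real (Suc N))" by (simp add: R_def h_def divide_inverse)
    qed
    have "(\<lambda>N. R N w) \<longlonglongrightarrow> \<rho> w"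
    proof (rule tendsto_sandwich[OF _ _ tendsto_const])
      show "(\<lambda>N. \<rho> w + t * inverse (real (Suc N))) \<longlonglongrightarrow> \<rho> w"
        using tendsto_add[OF tendsto_const[of "\<rho> w"] tendsto_mult_left[OF LIMSEQ_inverse_real_of_nat, of t]] by simp
    qed (use Rb in auto)
    then have "(\<lambda>k. R (\<kappa> k) w) \<longlonglongrightarrow> \<rho> w" using LIMSEQ_subseq_LIMSEQ[OF _ \<kappa>] by (fastforce simp: comp_def)
    then have "(\<lambda>k. min r (R (\<kappa> k) w)) \<longlonglongrightarrow> min r (\<rho> w)" by (intro tendsto_min tendsto_const)
    then have 2: "(\<lambda>k. I (min r (R (\<kappa> k) w)) w) \<longlonglongrightarrow> I (min r (\<rho> w)) w"
    proof (rule continuous_on_tendsto_compose[OF elim(2)])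
      show "min r (\<rho> w) \<in> {0..}" using r s t \<rho>b[OF elim(3)] by auto
      show "\<forall>\<^sub>F k in sequentially. min r (R (\<kappa> k) w) \<in> {0..}"
        using r s t \<rho>b[OF elim(3)] Rb(1) by (intro always_eventually allI) (auto intro: order_trans)
    qed
    show ?case using tendsto_add[OF 1 2] by simp
  qed
  have convE: "AE w in M. (\<lambda>k. \<integral>\<^sup>+ r\<in>{0..t}. ennreal ((norm (G (\<kappa> k) r w - (if r \<le> \<rho> w then H r w else 0)))\<^sup>2) \<partial>lborel) \<longlonglongrightarrow> 0"
    using lim AE_space
  proof eventually_elim
    case (elim w)
    show ?case
    proof (rule tendsto_sandwich[OF _ _ tendsto_const[of 0] elim(1)])
      have mono: "f \<le> c + (d + f)" for c d f :: ennreal by (simp add: add_increasing)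
      show "\<forall>\<^sub>F k in sequentially. (\<integral>\<^sup>+ r\<in>{0..t}. ennreal ((norm (G (\<kappa> k) r w - (if r \<le> \<rho> w then H r w else 0)))\<^sup>2) \<partial>lborel) \<le>
        ?e (m (\<kappa> k)) w + (ennreal (norm (J (\<kappa> k) (m (\<kappa> k)) t w)) + ennreal (norm (J (\<kappa> k) (m (\<kappa> k)) s w))) +
     (ennreal (norm (step_int (Q (\<kappa> k)) (D (\<kappa> k)) t w)) + ennreal (norm (step_int (Q (\<kappa> k)) (D (\<kappa> k)) s w)) + B (\<kappa> k) w)"
      proof (intro always_eventually allI order_trans[OF comb[OF elim(2)] mono])
        fix k r assume "0 < (r::real)"
        then show "(norm (G (\<kappa> k) r w - (if r \<le> \<rho> w then H r w else 0)))\<^sup>2 \<le> 4 * (norm (simple_value (S (m (\<kappa> k))) r w - H r w))\<^sup>2 + 2 * (late (\<kappa> k) r w * (norm (H r w))\<^sup>2)"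
          using pw[OF elim(2)] by blast
      qed
    qed simp
  qed
  show thesis
    by (rule that[of "\<lambda>k. Q (\<kappa> k)" "\<lambda>k. G (\<kappa> k)"]) (use G Q(5) tQ T(1) conv convE in \<open>auto simp: G_def\<close>)
qed

end

section \<open>Moments of the increments of the stopped integral\<close>

context wiener begin

lemma step_int_moments:
  fixes A :: "real \<Rightarrow> 'a \<Rightarrow> real^'k^'n"
  assumes A: "adapted_step Q A" and K: "\<And>r w. norm (A r w) \<le> K" and Q: "s \<in> Q" "t \<in> Q" and st: "s \<le> t"
    and Z: "Z \<in> borel_measurable (F s)" and L: "\<And>w. w \<in> space M \<Longrightarrow> \<bar>Z w\<bar> \<le> L"
  defines "d \<equiv> \<lambda>i w. (step_int Q A t w - step_int Q A s w) $ i"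
    and "c \<equiv> \<lambda>i i' w. \<integral>r. indicator {s..t} r * (\<Sum>a\<in>UNIV. A r w $ i $ a * A r w $ i' $ a) \<partial>lborel"
  shows "d i \<in> borel_measurable M" "c i i' \<in> borel_measurable M"
    "integrable M (\<lambda>w. d i w ^ 4)"
    "expectation (\<lambda>w. d i w ^ 4) \<le> 3 * real CARD('k) ^ 4 * K ^ 4 * (t - s)\<^sup>2"
    "expectation (\<lambda>w. Z w * d i w) = 0"
    "expectation (\<lambda>w. Z w * (d i w * d i' w)) = expectation (\<lambda>w. Z w * c i i' w)"
proof -
  note AD = adapted_stepD[OF A]
  obtain m n where m: "m < card Q" "grid_point Q m = s" and n: "n < card Q" "grid_point Q n = t"
    using grid_point_ex[OF AD(1)] Q by metis
  have mn: "m \<le> n" using grid_point_less[OF AD(1), of n m] m n st by (cases "m \<le> n") auto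
  have nN: "n \<le> card Q - 1" using n by auto
  let ?A = "\<lambda>j. A (grid_point Q (Suc j))"
  let ?V = "vec_int (grid_point Q) ?A m n"
  have d: "d i w = ?V w $ i" for i w
  proof -
    have "step_int Q A t w - step_int Q A s w = ?V w"
      unfolding m(2)[symmetric] n(2)[symmetric] step_int_grid_point[OF AD(1) m(1)] step_int_grid_point[OF AD(1) n(1)]
      unfolding vec_int_def using mn by (simp add: sum_diff_nat_ivl)
    then show ?thesis by (simp only: d_def)
  qed
  have c: "c i i' w = (\<Sum>j\<in>{m..<n}. (\<Sum>a\<in>UNIV. ?A j w $ i $ a * ?A j w $ i' $ a) * (grid_point Q (Suc j) - grid_point Q j))"
    if "w \<in> space M" for i i' w
    unfolding c_def m(2)[symmetric] n(2)[symmetric]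
    by (rule has_bochner_integral_integral_eq[OF step_energy[OF A mn n(1) that, of "\<lambda>x. \<Sum>a\<in>UNIV. x $ i $ a * x $ i' $ a"]])
  have Am[measurable]: "?A j \<in> borel_measurable M" if "j < n" for j
    using AD(5) that n by (intro measurable_filtration[of _ "grid_point Q j"]) (auto simp: adapted_def)
  have "c i i' \<in> borel_measurable M \<longleftrightarrow>
    (\<lambda>w. \<Sum>j\<in>{m..<n}. (\<Sum>a\<in>UNIV. ?A j w $ i $ a * ?A j w $ i' $ a) * (grid_point Q (Suc j) - grid_point Q j)) \<in> borel_measurable M"
    by (rule measurable_cong) (rule c)
  then show "c i i' \<in> borel_measurable M" by simp
  show "d i \<in> borel_measurable M"
    unfolding d[abs_def] using vec_int_measurable[OF AD(4,5) K mn nN] by (rule measurable_filtration)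
  show "integrable M (\<lambda>w. d i w ^ 4)" "expectation (\<lambda>w. d i w ^ 4) \<le> 3 * real CARD('k) ^ 4 * K ^ 4 * (t - s)\<^sup>2"
    unfolding d using vec_int_fourth_moment[OF AD(4,5) K mn nN, of i] unfolding m n by auto
  have Z': "Z \<in> borel_measurable (F (grid_point Q m))" using Z m by simp
  note mc = vec_int_mean_cov[OF AD(4,5) K mn nN Z' L]
  show "expectation (\<lambda>w. Z w * d i w) = 0" unfolding d by (rule mc(1))
  have "expectation (\<lambda>w. Z w * (d i w * d i' w)) =
    expectation (\<lambda>w. Z w * (\<Sum>j\<in>{m..<n}. (\<Sum>a\<in>UNIV. ?A j w $ i $ a * ?A j w $ i' $ a) * (grid_point Q (Suc j) - grid_point Q j)))"
    unfolding d by (rule mc(2))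
  also have "\<dots> = expectation (\<lambda>w. Z w * c i i' w)"
    by (rule Bochner_Integration.integral_cong) (simp_all add: c)
  finally show "expectation (\<lambda>w. Z w * (d i w * d i' w)) = expectation (\<lambda>w. Z w * c i i' w)" .
qed

text \<open>The fourth moment bound survives the limit by Fatou. It also bounds the second moments
  of \<open>Z\<close> times one increment and of \<open>Z\<close> times a product of two, so the
  mean and the covariance converge by uniform integrability; the integrated products of entries
  converge boundedly. \<open>Jt\<close> and \<open>Js\<close> are measurable versions of the
  integral at the stopped times, where measurability of \<open>I\<close> itself is not at
  hand.\<close>

lemma ito_stopped_moments:
  fixes H :: "real \<Rightarrow> 'a \<Rightarrow> real^'k^'n" and Jt Js :: "'a \<Rightarrow> real^'n"
  assumes ito: "is_ito_integral M F W H I" and t: "0 < t" and s: "0 \<le> s" "s \<le> t"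
    and \<rho>: "stopping_time F \<rho>" and \<rho>0: "\<And>w. w \<in> space M \<Longrightarrow> 0 \<le> \<rho> w"
    and K: "0 \<le> K" "\<And>w r. w \<in> space M \<Longrightarrow> 0 < r \<Longrightarrow> r \<le> \<rho> w \<Longrightarrow> norm (H r w) \<le> K"
    and J[measurable]: "Jt \<in> borel_measurable M" "Js \<in> borel_measurable M"
    and JI: "AE w in M. Jt w = I (min t (\<rho> w)) w" "AE w in M. Js w = I (min s (\<rho> w)) w"
    and Z: "Z \<in> borel_measurable (F s)" and L: "\<And>w. w \<in> space M \<Longrightarrow> \<bar>Z w\<bar> \<le> L"
  shows "integrable M (\<lambda>w. ((Jt w - Js w) $ i) ^ 4)"
    "expectation (\<lambda>w. ((Jt w - Js w) $ i) ^ 4) \<le> 3 * real CARD('k) ^ 4 * K ^ 4 * (t - s)\<^sup>2"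
    "expectation (\<lambda>w. Z w * (Jt w - Js w) $ i) = 0"
    "expectation (\<lambda>w. Z w * ((Jt w - Js w) $ i * (Jt w - Js w) $ i')) =
      expectation (\<lambda>w. Z w * (\<integral>r. indicator {s..t} r *
        (\<Sum>a\<in>UNIV. (if r \<le> \<rho> w then H r w else 0) $ i $ a * (if r \<le> \<rho> w then H r w else 0) $ i' $ a) \<partial>lborel))"
proof -
  \<comment> \<open>The approximation requires a stopping time bounded by t; the cap changes neither
    \<open>min t (\<rho> w)\<close> nor \<open>min s (\<rho> w)\<close>.\<close>
  define \<rho>' where "\<rho>' w = min (\<rho> w) t" for w
  have \<rho>': "stopping_time F \<rho>'" unfolding \<rho>'_def by (intro stopping_time_min \<rho> stopping_time_const)
  have \<rho>'b: "0 \<le> \<rho>' w \<and> \<rho>' w \<le> t" if "w \<in> space M" for w using \<rho>0[OF that] t by (simp add: \<rho>'_def)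
  have mins: "min t (\<rho>' w) = min t (\<rho> w)" "min s (\<rho>' w) = min s (\<rho> w)" for w
    using s by (auto simp: \<rho>'_def)
  have K': "norm (H r w) \<le> K" if "w \<in> space M" "0 < r" "r \<le> \<rho>' w" for w r
    using K(2)[OF that(1,2)] that by (simp add: \<rho>'_def)
  obtain Q :: "nat \<Rightarrow> real set" and G :: "nat \<Rightarrow> real \<Rightarrow> 'a \<Rightarrow> real^'k^'n" where
    G: "\<And>m. adapted_step (Q m) (G m)" and Q: "\<And>m. s \<in> Q m" "\<And>m. t \<in> Q m" and GK: "\<And>m r w. norm (G m r w) \<le> K"
    and limt: "AE w in M. (\<lambda>m. step_int (Q m) (G m) t w) \<longlonglongrightarrow> I (min t (\<rho>' w)) w"
    and lims: "AE w in M. (\<lambda>m. step_int (Q m) (G m) s w) \<longlonglongrightarrow> I (min s (\<rho>' w)) w"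
    and limE: "AE w in M. (\<lambda>m. \<integral>\<^sup>+ r\<in>{0..t}. ennreal ((norm (G m r w - (if r \<le> \<rho>' w then H r w else 0)))\<^sup>2) \<partial>lborel) \<longlonglongrightarrow> 0"
    by (rule ito_stopped_approx[OF ito t s \<rho>' \<rho>'b K(1) K']) blast+
  define d where "d m i w = (step_int (Q m) (G m) t w - step_int (Q m) (G m) s w) $ i" for m i w
  define e where "e i w = (Jt w - Js w) $ i" for i w
  define c where "c m i i' w = (\<integral>r. indicator {s..t} r * (\<Sum>a\<in>UNIV. G m r w $ i $ a * G m r w $ i' $ a) \<partial>lborel)" for m i i' w
  define H' where "H' r w = (if r \<le> \<rho> w then H r w else 0)" for r w
  define c' where "c' i i' w = (\<integral>r. indicator {s..t} r * (\<Sum>a\<in>UNIV. H' r w $ i $ a * H' r w $ i' $ a) \<partial>lborel)" for i i' w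
  note sm = step_int_moments[OF G GK Q s(2) Z L, folded d_def c_def]
  note [measurable] = sm(1)
  have s5: "expectation (\<lambda>w. Z w * d m i w) = 0" for m i by (rule sm(5)) auto
  have s6: "expectation (\<lambda>w. Z w * (d m i w * d m i' w)) = expectation (\<lambda>w. Z w * c m i i' w)" for m i i'
    by (rule sm(6)) auto
  let ?C = "3 * real CARD('k) ^ 4 * K ^ 4 * (t - s)\<^sup>2"
  have ZM[measurable]: "Z \<in> borel_measurable M" using Z by (rule measurable_filtration)
  have em[measurable]: "e i \<in> borel_measurable M" for i unfolding e_def[abs_def] by measurable
  have lim: "AE w in M. (\<lambda>m. d m i w) \<longlonglongrightarrow> e i w" for i
    using limt lims JI
    by eventually_elim (auto simp: d_def e_def mins intro!: tendsto_vec_nth tendsto_diff)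
  have lim4: "AE w in M. (\<lambda>m. d m i w ^ 4) \<longlonglongrightarrow> e i w ^ 4" for i
    using lim[of i] by eventually_elim (intro tendsto_power)
  show "integrable M (\<lambda>w. ((Jt w - Js w) $ i) ^ 4)"
    "expectation (\<lambda>w. ((Jt w - Js w) $ i) ^ 4) \<le> ?C"
    unfolding e_def[symmetric]
    by (rule fatou_bounded_expectation[OF _ sm(3) _ lim4 sm(4)]; simp)+
  have L2: "(Z w)\<^sup>2 \<le> L\<^sup>2" if "w \<in> space M" for w
    using L[OF that] power_mono[of "\<bar>Z w\<bar>" L 2] by simp
  have i2: "integrable M (\<lambda>w. (Z w * d m i w)\<^sup>2)" "expectation (\<lambda>w. (Z w * d m i w)\<^sup>2) \<le> L\<^sup>2 * (1 + ?C)" for m i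
  proof -
    have b: "(Z w * d m i w)\<^sup>2 \<le> L\<^sup>2 * (1 + d m i w ^ 4)" if "w \<in> space M" for w
      using power_le_1_plus_power4[of 2 "d m i w"] L2[OF that] unfolding power_mult_distrib by (intro mult_mono) auto
    have i: "integrable M (\<lambda>w. L\<^sup>2 * (1 + d m i w ^ 4))" using sm(3) by simp
    show 1: "integrable M (\<lambda>w. (Z w * d m i w)\<^sup>2)"
      by (rule Bochner_Integration.integrable_bound[OF i]) (use b in \<open>auto intro!: AE_I2 order_trans[OF _ abs_ge_self]\<close>)
    have "expectation (\<lambda>w. (Z w * d m i w)\<^sup>2) \<le> expectation (\<lambda>w. L\<^sup>2 * (1 + d m i w ^ 4))"
      by (intro integral_mono 1 i b)
    also have "\<dots> = L\<^sup>2 * (1 + expectation (\<lambda>w. d m i w ^ 4))" using sm(3) by (simp add: prob_space)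
    also have "\<dots> \<le> L\<^sup>2 * (1 + ?C)" using sm(4) by (intro mult_left_mono) auto
    finally show "expectation (\<lambda>w. (Z w * d m i w)\<^sup>2) \<le> L\<^sup>2 * (1 + ?C)" .
  qed
  have "(\<lambda>m. expectation (\<lambda>w. Z w * d m i w)) \<longlonglongrightarrow> expectation (\<lambda>w. Z w * e i w)"
  proof (rule integral_tendsto_of_bounded_second_moment(3)[OF _ _ _ i2])
    show "AE w in M. (\<lambda>m. Z w * d m i w) \<longlonglongrightarrow> Z w * e i w"
      using lim[of i] by eventually_elim (intro tendsto_mult_left)
  qed measurable
  then have "(\<lambda>m. 0) \<longlonglongrightarrow> expectation (\<lambda>w. Z w * e i w)" unfolding s5 .
  then show "expectation (\<lambda>w. Z w * (Jt w - Js w) $ i) = 0"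
    unfolding e_def[symmetric] by (simp add: LIMSEQ_const_iff)
  have i3: "integrable M (\<lambda>w. (Z w * (d m i w * d m i' w))\<^sup>2)" "expectation (\<lambda>w. (Z w * (d m i w * d m i' w))\<^sup>2) \<le> L\<^sup>2 * (?C + ?C)" for m
  proof -
    have b: "(Z w * (d m i w * d m i' w))\<^sup>2 \<le> L\<^sup>2 * (d m i w ^ 4 + d m i' w ^ 4)" if "w \<in> space M" for w
    proof -
      have "(x * y)\<^sup>2 \<le> x ^ 4 + y ^ 4" for x y :: real
      proof -
        have "0 \<le> x\<^sup>2 * y\<^sup>2" by simp
        moreover have "2 * x\<^sup>2 * y\<^sup>2 \<le> x ^ 4 + y ^ 4" using sum_squares_bound[of "x\<^sup>2" "y\<^sup>2"] by simp
        ultimately show ?thesis unfolding power_mult_distrib by linarith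
      qed
      then show ?thesis using L2[OF that] unfolding power_mult_distrib[of "Z w"] by (intro mult_mono) auto
    qed
    have i: "integrable M (\<lambda>w. L\<^sup>2 * (d m i w ^ 4 + d m i' w ^ 4))" using sm(3) by simp
    show 1: "integrable M (\<lambda>w. (Z w * (d m i w * d m i' w))\<^sup>2)"
      by (rule Bochner_Integration.integrable_bound[OF i]) (use b in \<open>auto intro!: AE_I2 order_trans[OF _ abs_ge_self]\<close>)
    have "expectation (\<lambda>w. (Z w * (d m i w * d m i' w))\<^sup>2) \<le> expectation (\<lambda>w. L\<^sup>2 * (d m i w ^ 4 + d m i' w ^ 4))"
      by (intro integral_mono 1 i b)
    also have "\<dots> = L\<^sup>2 * (expectation (\<lambda>w. d m i w ^ 4) + expectation (\<lambda>w. d m i' w ^ 4))" using sm(3) by simp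
    also have "\<dots> \<le> L\<^sup>2 * (?C + ?C)" using sm(4) by (intro mult_left_mono add_mono) auto
    finally show "expectation (\<lambda>w. (Z w * (d m i w * d m i' w))\<^sup>2) \<le> L\<^sup>2 * (?C + ?C)" .
  qed
  have 1: "(\<lambda>m. expectation (\<lambda>w. Z w * (d m i w * d m i' w))) \<longlonglongrightarrow> expectation (\<lambda>w. Z w * (e i w * e i' w))"
  proof (rule integral_tendsto_of_bounded_second_moment(3)[OF _ _ _ i3])
    show "AE w in M. (\<lambda>m. Z w * (d m i w * d m i' w)) \<longlonglongrightarrow> Z w * (e i w * e i' w)"
      using lim[of i] lim[of i'] by eventually_elim (intro tendsto_mult_left tendsto_mult)
  qed measurable
  have H: "progressively_measurable F H" using ito by (auto simp: is_ito_integral_def)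
  note Hsec = progressively_measurable_section[OF H less_imp_le[OF t]]
  have limc: "AE w in M. (\<lambda>m. c m i i' w) \<longlonglongrightarrow> c' i i' w"
    using limE AE_space
  proof eventually_elim
    case (elim w)
    have H'b: "norm (H' r w) \<le> K" if "0 < r" for r using K(2)[OF elim(2) that] K(1) by (simp add: H'_def)
    have "(\<integral>\<^sup>+ r\<in>{0..t}. ennreal ((norm (G m r w - (if r \<le> \<rho>' w then H r w else 0)))\<^sup>2) \<partial>lborel) =
      (\<integral>\<^sup>+ r\<in>{0..t}. ennreal ((norm (G m r w - H' r w))\<^sup>2) \<partial>lborel)" for m
      by (rule nn_integral_cong) (auto simp: indicator_def H'_def \<rho>'_def)
    then have l: "(\<lambda>m. \<integral>\<^sup>+ r\<in>{0..t}. ennreal ((norm (G m r w - H' r w))\<^sup>2) \<partial>lborel) \<longlonglongrightarrow> 0"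
      using elim(1) by simp
    show ?case
      unfolding c_def c'_def
    proof (rule L2_products_tendsto[OF _ _ GK H'b s l])
      have [measurable]: "(\<lambda>r. indicator {0..t} r *\<^sub>R H r w) \<in> borel_measurable borel" by (rule Hsec[OF elim(2)])
      have "(\<lambda>r. indicator {0..t} r *\<^sub>R H' r w) = (\<lambda>r. if r \<le> \<rho> w then indicator {0..t} r *\<^sub>R H r w else 0)"
        by (auto simp: H'_def)
      then show "(\<lambda>r. indicator {0..t} r *\<^sub>R H' r w) \<in> borel_measurable borel" by simp
      fix m
      obtain n where n: "n < card (Q m)" "grid_point (Q m) n = t"
        using grid_point_ex[OF adapted_stepD(1)[OF G[of m]] Q(2)[of m]] by blast
      have "(\<lambda>r. indicator {0..t} r * (G m r w $ i $ a)) \<in> borel_measurable borel" for i a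
        using step_energy[OF G[of m] _ n(1) elim(2), of 0 "\<lambda>x. x $ i $ a"] n(2)
          grid_point_0[OF adapted_stepD(1-3)[OF G[of m]]]
        by (auto simp: has_bochner_integral_iff dest: borel_measurable_integrable)
      then show "(\<lambda>r. indicator {0..t} r *\<^sub>R G m r w) \<in> borel_measurable borel"
        by (intro borel_measurable_vec_component) simp
    qed auto
  qed
  have c'm[measurable]: "c' i i' \<in> borel_measurable M"
  proof -
    have [measurable]: "(\<lambda>(w, r). indicator {0..t} r *\<^sub>R H r w) \<in> borel_measurable (M \<Otimes>\<^sub>M borel)"
      using measurable_pair_swap[OF progressively_measurable_joint[OF H, of t]] t by simp
    have [measurable]: "\<rho> \<in> borel_measurable M" using \<rho> by (rule stopping_time_measurable)
    have e: "indicator {s..t} r * (\<Sum>a\<in>UNIV. H' r w $ i $ a * H' r w $ i' $ a) =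
      (if r \<le> \<rho> w then indicator {s..t} r * (\<Sum>a\<in>UNIV. (indicator {0..t} r *\<^sub>R H r w) $ i $ a * (indicator {0..t} r *\<^sub>R H r w) $ i' $ a) else 0)" for r w
      using s by (auto simp: H'_def indicator_def)
    show ?thesis unfolding c'_def[abs_def] e
      by (intro sigma_finite_measure.borel_measurable_lebesgue_integral sigma_finite_lborel) measurable
  qed
  have cb: "\<bar>c m i i' w\<bar> \<le> (t - s) * (real CARD('k) * (K * K))" for m w
  proof -
    have b: "\<bar>\<Sum>a\<in>UNIV. G m r w $ i $ a * G m r w $ i' $ a\<bar> \<le> real CARD('k) * (K * K)" for r
    proof -
      have "\<bar>\<Sum>a\<in>UNIV. G m r w $ i $ a * G m r w $ i' $ a\<bar> \<le> (\<Sum>a\<in>UNIV. \<bar>G m r w $ i $ a * G m r w $ i' $ a\<bar>)" by (rule sum_abs)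
      also have "\<dots> \<le> (\<Sum>a\<in>(UNIV::'k set). K * K)"
        by (intro sum_mono abs_mult_le) (use abs_entry_le_norm order_trans GK in blast)+
      finally show ?thesis by simp
    qed
    let ?B = "real CARD('k) * (K * K)"
    have "norm (c m i i' w) \<le> (\<integral>r. indicator {s..t} r * ?B \<partial>lborel)"
      unfolding c_def
    proof (rule order_trans[OF integral_norm_bound integral_mono_AE'])
      show "integrable lborel (\<lambda>r. indicator {s..t} r * ?B)"
        by (intro integrable_mult_left integrable_real_indicator) (auto simp: emeasure_lborel_Icc_eq)
      show "AE r in lborel. norm (indicator {s..t} r * (\<Sum>a\<in>UNIV. G m r w $ i $ a * G m r w $ i' $ a)) \<le> indicator {s..t} r * ?B"
        using b by (intro always_eventually allI) (auto simp: indicator_def)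
    qed auto
    also have "\<dots> = (t - s) * ?B" using s by simp
    finally show ?thesis by simp
  qed
  have 2: "(\<lambda>m. expectation (\<lambda>w. Z w * c m i i' w)) \<longlonglongrightarrow> expectation (\<lambda>w. Z w * c' i i' w)"
  proof (rule integral_dominated_convergence[where w="\<lambda>_. L * ((t - s) * (real CARD('k) * (K * K)))"])
    show "AE w in M. norm (Z w * c m i i' w) \<le> L * ((t - s) * (real CARD('k) * (K * K)))" for m
      using L cb by (intro AE_I2) (auto intro!: abs_mult_le)
    show "AE w in M. (\<lambda>m. Z w * c m i i' w) \<longlonglongrightarrow> Z w * c' i i' w"
      using limc by eventually_elim (intro tendsto_mult_left)
  qed (use sm(2) in auto)
  have "expectation (\<lambda>w. Z w * (e i w * e i' w)) = expectation (\<lambda>w. Z w * c' i i' w)"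
    using LIMSEQ_unique[OF 1[unfolded s6] 2] .
  then show "expectation (\<lambda>w. Z w * ((Jt w - Js w) $ i * (Jt w - Js w) $ i')) =
      expectation (\<lambda>w. Z w * (\<integral>r. indicator {s..t} r *
        (\<Sum>a\<in>UNIV. (if r \<le> \<rho> w then H r w else 0) $ i $ a * (if r \<le> \<rho> w then H r w else 0) $ i' $ a) \<partial>lborel))"
    unfolding e_def c'_def H'_def .
qed

end

subsection \<open>Taylor expansion of functions of class \<open>C\<^sup>1\<^sup>,\<^sup>2\<close>\<close>

text \<open>Points closer than some d are covered by uniform continuity. At distance at least d the
  crude bound 2 |B| equals C d^2 and is absorbed by the quadratic term. A quadratic modulus is
  chosen because its expectation is controlled by second moments.\<close>

lemma continuous_compact_modulus:
  fixes f :: "'b::metric_space \<Rightarrow> 'c::real_normed_vector"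
  assumes K: "compact K" and f: "continuous_on K f" and e: "\<epsilon> > 0"
  obtains C where "C \<ge> 0" "\<And>p q. p \<in> K \<Longrightarrow> q \<in> K \<Longrightarrow> norm (f p - f q) \<le> \<epsilon> + C * (dist p q)\<^sup>2"
proof -
  obtain d where d: "d > 0" "\<And>p q. p \<in> K \<Longrightarrow> q \<in> K \<Longrightarrow> dist q p < d \<Longrightarrow> dist (f q) (f p) < \<epsilon>"
    using compact_uniformly_continuous[OF f K] e unfolding uniformly_continuous_on_def by metis
  obtain B where B: "\<And>p. p \<in> K \<Longrightarrow> norm (f p) \<le> B"
    using compact_imp_bounded[OF compact_continuous_image[OF f K]] by (auto simp: bounded_iff)
  define C where "C = 2 * \<bar>B\<bar> / d\<^sup>2"
  have C: "C \<ge> 0" by (simp add: C_def)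
  have "norm (f p - f q) \<le> \<epsilon> + C * (dist p q)\<^sup>2" if pq: "p \<in> K" "q \<in> K" for p q
  proof (cases "dist p q < d")
    case True
    then have "norm (f p - f q) < \<epsilon>" using d(2)[OF pq(2,1)] by (simp add: dist_norm)
    then show ?thesis using C by (simp add: add_increasing2)
  next
    case False
    have "norm (f p - f q) \<le> norm (f p) + norm (f q)" by (rule norm_triangle_ineq4)
    also have "\<dots> \<le> 2 * \<bar>B\<bar>" using B[OF pq(1)] B[OF pq(2)] by linarith
    also have "\<dots> = C * d\<^sup>2" using d by (simp add: C_def)
    also have "\<dots> \<le> C * (dist p q)\<^sup>2" using False d C by (intro mult_left_mono power_mono) auto
    finally show ?thesis using e by simp
  qed
  with C show thesis by (rule that)
qed

lemma quadratic_form_le: "\<bar>x \<bullet> ((A :: real^'n^'n) *v y)\<bar> \<le> real CARD('n) ^ 2 * (norm A * norm x * norm y)"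
proof -
  have "x \<bullet> (A *v y) = (\<Sum>i\<in>UNIV. \<Sum>j\<in>UNIV. x $ i * (A $ i $ j * y $ j))"
    by (simp add: inner_vec_def matrix_vector_mult_def sum_distrib_left)
  also have "\<bar>\<dots>\<bar> \<le> (\<Sum>i\<in>(UNIV::'n set). \<Sum>j\<in>(UNIV::'n set). norm x * (norm A * norm y))"
    by (intro order_trans[OF sum_abs] sum_mono abs_mult_le component_le_norm_cart abs_entry_le_norm)
  finally show ?thesis by (simp add: power2_eq_square mult_ac)
qed

lemma quadratic_form_sum: "x \<bullet> ((A :: real^'n^'n) *v y) = (\<Sum>i\<in>UNIV. \<Sum>j\<in>UNIV. A $ i $ j * (x $ i * y $ j))"
  by (simp add: inner_vec_def matrix_vector_mult_def sum_distrib_left mult_ac)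

lemma space_grad_inner:
  assumes "v t differentiable (at x)"
  shows "frechet_derivative (v t) (at x) h = space_grad v t x \<bullet> h"
proof -
  have lin: "linear (frechet_derivative (v t) (at x))"
    using assms by (rule linear_frechet_derivative)
  have "frechet_derivative (v t) (at x) (\<Sum>i\<in>UNIV. h $ i *\<^sub>R axis i 1) = (\<Sum>i\<in>UNIV. h $ i * frechet_derivative (v t) (at x) (axis i 1))"
    by (simp add: linear_sum[OF lin] linear_scale[OF lin])
  moreover have "(\<Sum>i\<in>UNIV. h $ i *\<^sub>R axis i 1) = h"
    using basis_expansion[of h] by (simp add: scalar_mult_eq_scaleR)
  ultimately show ?thesis by (simp add: space_grad_def inner_vec_def mult.commute)
qed

text \<open>The one-dimensional Maclaurin formula of order 2 for \<open>v t\<close> restricted to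
  the segment from x to x + h; differentiating the gradient along the segment produces the
  Hessian.\<close>

lemma C12_space_taylor:
  fixes v :: "real \<Rightarrow> real^'n \<Rightarrow> real"
  assumes v: "class_C12 T v" and t: "t \<in> {0..T}"
  obtains \<theta> where "0 < \<theta>" "\<theta> < 1"
    "v t (x + h) = v t x + space_grad v t x \<bullet> h + 1/2 * (h \<bullet> (space_hessian v t (x + \<theta> *\<^sub>R h) *v h))"
proof -
  define \<phi> where "\<phi> \<theta> = v t (x + \<theta> *\<^sub>R h)" for \<theta>
  define \<phi>1 where "\<phi>1 \<theta> = space_grad v t (x + \<theta> *\<^sub>R h) \<bullet> h" for \<theta>
  define \<phi>2 where "\<phi>2 \<theta> = (space_hessian v t (x + \<theta> *\<^sub>R h) *v h) \<bullet> h" for \<theta>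
  have dv: "v t differentiable (at z)" "space_grad v t differentiable (at z)" for z
    using v t by (auto simp: class_C12_def)
  have line: "((\<lambda>\<theta>. x + \<theta> *\<^sub>R h) has_derivative (\<lambda>r. r *\<^sub>R h)) (at \<theta>)" for \<theta>
    by (auto intro!: derivative_eq_intros)
  have 1: "(\<phi> has_real_derivative \<phi>1 \<theta>) (at \<theta>)" for \<theta>
  proof -
    have "(v t has_derivative (\<lambda>k. space_grad v t (x + \<theta> *\<^sub>R h) \<bullet> k)) (at (x + \<theta> *\<^sub>R h))"
    proof -
      have "frechet_derivative (v t) (at (x + \<theta> *\<^sub>R h)) = (\<lambda>k. space_grad v t (x + \<theta> *\<^sub>R h) \<bullet> k)"
        by (rule ext, rule space_grad_inner, rule dv)
      then show ?thesis using dv(1)[of "x + \<theta> *\<^sub>R h"] unfolding frechet_derivative_works by simp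
    qed
    from has_derivative_compose[OF line this]
    have "(\<phi> has_derivative (\<lambda>r. space_grad v t (x + \<theta> *\<^sub>R h) \<bullet> (r *\<^sub>R h))) (at \<theta>)" by (simp add: \<phi>_def[abs_def])
    moreover have "(\<lambda>r. space_grad v t (x + \<theta> *\<^sub>R h) \<bullet> (r *\<^sub>R h)) = (*) (\<phi>1 \<theta>)"
      by (simp add: \<phi>1_def fun_eq_iff)
    ultimately show ?thesis unfolding has_field_derivative_def by simp
  qed
  have 2: "(\<phi>1 has_real_derivative \<phi>2 \<theta>) (at \<theta>)" for \<theta>
  proof -
    have "(space_grad v t has_derivative (\<lambda>k. space_hessian v t (x + \<theta> *\<^sub>R h) *v k)) (at (x + \<theta> *\<^sub>R h))"
      using dv(2)[of "x + \<theta> *\<^sub>R h"] unfolding space_hessian_def jacobian_works .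
    from has_derivative_inner_left[OF has_derivative_compose[OF line this], of h]
    have "(\<phi>1 has_derivative (\<lambda>r. (space_hessian v t (x + \<theta> *\<^sub>R h) *v (r *\<^sub>R h)) \<bullet> h)) (at \<theta>)"
      by (simp add: \<phi>1_def[abs_def])
    moreover have "(\<lambda>r. (space_hessian v t (x + \<theta> *\<^sub>R h) *v (r *\<^sub>R h)) \<bullet> h) = (*) (\<phi>2 \<theta>)"
      by (simp add: \<phi>2_def fun_eq_iff matrix_vector_mult_scaleR)
    ultimately show ?thesis unfolding has_field_derivative_def by simp
  qed
  define D where "D m = (if m = 0 then \<phi> else if m = 1 then \<phi>1 else \<phi>2)" for m :: nat
  have "\<exists>\<theta>>0. \<theta> < 1 \<and> \<phi> 1 = (\<Sum>m<2. D m 0 / fact m * 1 ^ m) + D 2 \<theta> / fact 2 * 1 ^ 2"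
  proof (rule Maclaurin)
    show "\<forall>m t. m < 2 \<and> 0 \<le> t \<and> t \<le> 1 \<longrightarrow> (D m has_real_derivative D (Suc m) t) (at t)"
      using 1 2 by (auto simp: D_def less_2_cases_iff)
  qed (auto simp: D_def)
  then obtain \<theta> where "0 < \<theta>" "\<theta> < 1" "\<phi> 1 = \<phi> 0 + \<phi>1 0 + \<phi>2 \<theta> / 2"
    by (auto simp: D_def numeral_2_eq_2)
  then show thesis
    by (intro that[of \<theta>]) (auto simp: \<phi>_def \<phi>1_def \<phi>2_def inner_commute)
qed

lemma C12_time_mvt:
  assumes v: "class_C12 T v" and t: "0 \<le> t" "t \<le> t'" "t' \<le> T"
  obtains \<xi> where "\<xi> \<in> {t..t'}" "v t' x - v t x = (t' - t) * time_deriv T v \<xi> x"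
proof -
  have "((\<lambda>s. v s x) has_derivative (\<lambda>r. r * time_deriv T v s x)) (at s within {t..t'})" if "t \<le> s" "s \<le> t'" for s
  proof -
    have "((\<lambda>s. v s x) has_vector_derivative time_deriv T v s x) (at s within {0..T})"
      using v that t unfolding class_C12_def time_deriv_def by (auto simp: vector_derivative_works)
    then have "((\<lambda>s. v s x) has_vector_derivative time_deriv T v s x) (at s within {t..t'})"
      by (rule has_vector_derivative_within_subset) (use t in auto)
    then show ?thesis by (simp add: has_vector_derivative_def)
  qed
  from mvt_very_simple[OF t(2) this] show thesis using that by auto
qed

lemma C12_bounds:
  fixes v :: "real \<Rightarrow> real^'n \<Rightarrow> real"
  assumes v: "class_C12 T v"
  obtains B where "B \<ge> 0" "\<And>t x. t \<in> {0..T} \<Longrightarrow> norm x \<le> R \<Longrightarrow> \<bar>v t x\<bar> \<le> B \<and> \<bar>time_deriv T v t x\<bar> \<le> B \<and>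
    norm (space_grad v t x) \<le> B \<and> norm (space_hessian v t x) \<le> B"
proof -
  let ?K = "{0..T} \<times> cball (0::real^'n) R"
  have K: "compact ?K" by (intro compact_Times compact_cball) auto
  have b: "\<exists>B. \<forall>t x. t \<in> {0..T} \<longrightarrow> norm x \<le> R \<longrightarrow> norm (f t x) \<le> B"
    if "continuous_on ({0..T} \<times> UNIV) (\<lambda>(t, x). f t x)" for f :: "real \<Rightarrow> real^'n \<Rightarrow> 'c::real_normed_vector"
  proof -
    have "continuous_on ?K (\<lambda>(t, x). f t x)" using that by (rule continuous_on_subset) auto
    from compact_imp_bounded[OF compact_continuous_image[OF this K]]
    obtain B where B: "\<And>p. p \<in> ?K \<Longrightarrow> norm ((\<lambda>(t, x). f t x) p) \<le> B" unfolding bounded_iff by blast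
    show ?thesis using B[of "(_, _)"] by (intro exI[of _ B]) auto
  qed
  obtain B1 B2 B3 B4 where
    "\<And>t x. t \<in> {0..T} \<Longrightarrow> norm x \<le> R \<Longrightarrow> norm (v t x) \<le> B1"
    "\<And>t x. t \<in> {0..T} \<Longrightarrow> norm x \<le> R \<Longrightarrow> norm (time_deriv T v t x) \<le> B2"
    "\<And>t x. t \<in> {0..T} \<Longrightarrow> norm x \<le> R \<Longrightarrow> norm (space_grad v t x) \<le> B3"
    "\<And>t x. t \<in> {0..T} \<Longrightarrow> norm x \<le> R \<Longrightarrow> norm (space_hessian v t x) \<le> B4"
    using b[of v] b[of "time_deriv T v"] b[of "space_grad v"] b[of "space_hessian v"] v unfolding class_C12_def by blast
  then show thesis
    by (intro that[of "Max {0, B1, B2, B3, B4}"]) (auto simp: le_max_iff_disj)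
qed

lemma C12_modulus:
  fixes v :: "real \<Rightarrow> real^'n \<Rightarrow> real"
  assumes v: "class_C12 T v" and e: "\<epsilon> > 0"
  obtains C where "C \<ge> 0" "\<And>t x s y. t \<in> {0..T} \<Longrightarrow> s \<in> {0..T} \<Longrightarrow> norm x \<le> R \<Longrightarrow> norm y \<le> R \<Longrightarrow>
    \<bar>time_deriv T v s y - time_deriv T v t x\<bar> \<le> \<epsilon> + C * ((s - t)\<^sup>2 + (norm (y - x))\<^sup>2) \<and>
    norm (space_grad v s y - space_grad v t x) \<le> \<epsilon> + C * ((s - t)\<^sup>2 + (norm (y - x))\<^sup>2) \<and>
    norm (space_hessian v s y - space_hessian v t x) \<le> \<epsilon> + C * ((s - t)\<^sup>2 + (norm (y - x))\<^sup>2)"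
proof -
  let ?K = "{0..T} \<times> cball (0::real^'n) R"
  have K: "compact ?K" by (intro compact_Times compact_cball) auto
  have dist: "(dist (s, y) (t, x))\<^sup>2 = (s - t)\<^sup>2 + (norm (y - x))\<^sup>2" for s t :: real and x y :: "real^'n"
    by (simp only: dist_Pair_Pair) (simp add: dist_norm)
  have b: "\<exists>C\<ge>0. \<forall>t x s y. t \<in> {0..T} \<longrightarrow> s \<in> {0..T} \<longrightarrow> norm x \<le> R \<longrightarrow> norm y \<le> R \<longrightarrow>
    norm (f s y - f t x) \<le> \<epsilon> + C * ((s - t)\<^sup>2 + (norm (y - x))\<^sup>2)"
    if "continuous_on ({0..T} \<times> UNIV) (\<lambda>(t, x). f t x)" for f :: "real \<Rightarrow> real^'n \<Rightarrow> 'c::real_normed_vector"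
  proof -
    have "continuous_on ?K (\<lambda>(t, x). f t x)" using that by (rule continuous_on_subset) auto
    then obtain C where C: "C \<ge> 0" "\<And>p q. p \<in> ?K \<Longrightarrow> q \<in> ?K \<Longrightarrow> norm ((\<lambda>(t, x). f t x) p - (\<lambda>(t, x). f t x) q) \<le> \<epsilon> + C * (dist p q)\<^sup>2"
      using continuous_compact_modulus[OF K _ e] by metis
    show ?thesis
      using C(2)[of "(_, _)" "(_, _)", unfolded dist] C(1) by (intro exI[of _ C]) auto
  qed
  obtain C1 C2 C3 where C: "C1 \<ge> 0" "C2 \<ge> 0" "C3 \<ge> 0"
    "\<And>t x s y. t \<in> {0..T} \<Longrightarrow> s \<in> {0..T} \<Longrightarrow> norm x \<le> R \<Longrightarrow> norm y \<le> R \<Longrightarrow> norm (time_deriv T v s y - time_deriv T v t x) \<le> \<epsilon> + C1 * ((s - t)\<^sup>2 + (norm (y - x))\<^sup>2)"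
    "\<And>t x s y. t \<in> {0..T} \<Longrightarrow> s \<in> {0..T} \<Longrightarrow> norm x \<le> R \<Longrightarrow> norm y \<le> R \<Longrightarrow> norm (space_grad v s y - space_grad v t x) \<le> \<epsilon> + C2 * ((s - t)\<^sup>2 + (norm (y - x))\<^sup>2)"
    "\<And>t x s y. t \<in> {0..T} \<Longrightarrow> s \<in> {0..T} \<Longrightarrow> norm x \<le> R \<Longrightarrow> norm y \<le> R \<Longrightarrow> norm (space_hessian v s y - space_hessian v t x) \<le> \<epsilon> + C3 * ((s - t)\<^sup>2 + (norm (y - x))\<^sup>2)"
    using b[of "time_deriv T v"] b[of "space_grad v"] b[of "space_hessian v"] v unfolding class_C12_def by blast
  have le: "\<epsilon> + c * (a\<^sup>2 + d\<^sup>2) \<le> \<epsilon> + (C1 + C2 + C3) * (a\<^sup>2 + d\<^sup>2)" if "c \<in> {C1, C2, C3}" for c a d :: real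
    using C that by (intro add_left_mono mult_right_mono) auto
  show thesis
  proof (rule that[of "C1 + C2 + C3"])
    fix t s and x y :: "real^'n"
    assume a: "t \<in> {0..T}" "s \<in> {0..T}" "norm x \<le> R" "norm y \<le> R"
    show "\<bar>time_deriv T v s y - time_deriv T v t x\<bar> \<le> \<epsilon> + (C1 + C2 + C3) * ((s - t)\<^sup>2 + (norm (y - x))\<^sup>2) \<and>
    norm (space_grad v s y - space_grad v t x) \<le> \<epsilon> + (C1 + C2 + C3) * ((s - t)\<^sup>2 + (norm (y - x))\<^sup>2) \<and>
    norm (space_hessian v s y - space_hessian v t x) \<le> \<epsilon> + (C1 + C2 + C3) * ((s - t)\<^sup>2 + (norm (y - x))\<^sup>2)"
      using C(4)[OF a] C(5)[OF a] C(6)[OF a] le[of C1 "s - t" "norm (y - x)"] le[of C2 "s - t" "norm (y - x)"] le[of C3 "s - t" "norm (y - x)"]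
      by (auto intro: order_trans)
  qed (use C in auto)
qed

text \<open>The increment is split at (t, y): first order in time at fixed y, second order in space
  at fixed t. Both derivatives are taken at intermediate points and moved back to (t, x) by the
  modulus, which costs a multiple of \<Delta> and of |h|^2 respectively. The intermediate point in
  space stays in the ball by convexity.\<close>

lemma C12_taylor_lower:
  fixes v :: "real \<Rightarrow> real^'n \<Rightarrow> real"
  assumes v: "class_C12 T v" and e: "0 < \<epsilon>" and C: "0 \<le> C"
    and mod: "\<And>t x s y. t \<in> {0..T} \<Longrightarrow> s \<in> {0..T} \<Longrightarrow> norm x \<le> R \<Longrightarrow> norm y \<le> R \<Longrightarrow>
    \<bar>time_deriv T v s y - time_deriv T v t x\<bar> \<le> \<epsilon> + C * ((s - t)\<^sup>2 + (norm (y - x))\<^sup>2) \<and>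
    norm (space_hessian v s y - space_hessian v t x) \<le> \<epsilon> + C * ((s - t)\<^sup>2 + (norm (y - x))\<^sup>2)"
    and t: "0 \<le> t" "t \<le> t'" "t' \<le> T" and xy: "norm x \<le> R" "norm y \<le> R"
  defines "h \<equiv> y - x" and "\<Delta> \<equiv> t' - t"
  shows "v t' y - v t x \<ge> \<Delta> * time_deriv T v t x + space_grad v t x \<bullet> h + 1/2 * (h \<bullet> (space_hessian v t x *v h))
    - (\<Delta> + real CARD('n) ^ 2 * (norm h)\<^sup>2) * (\<epsilon> + C * (\<Delta>\<^sup>2 + (norm h)\<^sup>2))"
proof -
  let ?m = "\<epsilon> + C * (\<Delta>\<^sup>2 + (norm h)\<^sup>2)"
  obtain \<xi> where xi: "\<xi> \<in> {t..t'}" "v t' y - v t y = \<Delta> * time_deriv T v \<xi> y"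
    using C12_time_mvt[OF v t, of y] by (auto simp: \<Delta>_def)
  have "(\<xi> - t)\<^sup>2 \<le> \<Delta>\<^sup>2" using xi by (intro power_mono) (auto simp: \<Delta>_def)
  then have m1: "\<epsilon> + C * ((\<xi> - t)\<^sup>2 + (norm h)\<^sup>2) \<le> ?m" using C by (intro add_left_mono mult_left_mono add_right_mono)
  have "\<bar>time_deriv T v \<xi> y - time_deriv T v t x\<bar> \<le> \<epsilon> + C * ((\<xi> - t)\<^sup>2 + (norm h)\<^sup>2)"
    using mod[of t \<xi> x y] xi t xy by (simp add: h_def)
  then have "time_deriv T v t x - ?m \<le> time_deriv T v \<xi> y" using m1 by linarith
  then have 1: "\<Delta> * (time_deriv T v t x - ?m) \<le> v t' y - v t y"
    unfolding xi(2) using t by (intro mult_left_mono) (auto simp: \<Delta>_def)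
  obtain \<theta> where th: "0 < \<theta>" "\<theta> < 1"
    "v t (x + h) = v t x + space_grad v t x \<bullet> h + 1/2 * (h \<bullet> (space_hessian v t (x + \<theta> *\<^sub>R h) *v h))"
    by (rule C12_space_taylor[OF v, of t x h]) (use t in auto)
  let ?z = "x + \<theta> *\<^sub>R h"
  have z: "norm ?z \<le> R"
  proof -
    have "?z = (1 - \<theta>) *\<^sub>R x + \<theta> *\<^sub>R y" by (simp add: h_def algebra_simps)
    then have "norm ?z \<le> (1 - \<theta>) * norm x + \<theta> * norm y"
      using norm_triangle_ineq[of "(1 - \<theta>) *\<^sub>R x" "\<theta> *\<^sub>R y"] th by simp
    also have "\<dots> \<le> (1 - \<theta>) * R + \<theta> * R" using th xy by (intro add_mono mult_left_mono) auto
    finally show ?thesis by (simp add: algebra_simps)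
  qed
  have "norm (space_hessian v t ?z - space_hessian v t x) \<le> \<epsilon> + C * ((t - t)\<^sup>2 + (norm (?z - x))\<^sup>2)"
    using mod[of t t x ?z] t xy z by simp
  also have "\<dots> \<le> ?m"
  proof -
    have "norm (?z - x) \<le> norm h" using th by (simp add: mult_left_le_one_le)
    then have "(norm (?z - x))\<^sup>2 \<le> (norm h)\<^sup>2" by (intro power_mono) auto
    then have "(t - t)\<^sup>2 + (norm (?z - x))\<^sup>2 \<le> \<Delta>\<^sup>2 + (norm h)\<^sup>2"
      using zero_le_power2[of \<Delta>] by (simp only: diff_self zero_power2)
    then show ?thesis using C by (intro add_left_mono mult_left_mono)
  qed
  finally have hm: "norm (space_hessian v t ?z - space_hessian v t x) \<le> ?m" .
  have "h \<bullet> (space_hessian v t ?z *v h) = h \<bullet> (space_hessian v t x *v h) + h \<bullet> ((space_hessian v t ?z - space_hessian v t x) *v h)"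
    by (simp add: matrix_vector_mult_diff_rdistrib inner_diff_right)
  moreover have "\<bar>h \<bullet> ((space_hessian v t ?z - space_hessian v t x) *v h)\<bar> \<le> real CARD('n) ^ 2 * (?m * norm h * norm h)"
    by (rule order_trans[OF quadratic_form_le]) (use hm in \<open>auto intro!: mult_left_mono mult_right_mono\<close>)
  ultimately have "v t y - v t x \<ge> space_grad v t x \<bullet> h + 1/2 * (h \<bullet> (space_hessian v t x *v h)) - 1/2 * (real CARD('n) ^ 2 * (?m * norm h * norm h))"
    using th(3) by (simp add: h_def)
  moreover have "1/2 * (real CARD('n) ^ 2 * (?m * norm h * norm h)) \<le> real CARD('n) ^ 2 * (norm h)\<^sup>2 * ?m"
  proof -
    have "0 \<le> ?m" using e C by simp
    then have "0 \<le> real CARD('n) ^ 2 * (norm h)\<^sup>2 * ?m" by (intro mult_nonneg_nonneg) auto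
    moreover have "1/2 * (real CARD('n) ^ 2 * (?m * norm h * norm h)) = 1/2 * (real CARD('n) ^ 2 * (norm h)\<^sup>2 * ?m)"
      by (simp add: power2_eq_square mult_ac)
    ultimately show ?thesis by linarith
  qed
  ultimately have 2: "v t y - v t x \<ge> space_grad v t x \<bullet> h + 1/2 * (h \<bullet> (space_hessian v t x *v h)) - real CARD('n) ^ 2 * (norm h)\<^sup>2 * ?m"
    by linarith
  have "(\<Delta> + real CARD('n) ^ 2 * (norm h)\<^sup>2) * ?m = \<Delta> * ?m + real CARD('n) ^ 2 * (norm h)\<^sup>2 * ?m"
    by (rule distrib_right)
  moreover have "\<Delta> * (time_deriv T v t x - ?m) = \<Delta> * time_deriv T v t x - \<Delta> * ?m" by (rule right_diff_distrib)
  ultimately show ?thesis using 1 2 by linarith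
qed

text \<open>The trace written with the entries of \<sigma> times its transpose, the form in which
  the covariance of the martingale part occurs.\<close>

lemma generator_eq:
  fixes \<sigma> :: "real^'n \<Rightarrow> real^'k^'n"
  shows "generator b \<sigma> T v t x = time_deriv T v t x + space_grad v t x \<bullet> b x
     + 1 / 2 * (\<Sum>i\<in>UNIV. \<Sum>j\<in>UNIV. space_hessian v t x $ i $ j * (\<Sum>a\<in>UNIV. \<sigma> x $ i $ a * \<sigma> x $ j $ a))"
proof -
  let ?A = "space_hessian v t x"
  have "trace (transpose (\<sigma> x) ** ?A ** \<sigma> x) = (\<Sum>a\<in>UNIV. \<Sum>j\<in>UNIV. \<Sum>i\<in>UNIV. \<sigma> x $ i $ a * ?A $ i $ j * \<sigma> x $ j $ a)"
    by (simp add: trace_def matrix_matrix_mult_def transpose_def sum_distrib_right)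
  also have "\<dots> = (\<Sum>j\<in>UNIV. \<Sum>a\<in>UNIV. \<Sum>i\<in>UNIV. \<sigma> x $ i $ a * ?A $ i $ j * \<sigma> x $ j $ a)"
    by (rule sum.swap)
  also have "\<dots> = (\<Sum>j\<in>UNIV. \<Sum>i\<in>UNIV. \<Sum>a\<in>UNIV. \<sigma> x $ i $ a * ?A $ i $ j * \<sigma> x $ j $ a)"
    by (intro sum.cong refl sum.swap)
  also have "\<dots> = (\<Sum>i\<in>UNIV. \<Sum>j\<in>UNIV. \<Sum>a\<in>UNIV. \<sigma> x $ i $ a * ?A $ i $ j * \<sigma> x $ j $ a)"
    by (rule sum.swap)
  also have "\<dots> = (\<Sum>i\<in>UNIV. \<Sum>j\<in>UNIV. ?A $ i $ j * (\<Sum>a\<in>UNIV. \<sigma> x $ i $ a * \<sigma> x $ j $ a))"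
    by (simp add: sum_distrib_left mult_ac)
  finally show ?thesis by (simp add: generator_def)
qed

subsection \<open>The submartingale inequality\<close>

lemma norm_vec_sq: "(norm (x :: real^'n))\<^sup>2 = (\<Sum>i\<in>UNIV. (x $ i)\<^sup>2)"
  unfolding power2_norm_eq_inner inner_vec_def by (simp add: power2_eq_square)

lemma norm_power4_le: "(norm (x :: real^'n)) ^ 4 \<le> real CARD('n) * (\<Sum>i\<in>UNIV. (x $ i) ^ 4)"
proof -
  have "(norm x) ^ 4 = ((norm x)\<^sup>2)\<^sup>2" by simp
  also have "\<dots> = (\<Sum>i\<in>UNIV. (x $ i)\<^sup>2)\<^sup>2" by (simp only: norm_vec_sq)
  also have "\<dots> \<le> real CARD('n) * (\<Sum>i\<in>UNIV. ((x $ i)\<^sup>2)\<^sup>2)"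
    using sum_squared_le_sum_of_squares[of "\<lambda>i. (x $ i)\<^sup>2" UNIV] by (simp add: mult.commute)
  finally show ?thesis by simp
qed

text \<open>\<open>Y\<close> stands for the stopped solution, with bounds that hold for every
  outcome and not only almost surely. \<open>H\<close> is the integrand of the given Ito integral,
  controlled only up to \<rho>. The link \<open>HY\<close> starts after time 0 because a path with
  the wrong initial value is given the exit time 0 but a corrected value of
  \<open>Y\<close>.\<close>

locale stopped_diffusion = wiener M W for M :: "'a measure" and W :: "real \<Rightarrow> 'a \<Rightarrow> real^'k" +
  fixes T R K B :: real and \<rho> :: "'a \<Rightarrow> real" and H :: "real \<Rightarrow> 'a \<Rightarrow> real^'k^'n" and I :: "real \<Rightarrow> 'a \<Rightarrow> real^'n"
    and Y :: "real \<Rightarrow> 'a \<Rightarrow> real^'n" and b :: "real^'n \<Rightarrow> real^'n" and \<sigma> :: "real^'n \<Rightarrow> real^'k^'n"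
    and x0 :: "real^'n" and v :: "real \<Rightarrow> real^'n \<Rightarrow> real"
  assumes T: "0 < T" and v: "class_C12 T v"
    and \<rho>: "stopping_time F \<rho>" and \<rho>0: "\<And>w. w \<in> space M \<Longrightarrow> 0 \<le> \<rho> w"
    and ito: "is_ito_integral M F W H I"
    and Y_adapted: "\<And>t. t \<in> {0..T} \<Longrightarrow> Y t \<in> borel_measurable (F t)"
    and Y_joint: "(\<lambda>(w, r). Y r w) \<in> borel_measurable (M \<Otimes>\<^sub>M borel)"
    and Y_bounded: "\<And>t w. norm (Y t w) \<le> R"
    and b_meas: "b \<in> borel_measurable borel" and \<sigma>_meas: "\<sigma> \<in> borel_measurable borel"
    and K: "0 \<le> K" "\<And>x. norm x \<le> R \<Longrightarrow> norm (b x) \<le> K" "\<And>x. norm x \<le> R \<Longrightarrow> norm (\<sigma> x) \<le> K"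
    and B: "0 \<le> B" "\<And>t x. t \<in> {0..T} \<Longrightarrow> norm x \<le> R \<Longrightarrow> \<bar>v t x\<bar> \<le> B \<and> \<bar>time_deriv T v t x\<bar> \<le> B \<and>
      norm (space_grad v t x) \<le> B \<and> norm (space_hessian v t x) \<le> B"
    and HY: "\<And>w r. w \<in> space M \<Longrightarrow> 0 < r \<Longrightarrow> r \<le> \<rho> w \<Longrightarrow> H r w = \<sigma> (Y r w)"
    and Y_eq: "AE w in M. \<forall>t\<in>{0..T}. Y t w = x0 +
      (\<integral>r. indicator {0..t} r *\<^sub>R (if r \<le> \<rho> w then b (Y r w) else 0) \<partial>lborel) + I (min t (\<rho> w)) w"
begin

definition \<beta> :: "real \<Rightarrow> 'a \<Rightarrow> real^'n" where
  "\<beta> r w = (if r \<le> \<rho> w then b (Y r w) else 0)"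

text \<open>The (i, j) entry of \<sigma> times its transpose along \<open>Y\<close>, cut off at
  \<rho> (see \<open>covar_eq\<close>). It is expressed by the integrand \<open>H\<close>, as the
  moments of the integral are.\<close>

definition covar :: "'n \<Rightarrow> 'n \<Rightarrow> real \<Rightarrow> 'a \<Rightarrow> real" where
  "covar i j r w = (\<Sum>a\<in>UNIV. (if r \<le> \<rho> w then H r w else 0) $ i $ a * (if r \<le> \<rho> w then H r w else 0) $ j $ a)"

definition drift :: "real \<Rightarrow> 'a \<Rightarrow> real^'n" where
  "drift t w = (\<integral>r. indicator {0..t} r *\<^sub>R \<beta> r w \<partial>lborel)"

text \<open>Defined by subtraction and not as the stopped integral, with which it agrees almost
  surely: in this form it is measurable, and its increments are bounded for every outcome, so all
  products below are integrable.\<close>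

definition mart :: "real \<Rightarrow> 'a \<Rightarrow> real^'n" where
  "mart t w = Y t w - x0 - drift t w"

lemma \<rho>_measurable [measurable]: "\<rho> \<in> borel_measurable M"
  using \<rho> by (rule stopping_time_measurable)

lemma Y_measurable [measurable]: "Y t \<in> borel_measurable M"
  if "t \<in> {0..T}" for t using Y_adapted[OF that] by (rule measurable_filtration)

lemmas [measurable] = Y_joint b_meas \<sigma>_meas

lemma \<beta>_joint [measurable]: "(\<lambda>(w, r). \<beta> r w) \<in> borel_measurable (M \<Otimes>\<^sub>M borel)"
  unfolding \<beta>_def by measurable

lemma \<beta>_bound: "norm (\<beta> r w) \<le> K"
  using K Y_bounded by (simp add: \<beta>_def)

lemma Y_section [measurable]: "w \<in> space M \<Longrightarrow> (\<lambda>r. Y r w) \<in> borel_measurable borel"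
  using measurable_compose[OF measurable_Pair1' Y_joint] by simp

lemma \<beta>_section [measurable]: "w \<in> space M \<Longrightarrow> (\<lambda>r. \<beta> r w) \<in> borel_measurable borel"
  using measurable_compose[OF measurable_Pair1' \<beta>_joint] by simp

lemma \<beta>_integrable: "w \<in> space M \<Longrightarrow> integrable lborel (\<lambda>r. indicator {s..t} r *\<^sub>R \<beta> r w)"
proof (rule Bochner_Integration.integrable_bound)
  show "integrable lborel (\<lambda>r. indicator {s..t} r * K)"
    by (intro integrable_mult_left integrable_real_indicator) (auto simp: emeasure_lborel_Icc_eq)
  show "AE r in lborel. norm (indicator {s..t} r *\<^sub>R \<beta> r w) \<le> norm (indicator {s..t} r * K)"
    using \<beta>_bound by (intro always_eventually allI) (auto simp: indicator_def intro: order_trans[OF _ abs_ge_self])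
qed simp

lemma drift_measurable [measurable]: "drift t \<in> borel_measurable M"
  unfolding drift_def[abs_def]
  by (intro sigma_finite_measure.borel_measurable_lebesgue_integral sigma_finite_lborel) measurable

lemma drift_diff:
  assumes w: "w \<in> space M" and st: "0 \<le> s" "s \<le> t"
  shows "drift t w - drift s w = (\<integral>r. indicator {s..t} r *\<^sub>R \<beta> r w \<partial>lborel)"
    "norm (drift t w - drift s w) \<le> K * (t - s)"
proof -
  have "drift t w - drift s w = (\<integral>r. indicator {0..t} r *\<^sub>R \<beta> r w - indicator {0..s} r *\<^sub>R \<beta> r w \<partial>lborel)"
    unfolding drift_def using \<beta>_integrable[OF w] by (intro Bochner_Integration.integral_diff[symmetric])
  also have "\<dots> = (\<integral>r. indicator {s..t} r *\<^sub>R \<beta> r w \<partial>lborel)"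
  proof (rule integral_cong_AE)
    show "AE r in lborel. indicator {0..t} r *\<^sub>R \<beta> r w - indicator {0..s} r *\<^sub>R \<beta> r w = indicator {s..t} r *\<^sub>R \<beta> r w"
      using AE_lborel_singleton[of s] by eventually_elim (use st in \<open>auto simp: indicator_def\<close>)
  qed (use w in measurable)
  finally show 1: "drift t w - drift s w = (\<integral>r. indicator {s..t} r *\<^sub>R \<beta> r w \<partial>lborel)" .
  have "norm (drift t w - drift s w) \<le> (\<integral>r. indicator {s..t} r * K \<partial>lborel)"
    unfolding 1
  proof (rule order_trans[OF integral_norm_bound integral_mono_AE'])
    show "integrable lborel (\<lambda>r. indicator {s..t} r * K)"
      by (intro integrable_mult_left integrable_real_indicator) (auto simp: emeasure_lborel_Icc_eq)
    show "AE r in lborel. norm (indicator {s..t} r *\<^sub>R \<beta> r w) \<le> indicator {s..t} r * K"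
      using \<beta>_bound by (intro always_eventually allI) (auto simp: indicator_def)
  qed (use K(1) in auto)
  also have "\<dots> = K * (t - s)" using st by simp
  finally show "norm (drift t w - drift s w) \<le> K * (t - s)" .
qed

lemma mart_measurable: "t \<in> {0..T} \<Longrightarrow> mart t \<in> borel_measurable M"
  unfolding mart_def[abs_def] by measurable

lemma mart_ito: "AE w in M. \<forall>t\<in>{0..T}. mart t w = I (min t (\<rho> w)) w"
  using Y_eq by eventually_elim (auto simp: mart_def drift_def \<beta>_def)

lemma mart_bound:
  assumes "w \<in> space M" "0 \<le> s" "s \<le> t"
  shows "norm (mart t w - mart s w) \<le> 2 * R + K * (t - s)"
proof -
  have "mart t w - mart s w = (Y t w - Y s w) - (drift t w - drift s w)" by (simp add: mart_def)
  then have "norm (mart t w - mart s w) \<le> norm (Y t w - Y s w) + norm (drift t w - drift s w)"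
    using norm_triangle_ineq4 by metis
  then show ?thesis
    using norm_triangle_ineq4[of "Y t w" "Y s w"] Y_bounded[of t w] Y_bounded[of s w] drift_diff(2)[OF assms] by linarith
qed

lemma H_bound: "w \<in> space M \<Longrightarrow> 0 < r \<Longrightarrow> r \<le> \<rho> w \<Longrightarrow> norm (H r w) \<le> K"
  using HY[of w r] K(3)[OF Y_bounded] by simp

lemma covar_bound: "w \<in> space M \<Longrightarrow> 0 < r \<Longrightarrow> \<bar>covar i j r w\<bar> \<le> real CARD('k) * (K * K)"
proof -
  assume w: "w \<in> space M" "0 < r"
  let ?H = "if r \<le> \<rho> w then H r w else 0"
  have b: "norm ?H \<le> K" using H_bound[OF w] K(1) by simp
  have "\<bar>covar i j r w\<bar> \<le> (\<Sum>a\<in>UNIV. \<bar>?H $ i $ a * ?H $ j $ a\<bar>)" unfolding covar_def by (rule sum_abs)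
  also have "\<dots> \<le> (\<Sum>a\<in>(UNIV::'k set). K * K)"
    by (intro sum_mono abs_mult_le order_trans[OF abs_entry_le_norm b])
  finally show ?thesis by simp
qed

lemma covar_eq: "w \<in> space M \<Longrightarrow> 0 < r \<Longrightarrow> covar i j r w = (if r \<le> \<rho> w then \<Sum>a\<in>UNIV. \<sigma> (Y r w) $ i $ a * \<sigma> (Y r w) $ j $ a else 0)"
  using HY by (simp add: covar_def)

lemma covar_section:
  assumes w: "w \<in> space M" and s: "0 \<le> s"
  shows "integrable lborel (\<lambda>r. indicator {s..t} r * covar i j r w)"
    "\<bar>\<integral>r. indicator {s..t} r * covar i j r w \<partial>lborel\<bar> \<le> real CARD('k) * (K * K) * max 0 (t - s)"
proof -
  let ?C = "real CARD('k) * (K * K)"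
  have H: "progressively_measurable F H" using ito by (auto simp: is_ito_integral_def)
  have [measurable]: "(\<lambda>r. indicator {0..max 0 t} r *\<^sub>R H r w) \<in> borel_measurable borel"
    by (rule progressively_measurable_section[OF H _ w]) simp
  have e: "indicator {s..t} r * covar i j r w =
      (if r \<le> \<rho> w then indicator {s..t} r * (\<Sum>a\<in>UNIV. (indicator {0..max 0 t} r *\<^sub>R H r w) $ i $ a * (indicator {0..max 0 t} r *\<^sub>R H r w) $ j $ a) else 0)" for r
    using s by (auto simp: covar_def indicator_def)
  have m: "(\<lambda>r. indicator {s..t} r * covar i j r w) \<in> borel_measurable borel" unfolding e by measurable
  have bi: "integrable lborel (\<lambda>r. indicator {s..t} r * ?C)"
    by (intro integrable_mult_left integrable_real_indicator) (auto simp: emeasure_lborel_Icc_eq)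
  have le: "AE r in lborel. norm (indicator {s..t} r * covar i j r w) \<le> indicator {s..t} r * ?C"
    using AE_lborel_singleton[of 0] by eventually_elim (use s covar_bound[OF w] in \<open>auto simp: indicator_def\<close>)
  show "integrable lborel (\<lambda>r. indicator {s..t} r * covar i j r w)"
    by (rule Bochner_Integration.integrable_bound[OF bi])
      (use m le in \<open>auto elim!: eventually_mono intro: order_trans[OF _ abs_ge_self]\<close>)
  have "norm (\<integral>r. indicator {s..t} r * covar i j r w \<partial>lborel) \<le> (\<integral>r. indicator {s..t} r * ?C \<partial>lborel)"
    by (rule order_trans[OF integral_norm_bound integral_mono_AE'[OF bi le]]) simp
  also have "\<dots> = ?C * max 0 (t - s)" by (simp add: max_def)
  finally show "\<bar>\<integral>r. indicator {s..t} r * covar i j r w \<partial>lborel\<bar> \<le> ?C * max 0 (t - s)" by simp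
qed

text \<open>Both constants come from adding coordinate bounds over the dimension. The second factor
  \<open>CARD('n)\<close> in \<open>c2\<close> stems from bounding the fourth power of the norm by
  the fourth powers of the coordinates.\<close>

definition c1 :: real where "c1 = real CARD('n) * (real CARD('k) * (K * K))"
definition c2 :: real where "c2 = real CARD('n) * (real CARD('n) * (3 * real CARD('k) ^ 4 * K ^ 4))"

lemma mart_moments:
  assumes st: "0 \<le> s" "s < t" "t \<le> T"
    and Z: "Z \<in> borel_measurable (F s)" and L: "\<And>w. w \<in> space M \<Longrightarrow> \<bar>Z w\<bar> \<le> L"
  defines "d \<equiv> \<lambda>w. mart t w - mart s w"
  shows "expectation (\<lambda>w. Z w * d w $ i) = 0"
    "expectation (\<lambda>w. Z w * (d w $ i * d w $ j)) = expectation (\<lambda>w. Z w * (\<integral>r. indicator {s..t} r * covar i j r w \<partial>lborel))"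
    "expectation (\<lambda>w. (norm (d w))\<^sup>2) \<le> c1 * (t - s)"
    "expectation (\<lambda>w. (norm (d w)) ^ 4) \<le> c2 * (t - s)\<^sup>2"
proof -
  have stT: "s \<in> {0..T}" "t \<in> {0..T}" using st by auto
  note [measurable] = mart_measurable[OF stT(1)] mart_measurable[OF stT(2)]
  have AE: "AE w in M. mart t w = I (min t (\<rho> w)) w" "AE w in M. mart s w = I (min s (\<rho> w)) w"
    using mart_ito stT by (auto elim!: eventually_mono)
  have t: "0 < t" using st by simp
  note im = ito_stopped_moments[OF ito t st(1) less_imp_le[OF st(2)] \<rho> \<rho>0 K(1) H_bound mart_measurable[OF stT(2)] mart_measurable[OF stT(1)] AE]
  show "expectation (\<lambda>w. Z w * d w $ i) = 0"
    unfolding d_def by (rule im(3)[OF _ _ _ _ Z L]) auto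
  have cov: "expectation (\<lambda>w. Z w * (d w $ i * d w $ j)) = expectation (\<lambda>w. Z w * (\<integral>r. indicator {s..t} r * covar i j r w \<partial>lborel))"
    if Z: "Z \<in> borel_measurable (F s)" and L: "\<And>w. w \<in> space M \<Longrightarrow> \<bar>Z w\<bar> \<le> L" for Z L i j
    unfolding d_def covar_def by (rule im(4)[OF _ _ _ _ Z L]) auto
  show "expectation (\<lambda>w. Z w * (d w $ i * d w $ j)) = expectation (\<lambda>w. Z w * (\<integral>r. indicator {s..t} r * covar i j r w \<partial>lborel))"
    by (rule cov[OF Z L])
  have d4: "integrable M (\<lambda>w. (d w $ i) ^ 4)" "expectation (\<lambda>w. (d w $ i) ^ 4) \<le> 3 * real CARD('k) ^ 4 * K ^ 4 * (t - s)\<^sup>2" for i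
    unfolding d_def by (rule im(1,2)[of "\<lambda>_. 0" 0]; simp)+
  have dm[measurable]: "(\<lambda>w. d w $ i) \<in> borel_measurable M" for i unfolding d_def by measurable
  have d2: "integrable M (\<lambda>w. (d w $ i)\<^sup>2)" for i
    using integrable_power_of_power4[OF dm d4(1), of 2] by simp
  have e2: "expectation (\<lambda>w. (d w $ i)\<^sup>2) \<le> real CARD('k) * (K * K) * (t - s)" for i
  proof -
    have "expectation (\<lambda>w. (d w $ i)\<^sup>2) = expectation (\<lambda>w. \<integral>r. indicator {s..t} r * covar i i r w \<partial>lborel)"
      using cov[of "\<lambda>_. 1" 1 i i] by (simp add: power2_eq_square)
    also have "\<dots> \<le> expectation (\<lambda>w. real CARD('k) * (K * K) * (t - s))"
    proof (rule integral_mono_AE')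
      show "AE w in M. (\<integral>r. indicator {s..t} r * covar i i r w \<partial>lborel) \<le> real CARD('k) * (K * K) * (t - s)"
        using covar_section(2)[OF _ st(1), of _ t i i] st by (intro AE_I2) (force simp: max_def)
    qed (use K st in auto)
    finally show ?thesis by (simp add: prob_space)
  qed
  have n2: "(norm (d w))\<^sup>2 = (\<Sum>i\<in>UNIV. (d w $ i)\<^sup>2)" for w
    by (rule norm_vec_sq)
  have "expectation (\<lambda>w. (norm (d w))\<^sup>2) = (\<Sum>i\<in>UNIV. expectation (\<lambda>w. (d w $ i)\<^sup>2))"
    unfolding n2 using d2 by simp
  also have "\<dots> \<le> (\<Sum>i\<in>(UNIV::'n set). real CARD('k) * (K * K) * (t - s))" by (intro sum_mono e2)
  finally show "expectation (\<lambda>w. (norm (d w))\<^sup>2) \<le> c1 * (t - s)" by (simp add: c1_def mult_ac)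
  have i4: "integrable M (\<lambda>w. real CARD('n) * (\<Sum>i\<in>UNIV. (d w $ i) ^ 4))" using d4 by simp
  have "expectation (\<lambda>w. (norm (d w)) ^ 4) \<le> expectation (\<lambda>w. real CARD('n) * (\<Sum>i\<in>UNIV. (d w $ i) ^ 4))"
    by (rule integral_mono_AE'[OF i4]) (auto simp: norm_power4_le intro!: AE_I2 mult_nonneg_nonneg sum_nonneg)
  also have "\<dots> = real CARD('n) * (\<Sum>i\<in>UNIV. expectation (\<lambda>w. (d w $ i) ^ 4))" using d4 by simp
  also have "\<dots> \<le> real CARD('n) * (\<Sum>i\<in>(UNIV::'n set). 3 * real CARD('k) ^ 4 * K ^ 4 * (t - s)\<^sup>2)"
    by (intro mult_left_mono sum_mono d4) auto
  also have "\<dots> = c2 * (t - s)\<^sup>2" by (simp add: c2_def)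
  finally show "expectation (\<lambda>w. (norm (d w)) ^ 4) \<le> c2 * (t - s)\<^sup>2" .
qed

end

section \<open>One step of the expansion along the stopped process\<close>

lemma C12_measurable:
  fixes v :: "real \<Rightarrow> real^'n \<Rightarrow> real"
  assumes v: "class_C12 T v" and t: "t \<in> {0..T}"
  shows "v t \<in> borel_measurable borel" "time_deriv T v t \<in> borel_measurable borel"
    "space_grad v t \<in> borel_measurable borel" "space_hessian v t \<in> borel_measurable borel"
proof -
  have c: "f t \<in> borel_measurable borel" if "continuous_on ({0..T} \<times> UNIV) (\<lambda>(t, x). f t x)"
    for f :: "real \<Rightarrow> real^'n \<Rightarrow> 'c::real_normed_vector"
  proof (rule borel_measurable_continuous_onI)
    have "continuous_on UNIV (\<lambda>x. (t, x :: real^'n))" by (intro continuous_intros)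
    moreover have "(\<lambda>x. (t, x :: real^'n)) ` UNIV \<subseteq> {0..T} \<times> UNIV" using t by auto
    ultimately show "continuous_on UNIV (f t)"
      using continuous_on_compose2[OF that, of UNIV "\<lambda>x. (t, x)"] by simp
  qed
  show "v t \<in> borel_measurable borel" "time_deriv T v t \<in> borel_measurable borel"
    "space_grad v t \<in> borel_measurable borel" "space_hessian v t \<in> borel_measurable borel"
    using v by (auto simp: class_C12_def intro: c)
qed

context stopped_diffusion begin

definition cn :: real where "cn = real CARD('n) ^ 2"
text \<open>The drift over a step is at most K \<Delta>, and \<Delta>^2 \<le> T \<Delta>. So
  \<alpha> \<Delta> bounds the part of \<Delta> + cn |h|^2 that is not due to the martingale
  increment, h being the increment of \<open>Y\<close>.\<close>

definition \<alpha> :: real where "\<alpha> = 1 + 2 * cn * K\<^sup>2 * T"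

lemma consts_nonneg: "0 \<le> cn" "0 \<le> \<alpha>" "0 \<le> c1" "0 \<le> c2"
  using T by (auto simp: cn_def \<alpha>_def c1_def c2_def)

text \<open>The increment of \<open>Y\<close> is a drift of size at most K \<Delta> plus the
  martingale increment d. In the quadratic form only d is kept; the cross terms are bounded by a
  multiple of \<Delta> |d|, and |d| \<le> \<epsilon> + |d|^2 / \<epsilon>. The constant \<gamma>
  comes from C (\<Delta>^2 + 2 K^2 \<Delta>^2) \<le> \<gamma> \<Delta>. The error is sorted by
  powers 0, 2 and 4 of |d|, exactly the moments that are controlled.\<close>

lemma step_pathwise:
  assumes e: "0 < \<epsilon>" and C: "0 \<le> C"
    and mod: "\<And>t x s y. t \<in> {0..T} \<Longrightarrow> s \<in> {0..T} \<Longrightarrow> norm x \<le> R \<Longrightarrow> norm y \<le> R \<Longrightarrow>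
    \<bar>time_deriv T v s y - time_deriv T v t x\<bar> \<le> \<epsilon> + C * ((s - t)\<^sup>2 + (norm (y - x))\<^sup>2) \<and>
    norm (space_hessian v s y - space_hessian v t x) \<le> \<epsilon> + C * ((s - t)\<^sup>2 + (norm (y - x))\<^sup>2)"
    and st: "0 \<le> s" "s < t" "t \<le> T" and w: "w \<in> space M"
  defines "\<Delta> \<equiv> t - s" and "d \<equiv> mart t w - mart s w" and "x \<equiv> Y s w" and "\<gamma> \<equiv> C * (1 + 2 * K\<^sup>2) * T"
  shows "v t (Y t w) - v s x \<ge> \<Delta> * time_deriv T v s x + space_grad v s x \<bullet> (drift t w - drift s w)
    + space_grad v s x \<bullet> d + 1/2 * (d \<bullet> (space_hessian v s x *v d))
    - ((\<alpha> * \<Delta> * (\<epsilon> + \<gamma> * \<Delta>) + cn * B * K * \<Delta> * \<epsilon> + 1/2 * cn * B * K\<^sup>2 * \<Delta>\<^sup>2)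
      + (2 * C * \<alpha> * \<Delta> + 2 * cn * (\<epsilon> + \<gamma> * \<Delta>) + cn * B * K * \<Delta> / \<epsilon>) * (norm d)\<^sup>2 + 4 * cn * C * (norm d) ^ 4)"
proof -
  let ?b = "drift t w - drift s w" and ?A = "space_hessian v s x" and ?u = "(norm d)\<^sup>2"
  have D: "0 < \<Delta>" "\<Delta> \<le> T" using st by (auto simp: \<Delta>_def)
  have DT: "\<Delta>\<^sup>2 \<le> T * \<Delta>" using D by (simp add: power2_eq_square)
  have h: "Y t w - x = ?b + d" by (simp add: d_def mart_def x_def)
  have bb: "norm ?b \<le> K * \<Delta>" using drift_diff(2)[OF w, of s t] st by (simp add: \<Delta>_def)
  then have bb2: "(norm ?b)\<^sup>2 \<le> K\<^sup>2 * \<Delta>\<^sup>2" using power_mono[OF bb, of 2] by (simp add: power_mult_distrib)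
  have hb: "(norm (Y t w - x))\<^sup>2 \<le> 2 * (K\<^sup>2 * \<Delta>\<^sup>2) + 2 * ?u"
    unfolding h using norm_sq_le_two[of ?b d] bb2 by linarith
  have sT: "s \<in> {0..T}" using st by auto
  have AB: "norm ?A \<le> B" using B(2)[OF sT Y_bounded[of s w]] by (simp add: x_def)
  have "v t (Y t w) - v s x \<ge> (t - s) * time_deriv T v s x + space_grad v s x \<bullet> (Y t w - x) + 1/2 * ((Y t w - x) \<bullet> (?A *v (Y t w - x)))
    - ((t - s) + real CARD('n) ^ 2 * (norm (Y t w - x))\<^sup>2) * (\<epsilon> + C * ((t - s)\<^sup>2 + (norm (Y t w - x))\<^sup>2))"
    by (rule C12_taylor_lower[where R=R, OF v e C], rule mod) (use st Y_bounded in \<open>auto simp: x_def\<close>)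
  then have tl: "v t (Y t w) - v s x \<ge> \<Delta> * time_deriv T v s x + space_grad v s x \<bullet> (?b + d) + 1/2 * ((?b + d) \<bullet> (?A *v (?b + d)))
    - (\<Delta> + cn * (norm (Y t w - x))\<^sup>2) * (\<epsilon> + C * (\<Delta>\<^sup>2 + (norm (Y t w - x))\<^sup>2))"
    unfolding \<Delta>_def[symmetric] cn_def[symmetric] h .
  have f1: "\<Delta> + cn * (norm (Y t w - x))\<^sup>2 \<le> \<alpha> * \<Delta> + 2 * cn * ?u"
  proof -
    have "cn * (norm (Y t w - x))\<^sup>2 \<le> cn * (2 * (K\<^sup>2 * \<Delta>\<^sup>2) + 2 * ?u)" using consts_nonneg hb by (intro mult_left_mono)
    also have "\<dots> \<le> cn * (2 * (K\<^sup>2 * (T * \<Delta>)) + 2 * ?u)"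
      using consts_nonneg DT by (intro mult_left_mono add_right_mono) auto
    finally show ?thesis by (simp add: \<alpha>_def algebra_simps)
  qed
  have f2: "\<epsilon> + C * (\<Delta>\<^sup>2 + (norm (Y t w - x))\<^sup>2) \<le> \<epsilon> + \<gamma> * \<Delta> + 2 * C * ?u"
  proof -
    have "C * (\<Delta>\<^sup>2 + (norm (Y t w - x))\<^sup>2) \<le> C * (\<Delta>\<^sup>2 + (2 * (K\<^sup>2 * \<Delta>\<^sup>2) + 2 * ?u))" using C hb by (intro mult_left_mono add_left_mono)
    also have "\<dots> \<le> C * (T * \<Delta> + (2 * (K\<^sup>2 * (T * \<Delta>)) + 2 * ?u))"
      using C DT by (intro mult_left_mono add_mono add_right_mono) auto
    finally show ?thesis by (simp add: \<gamma>_def algebra_simps)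
  qed
  have g0: "0 \<le> \<gamma>" using C T by (simp add: \<gamma>_def)
  have "(\<Delta> + cn * (norm (Y t w - x))\<^sup>2) * (\<epsilon> + C * (\<Delta>\<^sup>2 + (norm (Y t w - x))\<^sup>2)) \<le> (\<alpha> * \<Delta> + 2 * cn * ?u) * (\<epsilon> + \<gamma> * \<Delta> + 2 * C * ?u)"
    using f1 f2 D consts_nonneg e C by (intro mult_mono) (auto intro!: add_nonneg_nonneg mult_nonneg_nonneg)
  also have "\<dots> = \<alpha> * \<Delta> * (\<epsilon> + \<gamma> * \<Delta>) + (2 * C * \<alpha> * \<Delta> + 2 * cn * (\<epsilon> + \<gamma> * \<Delta>)) * ?u + 4 * cn * C * (norm d) ^ 4"
    by (simp add: algebra_simps power2_eq_square power4_eq_xxxx)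
  finally have P: "(\<Delta> + cn * (norm (Y t w - x))\<^sup>2) * (\<epsilon> + C * (\<Delta>\<^sup>2 + (norm (Y t w - x))\<^sup>2)) \<le> \<dots>" .
  have qf: "\<bar>y \<bullet> (?A *v z)\<bar> \<le> cn * (B * ny * nz)" if "norm y \<le> ny" "norm z \<le> nz" for y z :: "real^'n" and ny nz
  proof -
    have n: "0 \<le> ny" "0 \<le> nz" using that norm_ge_zero order_trans by blast+
    have "\<bar>y \<bullet> (?A *v z)\<bar> \<le> cn * (norm ?A * norm y * norm z)" unfolding cn_def by (rule quadratic_form_le)
    also have "\<dots> \<le> cn * (B * ny * nz)"
      using AB that consts_nonneg B(1) n by (intro mult_left_mono mult_mono) auto
    finally show ?thesis .
  qed
  have "(?b + d) \<bullet> (?A *v (?b + d)) = d \<bullet> (?A *v d) + ?b \<bullet> (?A *v d) + d \<bullet> (?A *v ?b) + ?b \<bullet> (?A *v ?b)"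
    by (simp add: matrix_vector_right_distrib inner_add_left inner_add_right)
  moreover have "\<bar>?b \<bullet> (?A *v d)\<bar> \<le> cn * (B * (K * \<Delta>) * norm d)" "\<bar>d \<bullet> (?A *v ?b)\<bar> \<le> cn * (B * norm d * (K * \<Delta>))"
    "\<bar>?b \<bullet> (?A *v ?b)\<bar> \<le> cn * (B * (K * \<Delta>) * (K * \<Delta>))"
    using bb by (intro qf; simp)+
  moreover have "cn * (B * norm d * (K * \<Delta>)) = cn * B * K * \<Delta> * norm d" "cn * (B * (K * \<Delta>) * norm d) = cn * B * K * \<Delta> * norm d"
    "cn * (B * (K * \<Delta>) * (K * \<Delta>)) = cn * B * K\<^sup>2 * \<Delta>\<^sup>2"
    by (simp_all add: power2_eq_square mult_ac)
  ultimately have Q: "1/2 * ((?b + d) \<bullet> (?A *v (?b + d))) \<ge> 1/2 * (d \<bullet> (?A *v d)) - cn * B * K * \<Delta> * norm d - 1/2 * (cn * B * K\<^sup>2 * \<Delta>\<^sup>2)"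
    by linarith
  have nd: "norm d \<le> \<epsilon> + ?u / \<epsilon>"
  proof (cases "norm d \<le> \<epsilon>")
    case True then show ?thesis using e by (simp add: add_increasing2)
  next
    case False
    then have "norm d * \<epsilon> \<le> norm d * norm d" by (intro mult_left_mono) auto
    then have "norm d \<le> ?u / \<epsilon>" using e by (simp add: field_simps power2_eq_square)
    then show ?thesis using e by simp
  qed
  have "cn * B * K * \<Delta> * norm d \<le> cn * B * K * \<Delta> * (\<epsilon> + ?u / \<epsilon>)"
    using nd consts_nonneg B(1) K(1) D by (intro mult_left_mono) auto
  also have "\<dots> = cn * B * K * \<Delta> * \<epsilon> + cn * B * K * \<Delta> / \<epsilon> * ?u" by (simp add: algebra_simps)
  finally have N: "cn * B * K * \<Delta> * norm d \<le> \<dots>" .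
  have "space_grad v s x \<bullet> (?b + d) = space_grad v s x \<bullet> ?b + space_grad v s x \<bullet> d" by (rule inner_add_right)
  moreover have "(2 * C * \<alpha> * \<Delta> + 2 * cn * (\<epsilon> + \<gamma> * \<Delta>) + cn * B * K * \<Delta> / \<epsilon>) * ?u =
    (2 * C * \<alpha> * \<Delta> + 2 * cn * (\<epsilon> + \<gamma> * \<Delta>)) * ?u + cn * B * K * \<Delta> / \<epsilon> * ?u" by (rule distrib_right)
  ultimately show ?thesis using tl P Q N by linarith
qed

text \<open>The generator integrated over [s, t] with the derivatives of \<open>v\<close> frozen at
  (s, \<open>Y s\<close>) and the coefficients running along the path. It is what the leading Taylor
  terms become when the product of martingale increments is replaced by the integrated
  covariance.\<close>

definition \<Psi> :: "real \<Rightarrow> real \<Rightarrow> 'a \<Rightarrow> real" where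
  "\<Psi> s t w = (t - s) * time_deriv T v s (Y s w) + space_grad v s (Y s w) \<bullet> (drift t w - drift s w)
    + 1/2 * (\<Sum>i\<in>UNIV. \<Sum>j\<in>UNIV. space_hessian v s (Y s w) $ i $ j * (\<integral>r. indicator {s..t} r * covar i j r w \<partial>lborel))"

lemma covar_joint: "s \<ge> 0 \<Longrightarrow> (\<lambda>w. \<integral>r. indicator {s..t} r * covar i j r w \<partial>lborel) \<in> borel_measurable M"
proof -
  assume s: "s \<ge> 0"
  have H: "progressively_measurable F H" using ito by (auto simp: is_ito_integral_def)
  have [measurable]: "(\<lambda>(w, r). indicator {0..max 0 t} r *\<^sub>R H r w) \<in> borel_measurable (M \<Otimes>\<^sub>M borel)"
    using measurable_pair_swap[OF progressively_measurable_joint[OF H, of "max 0 t"]] by simp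
  have e: "indicator {s..t} r * covar i j r w =
      (if r \<le> \<rho> w then indicator {s..t} r * (\<Sum>a\<in>UNIV. (indicator {0..max 0 t} r *\<^sub>R H r w) $ i $ a * (indicator {0..max 0 t} r *\<^sub>R H r w) $ j $ a) else 0)" for r w
    using s by (auto simp: covar_def indicator_def)
  show ?thesis unfolding e
    by (intro sigma_finite_measure.borel_measurable_lebesgue_integral sigma_finite_lborel) measurable
qed

text \<open>The entries of the gradient and the Hessian at (s, \<open>Y s\<close>) are bounded and
  known at time s, so they serve as test functions \<open>Z\<close>: the term linear in the
  martingale increment vanishes in expectation, and the quadratic one turns into the covariance term
  of \<open>\<Psi>\<close>.\<close>

lemma step_expectation:
  assumes e: "0 < \<epsilon>" and C: "0 \<le> C"
    and mod: "\<And>t x s y. t \<in> {0..T} \<Longrightarrow> s \<in> {0..T} \<Longrightarrow> norm x \<le> R \<Longrightarrow> norm y \<le> R \<Longrightarrow>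
    \<bar>time_deriv T v s y - time_deriv T v t x\<bar> \<le> \<epsilon> + C * ((s - t)\<^sup>2 + (norm (y - x))\<^sup>2) \<and>
    norm (space_hessian v s y - space_hessian v t x) \<le> \<epsilon> + C * ((s - t)\<^sup>2 + (norm (y - x))\<^sup>2)"
    and st: "0 \<le> s" "s < t" "t \<le> T"
  defines "\<Delta> \<equiv> t - s" and "\<gamma> \<equiv> C * (1 + 2 * K\<^sup>2) * T"
  shows "integrable M (\<Psi> s t)"
    "expectation (\<lambda>w. v t (Y t w)) - expectation (\<lambda>w. v s (Y s w)) \<ge> expectation (\<Psi> s t)
    - ((\<alpha> * \<Delta> * (\<epsilon> + \<gamma> * \<Delta>) + cn * B * K * \<Delta> * \<epsilon> + 1/2 * cn * B * K\<^sup>2 * \<Delta>\<^sup>2)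
      + (2 * C * \<alpha> * \<Delta> + 2 * cn * (\<epsilon> + \<gamma> * \<Delta>) + cn * B * K * \<Delta> / \<epsilon>) * (c1 * \<Delta>) + 4 * cn * C * (c2 * \<Delta>\<^sup>2))"
proof -
  have sT: "s \<in> {0..T}" and tT: "t \<in> {0..T}" using st by auto
  note [measurable] = C12_measurable[OF v sT] C12_measurable[OF v tT] Y_measurable[OF sT] Y_measurable[OF tT]
    mart_measurable[OF sT] mart_measurable[OF tT] covar_joint[OF st(1)]
  define q0 where "q0 = \<alpha> * \<Delta> * (\<epsilon> + \<gamma> * \<Delta>) + cn * B * K * \<Delta> * \<epsilon> + 1/2 * cn * B * K\<^sup>2 * \<Delta>\<^sup>2"
  define q1 where "q1 = 2 * C * \<alpha> * \<Delta> + 2 * cn * (\<epsilon> + \<gamma> * \<Delta>) + cn * B * K * \<Delta> / \<epsilon>"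
  define q2 where "q2 = 4 * cn * C"
  have D: "0 < \<Delta>" using st by (simp add: \<Delta>_def)
  have g0: "0 \<le> \<gamma>" using C T by (simp add: \<gamma>_def)
  have q: "0 \<le> q1" "0 \<le> q2"
    using D e C g0 consts_nonneg B(1) K(1) by (auto simp: q1_def q2_def intro!: add_nonneg_nonneg mult_nonneg_nonneg)
  define d where "d w = mart t w - mart s w" for w
  have dm[measurable]: "d \<in> borel_measurable M" unfolding d_def[abs_def] by measurable
  define G where "G w = space_grad v s (Y s w)" for w
  define A where "A w = space_hessian v s (Y s w)" for w
  have YF: "Y s \<in> borel_measurable (F s)" using Y_adapted[OF sT] .
  have GF: "(\<lambda>w. G w $ i) \<in> borel_measurable (F s)" for i
    unfolding G_def by (intro borel_measurable_vec_nth measurable_compose[OF YF C12_measurable(3)[OF v sT]])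
  have AF: "(\<lambda>w. A w $ i $ j) \<in> borel_measurable (F s)" for i j
    unfolding A_def by (intro borel_measurable_vec_nth measurable_compose[OF YF C12_measurable(4)[OF v sT]])
  note [measurable] = GF[THEN measurable_filtration] AF[THEN measurable_filtration]
  note Bs = B(2)[OF sT Y_bounded]
  have Gb: "\<bar>G w $ i\<bar> \<le> B" for w i
    using Bs[of s w] component_le_norm_cart[of "G w" i] by (simp add: G_def)
  have Ab: "\<bar>A w $ i $ j\<bar> \<le> B" for w i j
    using Bs[of s w] abs_entry_le_norm[of "A w" i j] by (simp add: A_def)
  define D' where "D' = 2 * R + K * (t - s)"
  have db: "norm (d w) \<le> D'" if "w \<in> space M" for w
    using mart_bound[OF that, of s t] st by (simp add: d_def D'_def)
  have dib: "\<bar>d w $ i\<bar> \<le> D'" if "w \<in> space M" for w i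
    using order_trans[OF component_le_norm_cart db[OF that]] .
  have sb: "\<bar>\<integral>r. indicator {s..t} r * covar i j r w \<partial>lborel\<bar> \<le> real CARD('k) * (K * K) * max 0 (t - s)" if "w \<in> space M" for i j w
    by (rule covar_section(2)[OF that st(1)])
  let ?S = "\<lambda>i j w. \<integral>r. indicator {s..t} r * covar i j r w \<partial>lborel"
  have i0: "integrable M (\<lambda>w. (t - s) * time_deriv T v s (Y s w))"
    using Bs by (intro integrable_mult_right integrable_const_bound[of _ B]) auto
  have i1: "integrable M (\<lambda>w. G w \<bullet> (drift t w - drift s w))"
  proof (rule integrable_const_bound[of _ "B * (K * (t - s))"])
    show "AE w in M. norm (G w \<bullet> (drift t w - drift s w)) \<le> B * (K * (t - s))"
    proof (rule AE_I2)
      fix w assume w: "w \<in> space M"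
      have "\<bar>G w \<bullet> (drift t w - drift s w)\<bar> \<le> norm (G w) * norm (drift t w - drift s w)" by (rule Cauchy_Schwarz_ineq2)
      also have "\<dots> \<le> B * (K * (t - s))"
        using Bs[of s w] drift_diff(2)[OF w, of s t] st B(1) by (intro mult_mono) (auto simp: G_def)
      finally show "norm (G w \<bullet> (drift t w - drift s w)) \<le> B * (K * (t - s))" by simp
    qed
  qed (unfold G_def, measurable)
  have i2: "integrable M (\<lambda>w. A w $ i $ j * ?S i j w)" for i j
    by (rule integrable_const_bound[of _ "B * (real CARD('k) * (K * K) * max 0 (t - s))"])
      (use Ab sb in \<open>auto intro!: AE_I2 abs_mult_le\<close>)
  show i\<Psi>: "integrable M (\<Psi> s t)"
    unfolding \<Psi>_def[abs_def] using i0 i1 i2 unfolding G_def A_def by auto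
  have i3: "integrable M (\<lambda>w. G w $ i * d w $ i)" for i
    by (rule integrable_const_bound[of _ "B * D'"]) (use Gb dib in \<open>auto intro!: AE_I2 abs_mult_le\<close>)
  have i4: "integrable M (\<lambda>w. A w $ i $ j * (d w $ i * d w $ j))" for i j
    by (rule integrable_const_bound[of _ "B * (D' * D')"]) (use Ab dib in \<open>auto intro!: AE_I2 abs_mult_le\<close>)
  have i5: "integrable M (\<lambda>w. (norm (d w)) ^ k)" for k
    by (rule integrable_const_bound[of _ "D' ^ k"]) (use db in \<open>auto intro!: AE_I2 power_mono\<close>)
  have iv: "integrable M (\<lambda>w. v t (Y t w))" "integrable M (\<lambda>w. v s (Y s w))"
    using B(2)[OF tT Y_bounded] Bs by (intro integrable_const_bound[of _ B]; simp)+
  note mm = mart_moments[OF st, folded d_def]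
  have EG: "expectation (\<lambda>w. G w \<bullet> d w) = 0"
    unfolding inner_vec_def using i3 mm(1)[OF GF Gb] by simp
  have IG: "integrable M (\<lambda>w. G w \<bullet> d w)" unfolding inner_vec_def using i3 by simp
  have IA: "integrable M (\<lambda>w. d w \<bullet> (A w *v d w))" unfolding quadratic_form_sum using i4 by simp
  have EA: "expectation (\<lambda>w. d w \<bullet> (A w *v d w)) = expectation (\<lambda>w. \<Sum>i\<in>UNIV. \<Sum>j\<in>UNIV. A w $ i $ j * ?S i j w)"
    unfolding quadratic_form_sum using i4 i2 mm(2)[OF AF Ab] by simp
  let ?q = "\<lambda>w. q0 + q1 * (norm (d w))\<^sup>2 + q2 * (norm (d w)) ^ 4"
  have iq: "integrable M ?q" using i5 by simp
  let ?L = "\<lambda>w. (t - s) * time_deriv T v s (Y s w) + G w \<bullet> (drift t w - drift s w) + G w \<bullet> d w + 1/2 * (d w \<bullet> (A w *v d w)) - ?q w"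
  have IA': "integrable M (\<lambda>w. 1/2 * (d w \<bullet> (A w *v d w)))" by (rule integrable_mult_right) (rule IA)
  note j1 = Bochner_Integration.integrable_add[OF i0 i1]
  note j2 = Bochner_Integration.integrable_add[OF j1 IG]
  note j3 = Bochner_Integration.integrable_add[OF j2 IA']
  have iL: "integrable M ?L" by (rule Bochner_Integration.integrable_diff[OF j3 iq])
  have "expectation ?L \<le> expectation (\<lambda>w. v t (Y t w) - v s (Y s w))"
  proof (rule integral_mono[OF iL])
    show "integrable M (\<lambda>w. v t (Y t w) - v s (Y s w))" using iv by simp
    fix w assume w: "w \<in> space M"
    show "?L w \<le> v t (Y t w) - v s (Y s w)"
      using step_pathwise[OF e C mod st w] unfolding q0_def q1_def q2_def d_def \<Delta>_def \<gamma>_def G_def A_def by simp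
  qed
  also have "\<dots> = expectation (\<lambda>w. v t (Y t w)) - expectation (\<lambda>w. v s (Y s w))" using iv by simp
  finally have 1: "expectation ?L \<le> \<dots>" .
  have "expectation ?L = expectation (\<lambda>w. (t - s) * time_deriv T v s (Y s w)) + expectation (\<lambda>w. G w \<bullet> (drift t w - drift s w))
      + 1/2 * expectation (\<lambda>w. d w \<bullet> (A w *v d w)) - expectation ?q"
    unfolding Bochner_Integration.integral_diff[OF j3 iq] Bochner_Integration.integral_add[OF j2 IA']
      Bochner_Integration.integral_add[OF j1 IG] Bochner_Integration.integral_add[OF i0 i1] EG by simp
  also have "expectation (\<lambda>w. (t - s) * time_deriv T v s (Y s w)) + expectation (\<lambda>w. G w \<bullet> (drift t w - drift s w))
      + 1/2 * expectation (\<lambda>w. d w \<bullet> (A w *v d w)) = expectation (\<Psi> s t)"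
  proof -
    have "expectation (\<Psi> s t) = expectation (\<lambda>w. (t - s) * time_deriv T v s (Y s w) + G w \<bullet> (drift t w - drift s w)
       + 1/2 * (\<Sum>i\<in>UNIV. \<Sum>j\<in>UNIV. A w $ i $ j * ?S i j w))"
      by (simp add: \<Psi>_def[abs_def] G_def A_def)
    also have "\<dots> = expectation (\<lambda>w. (t - s) * time_deriv T v s (Y s w)) + expectation (\<lambda>w. G w \<bullet> (drift t w - drift s w))
       + 1/2 * expectation (\<lambda>w. \<Sum>i\<in>UNIV. \<Sum>j\<in>UNIV. A w $ i $ j * ?S i j w)"
    proof -
      have i6: "integrable M (\<lambda>w. \<Sum>i\<in>UNIV. \<Sum>j\<in>UNIV. A w $ i $ j * ?S i j w)" using i2 by simp
      show ?thesis using i0 i1 i6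
        by (simp only: Bochner_Integration.integral_add Bochner_Integration.integrable_add integrable_mult_right integral_mult_right_zero)
    qed
    finally show ?thesis unfolding EA by simp
  qed
  finally have 2: "expectation ?L = expectation (\<Psi> s t) - expectation ?q" .
  have "expectation ?q = q0 + q1 * expectation (\<lambda>w. (norm (d w))\<^sup>2) + q2 * expectation (\<lambda>w. (norm (d w)) ^ 4)"
    using i5 by (simp add: prob_space)
  also have "\<dots> \<le> q0 + q1 * (c1 * \<Delta>) + q2 * (c2 * \<Delta>\<^sup>2)"
    using mm(3,4)[of "\<lambda>_. 0" 0] q unfolding \<Delta>_def by (intro add_mono mult_left_mono) auto
  finally show "expectation (\<lambda>w. v t (Y t w)) - expectation (\<lambda>w. v s (Y s w)) \<ge> expectation (\<Psi> s t)
    - ((\<alpha> * \<Delta> * (\<epsilon> + \<gamma> * \<Delta>) + cn * B * K * \<Delta> * \<epsilon> + 1/2 * cn * B * K\<^sup>2 * \<Delta>\<^sup>2)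
      + (2 * C * \<alpha> * \<Delta> + 2 * cn * (\<epsilon> + \<gamma> * \<Delta>) + cn * B * K * \<Delta> / \<epsilon>) * (c1 * \<Delta>) + 4 * cn * C * (c2 * \<Delta>\<^sup>2))"
    using 1 2 unfolding q0_def q1_def q2_def by linarith
qed

end

context stopped_diffusion begin

text \<open>The cost of a change of size m in all derivatives of \<open>v\<close>: 1 for the time
  derivative, K for the gradient against the drift, and the last summand for all entries of the
  Hessian against the covariance.\<close>

definition c3 :: real where "c3 = 1 + K + cn * (real CARD('k) * (K * K))"
text \<open>The squared drift contributes 2 K^2 (r - s)^2 \<le> 2 K^2 T (r - s), the martingale part
  2 c1 (r - s).\<close>

definition c4 :: real where "c4 = 2 * K\<^sup>2 * T + 2 * c1"

lemma c34: "1 \<le> c3" "0 \<le> c4"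
  using K consts_nonneg T by (auto simp: c3_def c4_def)

lemma Y_increment:
  assumes st: "0 \<le> s" "s \<le> r" "r \<le> T"
  shows "expectation (\<lambda>w. (norm (Y r w - Y s w))\<^sup>2) \<le> c4 * (r - s)"
proof (cases "s = r")
  case True then show ?thesis by simp
next
  case False
  then have sr: "s < r" using st by simp
  have sT: "s \<in> {0..T}" "r \<in> {0..T}" using st by auto
  note [measurable] = Y_measurable[OF sT(1)] Y_measurable[OF sT(2)] mart_measurable[OF sT(1)] mart_measurable[OF sT(2)]
  let ?d = "\<lambda>w. mart r w - mart s w"
  have id: "integrable M (\<lambda>w. (norm (?d w))\<^sup>2)"
  proof (rule integrable_const_bound[of _ "(2 * R + K * (r - s))\<^sup>2"])
    show "AE w in M. norm ((norm (?d w))\<^sup>2) \<le> (2 * R + K * (r - s))\<^sup>2"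
      using mart_bound st by (intro AE_I2) (auto intro!: power_mono)
  qed measurable
  have "expectation (\<lambda>w. (norm (Y r w - Y s w))\<^sup>2) \<le> expectation (\<lambda>w. 2 * (K * (r - s))\<^sup>2 + 2 * (norm (?d w))\<^sup>2)"
  proof (rule integral_mono_AE')
    show "integrable M (\<lambda>w. 2 * (K * (r - s))\<^sup>2 + 2 * (norm (?d w))\<^sup>2)" using id by simp
    show "AE w in M. (norm (Y r w - Y s w))\<^sup>2 \<le> 2 * (K * (r - s))\<^sup>2 + 2 * (norm (?d w))\<^sup>2"
    proof (rule AE_I2)
      fix w assume w: "w \<in> space M"
      have "Y r w - Y s w = (drift r w - drift s w) + ?d w" by (simp add: mart_def)
      then have "(norm (Y r w - Y s w))\<^sup>2 \<le> 2 * (norm (drift r w - drift s w))\<^sup>2 + 2 * (norm (?d w))\<^sup>2"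
        using norm_sq_le_two by metis
      also have "\<dots> \<le> 2 * (K * (r - s))\<^sup>2 + 2 * (norm (?d w))\<^sup>2"
        using drift_diff(2)[OF w st(1,2)] by (intro add_right_mono mult_left_mono power_mono) auto
      finally show "(norm (Y r w - Y s w))\<^sup>2 \<le> 2 * (K * (r - s))\<^sup>2 + 2 * (norm (?d w))\<^sup>2" .
    qed
  qed auto
  also have "\<dots> = 2 * (K * (r - s))\<^sup>2 + 2 * expectation (\<lambda>w. (norm (?d w))\<^sup>2)" using id by (simp add: prob_space)
  also have "\<dots> \<le> 2 * (K\<^sup>2 * (T * (r - s))) + 2 * (c1 * (r - s))"
  proof (intro add_mono mult_left_mono)
    have "(r - s)\<^sup>2 \<le> T * (r - s)" using st by (auto simp: power2_eq_square intro: mult_right_mono)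
    then show "(K * (r - s))\<^sup>2 \<le> K\<^sup>2 * (T * (r - s))" by (simp add: power_mult_distrib mult_left_mono)
    show "expectation (\<lambda>w. (norm (?d w))\<^sup>2) \<le> c1 * (r - s)" by (rule mart_moments(3)[OF st(1) sr st(3), of "\<lambda>_. 0" 0]) auto
  qed auto
  finally show ?thesis by (simp add: c4_def algebra_simps)
qed

text \<open>By Fubini the bound on each squared increment is integrated over the step. The result is
  of second order in t - s, hence negligible after summation over a partition.\<close>

lemma Y_increment_integral:
  assumes st: "0 \<le> s" "s \<le> t" "t \<le> T"
  shows "\<And>w. w \<in> space M \<Longrightarrow> integrable lborel (\<lambda>r. indicator {s..t} r * (norm (Y r w - Y s w))\<^sup>2)"
    "integrable M (\<lambda>w. \<integral>r. indicator {s..t} r * (norm (Y r w - Y s w))\<^sup>2 \<partial>lborel)"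
    "expectation (\<lambda>w. \<integral>r. indicator {s..t} r * (norm (Y r w - Y s w))\<^sup>2 \<partial>lborel) \<le> c4 * (t - s)\<^sup>2"
proof -
  have sT: "s \<in> {0..T}" using st by auto
  note [measurable] = Y_measurable[OF sT]
  interpret pair_sigma_finite M lborel ..
  let ?f = "\<lambda>w r. indicator {s..t} r * (norm (Y r w - Y s w))\<^sup>2"
  have b: "(norm (Y r w - Y s w))\<^sup>2 \<le> (2 * R)\<^sup>2" for r w
    using norm_triangle_ineq4[of "Y r w" "Y s w"] Y_bounded[of r w] Y_bounded[of s w] by (intro power_mono) auto
  have bi: "integrable lborel (\<lambda>r. indicator {s..t} r * (2 * R)\<^sup>2)"
    by (intro integrable_mult_left integrable_real_indicator) (auto simp: emeasure_lborel_Icc_eq)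
  show "integrable lborel (?f w)" if w: "w \<in> space M" for w
  proof (rule Bochner_Integration.integrable_bound[OF bi])
    show "AE r in lborel. norm (?f w r) \<le> norm (indicator {s..t} r * (2 * R)\<^sup>2)"
      using b by (intro always_eventually allI) (auto simp: indicator_def)
  qed (use w in measurable)
  have int: "integrable (M \<Otimes>\<^sub>M lborel) (\<lambda>(w, r). ?f w r)"
  proof (rule Bochner_Integration.integrable_bound)
    have "emeasure (M \<Otimes>\<^sub>M lborel) (space M \<times> {s..t}) = emeasure M (space M) * emeasure lborel {s..t}"
      by (intro lborel.emeasure_pair_measure_Times) auto
    then have "emeasure (M \<Otimes>\<^sub>M lborel) (space M \<times> {s..t}) < \<infinity>"
      by (simp add: emeasure_space_1 emeasure_lborel_Icc_eq)
    then show "integrable (M \<Otimes>\<^sub>M lborel) (\<lambda>p. indicator (space M \<times> {s..t}) p * (2 * R)\<^sup>2)"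
      by (intro integrable_mult_left integrable_real_indicator) auto
    show "AE p in M \<Otimes>\<^sub>M lborel. norm (case p of (w, r) \<Rightarrow> ?f w r) \<le> norm (indicator (space M \<times> {s..t}) p * (2 * R)\<^sup>2)"
      using b by (intro AE_I2) (auto simp: indicator_def space_pair_measure)
  qed measurable
  show "integrable M (\<lambda>w. \<integral>r. ?f w r \<partial>lborel)" using integrable_fst[OF int] .
  have "expectation (\<lambda>w. \<integral>r. ?f w r \<partial>lborel) = (\<integral>r. expectation (\<lambda>w. ?f w r) \<partial>lborel)"
    by (rule Fubini_integral[OF int, symmetric])
  also have "\<dots> \<le> (\<integral>r. indicator {s..t} r * (c4 * (t - s)) \<partial>lborel)"
  proof (rule integral_mono_AE')
    show "integrable lborel (\<lambda>r. indicator {s..t} r * (c4 * (t - s)))"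
      by (intro integrable_mult_left integrable_real_indicator) (auto simp: emeasure_lborel_Icc_eq)
    have "expectation (\<lambda>w. (norm (Y r w - Y s w))\<^sup>2) \<le> c4 * (t - s)" if "s \<le> r" "r \<le> t" for r
      using Y_increment[OF st(1) that(1)] that st c34 mult_left_mono[of "r - s" "t - s" c4] by simp
    then show "AE r in lborel. expectation (\<lambda>w. ?f w r) \<le> indicator {s..t} r * (c4 * (t - s))"
      by (intro always_eventually allI) (auto simp: indicator_def)
  qed (use c34 st in auto)
  also have "\<dots> = c4 * (t - s)\<^sup>2" using st by (simp add: power2_eq_square)
  finally show "expectation (\<lambda>w. \<integral>r. ?f w r \<partial>lborel) \<le> c4 * (t - s)\<^sup>2" .
qed

definition \<Phi> :: "real \<Rightarrow> 'a \<Rightarrow> real" where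
  "\<Phi> r w = (if r \<le> \<rho> w then generator b \<sigma> T v r (Y r w) else time_deriv T v r (Y r w))"

lemma frozen_generator:
  assumes m0: "0 \<le> m" and w: "w \<in> space M" and r: "0 < r" "r \<le> T" and s: "s \<in> {0..T}"
    and m: "\<bar>time_deriv T v s (Y s w) - time_deriv T v r (Y r w)\<bar> \<le> m"
      "norm (space_grad v s (Y s w) - space_grad v r (Y r w)) \<le> m"
      "norm (space_hessian v s (Y s w) - space_hessian v r (Y r w)) \<le> m"
  shows "\<Phi> r w - c3 * m \<le> time_deriv T v s (Y s w) + space_grad v s (Y s w) \<bullet> \<beta> r w
    + 1/2 * (\<Sum>i\<in>UNIV. \<Sum>j\<in>UNIV. space_hessian v s (Y s w) $ i $ j * covar i j r w)"
proof (cases "r \<le> \<rho> w")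
  case False
  then have "\<beta> r w = 0" "covar i j r w = 0" for i j by (simp_all add: \<beta>_def covar_def)
  moreover have "m \<le> c3 * m" using mult_right_mono[OF c34(1) m0] by simp
  ultimately show ?thesis using m(1) False by (simp add: \<Phi>_def)
next
  case True
  let ?g = "space_grad v s (Y s w)" and ?g' = "space_grad v r (Y r w)"
  let ?A = "space_hessian v s (Y s w)" and ?A' = "space_hessian v r (Y r w)"
  have P: "\<Phi> r w = time_deriv T v r (Y r w) + ?g' \<bullet> \<beta> r w + 1/2 * (\<Sum>i\<in>UNIV. \<Sum>j\<in>UNIV. ?A' $ i $ j * covar i j r w)"
    using True covar_eq[OF w r(1)] by (simp add: \<Phi>_def generator_eq \<beta>_def)
  have 1: "\<bar>(?g - ?g') \<bullet> \<beta> r w\<bar> \<le> m * K"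
    by (rule order_trans[OF Cauchy_Schwarz_ineq2 mult_mono[OF m(2) \<beta>_bound m0 norm_ge_zero]])
  have "\<bar>\<Sum>i\<in>UNIV. \<Sum>j\<in>UNIV. (?A - ?A') $ i $ j * covar i j r w\<bar> \<le> (\<Sum>i\<in>(UNIV::'n set). \<Sum>j\<in>(UNIV::'n set). m * (real CARD('k) * (K * K)))"
    by (intro order_trans[OF sum_abs] sum_mono abs_mult_le order_trans[OF abs_entry_le_norm m(3)] covar_bound[OF w r(1)])
  also have "\<dots> = cn * (real CARD('k) * (K * K)) * m" by (simp add: cn_def power2_eq_square)
  finally have 2: "\<bar>\<Sum>i\<in>UNIV. \<Sum>j\<in>UNIV. (?A - ?A') $ i $ j * covar i j r w\<bar> \<le> cn * (real CARD('k) * (K * K)) * m" .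
  have d: "(\<Sum>i\<in>UNIV. \<Sum>j\<in>UNIV. ?A $ i $ j * covar i j r w) - (\<Sum>i\<in>UNIV. \<Sum>j\<in>UNIV. ?A' $ i $ j * covar i j r w) =
     (\<Sum>i\<in>UNIV. \<Sum>j\<in>UNIV. (?A - ?A') $ i $ j * covar i j r w)"
    by (simp add: sum_subtractf left_diff_distrib)
  have c: "c3 * m = m + m * K + cn * (real CARD('k) * (K * K)) * m" by (simp add: c3_def algebra_simps)
  have "(?g - ?g') \<bullet> \<beta> r w = ?g \<bullet> \<beta> r w - ?g' \<bullet> \<beta> r w" by (rule inner_diff_left)
  then show ?thesis using 1 2 d m(1) unfolding P c by linarith
qed

text \<open>\<open>\<Psi>\<close> is an integral over [s, t] whose integrand is compared with
  \<open>\<Phi>\<close> at each time; the modulus leaves the squared displacement of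
  \<open>Y\<close>, kept as an integral for the preceding estimate. The bound on
  \<open>\<Phi>\<close> is asked for almost every time only: at the exit time itself
  \<open>\<Phi>\<close> is the generator while \<open>Y\<close> may be on the frontier, where no
  sign of the generator is assumed.\<close>

lemma \<Psi>_lower:
  assumes e: "0 < \<epsilon>" and C: "0 \<le> C"
    and mod: "\<And>t x s y. t \<in> {0..T} \<Longrightarrow> s \<in> {0..T} \<Longrightarrow> norm x \<le> R \<Longrightarrow> norm y \<le> R \<Longrightarrow>
    \<bar>time_deriv T v s y - time_deriv T v t x\<bar> \<le> \<epsilon> + C * ((s - t)\<^sup>2 + (norm (y - x))\<^sup>2) \<and>
    norm (space_grad v s y - space_grad v t x) \<le> \<epsilon> + C * ((s - t)\<^sup>2 + (norm (y - x))\<^sup>2) \<and>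
    norm (space_hessian v s y - space_hessian v t x) \<le> \<epsilon> + C * ((s - t)\<^sup>2 + (norm (y - x))\<^sup>2)"
    and st: "0 \<le> s" "s < t" "t \<le> T" and w: "w \<in> space M"
    and l: "AE r in lborel. r \<in> {0..T} \<longrightarrow> - l \<le> \<Phi> r w"
  shows "\<Psi> s t w \<ge> - l * (t - s) - c3 * ((\<epsilon> + C * (t - s)\<^sup>2) * (t - s) + C * (\<integral>r. indicator {s..t} r * (norm (Y r w - Y s w))\<^sup>2 \<partial>lborel))"
proof -
  have sT: "s \<in> {0..T}" using st by auto
  let ?i = "\<lambda>r. indicator {s..t} r :: real"
  let ?A = "space_hessian v s (Y s w)" and ?g = "space_grad v s (Y s w)" and ?p = "time_deriv T v s (Y s w)"
  have ii: "integrable lborel (\<lambda>r. ?i r * c)" for c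
    by (intro integrable_mult_left integrable_real_indicator) (auto simp: emeasure_lborel_Icc_eq)
  have i1: "integrable lborel (\<lambda>r. ?g \<bullet> (?i r *\<^sub>R \<beta> r w))" by (intro integrable_inner_right \<beta>_integrable[OF w])
  have i2: "integrable lborel (\<lambda>r. \<Sum>i\<in>UNIV. \<Sum>j\<in>UNIV. ?A $ i $ j * (?i r * covar i j r w))"
    using covar_section(1)[OF w st(1)] by (intro Bochner_Integration.integrable_sum integrable_mult_right)
  have i2': "integrable lborel (\<lambda>r. 1/2 * (\<Sum>i\<in>UNIV. \<Sum>j\<in>UNIV. ?A $ i $ j * (?i r * covar i j r w)))"
    by (rule integrable_mult_right) (rule i2)
  note i12 = Bochner_Integration.integrable_add[OF ii i1]
  have s2: "(\<integral>r. (\<Sum>i\<in>UNIV. \<Sum>j\<in>UNIV. ?A $ i $ j * (?i r * covar i j r w)) \<partial>lborel) = (\<Sum>i\<in>UNIV. \<Sum>j\<in>UNIV. ?A $ i $ j * (\<integral>r. ?i r * covar i j r w \<partial>lborel))"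
    using covar_section(1)[OF w st(1)] by simp
  have s1: "(\<integral>r. ?g \<bullet> (?i r *\<^sub>R \<beta> r w) \<partial>lborel) = ?g \<bullet> (drift t w - drift s w)"
    unfolding drift_diff(1)[OF w st(1) less_imp_le[OF st(2)]] by (rule integral_inner_right) (rule \<beta>_integrable[OF w])
  have s0: "(\<integral>r. ?i r * c \<partial>lborel) = (t - s) * c" for c using st by simp
  have \<Psi>: "\<Psi> s t w = (\<integral>r. ?i r * ?p + ?g \<bullet> (?i r *\<^sub>R \<beta> r w) + 1/2 * (\<Sum>i\<in>UNIV. \<Sum>j\<in>UNIV. ?A $ i $ j * (?i r * covar i j r w)) \<partial>lborel)"
    unfolding Bochner_Integration.integral_add[OF i12 i2'] Bochner_Integration.integral_add[OF ii i1] integral_mult_right_zero s0 s1 s2 \<Psi>_def ..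
  let ?n = "\<lambda>r. (norm (Y r w - Y s w))\<^sup>2"
  have i3: "integrable lborel (\<lambda>r. ?i r * ?n r)" using Y_increment_integral(1)[OF st(1) less_imp_le[OF st(2)] st(3) w] .
  have i3': "integrable lborel (\<lambda>r. c3 * C * (?i r * ?n r))" by (rule integrable_mult_right) (rule i3)
  let ?k = "- l - c3 * (\<epsilon> + C * (t - s)\<^sup>2)"
  have "(\<integral>r. ?i r * ?k - c3 * C * (?i r * ?n r) \<partial>lborel) \<le> \<Psi> s t w"
    unfolding \<Psi>
  proof (rule integral_mono_AE)
    show "integrable lborel (\<lambda>r. ?i r * ?k - c3 * C * (?i r * ?n r))" by (rule Bochner_Integration.integrable_diff[OF ii i3'])
    show "integrable lborel (\<lambda>r. ?i r * ?p + ?g \<bullet> (?i r *\<^sub>R \<beta> r w) + 1/2 * (\<Sum>i\<in>UNIV. \<Sum>j\<in>UNIV. ?A $ i $ j * (?i r * covar i j r w)))"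
      by (rule Bochner_Integration.integrable_add[OF i12 i2'])
    show "AE r in lborel. ?i r * ?k - c3 * C * (?i r * ?n r) \<le> ?i r * ?p + ?g \<bullet> (?i r *\<^sub>R \<beta> r w) + 1/2 * (\<Sum>i\<in>UNIV. \<Sum>j\<in>UNIV. ?A $ i $ j * (?i r * covar i j r w))"
      using l AE_lborel_singleton[of 0]
    proof eventually_elim
      case (elim r)
      show ?case
      proof (cases "r \<in> {s..t}")
        case True
        then have r: "0 < r" "r \<le> T" "r \<in> {0..T}" using st elim by auto
        define m where "m = \<epsilon> + C * ((s - r)\<^sup>2 + (norm (Y s w - Y r w))\<^sup>2)"
        have m0: "0 \<le> m" using e C by (simp add: m_def)
        have "(s - r)\<^sup>2 \<le> (t - s)\<^sup>2" using True by (subst power2_commute, intro power_mono) auto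
        then have "C * ((s - r)\<^sup>2 + (norm (Y s w - Y r w))\<^sup>2) \<le> C * ((t - s)\<^sup>2 + ?n r)"
          using C by (intro mult_left_mono add_mono) (auto simp: norm_minus_commute)
        then have "m \<le> \<epsilon> + C * (t - s)\<^sup>2 + C * ?n r" by (simp add: m_def distrib_left)
        then have "c3 * m \<le> c3 * (\<epsilon> + C * (t - s)\<^sup>2 + C * ?n r)" using c34 by (intro mult_left_mono) auto
        also have "\<dots> = c3 * (\<epsilon> + C * (t - s)\<^sup>2) + c3 * C * ?n r" by (simp add: algebra_simps)
        finally have cm: "c3 * m \<le> \<dots>" .
        have md: "\<bar>time_deriv T v s (Y s w) - time_deriv T v r (Y r w)\<bar> \<le> m"
          "norm (space_grad v s (Y s w) - space_grad v r (Y r w)) \<le> m"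
          "norm (space_hessian v s (Y s w) - space_hessian v r (Y r w)) \<le> m"
          using mod[OF r(3) sT Y_bounded Y_bounded, of s w r w] by (auto simp: m_def)
        have "\<Phi> r w - c3 * m \<le> ?p + ?g \<bullet> \<beta> r w + 1/2 * (\<Sum>i\<in>UNIV. \<Sum>j\<in>UNIV. ?A $ i $ j * covar i j r w)"
          by (rule frozen_generator[OF m0 w r(1,2) sT md])
        moreover have "- l \<le> \<Phi> r w" using elim r by auto
        ultimately show ?thesis using True cm by (simp add: indicator_def)
      qed simp
    qed
  qed
  moreover have "(\<integral>r. ?i r * ?k - c3 * C * (?i r * ?n r) \<partial>lborel) = (t - s) * ?k - c3 * C * (\<integral>r. ?i r * ?n r \<partial>lborel)"
    unfolding Bochner_Integration.integral_diff[OF ii i3'] s0 integral_mult_right_zero ..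
  ultimately show ?thesis by (simp add: algebra_simps)
qed

text \<open>A one-sided Dynkin formula with a penalty for the bad paths. One step loses at most (L
  P(bad) + c5 \<epsilon>) \<Delta> + C' \<Delta>^2. Along a uniform partition the last term adds up
  to C' T^2 / (N + 1) and disappears as N grows with \<epsilon> fixed; then \<epsilon> tends to 0,
  which is possible because \<open>c5\<close> does not depend on it.\<close>

lemma dynkin_lower:
  assumes bad: "bad \<in> sets M" and L: "0 \<le> L"
    and \<Phi>: "\<And>w. w \<in> space M \<Longrightarrow> AE r in lborel. r \<in> {0..T} \<longrightarrow> - (L * indicator bad w) \<le> \<Phi> r w"
  shows "expectation (\<lambda>w. v T (Y T w)) \<ge> expectation (\<lambda>w. v 0 (Y 0 w)) - L * T * prob bad"
proof -
  define c5 where "c5 = c3 + \<alpha> + cn * B * K + 2 * cn * c1"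
  let ?E = "\<lambda>t. expectation (\<lambda>w. v t (Y t w))"
  have step: "\<exists>C'. \<forall>s t. 0 \<le> s \<longrightarrow> s < t \<longrightarrow> t \<le> T \<longrightarrow>
      ?E t - ?E s \<ge> - (L * prob bad + c5 * \<epsilon>) * (t - s) - C' * (t - s)\<^sup>2" if e: "0 < \<epsilon>" for \<epsilon>
  proof -
    obtain C where C: "C \<ge> 0" and mod: "\<And>t x s y. t \<in> {0..T} \<Longrightarrow> s \<in> {0..T} \<Longrightarrow> norm x \<le> R \<Longrightarrow> norm y \<le> R \<Longrightarrow>
      \<bar>time_deriv T v s y - time_deriv T v t x\<bar> \<le> \<epsilon> + C * ((s - t)\<^sup>2 + (norm (y - x))\<^sup>2) \<and>
      norm (space_grad v s y - space_grad v t x) \<le> \<epsilon> + C * ((s - t)\<^sup>2 + (norm (y - x))\<^sup>2) \<and>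
      norm (space_hessian v s y - space_hessian v t x) \<le> \<epsilon> + C * ((s - t)\<^sup>2 + (norm (y - x))\<^sup>2)"
      using C12_modulus[OF v e, of R] by blast
    define \<gamma> where "\<gamma> = C * (1 + 2 * K\<^sup>2) * T"
    \<comment> \<open>The coefficients of \<Delta>^2, one factor of the cubic term being bounded by
      T. It depends on \<epsilon>, through the modulus constant \<open>C\<close> and through 1 /
      \<epsilon>, but not on the step.\<close>
    define C' where "C' = c3 * C * (T + c4) + \<alpha> * \<gamma> + 1/2 * cn * B * K\<^sup>2 + c1 * (2 * C * \<alpha> + 2 * cn * \<gamma> + cn * B * K / \<epsilon>) + 4 * cn * C * c2"
    have "?E t - ?E s \<ge> - (L * prob bad + c5 * \<epsilon>) * (t - s) - C' * (t - s)\<^sup>2" if st: "0 \<le> s" "s < t" "t \<le> T" for s t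
    proof -
      define \<Delta> where "\<Delta> = t - s"
      have D: "0 < \<Delta>" "\<Delta> \<le> T" using st by (auto simp: \<Delta>_def)
      let ?n = "\<lambda>w. \<integral>r. indicator {s..t} r * (norm (Y r w - Y s w))\<^sup>2 \<partial>lborel"
      note yi = Y_increment_integral[OF st(1) less_imp_le[OF st(2)] st(3)]
      have mod': "\<bar>time_deriv T v s y - time_deriv T v t x\<bar> \<le> \<epsilon> + C * ((s - t)\<^sup>2 + (norm (y - x))\<^sup>2) \<and>
        norm (space_hessian v s y - space_hessian v t x) \<le> \<epsilon> + C * ((s - t)\<^sup>2 + (norm (y - x))\<^sup>2)"
        if "t \<in> {0..T}" "s \<in> {0..T}" "norm x \<le> R" "norm y \<le> R" for t x s y
        using mod[OF that] by blast
      note se = step_expectation[OF e C mod' st, folded \<Delta>_def \<gamma>_def]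
      let ?low = "\<lambda>w. (- L * \<Delta>) * indicator bad w - c3 * ((\<epsilon> + C * \<Delta>\<^sup>2) * \<Delta>) - c3 * C * ?n w"
      have il: "integrable M (\<lambda>w. (- L * \<Delta>) * indicator bad w)" "integrable M (\<lambda>w. c3 * ((\<epsilon> + C * \<Delta>\<^sup>2) * \<Delta>))" "integrable M (\<lambda>w. c3 * C * ?n w)"
        using bad yi(2) by (auto intro!: integrable_mult_right integrable_real_indicator simp: less_top[symmetric])
      note ild = Bochner_Integration.integrable_diff[OF il(1,2)]
      have "expectation ?low \<le> expectation (\<Psi> s t)"
      proof (rule integral_mono)
        show "integrable M ?low" by (rule Bochner_Integration.integrable_diff[OF ild il(3)])
        show "integrable M (\<Psi> s t)" using se(1) by auto
        fix w assume w: "w \<in> space M"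
        show "?low w \<le> \<Psi> s t w"
          using \<Psi>_lower[OF e C mod st w \<Phi>[OF w]] by (simp add: \<Delta>_def[symmetric] algebra_simps)
      qed
      moreover have "expectation ?low = (- L * \<Delta>) * prob bad - c3 * ((\<epsilon> + C * \<Delta>\<^sup>2) * \<Delta>) - c3 * C * expectation ?n"
        unfolding Bochner_Integration.integral_diff[OF ild il(3)] Bochner_Integration.integral_diff[OF il(1,2)] integral_mult_right_zero
        using bad by (simp add: prob_space)
      moreover have "c3 * C * expectation ?n \<le> c3 * C * (c4 * \<Delta>\<^sup>2)"
        using yi(3) c34 C unfolding \<Delta>_def by (intro mult_left_mono) auto
      moreover have "c3 * ((\<epsilon> + C * \<Delta>\<^sup>2) * \<Delta>) \<le> c3 * (\<epsilon> * \<Delta> + C * (T * \<Delta>\<^sup>2))"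
      proof -
        have "C * \<Delta>\<^sup>2 * \<Delta> \<le> C * \<Delta>\<^sup>2 * T" using C D by (intro mult_left_mono) auto
        then show ?thesis using c34 by (intro mult_left_mono) (auto simp: algebra_simps)
      qed
      moreover have "?E t - ?E s \<ge> expectation (\<Psi> s t)
        - ((\<alpha> * \<Delta> * (\<epsilon> + \<gamma> * \<Delta>) + cn * B * K * \<Delta> * \<epsilon> + 1/2 * cn * B * K\<^sup>2 * \<Delta>\<^sup>2)
        + (2 * C * \<alpha> * \<Delta> + 2 * cn * (\<epsilon> + \<gamma> * \<Delta>) + cn * B * K * \<Delta> / \<epsilon>) * (c1 * \<Delta>) + 4 * cn * C * (c2 * \<Delta>\<^sup>2))"
        by (rule se(2)) auto
      moreover have "(L * prob bad + c5 * \<epsilon>) * \<Delta> + C' * \<Delta>\<^sup>2 = L * \<Delta> * prob bad + c3 * (\<epsilon> * \<Delta> + C * (T * \<Delta>\<^sup>2)) + c3 * C * (c4 * \<Delta>\<^sup>2)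
        + ((\<alpha> * \<Delta> * (\<epsilon> + \<gamma> * \<Delta>) + cn * B * K * \<Delta> * \<epsilon> + 1/2 * cn * B * K\<^sup>2 * \<Delta>\<^sup>2)
        + (2 * C * \<alpha> * \<Delta> + 2 * cn * (\<epsilon> + \<gamma> * \<Delta>) + cn * B * K * \<Delta> / \<epsilon>) * (c1 * \<Delta>) + 4 * cn * C * (c2 * \<Delta>\<^sup>2))"
        by (simp add: C'_def c5_def algebra_simps power2_eq_square)
      moreover have "- (L * prob bad + c5 * \<epsilon>) * \<Delta> - C' * \<Delta>\<^sup>2 = - ((L * prob bad + c5 * \<epsilon>) * \<Delta> + C' * \<Delta>\<^sup>2)" "(- L * \<Delta>) * prob bad = - (L * \<Delta> * prob bad)"
        by (simp_all add: algebra_simps)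
      ultimately have "- (L * prob bad + c5 * \<epsilon>) * \<Delta> - C' * \<Delta>\<^sup>2 \<le> ?E t - ?E s" by linarith
      then show ?thesis by (simp only: \<Delta>_def)
    qed
    then show ?thesis by blast
  qed
  have eps: "?E T - ?E 0 \<ge> - (L * prob bad + c5 * \<epsilon>) * T" if e: "0 < \<epsilon>" for \<epsilon>
  proof -
    obtain C' where C': "\<And>s t. 0 \<le> s \<Longrightarrow> s < t \<Longrightarrow> t \<le> T \<Longrightarrow> ?E t - ?E s \<ge> - (L * prob bad + c5 * \<epsilon>) * (t - s) - C' * (t - s)\<^sup>2"
      using step[OF e] by blast
    have N: "- (L * prob bad + c5 * \<epsilon>) * T - C' * T\<^sup>2 * inverse (real (Suc N)) \<le> ?E T - ?E 0" for N
    proof -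
      define h where "h = T / real (Suc N)"
      have h: "0 < h" "h * real (Suc N) = T" using T by (auto simp: h_def)
      have "(\<Sum>i<Suc N. - (L * prob bad + c5 * \<epsilon>) * h - C' * h\<^sup>2) \<le> (\<Sum>i<Suc N. ?E (h * real (Suc i)) - ?E (h * real i))"
      proof (rule sum_mono)
        fix i assume "i \<in> {..<Suc N}"
        then have "h * real (Suc i) \<le> h * real (Suc N)" using h by (intro mult_left_mono) auto
        then have "h * real (Suc i) \<le> T" unfolding h(2) .
        moreover have "h * real (Suc i) - h * real i = h" by (simp add: algebra_simps)
        ultimately show "- (L * prob bad + c5 * \<epsilon>) * h - C' * h\<^sup>2 \<le> ?E (h * real (Suc i)) - ?E (h * real i)"
          using C'[of "h * real i" "h * real (Suc i)"] h by (simp add: algebra_simps)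
      qed
      also have "\<dots> = ?E (h * real (Suc N)) - ?E (h * real 0)" by (rule sum_lessThan_telescope[of "\<lambda>i. ?E (h * real i)"])
      also have "\<dots> = ?E T - ?E 0" by (simp only: h(2)) simp
      also have "(\<Sum>i<Suc N. - (L * prob bad + c5 * \<epsilon>) * h - C' * h\<^sup>2) = - (L * prob bad + c5 * \<epsilon>) * T - C' * T\<^sup>2 * inverse (real (Suc N))"
      proof -
        have "real (Suc N) * h\<^sup>2 = T\<^sup>2 * inverse (real (Suc N))"
        proof -
          have "real (Suc N) * h\<^sup>2 = h * real (Suc N) * h" by (simp only: power2_eq_square mult_ac)
          also have "\<dots> = T * h" unfolding h(2) ..
          finally show ?thesis by (simp only: h_def power2_eq_square divide_inverse mult.assoc)
        qed
        moreover have "(\<Sum>i<Suc N. - (L * prob bad + c5 * \<epsilon>) * h - C' * h\<^sup>2) = - (L * prob bad + c5 * \<epsilon>) * (h * real (Suc N)) - C' * (real (Suc N) * h\<^sup>2)"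
          by (simp only: sum_constant card_lessThan) (simp only: algebra_simps)
        ultimately show ?thesis by (simp only: h(2) mult.assoc)
      qed
      finally show ?thesis .
    qed
    have "(\<lambda>N. - (L * prob bad + c5 * \<epsilon>) * T - C' * T\<^sup>2 * inverse (real (Suc N))) \<longlonglongrightarrow> - (L * prob bad + c5 * \<epsilon>) * T - C' * T\<^sup>2 * 0"
      by (intro tendsto_diff tendsto_const tendsto_mult_left LIMSEQ_inverse_real_of_nat)
    then have "- (L * prob bad + c5 * \<epsilon>) * T - C' * T\<^sup>2 * 0 \<le> ?E T - ?E 0"
      by (rule LIMSEQ_le_const2) (use N in blast)
    then show ?thesis by simp
  qed
  have c5: "0 \<le> c5" using c34 consts_nonneg B(1) K(1) by (auto simp: c5_def intro!: add_nonneg_nonneg mult_nonneg_nonneg)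
  show ?thesis
  proof (rule field_le_epsilon)
    fix e :: real assume e: "0 < e"
    define \<epsilon> where "\<epsilon> = e / (c5 * T + 1)"
    have p: "0 < c5 * T + 1" using c5 T by (simp add: add_nonneg_pos)
    then have "0 < \<epsilon>" using e by (simp add: \<epsilon>_def)
    moreover have "c5 * \<epsilon> * T \<le> e"
    proof -
      have "c5 * \<epsilon> * T = e * (c5 * T / (c5 * T + 1))" by (simp add: \<epsilon>_def mult_ac)
      also have "\<dots> \<le> e * 1" using p e by (intro mult_left_mono) auto
      finally show ?thesis by simp
    qed
    ultimately show "?E 0 - L * T * prob bad \<le> ?E T + e" using eps[of \<epsilon>] by (simp add: algebra_simps)
  qed
qed

end

subsection \<open>Exit times\<close>

text \<open>Replaces an uncountable quantifier by countable ones, for measurability. On the compact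
  interval the distance to the complement attains a positive minimum; conversely a bound at the
  rational multiples of t extends to all times by continuity. The complement must be nonempty
  because \<open>infdist\<close> to the empty set is 0.\<close>

lemma path_stays_in_open_iff:
  fixes f :: "real \<Rightarrow> 'b::metric_space"
  assumes f: "continuous_on {0..t} f" and t: "0 \<le> t" and G: "open G" "- G \<noteq> {}"
  shows "(\<forall>s\<in>{0..t}. f s \<in> G) \<longleftrightarrow>
    (\<exists>n::nat. \<forall>q::rat. 0 \<le> q \<and> q \<le> 1 \<longrightarrow> inverse (real (Suc n)) \<le> infdist (f (of_rat q * t)) (- G))"
    (is "?l \<longleftrightarrow> ?r")
proof
  let ?g = "\<lambda>s. infdist (f s) (- G)"
  have g: "continuous_on {0..t} ?g" using f by (intro continuous_intros)
  have cl: "closed (- G)" using G(1) by (rule closed_Compl)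
  have qt: "of_rat q * t \<in> {0..t}" if "0 \<le> q" "q \<le> 1" for q
    using that t by (auto simp: mult_left_le_one_le)
  { assume l: ?l
    obtain s0 where s0: "s0 \<in> {0..t}" "\<And>s. s \<in> {0..t} \<Longrightarrow> ?g s0 \<le> ?g s"
      using continuous_attains_inf[OF _ _ g] t by auto
    have "f s0 \<notin> - G" using l s0(1) by blast
    then have "?g s0 \<noteq> 0" using in_closed_iff_infdist_zero[OF cl G(2), of "f s0"] by blast
    then have "0 < ?g s0" using infdist_nonneg[of "f s0" "- G"] by linarith
    then obtain n where n: "inverse (real (Suc n)) < ?g s0" using reals_Archimedean by blast
    show ?r
    proof (intro exI[of _ n] allI impI)
      fix q :: rat assume "0 \<le> q \<and> q \<le> 1"
      then show "inverse (real (Suc n)) \<le> ?g (of_rat q * t)" using s0(2)[OF qt[of q]] n by linarith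
    qed }
  { assume ?r
    then obtain n where n: "\<And>q. 0 \<le> q \<Longrightarrow> q \<le> 1 \<Longrightarrow> inverse (real (Suc n)) \<le> ?g (of_rat q * t)" by blast
    show ?l
    proof
      fix s assume s: "s \<in> {0..t}"
      have "inverse (real (Suc n)) \<le> ?g s"
      proof (rule ccontr)
        assume less: "\<not> ?thesis"
        then obtain d where d: "d > 0" "\<And>r. r \<in> {0..t} \<Longrightarrow> dist r s < d \<Longrightarrow> dist (?g r) (?g s) < inverse (real (Suc n)) - ?g s"
          using g s unfolding continuous_on_iff by (metis diff_gt_0_iff_gt not_le)
        show False
        proof (cases "t = 0")
          case True
          then show False using n[of 0] less s by simp
        next
          case False
          then have tp: "0 < t" using t by simp
          have "max 0 ((s - d) / t) < min 1 ((s + d) / t)" using s d tp by (auto simp: field_simps)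
          then obtain q where q: "max 0 ((s - d) / t) < of_rat q" "of_rat q < min 1 ((s + d) / t)" using of_rat_dense by blast
          have "0 < (of_rat q :: real)" "(of_rat q :: real) < 1" using q by linarith+
          then have q01: "0 \<le> q" "q \<le> 1" by (simp_all add: zero_less_of_rat_iff of_rat_less_1_iff)
          have "(s - d) / t < of_rat q" "of_rat q < (s + d) / t" using q by simp_all
          then have "s - d < of_rat q * t" "of_rat q * t < s + d"
            using tp by (simp_all only: pos_divide_less_eq pos_less_divide_eq)
          then have "dist (of_rat q * t) s < d" unfolding dist_real_def by linarith
          then have "dist (?g (of_rat q * t)) (?g s) < inverse (real (Suc n)) - ?g s" by (rule d(2)[OF qt[OF q01]])
          then show False using n[OF q01] by (simp add: dist_real_def)
        qed
      qed
      then have "0 < ?g s" using inverse_positive_iff_positive[of "real (Suc n)"] by linarith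
      then have "f s \<notin> - G" using infdist_zero[of "f s" "- G"] by (intro notI) simp
      then show "f s \<in> G" by simp
    qed }
qed

text \<open>Rounding is downwards, so that the approximations of a time within the domain of a path
  remain in it.\<close>

lemma floor_grid:
  fixes r :: real
  defines "f \<equiv> \<lambda>n. real_of_int \<lfloor>r * real (Suc n)\<rfloor> * inverse (real (Suc n))"
  shows "f n \<le> r" "0 \<le> r \<Longrightarrow> 0 \<le> f n" "f \<longlonglongrightarrow> r"
proof -
  have i: "0 < inverse (real (Suc n))" for n by simp
  have r: "r * real (Suc n) * inverse (real (Suc n)) = r" for n by (simp add: mult.assoc del: of_nat_Suc)
  have le: "f n \<le> r" for n
    using mult_right_mono[of "real_of_int \<lfloor>r * real (Suc n)\<rfloor>" "r * real (Suc n)" "inverse (real (Suc n))"] i[of n]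
    unfolding f_def r by linarith
  show "f n \<le> r" by (rule le)
  show "0 \<le> r \<Longrightarrow> 0 \<le> f n" using i[of n] unfolding f_def by (intro mult_nonneg_nonneg) auto
  have ge: "r - inverse (real (Suc n)) \<le> f n" for n
  proof -
    have "(r * real (Suc n) - 1) * inverse (real (Suc n)) \<le> f n"
      unfolding f_def using i[of n] by (intro mult_right_mono) linarith+
    then show ?thesis unfolding left_diff_distrib r by simp
  qed
  show "f \<longlonglongrightarrow> r"
  proof (rule tendsto_sandwich[OF _ _ _ tendsto_const])
    show "(\<lambda>n. r - inverse (real (Suc n))) \<longlonglongrightarrow> r"
      using tendsto_diff[OF tendsto_const[of r] LIMSEQ_inverse_real_of_nat] by simp
  qed (use le ge in auto)
qed

section \<open>Measurability along a solution path\<close>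

locale solution_path = wiener M W for M :: "'a measure" and W :: "real \<Rightarrow> 'a \<Rightarrow> real^'k" +
  fixes X :: "real \<Rightarrow> 'a \<Rightarrow> real^'n" and \<zeta> :: "'a \<Rightarrow> ereal"
  assumes \<zeta>_pos: "\<And>w. w \<in> space M \<Longrightarrow> 0 < \<zeta> w"
    and \<zeta>_stopping: "\<And>t. Measurable.pred (F t) (\<lambda>w. \<zeta> w \<le> ereal t)"
    and X_adapted: "\<And>t. 0 \<le> t \<Longrightarrow> X t \<in> borel_measurable (restrict_space (F t) {w \<in> space M. ereal t < \<zeta> w})"
    and X_continuous: "\<And>w. w \<in> space M \<Longrightarrow> continuous_on {t. 0 \<le> t \<and> ereal t < \<zeta> w} (\<lambda>t. X t w)"
begin

text \<open>Extension by 0 after the lifetime turns the restricted measurability of \<open>X\<close>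
  into measurability on the whole space.\<close>

definition X' :: "real \<Rightarrow> 'a \<Rightarrow> real^'n" where
  "X' t w = (if ereal t < \<zeta> w then X t w else 0)"

lemma alive_pred: "s \<le> t \<Longrightarrow> Measurable.pred (F t) (\<lambda>w. ereal s < \<zeta> w)"
proof -
  assume "s \<le> t"
  then have "Measurable.pred (F t) (\<lambda>w. \<zeta> w \<le> ereal s)"
    using \<zeta>_stopping[of s] by (rule measurable_filtration_mono[rotated])
  then have "Measurable.pred (F t) (\<lambda>w. \<not> \<zeta> w \<le> ereal s)" by measurable
  then show ?thesis by (simp add: not_le)
qed

lemma X'_adapted: "0 \<le> s \<Longrightarrow> s \<le> t \<Longrightarrow> X' s \<in> borel_measurable (F t)"
proof -
  assume s: "0 \<le> s" "s \<le> t"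
  have A: "{w \<in> space M. ereal s < \<zeta> w} \<inter> space (F s) \<in> sets (F s)"
    using alive_pred[OF order_refl, of s] unfolding pred_def by (simp add: Int_absorb2 Collect_mono)
  have "(\<lambda>w. indicator {w \<in> space M. ereal s < \<zeta> w} w *\<^sub>R X s w) \<in> borel_measurable (F s)"
    using X_adapted[OF s(1)] borel_measurable_restrict_space_iff[OF A, of "X s"] by simp
  moreover have "(\<lambda>w. indicator {w \<in> space M. ereal s < \<zeta> w} w *\<^sub>R X s w) \<in> borel_measurable (F s) \<longleftrightarrow> X' s \<in> borel_measurable (F s)"
    by (rule measurable_cong) (auto simp: X'_def indicator_def)
  ultimately show ?thesis using measurable_filtration_mono[OF _ s(2)] by blast
qed

text \<open>The time min t \<kappa> is rounded down to a grid. At the rounded time the value is put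
  together from countably many fixed times not exceeding t, hence is known at t, and continuity of
  the path gives the limit.\<close>

lemma X_stopped_adapted:
  assumes \<kappa>: "stopping_time F \<kappa>" and k: "\<And>w. w \<in> space M \<Longrightarrow> 0 \<le> \<kappa> w \<and> ereal (\<kappa> w) < \<zeta> w" and t: "0 \<le> t"
  shows "(\<lambda>w. X (min t (\<kappa> w)) w) \<in> borel_measurable (F t)"
proof -
  define m where "m w = min t (\<kappa> w)" for w
  have mm: "m \<in> borel_measurable (F t)"
    unfolding borel_measurable_iff_le
  proof
    fix a
    show "{w \<in> space (F t). m w \<le> a} \<in> sets (F t)"
    proof (cases "t \<le> a")
      case True
      then have "{w \<in> space (F t). m w \<le> a} = space (F t)" by (auto simp: m_def min_le_iff_disj)
      then show ?thesis by (simp only: sets.top)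
    next
      case False
      then have "{w \<in> space (F t). m w \<le> a} = {w \<in> space M. \<kappa> w \<le> a}" by (auto simp: m_def min_le_iff_disj)
      moreover have "{w \<in> space M. \<kappa> w \<le> a} \<in> sets (F a)" using stopping_timeD[OF \<kappa>, of a] unfolding pred_def by simp
      ultimately show ?thesis using filtration_mono[of a t] False by auto
    qed
  qed
  define s where "s n w = real_of_int \<lfloor>m w * real (Suc n)\<rfloor> * inverse (real (Suc n))" for n w
  have m0: "0 \<le> m w" "m w \<le> t" "ereal (m w) < \<zeta> w" if "w \<in> space M" for w
    using k[OF that] t by (auto simp: m_def min_def intro: le_less_trans[of _ "ereal (\<kappa> w)"])
  have s: "0 \<le> s n w" "s n w \<le> m w" if w: "w \<in> space M" for n w
    unfolding s_def by (rule floor_grid(2)[OF m0(1)[OF w]], rule floor_grid(1))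
  have "(\<lambda>w. X (m w) w) \<in> borel_measurable (F t)"
  proof (rule borel_measurable_LIMSEQ_metric)
    \<comment> \<open>Set to 0 for grid times outside [0, t], so that \<open>f n i\<close> is
      measurable at time t for every integer i, including those that never occur as rounded
      times.\<close>
    define f where "f n i w = (let r = real_of_int i * inverse (real (Suc n)) in if 0 \<le> r \<and> r \<le> t then X' r w else 0)" for n i w
    have fm: "f n i \<in> borel_measurable (F t)" for n i
    proof (cases "0 \<le> real_of_int i * inverse (real (Suc n)) \<and> real_of_int i * inverse (real (Suc n)) \<le> t")
      case True
      then show ?thesis unfolding f_def[abs_def] Let_def using X'_adapted by auto
    next
      case False
      then show ?thesis unfolding f_def[abs_def] Let_def by auto
    qed
    have gm: "(\<lambda>w. \<lfloor>m w * real (Suc n)\<rfloor>) \<in> measurable (F t) (count_space UNIV)" for n using mm by measurable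
    show "(\<lambda>w. f n \<lfloor>m w * real (Suc n)\<rfloor> w) \<in> borel_measurable (F t)" for n
      by (rule measurable_compose_countable[OF fm gm])
    fix w assume "w \<in> space (F t)"
    then have w: "w \<in> space M" by simp
    have eq: "f n \<lfloor>m w * real (Suc n)\<rfloor> w = X (s n w) w" for n
    proof -
      have "0 \<le> s n w \<and> s n w \<le> t" "ereal (s n w) < \<zeta> w"
        using s[OF w, of n] m0[OF w] by (auto intro: le_less_trans[of _ "ereal (m w)"])
      then show ?thesis unfolding f_def Let_def s_def[symmetric] X'_def by simp
    qed
    have lim: "(\<lambda>n. s n w) \<longlonglongrightarrow> m w" unfolding s_def by (rule floor_grid)
    show "(\<lambda>n. f n \<lfloor>m w * real (Suc n)\<rfloor> w) \<longlonglongrightarrow> X (m w) w"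
      unfolding eq
    proof (rule continuous_on_tendsto_compose[OF X_continuous[OF w] lim])
      show "m w \<in> {t. 0 \<le> t \<and> ereal t < \<zeta> w}" using m0[OF w] by auto
      show "\<forall>\<^sub>F n in sequentially. s n w \<in> {t. 0 \<le> t \<and> ereal t < \<zeta> w}"
      proof (intro always_eventually allI)
        fix n
        have "ereal (s n w) < \<zeta> w" using s(2)[OF w, of n] m0(3)[OF w] by (auto intro: le_less_trans[of _ "ereal (m w)"])
        then show "s n w \<in> {t. 0 \<le> t \<and> ereal t < \<zeta> w}" using s(1)[OF w] by simp
      qed
    qed
  qed
  then show ?thesis by (simp add: m_def)
qed

lemma stays_pred:
  assumes Z: "\<And>q::rat. 0 \<le> q \<Longrightarrow> q \<le> 1 \<Longrightarrow> Z (of_rat q * t) \<in> borel_measurable N"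
  shows "Measurable.pred N (\<lambda>w. \<exists>n::nat. \<forall>q::rat. 0 \<le> q \<and> q \<le> 1 \<longrightarrow>
    inverse (real (Suc n)) \<le> infdist ((Z (of_rat q * t) w) :: real^'n) (- G))"
proof (intro pred_intros_countable)
  fix n :: nat and q :: rat
  show "Measurable.pred N (\<lambda>w. 0 \<le> q \<and> q \<le> 1 \<longrightarrow> inverse (real (Suc n)) \<le> infdist (Z (of_rat q * t) w) (- G))"
  proof (cases "0 \<le> q \<and> q \<le> 1")
    case True
    have [measurable]: "(\<lambda>x::real^'n. infdist x (- G)) \<in> borel_measurable borel"
      by (intro borel_measurable_continuous_onI continuous_intros)
    have [measurable]: "Z (of_rat q * t) \<in> borel_measurable N" using Z True by auto
    show ?thesis using True by simp
  next
    case False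
    then have "(\<lambda>w. 0 \<le> q \<and> q \<le> 1 \<longrightarrow> inverse (real (Suc n)) \<le> infdist (Z (of_rat q * t) w) (- G)) = (\<lambda>w. True)"
      by blast
    then show ?thesis by (simp only:) simp
  qed
qed

text \<open>Since \<open>D\<close> is contained in \<open>G\<close>, a path in \<open>D\<close> at
  time T that stays in \<open>G\<close> before T stays in \<open>G\<close> on the closed interval,
  to which \<open>path_stays_in_open_iff\<close> applies.\<close>

lemma reach_avoid_measurable:
  assumes G: "open G" "- G \<noteq> {}" and D: "D \<subseteq> G" "closed D" and T: "0 < T"
  shows "{w \<in> space M. ereal T < \<zeta> w \<and> X T w \<in> D \<and> (\<forall>t\<in>{0..<T}. X t w \<in> G)} \<in> sets M"
proof -
  have "{w \<in> space M. ereal T < \<zeta> w \<and> X T w \<in> D \<and> (\<forall>t\<in>{0..<T}. X t w \<in> G)} =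
    {w \<in> space M. ereal T < \<zeta> w \<and> X' T w \<in> D \<and> (\<exists>n::nat. \<forall>q::rat. 0 \<le> q \<and> q \<le> 1 \<longrightarrow>
      inverse (real (Suc n)) \<le> infdist (X' (of_rat q * T) w) (- G))}"
  proof (intro Collect_cong conj_cong refl)
    fix w assume w: "w \<in> space M" "ereal T < \<zeta> w"
    have le: "ereal s < \<zeta> w" if "s \<le> T" for s using w(2) that by (auto intro: le_less_trans[of _ "ereal T"])
    show DX: "X T w \<in> D \<longleftrightarrow> X' T w \<in> D" using w by (simp add: X'_def)
    assume "X' T w \<in> D"
    then have XD: "X T w \<in> D" using DX by simp
    have "(\<forall>t\<in>{0..<T}. X t w \<in> G) \<longleftrightarrow> (\<forall>t\<in>{0..T}. X t w \<in> G)"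
    proof
      assume a: "\<forall>t\<in>{0..<T}. X t w \<in> G"
      show "\<forall>t\<in>{0..T}. X t w \<in> G"
      proof
        fix t assume "t \<in> {0..T}"
        then show "X t w \<in> G" using a XD D by (cases "t = T") auto
      qed
    qed auto
    also have "\<dots> \<longleftrightarrow> (\<exists>n::nat. \<forall>q::rat. 0 \<le> q \<and> q \<le> 1 \<longrightarrow> inverse (real (Suc n)) \<le> infdist (X (of_rat q * T) w) (- G))"
    proof (rule path_stays_in_open_iff[OF _ _ G])
      show "continuous_on {0..T} (\<lambda>t. X t w)"
        by (rule continuous_on_subset[OF X_continuous[OF w(1)]]) (use le in auto)
    qed (use T in simp)
    also have "\<dots> \<longleftrightarrow> (\<exists>n::nat. \<forall>q::rat. 0 \<le> q \<and> q \<le> 1 \<longrightarrow> inverse (real (Suc n)) \<le> infdist (X' (of_rat q * T) w) (- G))"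
    proof -
      have "X' (of_rat q * T) w = X (of_rat q * T) w" if "0 \<le> q" "q \<le> 1" for q :: rat
        using le[of "of_rat q * T"] T that by (simp add: X'_def mult_left_le_one_le)
      then show ?thesis by (metis (mono_tags, lifting))
    qed
    finally show "(\<forall>t\<in>{0..<T}. X t w \<in> G) \<longleftrightarrow> \<dots>" .
  qed
  also have "\<dots> \<in> sets M"
  proof -
    have m: "X' s \<in> borel_measurable M" if "0 \<le> s" for s
      using measurable_filtration[OF X'_adapted[OF that order_refl]] .
    have [measurable]: "Measurable.pred M (\<lambda>w. ereal T < \<zeta> w)" using measurable_filtration[OF alive_pred[OF order_refl]] .
    have [measurable]: "D \<in> sets borel" "X' T \<in> borel_measurable M" using D T m by auto
    have [measurable]: "Measurable.pred M (\<lambda>w. \<exists>n::nat. \<forall>q::rat. 0 \<le> q \<and> q \<le> 1 \<longrightarrow> inverse (real (Suc n)) \<le> infdist (X' (of_rat q * T) w) (- G))"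
      using m T by (intro stays_pred) simp
    show ?thesis by measurable
  qed
  finally show ?thesis .
qed

end

section \<open>The exit time from an open set\<close>

locale exit_time = solution_path M W X \<zeta> for M :: "'a measure" and W :: "real \<Rightarrow> 'a \<Rightarrow> real^'k"
    and X :: "real \<Rightarrow> 'a \<Rightarrow> real^'n" and \<zeta> +
  fixes \<kappa> :: "'a \<Rightarrow> real" and G :: "(real^'n) set"
  assumes \<kappa>: "stopping_time F \<kappa>" and \<kappa>b: "\<And>w. w \<in> space M \<Longrightarrow> 0 \<le> \<kappa> w \<and> ereal (\<kappa> w) < \<zeta> w"
    and G: "open G" "- G \<noteq> {}"
begin

text \<open>A path that stays in \<open>G\<close> up to \<open>\<kappa>\<close> gets the exit time \<open>\<kappa>\<close>, so that \<open>Inf\<close> is never taken over an empty set.\<close>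

definition exit :: "'a \<Rightarrow> real" where
  "exit w = Inf (insert (\<kappa> w) {t \<in> {0..\<kappa> w}. X t w \<notin> G})"

lemma exit_bdd: "w \<in> space M \<Longrightarrow> bdd_below (insert (\<kappa> w) {t \<in> {0..\<kappa> w}. X t w \<notin> G})"
  using \<kappa>b by (intro bdd_belowI[of _ 0]) auto

lemma exit_bounds:
  assumes w: "w \<in> space M" shows "0 \<le> exit w" "exit w \<le> \<kappa> w" "ereal (exit w) < \<zeta> w"
proof -
  show "0 \<le> exit w" unfolding exit_def using \<kappa>b[OF w] by (intro cInf_greatest) auto
  show le: "exit w \<le> \<kappa> w" unfolding exit_def by (intro cInf_lower exit_bdd w) auto
  show "ereal (exit w) < \<zeta> w" using \<kappa>b[OF w] le by (auto intro: le_less_trans[of _ "ereal (\<kappa> w)"])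
qed

lemma before_exit: "w \<in> space M \<Longrightarrow> 0 \<le> t \<Longrightarrow> t < exit w \<Longrightarrow> X t w \<in> G"
proof (rule ccontr)
  assume w: "w \<in> space M" and t: "0 \<le> t" "t < exit w" and n: "X t w \<notin> G"
  have "t \<in> insert (\<kappa> w) {t \<in> {0..\<kappa> w}. X t w \<notin> G}" using t n exit_bounds(2)[OF w] by auto
  then have "exit w \<le> t" unfolding exit_def by (intro cInf_lower exit_bdd w)
  then show False using t by simp
qed

lemma path_continuous: "w \<in> space M \<Longrightarrow> continuous_on {0..\<kappa> w} (\<lambda>t. X t w)"
  by (rule continuous_on_subset[OF X_continuous]) (use \<kappa>b in \<open>auto intro: le_less_trans[of _ "ereal (\<kappa> _)"]\<close>)

lemma exit_le: "w \<in> space M \<Longrightarrow> 0 \<le> t \<Longrightarrow> t \<le> \<kappa> w \<Longrightarrow> X t w \<notin> G \<Longrightarrow> exit w \<le> t"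
  unfolding exit_def by (intro cInf_lower exit_bdd) auto

text \<open>If the exit precedes \<kappa>, the set of times outside \<open>G\<close> is nonempty,
  and by continuity it is closed, so it contains its infimum.\<close>

lemma at_exit:
  assumes w: "w \<in> space M" and lt: "exit w < \<kappa> w" shows "X (exit w) w \<notin> G"
proof -
  let ?S = "{t \<in> {0..\<kappa> w}. X t w \<notin> G}"
  have cl: "closed ?S"
  proof -
    have "closed ({0..\<kappa> w} \<inter> (\<lambda>t. X t w) -` (- G))"
      using path_continuous[OF w] G(1) by (intro continuous_closed_preimage closed_Compl) auto
    moreover have "?S = {0..\<kappa> w} \<inter> (\<lambda>t. X t w) -` (- G)" by auto
    ultimately show ?thesis by simp
  qed
  have ne: "?S \<noteq> {}"
  proof
    assume "?S = {}"
    then have "exit w = \<kappa> w" unfolding exit_def by (simp only: cInf_singleton)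
    then show False using lt by simp
  qed
  have bd: "bdd_below ?S" by (intro bdd_belowI[of _ 0]) auto
  have "exit w = min (\<kappa> w) (Inf ?S)"
    unfolding exit_def using ne bd by (simp add: cInf_insert inf_min)
  then have "exit w = Inf ?S" using lt by simp
  then show ?thesis using closed_contains_Inf[OF ne bd cl] by auto
qed

text \<open>Before the exit the path is in \<open>G\<close>, and its value at a positive exit time
  is a limit of such values. When the exit time is 0 there are no earlier times, and the initial
  value has to be in \<open>G\<close>.\<close>

lemma exit_closure:
  assumes w: "w \<in> space M" and X0: "X 0 w \<in> G" and t: "0 \<le> t"
  shows "X (min t (exit w)) w \<in> closure G"
proof (cases "t < exit w")
  case True
  then show ?thesis using before_exit[OF w t] closure_subset by (auto simp: min_def)
next
  case False
  show ?thesis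
  proof (cases "exit w = 0")
    case True then show ?thesis using False X0 closure_subset t by (auto simp: min_def)
  next
    case ne: False
    then have pos: "0 < exit w" using exit_bounds(1)[OF w] by simp
    define s where "s n = exit w - exit w * inverse (real (Suc n))" for n
    have "inverse (real (Suc n)) \<le> 1" for n by (simp add: inverse_le_1_iff)
    then have s: "0 \<le> s n" "s n < exit w" for n using pos by (auto simp: s_def)
    have "s \<longlonglongrightarrow> exit w - exit w * 0"
      unfolding s_def by (intro tendsto_diff tendsto_const tendsto_mult_left LIMSEQ_inverse_real_of_nat)
    then have lim: "(\<lambda>n. X (s n) w) \<longlonglongrightarrow> X (exit w) w"
      using s(1) order_trans[OF less_imp_le[OF s(2)] exit_bounds(2)[OF w]] exit_bounds[OF w]
      by (intro continuous_on_tendsto_compose[OF path_continuous[OF w]]) (auto intro!: always_eventually)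
    have "X (exit w) w \<in> closure G"
      using before_exit[OF w s] lim by (auto simp: closure_sequential intro!: exI[of _ "\<lambda>n. X (s n) w"])
    then show ?thesis using False by (auto simp: min_def not_less intro: order_antisym)
  qed
qed

lemma exit_frontier:
  assumes "w \<in> space M" "X 0 w \<in> G" "exit w < \<kappa> w" shows "X (exit w) w \<in> frontier G"
  using at_exit[OF assms(1,3)] exit_closure[OF assms(1,2), of "exit w"] exit_bounds(1)[OF assms(1)] G(1)
  by (simp add: frontier_def interior_open)

text \<open>The exit has happened by time t iff \<kappa> has, or the path stopped at \<kappa> is
  outside \<open>G\<close> at some time in [0, t]. Both are decided at time t; stopping at \<kappa>
  keeps the path within its lifetime. As the exit value is attained, no information after t is
  involved.\<close>

lemma exit_stopping: "stopping_time F exit"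
proof
  fix t
  show "Measurable.pred (F t) (\<lambda>w. exit w \<le> t)"
  proof (cases "t < 0")
    case True
    have "Measurable.pred (F t) (\<lambda>w. exit w \<le> t) \<longleftrightarrow> Measurable.pred (F t) (\<lambda>w. False)"
      using exit_bounds(1) True by (intro measurable_cong) force
    then show ?thesis by simp
  next
    case False
    then have t: "0 \<le> t" by simp
    define Z where "Z s w = X (min s (\<kappa> w)) w" for s w
    have Zm: "Z s \<in> borel_measurable (F t)" if "0 \<le> s" "s \<le> t" for s
      using X_stopped_adapted[OF \<kappa> \<kappa>b that(1)] measurable_filtration_mono[OF _ that(2)] unfolding Z_def[abs_def] by blast
    let ?P = "\<lambda>w. \<exists>n::nat. \<forall>q::rat. 0 \<le> q \<and> q \<le> 1 \<longrightarrow> inverse (real (Suc n)) \<le> infdist (Z (of_rat q * t) w) (- G)"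
    have eq: "exit w \<le> t \<longleftrightarrow> \<kappa> w \<le> t \<or> \<not> ?P w" if "w \<in> space (F t)" for w
    proof -
      have w: "w \<in> space M" using that by simp
      have Zc: "continuous_on {0..t} (\<lambda>s. Z s w)"
        unfolding Z_def using \<kappa>b[OF w]
        by (intro continuous_on_compose2[OF path_continuous[OF w]] continuous_intros) auto
      have "(\<forall>s\<in>{0..t}. Z s w \<in> G) \<longleftrightarrow> ?P w" by (rule path_stays_in_open_iff[OF Zc t G])
      moreover have "exit w \<le> t \<longleftrightarrow> \<kappa> w \<le> t \<or> \<not> (\<forall>s\<in>{0..t}. Z s w \<in> G)"
      proof
        assume le: "exit w \<le> t"
        show "\<kappa> w \<le> t \<or> \<not> (\<forall>s\<in>{0..t}. Z s w \<in> G)"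
        proof (rule disjCI)
          assume "\<not> \<not> (\<forall>s\<in>{0..t}. Z s w \<in> G)"
          then have "Z (exit w) w \<in> G" using le exit_bounds[OF w] by auto
          then have "X (exit w) w \<in> G" using exit_bounds(2)[OF w] by (simp add: Z_def)
          then have "\<not> exit w < \<kappa> w" using at_exit[OF w] by auto
          then show "\<kappa> w \<le> t" using le by simp
        qed
      next
        assume "\<kappa> w \<le> t \<or> \<not> (\<forall>s\<in>{0..t}. Z s w \<in> G)"
        then show "exit w \<le> t"
        proof
          assume "\<kappa> w \<le> t" then show ?thesis using exit_bounds(2)[OF w] by simp
        next
          assume "\<not> (\<forall>s\<in>{0..t}. Z s w \<in> G)"
          then obtain s where s: "s \<in> {0..t}" "X (min s (\<kappa> w)) w \<notin> G" by (auto simp: Z_def)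
          then have "exit w \<le> min s (\<kappa> w)" using \<kappa>b[OF w] by (intro exit_le[OF w]) auto
          then show ?thesis using s by auto
        qed
      qed
      ultimately show ?thesis by blast
    qed
    have [measurable]: "Measurable.pred (F t) ?P"
      using t by (intro stays_pred Zm) (auto simp: mult_left_le_one_le)
    have [measurable]: "Measurable.pred (F t) (\<lambda>w. \<kappa> w \<le> t)" by (rule stopping_timeD[OF \<kappa>])
    have "Measurable.pred (F t) (\<lambda>w. exit w \<le> t) \<longleftrightarrow> Measurable.pred (F t) (\<lambda>w. \<kappa> w \<le> t \<or> \<not> ?P w)"
      by (rule measurable_cong) (rule eq)
    moreover have "Measurable.pred (F t) (\<lambda>w. \<kappa> w \<le> t \<or> \<not> ?P w)"
      by measurable
    ultimately show ?thesis by (rule iffD2)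
  qed
qed

end

subsection \<open>The reach-avoid bound\<close>

text \<open>The bad paths start in the wrong place, which has probability 0, or are stopped by
  \<kappa> before T while no earlier exit has occurred. On them all quantities are bounded by B: the
  drift over [0, T] loses at most B T and the terminal value at most B, whence the factor
  \<open>B * T + B\<close>.\<close>

lemma (in exit_time) stopped_diffusion_bound:
  fixes b :: "real^'n \<Rightarrow> real^'n" and \<sigma> :: "real^'n \<Rightarrow> real^'k^'n" and v :: "real \<Rightarrow> real^'n \<Rightarrow> real"
  assumes bc: "continuous_on UNIV b" and \<sigma>c: "continuous_on UNIV \<sigma>"
    and R: "\<And>x. x \<in> closure G \<Longrightarrow> norm x \<le> R" and x0: "x0 \<in> G"
    and X0: "AE w in M. X 0 w = x0" and T: "0 < T" and \<kappa>T: "\<And>w. w \<in> space M \<Longrightarrow> \<kappa> w \<le> T"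
    and \<tau>: "\<And>w. w \<in> space M \<Longrightarrow> \<kappa> w \<le> \<tau> w" and sol: "solves_sde_upto M F W b \<sigma> x0 \<tau> X"
    and v: "class_C12 T v"
    and B: "0 \<le> B" "\<And>t x. t \<in> {0..T} \<Longrightarrow> norm x \<le> R \<Longrightarrow> \<bar>v t x\<bar> \<le> B \<and> \<bar>time_deriv T v t x\<bar> \<le> B \<and>
      norm (space_grad v t x) \<le> B \<and> norm (space_hessian v t x) \<le> B"
    and gen: "\<And>x t. x \<in> G \<Longrightarrow> t \<in> {0..T} \<Longrightarrow> generator b \<sigma> T v t x \<ge> 0"
    and fro: "\<And>x t. x \<in> frontier G \<Longrightarrow> t \<in> {0..T} \<Longrightarrow> time_deriv T v t x \<ge> 0"
    and D: "D \<subseteq> G" "closed D" "\<And>x. x \<in> closure G \<Longrightarrow> v T x \<le> indicator D x"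
  defines "bad \<equiv> {w \<in> space M. X 0 w \<notin> G \<or> exit w = \<kappa> w \<and> \<kappa> w < T}"
    and "E \<equiv> {w \<in> space M. ereal T < \<zeta> w \<and> X T w \<in> D \<and> (\<forall>t\<in>{0..<T}. X t w \<in> G)}"
  shows "v 0 x0 \<le> prob E + (B * T + B) * prob bad" "bad \<in> sets M"
proof -
  \<comment> \<open>The default x0 keeps \<open>Y\<close> in the closure of \<open>G\<close> for
    every outcome, including those with a wrong initial value. The extension to negative times by
    \<open>max t 0\<close> makes the paths continuous on the whole line, as needed for joint
    measurability.\<close>
  define Y where "Y t w = (if w \<in> space M \<and> X 0 w \<in> G then X (min (max t 0) (exit w)) w else x0)" for t w
  obtain I where ito: "is_ito_integral M F W (\<lambda>s w. indicator {0..\<tau> w} s *\<^sub>R \<sigma> (X s w)) I"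
    and eq: "AE w in M. \<forall>t\<ge>0. X (min t (\<tau> w)) w = x0 + integral {0..min t (\<tau> w)} (\<lambda>s. b (X s w)) + I t w"
    using sol unfolding solves_sde_upto_def by blast
  have "compact (cball (0 :: real^'n) R)" by simp
  then have bb: "bounded (b ` cball 0 R)" "bounded (\<sigma> ` cball 0 R)"
    using bc \<sigma>c by (auto intro!: compact_imp_bounded compact_continuous_image intro: continuous_on_subset)
  then obtain K1 K2 where "\<And>x. norm x \<le> R \<Longrightarrow> norm (b x) \<le> K1" "\<And>x. norm x \<le> R \<Longrightarrow> norm (\<sigma> x) \<le> K2"
    unfolding bounded_iff by (metis image_eqI mem_cball_0)
  then obtain K where K: "0 \<le> K" "\<And>x. norm x \<le> R \<Longrightarrow> norm (b x) \<le> K" "\<And>x. norm x \<le> R \<Longrightarrow> norm (\<sigma> x) \<le> K"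
    by (intro that[of "max 0 (max K1 K2)"]) (auto simp: le_max_iff_disj)
  have Yc: "Y t w \<in> closure G" for t w
    using exit_closure[of w "max t 0"] x0 closure_subset by (auto simp: Y_def)
  have X0m: "X 0 \<in> borel_measurable (F t)" if "0 \<le> t" for t
  proof -
    have "X 0 \<in> borel_measurable (F t) \<longleftrightarrow> X' 0 \<in> borel_measurable (F t)"
      using \<zeta>_pos by (intro measurable_cong) (auto simp: X'_def zero_ereal_def[symmetric])
    then show ?thesis using X'_adapted[OF order_refl that] by simp
  qed
  have Gb: "G \<in> sets borel" using G by simp
  have Yad: "Y t \<in> borel_measurable (F t)" if t: "0 \<le> t" for t
  proof -
    have [measurable]: "(\<lambda>w. X (min t (exit w)) w) \<in> borel_measurable (F t)"
      using X_stopped_adapted[OF exit_stopping _ t] exit_bounds by auto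
    note [measurable] = X0m[OF t] Gb
    have "(\<lambda>w. if X 0 w \<in> G then X (min t (exit w)) w else x0) \<in> borel_measurable (F t)" by measurable
    moreover have "Y t \<in> borel_measurable (F t) \<longleftrightarrow> (\<lambda>w. if X 0 w \<in> G then X (min t (exit w)) w else x0) \<in> borel_measurable (F t)"
      using t by (intro measurable_cong) (simp add: Y_def)
    ultimately show ?thesis by simp
  qed
  have YM: "Y t \<in> borel_measurable M" for t
  proof -
    have "Y t = Y (max t 0)" by (simp add: Y_def fun_eq_iff)
    then show ?thesis using measurable_filtration[OF Yad[of "max t 0"]] by simp
  qed
  have Ycont: "continuous_on UNIV (\<lambda>t. Y t w)" if w: "w \<in> space M" for w
  proof (cases "X 0 w \<in> G")
    case True
    have "continuous_on UNIV (\<lambda>t. X (min (max t 0) (exit w)) w)"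
      using exit_bounds[OF w] by (intro continuous_on_compose2[OF path_continuous[OF w]] continuous_intros) auto
    then show ?thesis using True w by (simp add: Y_def)
  qed (simp add: Y_def)
  \<comment> \<open>Joint measurability of a process with continuous paths, by rounding the time
    down to a grid.\<close>
  have Yj: "(\<lambda>(w, r). Y r w) \<in> borel_measurable (M \<Otimes>\<^sub>M borel)"
  proof (rule borel_measurable_LIMSEQ_metric)
    let ?f = "\<lambda>n (i::int) p. Y (real_of_int i * inverse (real (Suc n))) (fst p)"
    have fm: "?f n i \<in> borel_measurable (M \<Otimes>\<^sub>M borel)" for n i
      by (rule measurable_compose[OF measurable_fst YM])
    have gm: "(\<lambda>p. \<lfloor>snd p * real (Suc n)\<rfloor>) \<in> measurable (M \<Otimes>\<^sub>M borel) (count_space UNIV)" for n by measurable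
    show "(\<lambda>p. ?f n \<lfloor>snd p * real (Suc n)\<rfloor> p) \<in> borel_measurable (M \<Otimes>\<^sub>M borel)" for n
      by (rule measurable_compose_countable[OF fm gm])
    fix p assume "p \<in> space (M \<Otimes>\<^sub>M (borel :: real measure))"
    then obtain w r where p: "p = (w, r)" "w \<in> space M" by (auto simp: space_pair_measure)
    have "(\<lambda>n. real_of_int \<lfloor>r * real (Suc n)\<rfloor> * inverse (real (Suc n))) \<longlonglongrightarrow> r" by (rule floor_grid)
    then show "(\<lambda>n. ?f n \<lfloor>snd p * real (Suc n)\<rfloor> p) \<longlonglongrightarrow> (case p of (w, r) \<Rightarrow> Y r w)"
      unfolding p fst_conv snd_conv prod.case by (rule continuous_on_tendsto_compose[OF Ycont[OF p(2)]]) auto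
  qed
  have exit0: "exit w = 0" if "w \<in> space M" "X 0 w \<notin> G" for w
    using exit_le[OF that(1) order_refl _ that(2)] exit_bounds(1)[OF that(1)] \<kappa>b[OF that(1)] by simp
  interpret stopped_diffusion M W T R K B exit "\<lambda>s w. indicator {0..\<tau> w} s *\<^sub>R \<sigma> (X s w)" I Y b \<sigma> x0 v
  proof unfold_locales
    show "indicator {0..\<tau> w} r *\<^sub>R \<sigma> (X r w) = \<sigma> (Y r w)" if w: "w \<in> space M" and r: "0 < r" "r \<le> exit w" for w r
    proof -
      have "X 0 w \<in> G" using exit0[OF w] r by auto
      moreover have "r \<le> \<tau> w" using r exit_bounds(2)[OF w] \<tau>[OF w] by simp
      ultimately show ?thesis using r w by (simp add: Y_def)
    qed
    show "AE w in M. \<forall>t\<in>{0..T}. Y t w = x0 + (LBINT r. indicator {0..t} r *\<^sub>R (if r \<le> exit w then b (Y r w) else 0)) + I (min t (exit w)) w"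
      using eq X0 AE_space
    proof eventually_elim
      case (elim w)
      have XG: "X 0 w \<in> G" using elim x0 by simp
      show ?case
      proof
        fix t assume t: "t \<in> {0..T}"
        define u where "u = min t (exit w)"
        have u: "0 \<le> u" "u \<le> \<kappa> w" "u \<le> \<tau> w"
          using t exit_bounds[OF elim(3)] \<tau>[OF elim(3)] by (auto simp: u_def)
        have Yt: "Y t w = X u w" using t XG elim by (simp add: Y_def u_def)
        have "X (min u (\<tau> w)) w = x0 + integral {0..min u (\<tau> w)} (\<lambda>s. b (X s w)) + I u w" using elim(1) u by blast
        then have 1: "X u w = x0 + integral {0..u} (\<lambda>s. b (X s w)) + I u w" using u by (simp add: min_absorb1)
        have "continuous_on {0..u} (\<lambda>s. b (X s w))"
          using u by (intro continuous_on_compose2[OF bc] continuous_on_subset[OF path_continuous[OF elim(3)]]) auto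
        then have "set_integrable lborel {0..u} (\<lambda>s. b (X s w))" by (rule borel_integrable_atLeastAtMost')
        then have "integral {0..u} (\<lambda>s. b (X s w)) = (LBINT r. indicator {0..u} r *\<^sub>R b (X r w))"
          using set_borel_integral_eq_integral(2) unfolding set_lebesgue_integral_def by metis
        also have "\<dots> = (LBINT r. indicator {0..t} r *\<^sub>R (if r \<le> exit w then b (Y r w) else 0))"
          by (rule Bochner_Integration.integral_cong) (use XG elim in \<open>auto simp: indicator_def u_def Y_def\<close>)
        finally show "Y t w = x0 + (LBINT r. indicator {0..t} r *\<^sub>R (if r \<le> exit w then b (Y r w) else 0)) + I (min t (exit w)) w"
          unfolding Yt 1 by (simp add: u_def)
      qed
    qed
  qed (use T v exit_stopping exit_bounds ito Yad Yj R[OF Yc] bc \<sigma>c K B in \<open>auto intro: borel_measurable_continuous_onI\<close>)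
  note [measurable] = measurable_filtration[OF X0m[OF order_refl]] stopping_time_measurable[OF \<kappa>] \<rho>_measurable Gb
  show bad: "bad \<in> sets M" unfolding bad_def by measurable
  have Em: "E \<in> sets M" unfolding E_def by (rule reach_avoid_measurable[OF G D(1,2) T])
  have "expectation (\<lambda>w. v T (Y T w)) \<ge> expectation (\<lambda>w. v 0 (Y 0 w)) - B * T * prob bad"
  proof (rule dynkin_lower[OF bad B(1)])
    fix w assume w: "w \<in> space M"
    show "AE r in lborel. r \<in> {0..T} \<longrightarrow> - (B * indicator bad w) \<le> \<Phi> r w"
      \<comment> \<open>With the exit time itself excluded, \<open>\<Phi>\<close> is the generator
        exactly at the times when the path is still in \<open>G\<close>.\<close>
      using AE_lborel_singleton[of "exit w"] AE_lborel_singleton[of 0]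
    proof eventually_elim
      case (elim r)
      show ?case
      proof
        assume r: "r \<in> {0..T}"
        show "- (B * indicator bad w) \<le> \<Phi> r w"
        proof (cases "r < exit w")
          case True
          then have XG: "X 0 w \<in> G" using exit0[OF w] r by force
          have "Y r w = X r w" using True r w XG by (simp add: Y_def)
          then have "Y r w \<in> G" using before_exit[OF w _ True] r by simp
          then have "0 \<le> \<Phi> r w" using gen r True by (simp add: \<Phi>_def)
          then show ?thesis using B(1) by (auto simp: indicator_def)
        next
          case False
          then have P: "\<Phi> r w = time_deriv T v r (Y r w)" using elim by (simp add: \<Phi>_def)
          show ?thesis
          proof (cases "w \<in> bad")
            case True
            have "\<bar>time_deriv T v r (Y r w)\<bar> \<le> B" using B(2)[OF r R[OF Yc[of r w]]] by blast
            then have "- B \<le> time_deriv T v r (Y r w)" by linarith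
            then show ?thesis using True unfolding P by simp
          next
            case nb: False
            then have XG: "X 0 w \<in> G" and "\<not> (exit w = \<kappa> w \<and> \<kappa> w < T)" using w by (auto simp: bad_def)
            \<comment> \<open>Here exit < r \<le> T; if the exit were \<kappa>, then \<kappa> < T
              and the path would be bad. So the path really left \<open>G\<close>, and it rests on
              the frontier.\<close>
            then have "exit w < \<kappa> w" using False elim r exit_bounds(2)[OF w] \<kappa>T[OF w] by auto
            then have "X (exit w) w \<in> frontier G" using exit_frontier[OF w XG] by simp
            moreover have "Y r w = X (exit w) w" using False r w XG by (simp add: Y_def)
            ultimately show ?thesis unfolding P using fro r nb by simp
          qed
        qed
      qed
    qed
  qed
  moreover have "expectation (\<lambda>w. v 0 (Y 0 w)) = v 0 x0"
  proof -
    have "AE w in M. v 0 (Y 0 w) = v 0 x0"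
      using X0 AE_space
    proof eventually_elim
      case (elim w)
      then show ?case using exit_bounds(1)[OF elim(2)] by (simp add: Y_def)
    qed
    moreover have "(\<lambda>w. v 0 (Y 0 w)) \<in> borel_measurable M"
      using T by (intro measurable_compose[OF YM C12_measurable(1)[OF v]]) auto
    ultimately have "expectation (\<lambda>w. v 0 (Y 0 w)) = expectation (\<lambda>w. v 0 x0)" by (intro integral_cong_AE) auto
    then show ?thesis by (simp add: prob_space)
  qed
  moreover have "expectation (\<lambda>w. v T (Y T w)) \<le> prob E + B * prob bad"
  proof -
    have iE: "integrable M (indicator E :: 'a \<Rightarrow> real)" "integrable M (\<lambda>w. B * indicator bad w)"
      using Em bad by (auto intro!: integrable_mult_right integrable_real_indicator simp: less_top[symmetric])
    have "expectation (\<lambda>w. v T (Y T w)) \<le> expectation (\<lambda>w. indicator E w + B * indicator bad w)"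
    proof (rule integral_mono)
      show "integrable M (\<lambda>w. v T (Y T w))"
      proof (rule integrable_const_bound[of _ B])
        show "AE w in M. norm (v T (Y T w)) \<le> B" using B(2)[OF _ R[OF Yc]] T by auto
        show "(\<lambda>w. v T (Y T w)) \<in> borel_measurable M"
          using T by (intro measurable_compose[OF YM C12_measurable(1)[OF v]]) auto
      qed
      show "integrable M (\<lambda>w. indicator E w + B * indicator bad w)" using iE by (rule Bochner_Integration.integrable_add)
      fix w assume w: "w \<in> space M"
      show "v T (Y T w) \<le> indicator E w + B * indicator bad w"
      proof (cases "w \<in> bad")
        case True
        have "\<bar>v T (Y T w)\<bar> \<le> B" using B(2)[OF _ R[OF Yc[of T w]], of T] T by auto
        then show ?thesis using True by (auto simp: indicator_def)
      next
        case False
        then have XG: "X 0 w \<in> G" and nk: "\<not> (exit w = \<kappa> w \<and> \<kappa> w < T)" using w by (auto simp: bad_def)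
        have "v T (Y T w) \<le> indicator E w"
        proof (cases "Y T w \<in> D")
          case notD: False
          then show ?thesis using D(3)[OF Yc[of T w]] by (auto simp: indicator_def split: if_splits)
        next
          case inD: True
          have exT: "exit w \<le> T" using exit_bounds(2)[OF w] \<kappa>T[OF w] by simp
          have YT: "Y T w = X (exit w) w" using T exT w XG by (simp add: Y_def min_absorb2)
          then have "X (exit w) w \<in> G" using inD D(1) by auto
          then have "\<not> exit w < \<kappa> w" using at_exit[OF w] by auto
          \<comment> \<open>A value in \<open>D\<close>, hence in \<open>G\<close>, excludes a
            genuine exit, so the exit time is \<kappa>; as the path is not bad, \<kappa> is
            T.\<close>
          then have exK: "exit w = \<kappa> w" "exit w = T" using exit_bounds(2)[OF w] nk \<kappa>T[OF w] by auto
          then have "w \<in> E"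
            using w inD YT before_exit[OF w] exit_bounds(3)[OF w] by (auto simp: E_def)
          then show ?thesis using D(3)[OF Yc[of T w]] inD by simp
        qed
        then show ?thesis using False by simp
      qed
    qed
    also have "\<dots> = prob E + B * prob bad"
      unfolding Bochner_Integration.integral_add[OF iE] using Em bad by simp
    finally show ?thesis .
  qed
  ultimately show "v 0 x0 \<le> prob E + (B * T + B) * prob bad" by (simp add: algebra_simps)
qed

theorem corollary6:
  fixes M :: "'a measure"
    and W :: "real \<Rightarrow> 'a \<Rightarrow> real^'k"
    and b :: "real^'n \<Rightarrow> real^'n"
    and \<sigma> :: "real^'n \<Rightarrow> real^'k^'n"
    and X :: "real^'n \<Rightarrow> real \<Rightarrow> 'a \<Rightarrow> real^'n"
    and \<zeta> :: "real^'n \<Rightarrow> 'a \<Rightarrow> ereal"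
    and \<X> \<X>s :: "(real^'n) set"
    and T :: real
    and v :: "real \<Rightarrow> real^'n \<Rightarrow> real"
  assumes "prob_space M"
    and "wiener_process M W"
    and "local_lipschitz (UNIV :: real set) UNIV (\<lambda>_. b)"
    and "local_lipschitz (UNIV :: real set) UNIV (\<lambda>_. \<sigma>)"
    and "\<And>x0. maximal_local_strong_solution M W b \<sigma> x0 (X x0) (\<zeta> x0)"
    and "open \<X>" and "bounded \<X>"
    and "\<X>s \<subseteq> \<X>" and "closed \<X>s" and "interior \<X>s \<noteq> {}"
    and "0 < T"
    and "class_C12 T v"
    and "\<And>x t. x \<in> \<X> \<Longrightarrow> t \<in> {0..T} \<Longrightarrow> generator b \<sigma> T v t x \<ge> 0"
    and "\<And>x t. x \<in> frontier \<X> \<Longrightarrow> t \<in> {0..T} \<Longrightarrow> time_deriv T v t x \<ge> 0"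
    and "\<And>x. x \<in> closure \<X> \<Longrightarrow> v T x \<le> indicator \<X>s x"
  shows "\<forall>x0 \<in> \<X> - \<X>s. reach_avoid_probability M (X x0) (\<zeta> x0) \<X> \<X>s T \<ge> v 0 x0"
proof
  fix x0 assume x0: "x0 \<in> \<X> - \<X>s"
  interpret wiener M W using assms(1,2) by (intro wiener.intro wiener_axioms.intro)
  define Z where "Z = X x0"
  define z where "z = \<zeta> x0"
  have sol: "local_strong_solution M W b \<sigma> x0 Z z"
    and expl: "AE w in M. z w < \<infinity> \<longrightarrow> Limsup (at_left (real_of_ereal (z w))) (\<lambda>t. ereal (norm (Z t w))) = \<infinity>"
    using assms(5)[of x0] unfolding maximal_local_strong_solution_def Z_def z_def by auto
  note sol' = sol[unfolded local_strong_solution_def Let_def]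
  have sp: "solution_path M W Z z"
    using sol' by unfold_locales blast+
  obtain \<tau> where st: "\<And>k. stopping_time F (\<tau> k)"
    and \<tau>: "\<And>w. w \<in> space M \<Longrightarrow> incseq (\<lambda>k. \<tau> k w) \<and> (\<forall>k. 0 \<le> \<tau> k w \<and> ereal (\<tau> k w) < z w)"
    and \<tau>lim: "AE w in M. (\<lambda>k. ereal (\<tau> k w)) \<longlonglongrightarrow> z w"
    and sde: "\<And>k. solves_sde_upto M F W b \<sigma> x0 (\<tau> k) Z"
    using sol' by blast
  have X0: "AE w in M. Z 0 w = x0" using sol' by blast
  have bc: "continuous_on UNIV b" and \<sigma>c: "continuous_on UNIV \<sigma>"
    using local_lipschitz_continuous_on[OF assms(3), of 0] local_lipschitz_continuous_on[OF assms(4), of 0] by auto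
  obtain R where R: "\<And>x. x \<in> closure \<X> \<Longrightarrow> norm x \<le> R"
    using bounded_closure[OF assms(7)] unfolding bounded_iff by blast
  obtain B where B: "0 \<le> B" "\<And>t x. t \<in> {0..T} \<Longrightarrow> norm x \<le> R \<Longrightarrow> \<bar>v t x\<bar> \<le> B \<and> \<bar>time_deriv T v t x\<bar> \<le> B \<and>
      norm (space_grad v t x) \<le> B \<and> norm (space_hessian v t x) \<le> B"
    using C12_bounds[OF assms(12), of R] by blast
  \<comment> \<open>Needed for the distances to the complement by which exits are detected.\<close>
  have ne: "- \<X> \<noteq> {}"
  proof
    assume "- \<X> = {}"
    then have "\<X> = UNIV" by auto
    then show False using assms(7) not_bounded_UNIV by simp
  qed
  \<comment> \<open>The localising time keeps the path strictly within its lifetime and the equation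
    valid; T is the horizon.\<close>
  define \<kappa> where "\<kappa> k w = min (\<tau> k w) T" for k w
  have ex: "exit_time M W Z z (\<kappa> k) \<X>" for k
  proof (intro exit_time.intro exit_time_axioms.intro sp)
    show "stopping_time F (\<kappa> k)" unfolding \<kappa>_def by (intro stopping_time_min st stopping_time_const)
    show "0 \<le> \<kappa> k w \<and> ereal (\<kappa> k w) < z w" if "w \<in> space M" for w
      using \<tau>[OF that] assms(11) by (auto simp: \<kappa>_def min_def intro: le_less_trans[of _ "ereal (\<tau> k w)"])
  qed (use assms(6) ne in auto)
  define bad where "bad k = {w \<in> space M. Z 0 w \<notin> \<X> \<or> exit_time.exit Z (\<kappa> k) \<X> w = \<kappa> k w \<and> \<kappa> k w < T}" for k
  define E where "E = {w \<in> space M. ereal T < z w \<and> Z T w \<in> \<X>s \<and> (\<forall>t\<in>{0..<T}. Z t w \<in> \<X>)}"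
  have main: "v 0 x0 \<le> prob E + (B * T + B) * prob (bad k)" "bad k \<in> sets M" for k
    using exit_time.stopped_diffusion_bound[OF ex[of k] bc \<sigma>c R _ X0 assms(11) _ _ sde assms(12) B assms(13,14) assms(8,9,15), of k] x0
    unfolding bad_def E_def by (auto simp: \<kappa>_def)
  have ev: "AE w in M. (\<lambda>k. indicator (bad k) w) \<longlonglongrightarrow> (0::real)"
    using \<tau>lim expl X0 AE_space
  proof eventually_elim
    case (elim w)
    note w = elim(4)
    \<comment> \<open>If w were bad for infinitely many k, then \<tau> k < T with the path in \<X>
      on [0, \<tau> k) for infinitely many k. As \<tau> is increasing, all \<tau> k are at most T,
      so the lifetime is finite, and the whole path up to it lies in the bounded set \<X>. This
      contradicts explosion.\<close>
    have "\<exists>N. \<forall>k\<ge>N. w \<notin> bad k"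
    proof (rule ccontr)
      assume "\<not> ?thesis"
      then have inf: "\<exists>k\<ge>N. w \<in> bad k" for N by blast
      have badD: "\<tau> k w < T \<and> (\<forall>t. 0 \<le> t \<longrightarrow> t < \<tau> k w \<longrightarrow> Z t w \<in> \<X>)" if "w \<in> bad k" for k
        using that elim(3) x0 exit_time.before_exit[OF ex[of k] w] unfolding bad_def by (auto simp: \<kappa>_def min_def split: if_splits)
      have le: "\<tau> k w \<le> T" for k
      proof -
        obtain j where "k \<le> j" "w \<in> bad j" using inf by blast
        then show ?thesis using badD[of j] \<tau>[OF w] by (auto dest: incseqD[of _ k j])
      qed
      have zT: "z w \<le> ereal T" by (rule LIMSEQ_le_const2[OF elim(1)]) (use le in auto)
      have z0: "0 < z w" using solution_path.\<zeta>_pos[OF sp w] .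
      obtain c where c: "z w = ereal c" "0 < c" using zT z0 by (cases "z w") auto
      \<comment> \<open>Any time before the lifetime is eventually passed by \<tau> k, and some such
        k is bad.\<close>
      have inX: "Z t w \<in> \<X>" if t: "0 \<le> t" "t < c" for t
      proof -
        have "\<forall>\<^sub>F k in sequentially. ereal t < ereal (\<tau> k w)"
          using elim(1) t unfolding c by (intro order_tendstoD(1)) auto
        then obtain N where N: "\<And>k. k \<ge> N \<Longrightarrow> t < \<tau> k w" by (auto simp: eventually_sequentially)
        obtain j where j: "N \<le> j" "w \<in> bad j" using inf by blast
        then show ?thesis using badD[OF j(2)] N[OF j(1)] t by auto
      qed
      have "\<forall>\<^sub>F t in at_left c. t \<in> {0<..<c}" using c(2) by (rule eventually_at_left_real)
      then have "\<forall>\<^sub>F t in at_left c. ereal (norm (Z t w)) \<le> ereal R"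
        by eventually_elim (use R[OF subsetD[OF closure_subset inX]] in auto)
      then have "Limsup (at_left c) (\<lambda>t. ereal (norm (Z t w))) \<le> ereal R" by (rule Limsup_bounded)
      then show False using elim(2) unfolding c by simp
    qed
    then have "\<forall>\<^sub>F k in sequentially. indicator (bad k) w = (0::real)"
      unfolding eventually_sequentially by (auto simp: indicator_def)
    then show ?case by (rule tendsto_eventually)
  qed
  have "(\<lambda>k. expectation (indicator (bad k))) \<longlonglongrightarrow> expectation (\<lambda>w. 0::real)"
    by (rule integral_dominated_convergence[where w="\<lambda>_. 1"]) (use main(2) ev in auto)
  then have "(\<lambda>k. prob (bad k)) \<longlonglongrightarrow> 0" using main(2) by simp
  then have "(\<lambda>k. prob E + (B * T + B) * prob (bad k)) \<longlonglongrightarrow> prob E + (B * T + B) * 0"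
    by (intro tendsto_intros)
  then have "v 0 x0 \<le> prob E + (B * T + B) * 0"
    by (rule LIMSEQ_le_const) (use main(1) in auto)
  then show "v 0 x0 \<le> reach_avoid_probability M (X x0) (\<zeta> x0) \<X> \<X>s T"
    by (simp add: reach_avoid_probability_def E_def Z_def z_def)
qed

end
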